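(* Let $\frac{dY}{dx}=A(x,t)Y$ be a parameterized linear differential system of order $n$ satisfying the standing assumptions in the context (in particular with only parameterized regular singular points), and let $G\subset\mathrm{GL}_n(k_0)$ be its PPV-group over $k=k_0(x)$. If the system is projectively isomonodromic on $\mathcal{D}\times\mathcal{P}$, then the commutator subgroup $(G,G)$ is conjugate in $\mathrm{GL}_n(k_0)$ to a subgroup of $\mathrm{GL}_n(\mathbb{C})$.
   Context: Analytic setting. $\mathcal{P}$ is a simply connected open subset of $\mathbb{C}^r$ with coordinates $t=(t_1,\dots,t_r)$; $\mathcal{D}$ is an open subset of $\mathbb{P}^1(\mathbb{C})$ whose complement is a union of $m$ disjoint closed disks $D_1,\dots,D_m$; $x_0\in\mathcal{D}$; $\gamma_1,\dots,\gamma_m$ are the usual loops based at $x_0$ in $\mathcal{D}$, $\gamma_i$ encircling $D_i$ once, generating $\pi_1(\mathcal{D},x_0)$. $A(x,t)$ is an $n\times n$ matrix whose entries are rational functions of $x$ with coefficients analytic in $t$, and the equation is analytic on $\mathcal{D}\times\mathcal{P}$ (also at $x=\infty$, in the local coordinate $1/x$, if $\infty\in\mathcal{D}$). For each $t\in\mathcal{P}$ the equation has a unique singular point $x_i(t)$ in each $D_i$, and it is a parameterized regular singular point. Parameterized regular singular point. Let $U\subset\mathbb{C}^r$ be open connected, $\mathcal{O}_U$ the ring of analytic functions on $U$, and $\alpha\in\mathcal{O}_U$. Let $\mathcal{O}_U(\{x-\alpha\})$ be the ring of Laurent series $\sum_{j\ge N}a_j(t)(x-\alpha(t))^j$ ($N\in\mathbb{Z}$,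 $a_j\in\mathcal{O}_U$) such that for each fixed $t\in U$ the series converges for $0<|x-\alpha(t)|<R_t$ for some $R_t>0$. An equation $\frac{dY}{dx}=AY$ with $A\in\mathfrak{gl}_n(\mathcal{O}_U(\{x-\alpha\}))$ has a parameterized regular singular point at $\alpha$ if there is $P\in\mathrm{GL}_n(\mathcal{O}_U(\{x-\alpha\}))$ such that $P^{-1}AP-P^{-1}\frac{dP}{dx}$ has only terms $(x-\alpha)^j$ with $j\ge -1$. The condition is required locally near each parameter value of $\mathcal{P}$ (with $\alpha=x_i$, analytic in $t$; the coordinate $1/x$ is used at $\infty$). Projective isomonodromy. Let $\mathrm{Scal}_n$ be the group of nonzero scalar $n\times n$ matrices. The equation is projectively isomonodromic on $\mathcal{D}\times\mathcal{P}$ if there exist analytic functions $c_1,\dots,c_m:\mathcal{P}\to\mathrm{Scal}_n(\mathbb{C})$ and fixed $G_1,\dots,G_m\in\mathrm{GL}_n(\mathbb{C})$ such that for each $t\in\mathcal{P}$ there is a local fundamental solution $Y_t(x)$ at $x_0$ whose analytic continuation along $\gamma_i$ is $Y_t(x)\,G_i\,c_i(t)$ for every $i$. PPV-group. $k_0$ is a field containing $\mathbb{C}(t_1,\dots,t_r)$ and the functions of $t$ occurring as coefficients of the entries of $A$, equipped with commuting derivations $\Pi=\{\partial_1,\dots,\partial_r\}$ extending $\partial/\partial t_i$, whose common field of constants is $\mathbb{C}$, and which is differentially closed with respect to $\Pi$ (every system of polynomial differential equations over $k_0$ having a solution in some differential extension field has one in $k_0$). Let $k=k_0(x)$ with derivations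 $\Delta=\{\partial_x,\partial_1,\dots,\partial_r\}$, where $\partial_x(x)=1$, $\partial_x|_{k_0}=0$, $\partial_i(x)=0$. Then $A\in\mathfrak{gl}_n(k)$. The PPV-field $K$ is the $\Delta$-field extension of $k$ generated by the entries of an invertible matrix $Z$ with $\partial_xZ=AZ$, with field of $\partial_x$-constants $k_0$. The PPV-group is the group of field automorphisms of $K$ over $k$ commuting with $\Delta$; it is identified with a subgroup $G\subset\mathrm{GL}_n(k_0)$ via $\sigma\mapsto M_\sigma$, $\sigma(Z)=ZM_\sigma$ (a change of $Z$ conjugates $G$ in $\mathrm{GL}_n(k_0)$). *)

theory Defs
  imports
    "HOL-Complex_Analysis.Complex_Analysis"
    "HOL-Computational_Algebra.Fraction_Field"
    "HOL-Algebra.Ring"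
    "HOL-Algebra.Generated_Groups"
begin

section \<open>The Riemann sphere\<close>

datatype riemann_sphere = Pt complex | Infty

definition inf_chart :: "complex \<Rightarrow> riemann_sphere" where
  "inf_chart w = (if w = 0 then Infty else Pt (1 / w))"

instantiation riemann_sphere :: topological_space
begin

definition open_riemann_sphere :: "riemann_sphere set \<Rightarrow> bool" where
  "open_riemann_sphere S \<longleftrightarrow> open (Pt -` S) \<and> open (inf_chart -` S)"

instance
proof
  show "open (UNIV :: riemann_sphere set)"
    by (simp add: open_riemann_sphere_def)
next
  fix S T :: "riemann_sphere set"
  assume "open S" "open T"
  then show "open (S \<inter> T)"
    by (simp add: open_riemann_sphere_def vimage_Int open_Int)
next
  fix K :: "riemann_sphere set set"
  assume "\<forall>S\<in>K. open S"
  then show "open (\<Union>K)"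
    by (auto simp: open_riemann_sphere_def vimage_Union intro!: open_UN)
qed

end

definition sphere_holomorphic_on :: "(riemann_sphere \<Rightarrow> complex) \<Rightarrow> riemann_sphere set \<Rightarrow> bool" where
  "sphere_holomorphic_on f S \<longleftrightarrow>
     (\<lambda>z. f (Pt z)) holomorphic_on (Pt -` S) \<and> (\<lambda>w. f (inf_chart w)) holomorphic_on (inf_chart -` S)"

definition moebius :: "complex \<Rightarrow> complex \<Rightarrow> complex \<Rightarrow> complex \<Rightarrow> complex \<Rightarrow> riemann_sphere" where
  "moebius a b c d z = (if c * z + d = 0 then Infty else Pt ((a * z + b) / (c * z + d)))"

text \<open>Closed disks of the sphere are the Moebius images of the closed unit disk; they may contain
  the point at infinity.\<close>

definition closed_disk :: "riemann_sphere set \<Rightarrow> bool" where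
  "closed_disk B \<longleftrightarrow> (\<exists>a b c d. a * d \<noteq> b * c \<and> B = moebius a b c d ` cball 0 1)"

text \<open>A loop in \<open>D\<close> goes once around the disk \<open>B\<close>, counterclockwise, if it is freely homotopic in
  \<open>D\<close> to a slightly larger concentric circle, where the closed annulus between circle and disk
  contains no other point of the complement of \<open>D\<close>.\<close>

definition encircles_once :: "riemann_sphere set \<Rightarrow> riemann_sphere set \<Rightarrow> (real \<Rightarrow> riemann_sphere) \<Rightarrow> bool" where
  "encircles_once D B g \<longleftrightarrow>
     (\<exists>a b c d \<rho>. a * d \<noteq> b * c \<and> B = moebius a b c d ` cball 0 1 \<and> \<rho> > 1 \<and>
        moebius a b c d ` (cball 0 \<rho> - cball 0 1) \<subseteq> D \<and>
        homotopic_loops D g (moebius a b c d \<circ> circlepath 0 \<rho>))"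

definition loop_at :: "riemann_sphere set \<Rightarrow> riemann_sphere \<Rightarrow> (real \<Rightarrow> riemann_sphere) \<Rightarrow> bool" where
  "loop_at D x0 g \<longleftrightarrow> path g \<and> path_image g \<subseteq> D \<and> pathstart g = x0 \<and> pathfinish g = x0"

text \<open>The letter \<open>(True, i)\<close> stands for \<open>\<gamma> i\<close>, the letter \<open>(False, i)\<close> for its inverse.\<close>

fun word_path :: "riemann_sphere \<Rightarrow> (nat \<Rightarrow> real \<Rightarrow> riemann_sphere) \<Rightarrow> (bool \<times> nat) list \<Rightarrow> real \<Rightarrow> riemann_sphere" where
  "word_path x0 \<gamma> [] = (\<lambda>_. x0)"
| "word_path x0 \<gamma> ((b, i) # ws) = (if b then \<gamma> i else reversepath (\<gamma> i)) +++ word_path x0 \<gamma> ws"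

definition generates_pi1 :: "riemann_sphere set \<Rightarrow> riemann_sphere \<Rightarrow> nat \<Rightarrow> (nat \<Rightarrow> real \<Rightarrow> riemann_sphere) \<Rightarrow> bool" where
  "generates_pi1 D x0 m \<gamma> \<longleftrightarrow>
     (\<forall>p. loop_at D x0 p \<longrightarrow>
        (\<exists>ws. snd ` set ws \<subseteq> {..<m} \<and> homotopic_paths D p (word_path x0 \<gamma> ws)))"

text \<open>\<open>g\<close>, as a germ at the endpoint of \<open>p\<close>, is the analytic continuation along \<open>p\<close> of the germ of
  \<open>f\<close> at the starting point.\<close>

definition analytic_continuation ::
  "(real \<Rightarrow> riemann_sphere) \<Rightarrow> (riemann_sphere \<Rightarrow> complex) \<Rightarrow> (riemann_sphere \<Rightarrow> complex) \<Rightarrow> bool" where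
  "analytic_continuation p f g \<longleftrightarrow>
     (\<exists>F N. (\<forall>s\<in>{0..1}. open (N s) \<and> p s \<in> N s \<and> sphere_holomorphic_on (F s) (N s)) \<and>
        (\<forall>s\<in>{0..1}. \<exists>\<epsilon>>0. \<forall>s'\<in>{0..1}. \<bar>s' - s\<bar> < \<epsilon> \<longrightarrow>
            p s' \<in> N s \<and> (\<forall>\<^sub>F x in nhds (p s'). F s' x = F s x)) \<and>
        (\<forall>\<^sub>F x in nhds (p 0). F 0 x = f x) \<and>
        (\<forall>\<^sub>F x in nhds (p 1). F 1 x = g x))"


section \<open>Analytic functions of several complex variables\<close>

definition mv_holomorphic_on :: "(complex ^ 'r \<Rightarrow> complex) \<Rightarrow> (complex ^ 'r) set \<Rightarrow> bool" where
  "mv_holomorphic_on f U \<longleftrightarrow>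
     (\<forall>t\<in>U. \<exists>f'. (f has_derivative f') (at t) \<and> (\<forall>c v. f' (c *s v) = c * f' v))"

definition joint_holomorphic_on ::
  "(complex \<Rightarrow> complex ^ 'r \<Rightarrow> complex) \<Rightarrow> (complex \<times> (complex ^ 'r)) set \<Rightarrow> bool" where
  "joint_holomorphic_on f W \<longleftrightarrow>
     (\<forall>q\<in>W. \<exists>f'. ((\<lambda>(x, t). f x t) has_derivative f') (at q) \<and>
        (\<forall>c u v. f' (c * u, c *s v) = c * f' (u, v)))"

definition partial :: "'r \<Rightarrow> (complex ^ 'r \<Rightarrow> complex) \<Rightarrow> complex ^ 'r \<Rightarrow> complex" where
  "partial i f t = deriv (\<lambda>s. f (t + s *s axis i 1)) 0"


section \<open>Parameterized equations\<close>

text \<open>With \<open>w = 1/x\<close> the equation \<open>dY/dx = A Y\<close> becomes \<open>dY/dw = - w\<^sup>-\<^sup>2 A(1/w, t) Y\<close>.\<close>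

definition at_inf :: "(complex \<Rightarrow> 'p \<Rightarrow> complex ^ 'n ^ 'n) \<Rightarrow> complex \<Rightarrow> 'p \<Rightarrow> complex ^ 'n ^ 'n" where
  "at_inf A w t = (\<chi> i j. - (A (1 / w) t $ i $ j) / w\<^sup>2)"

definition analytic_equation_on ::
  "(complex \<Rightarrow> complex ^ 'r \<Rightarrow> complex ^ 'n ^ 'n) \<Rightarrow> riemann_sphere set \<Rightarrow> (complex ^ 'r) set \<Rightarrow> bool" where
  "analytic_equation_on A D P \<longleftrightarrow>
     (\<forall>i j. joint_holomorphic_on (\<lambda>x t. A x t $ i $ j) ((Pt -` D) \<times> P) \<and>
        (\<exists>B. joint_holomorphic_on B ((inf_chart -` D) \<times> P) \<and>
             (\<forall>w t. w \<noteq> 0 \<and> inf_chart w \<in> D \<and> t \<in> P \<longrightarrow> B w t = at_inf A w t $ i $ j)))"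

text \<open>Singularity of the equation at a point for a fixed parameter value; removable singularities
  do not count.\<close>

fun singular_point :: "(complex \<Rightarrow> 'p \<Rightarrow> complex ^ 'n ^ 'n) \<Rightarrow> 'p \<Rightarrow> riemann_sphere \<Rightarrow> bool" where
  "singular_point A t (Pt z) \<longleftrightarrow>
     \<not> (\<forall>i j. \<exists>g. g analytic_on {z} \<and> (\<forall>\<^sub>F x in at z. A x t $ i $ j = g x))"
| "singular_point A t Infty \<longleftrightarrow>
     \<not> (\<forall>i j. \<exists>g. g analytic_on {0} \<and> (\<forall>\<^sub>F w in at 0. at_inf A w t $ i $ j = g w))"

text \<open>The ring of parameterized Laurent series over \<open>U\<close>. The formal variable stands for \<open>x - \<alpha>(t)\<close>,
  so that \<^const>\<open>fls_deriv\<close> is \<open>d/dx\<close> and the ring itself does not depend on \<open>\<alpha>\<close>.\<close>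

definition laurent_ring :: "(complex ^ 'r) set \<Rightarrow> (complex ^ 'r \<Rightarrow> complex fls) set" where
  "laurent_ring U = {F. (\<exists>N. \<forall>t\<in>U. \<forall>j<N. fls_nth (F t) j = 0) \<and>
     (\<forall>j. mv_holomorphic_on (\<lambda>t. fls_nth (F t) j) U) \<and>
     (\<forall>t\<in>U. fls_conv_radius (F t) > 0)}"

definition laurent_matrices :: "(complex ^ 'r) set \<Rightarrow> (complex ^ 'r \<Rightarrow> (complex fls) ^ 'n ^ 'n) set" where
  "laurent_matrices U = {F. \<forall>i j. (\<lambda>t. F t $ i $ j) \<in> laurent_ring U}"

definition param_regular_singular ::
  "(complex ^ 'r) set \<Rightarrow> (complex ^ 'r \<Rightarrow> complex) \<Rightarrow> (complex \<Rightarrow> complex ^ 'r \<Rightarrow> complex ^ 'n ^ 'n) \<Rightarrow> bool" where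
  "param_regular_singular U \<alpha> A \<longleftrightarrow> mv_holomorphic_on \<alpha> U \<and>
     (\<exists>L \<in> laurent_matrices U. \<exists>S \<in> laurent_matrices U. \<exists>S' \<in> laurent_matrices U.
        (\<forall>t\<in>U. \<forall>i j. (\<lambda>h. A (\<alpha> t + h) t $ i $ j) has_laurent_expansion (L t $ i $ j)) \<and>
        (\<forall>t\<in>U. S t ** S' t = mat 1 \<and> S' t ** S t = mat 1) \<and>
        (\<forall>t\<in>U. \<forall>i j. \<forall>k < -1.
           fls_nth ((S' t ** L t ** S t - S' t ** map_matrix fls_deriv (S t)) $ i $ j) k = 0))"

definition param_regular_singular_near ::
  "(complex ^ 'r) set \<Rightarrow> (complex \<Rightarrow> complex ^ 'r \<Rightarrow> complex ^ 'n ^ 'n) \<Rightarrow>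
   (complex ^ 'r \<Rightarrow> riemann_sphere) \<Rightarrow> complex ^ 'r \<Rightarrow> bool" where
  "param_regular_singular_near P A \<xi> t0 \<longleftrightarrow>
     (\<exists>U \<alpha>. open U \<and> connected U \<and> t0 \<in> U \<and> U \<subseteq> P \<and>
        (if \<xi> t0 \<noteq> Infty
         then (\<forall>t\<in>U. \<xi> t = Pt (\<alpha> t)) \<and> param_regular_singular U \<alpha> A
         else (\<forall>t\<in>U. \<xi> t = inf_chart (\<alpha> t)) \<and> param_regular_singular U \<alpha> (at_inf A)))"

definition rational_function :: "(complex \<Rightarrow> complex) \<Rightarrow> bool" where
  "rational_function f \<longleftrightarrow> (\<exists>u v. v \<noteq> 0 \<and> (\<forall>x. poly v x \<noteq> 0 \<longrightarrow> f x = poly u x / poly v x))"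

definition poly_at :: "('p \<Rightarrow> complex) list \<Rightarrow> 'p \<Rightarrow> complex poly" where
  "poly_at cs t = Poly (map (\<lambda>f. f t) cs)"

text \<open>The entry \<open>(i, j)\<close> of \<open>A\<close> is the quotient of the polynomials in \<open>x\<close> with coefficient lists
  \<open>num i j\<close> and \<open>den i j\<close>. At special parameter values the denominator may vanish
  identically in \<open>x\<close>; there \<open>A\<close> is pinned down by rationality in \<open>x\<close> and analyticity on
  \<open>D \<times> P\<close>.\<close>

locale regular_singular_system =
  fixes P :: "(complex ^ 'r) set"
    and D :: "riemann_sphere set"
    and m :: nat
    and B :: "nat \<Rightarrow> riemann_sphere set"
    and x0 :: riemann_sphere
    and \<gamma> :: "nat \<Rightarrow> real \<Rightarrow> riemann_sphere"
    and num den :: "'n::finite \<Rightarrow> 'n \<Rightarrow> (complex ^ 'r \<Rightarrow> complex) list"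
    and A :: "complex \<Rightarrow> complex ^ 'r \<Rightarrow> complex ^ 'n ^ 'n"
    and \<xi> :: "nat \<Rightarrow> complex ^ 'r \<Rightarrow> riemann_sphere"
  assumes P_open: "open P"
    and P_simply_connected: "simply_connected P"
    and D_open: "open D"
    and disks: "\<And>i. i < m \<Longrightarrow> closed_disk (B i)"
    and disks_disjoint: "disjoint_family_on B {..<m}"
    and compl_D: "- D = (\<Union>i<m. B i)"
    and x0_in: "x0 \<in> D"
    and loops: "\<And>i. i < m \<Longrightarrow> loop_at D x0 (\<gamma> i)"
    and loops_encircle: "\<And>i. i < m \<Longrightarrow> encircles_once D (B i) (\<gamma> i)"
    and loops_generate: "generates_pi1 D x0 m \<gamma>"
    and coeffs_holomorphic: "\<And>i j f. f \<in> set (num i j) \<union> set (den i j) \<Longrightarrow> mv_holomorphic_on f P"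
    and den_nonzero: "\<And>i j. \<exists>f\<in>set (den i j). \<exists>t\<in>P. f t \<noteq> 0"
    and entries_rational: "\<And>i j t. t \<in> P \<Longrightarrow> rational_function (\<lambda>x. A x t $ i $ j)"
    and entries_quotient: "\<And>i j t x. t \<in> P \<Longrightarrow> Pt x \<in> D \<Longrightarrow>
          poly (poly_at (den i j) t) x * A x t $ i $ j = poly (poly_at (num i j) t) x"
    and analytic: "analytic_equation_on A D P"
    and unique_singular: "\<And>i t. i < m \<Longrightarrow> t \<in> P \<Longrightarrow> {x \<in> B i. singular_point A t x} = {\<xi> i t}"
    and regular_singular: "\<And>i t. i < m \<Longrightarrow> t \<in> P \<Longrightarrow> param_regular_singular_near P A (\<xi> i) t"

definition local_fundamental_solution ::
  "(complex \<Rightarrow> 'p \<Rightarrow> complex ^ 'n ^ 'n) \<Rightarrow> 'p \<Rightarrow> riemann_sphere \<Rightarrow> (riemann_sphere \<Rightarrow> complex ^ 'n ^ 'n) \<Rightarrow> bool" where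
  "local_fundamental_solution A t x0 Y \<longleftrightarrow>
     (\<exists>N. open N \<and> x0 \<in> N \<and> (\<forall>a b. sphere_holomorphic_on (\<lambda>x. Y x $ a $ b) N) \<and>
        (\<forall>x\<in>N. invertible (Y x)) \<and>
        (\<forall>z. Pt z \<in> N \<longrightarrow> (\<forall>a b.
           ((\<lambda>u. Y (Pt u) $ a $ b) has_field_derivative (A z t ** Y (Pt z)) $ a $ b) (at z))))"

definition projectively_isomonodromic ::
  "(complex ^ 'r) set \<Rightarrow> nat \<Rightarrow> riemann_sphere \<Rightarrow> (nat \<Rightarrow> real \<Rightarrow> riemann_sphere) \<Rightarrow>
   (complex \<Rightarrow> complex ^ 'r \<Rightarrow> complex ^ 'n ^ 'n) \<Rightarrow> bool" where
  "projectively_isomonodromic P m x0 \<gamma> A \<longleftrightarrow>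
     (\<exists>(c :: nat \<Rightarrow> complex ^ 'r \<Rightarrow> complex) (G :: nat \<Rightarrow> complex ^ 'n ^ 'n).
        (\<forall>i<m. mv_holomorphic_on (c i) P \<and> (\<forall>t\<in>P. c i t \<noteq> 0)) \<and>
        (\<forall>i<m. invertible (G i)) \<and>
        (\<forall>t\<in>P. \<exists>Y. local_fundamental_solution A t x0 Y \<and>
           (\<forall>i<m. \<forall>a b. analytic_continuation (\<gamma> i)
              (\<lambda>x. Y x $ a $ b) (\<lambda>x. (Y x ** G i ** mat (c i t)) $ a $ b))))"


section \<open>Differential algebra\<close>

definition is_field_hom :: "('a::field \<Rightarrow> 'b::field) \<Rightarrow> bool" where
  "is_field_hom h \<longleftrightarrow> h 1 = 1 \<and> (\<forall>x y. h (x + y) = h x + h y \<and> h (x * y) = h x * h y)"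

definition is_derivation :: "('a::field \<Rightarrow> 'a) \<Rightarrow> bool" where
  "is_derivation \<delta> \<longleftrightarrow> (\<forall>x y. \<delta> (x + y) = \<delta> x + \<delta> y \<and> \<delta> (x * y) = \<delta> x * y + x * \<delta> y)"

definition commuting_derivations :: "('r \<Rightarrow> 'a::field \<Rightarrow> 'a) \<Rightarrow> bool" where
  "commuting_derivations d \<longleftrightarrow> (\<forall>i. is_derivation (d i)) \<and> (\<forall>i j x. d i (d j x) = d j (d i x))"

text \<open>\<open>Jet n [i\<^sub>1, \<dots>, i\<^sub>k]\<close> stands for the derivative \<open>\<partial>\<^sub>i\<^sub>1 \<dots> \<partial>\<^sub>i\<^sub>k y\<^sub>n\<close> of the \<open>n\<close>-th unknown.\<close>

datatype ('k, 'r) diff_poly =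
    Coeff 'k
  | Jet nat "'r list"
  | Plus "('k, 'r) diff_poly" "('k, 'r) diff_poly"
  | Times "('k, 'r) diff_poly" "('k, 'r) diff_poly"

primrec diff_poly_eval ::
  "('a, 'b) ring_scheme \<Rightarrow> ('r \<Rightarrow> 'a \<Rightarrow> 'a) \<Rightarrow> ('k \<Rightarrow> 'a) \<Rightarrow> (nat \<Rightarrow> 'a) \<Rightarrow> ('k, 'r) diff_poly \<Rightarrow> 'a" where
  "diff_poly_eval L \<delta> e y (Coeff c) = e c"
| "diff_poly_eval L \<delta> e y (Jet n is) = foldr \<delta> is (y n)"
| "diff_poly_eval L \<delta> e y (Plus f g) = diff_poly_eval L \<delta> e y f \<oplus>\<^bsub>L\<^esub> diff_poly_eval L \<delta> e y g"
| "diff_poly_eval L \<delta> e y (Times f g) = diff_poly_eval L \<delta> e y f \<otimes>\<^bsub>L\<^esub> diff_poly_eval L \<delta> e y g"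

definition type_ring :: "'k::field ring" where
  "type_ring = \<lparr>carrier = UNIV, monoid.mult = (*), one = 1, zero = 0, add = (+)\<rparr>"

definition diff_field_extension ::
  "('r \<Rightarrow> 'k::field \<Rightarrow> 'k) \<Rightarrow> ('a, 'b) ring_scheme \<Rightarrow> ('r \<Rightarrow> 'a \<Rightarrow> 'a) \<Rightarrow> ('k \<Rightarrow> 'a) \<Rightarrow> bool" where
  "diff_field_extension d L \<delta> e \<longleftrightarrow> Ring.field L \<and> e \<in> ring_hom type_ring L \<and>
     (\<forall>i. \<forall>x\<in>carrier L. \<delta> i x \<in> carrier L) \<and>
     (\<forall>i. \<forall>x\<in>carrier L. \<forall>y\<in>carrier L. \<delta> i (x \<oplus>\<^bsub>L\<^esub> y) = \<delta> i x \<oplus>\<^bsub>L\<^esub> \<delta> i y \<and>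
        \<delta> i (x \<otimes>\<^bsub>L\<^esub> y) = (\<delta> i x \<otimes>\<^bsub>L\<^esub> y) \<oplus>\<^bsub>L\<^esub> (x \<otimes>\<^bsub>L\<^esub> \<delta> i y)) \<and>
     (\<forall>i j. \<forall>x\<in>carrier L. \<delta> i (\<delta> j x) = \<delta> j (\<delta> i x)) \<and>
     (\<forall>i c. \<delta> i (e c) = e (d i c))"

text \<open>Finite systems in finitely many unknowns. The extensions \<open>L\<close> range over all differential
  fields with carrier in the type \<open>'k\<close> of the base field. For an infinite field this is no
  restriction: a solution of a finite system in an arbitrary extension lies in a differential
  subfield generated over the base field by finitely many elements, which has the cardinality of
  the base field and can hence be transported into \<open>'k\<close> (the embedding \<open>e\<close> is arbitrary).\<close>

definition differentially_closed :: "('r \<Rightarrow> 'k::field \<Rightarrow> 'k) \<Rightarrow> bool" where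
  "differentially_closed d \<longleftrightarrow>
     (\<forall>S :: ('k, 'r) diff_poly set. finite S \<longrightarrow>
        (\<exists>(L :: 'k ring) \<delta> e y. diff_field_extension d L \<delta> e \<and> (\<forall>n. y n \<in> carrier L) \<and>
           (\<forall>f\<in>S. diff_poly_eval L \<delta> e y f = \<zero>\<^bsub>L\<^esub>)) \<longrightarrow>
        (\<exists>y. \<forall>f\<in>S. diff_poly_eval type_ring d id y f = 0))"

text \<open>\<open>k\<^sub>0\<close> is the type \<open>'k\<close>. The functions of \<open>t\<close> it is required to contain form a differential
  ring \<open>R\<close> of analytic functions on \<open>P\<close> (constants, coordinates, coefficients of \<open>A\<close>), embedded by \<open>\<iota>\<close>;
  elements of \<open>R\<close> only matter through their restrictions to \<open>P\<close>.\<close>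

locale closed_base_field =
  fixes P :: "(complex ^ 'r) set"
    and num den :: "'n::finite \<Rightarrow> 'n \<Rightarrow> (complex ^ 'r \<Rightarrow> complex) list"
    and R :: "(complex ^ 'r \<Rightarrow> complex) set"
    and \<iota> :: "(complex ^ 'r \<Rightarrow> complex) \<Rightarrow> 'k::field"
    and d :: "'r \<Rightarrow> 'k \<Rightarrow> 'k"
  assumes R_holomorphic: "\<And>f. f \<in> R \<Longrightarrow> mv_holomorphic_on f P"
    and R_const: "\<And>c. (\<lambda>_. c) \<in> R"
    and R_coord: "\<And>i. (\<lambda>t. t $ i) \<in> R"
    and R_coeffs: "\<And>i j. set (num i j) \<union> set (den i j) \<subseteq> R"
    and R_add: "\<And>f g. f \<in> R \<Longrightarrow> g \<in> R \<Longrightarrow> (\<lambda>t. f t + g t) \<in> R"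
    and R_mult: "\<And>f g. f \<in> R \<Longrightarrow> g \<in> R \<Longrightarrow> (\<lambda>t. f t * g t) \<in> R"
    and R_partial: "\<And>f i. f \<in> R \<Longrightarrow> partial i f \<in> R"
    and \<iota>_eq: "\<And>f g. f \<in> R \<Longrightarrow> g \<in> R \<Longrightarrow> \<iota> f = \<iota> g \<longleftrightarrow> (\<forall>t\<in>P. f t = g t)"
    and \<iota>_one: "\<iota> (\<lambda>_. 1) = 1"
    and \<iota>_add: "\<And>f g. f \<in> R \<Longrightarrow> g \<in> R \<Longrightarrow> \<iota> (\<lambda>t. f t + g t) = \<iota> f + \<iota> g"
    and \<iota>_mult: "\<And>f g. f \<in> R \<Longrightarrow> g \<in> R \<Longrightarrow> \<iota> (\<lambda>t. f t * g t) = \<iota> f * \<iota> g"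
    and \<iota>_partial: "\<And>f i. f \<in> R \<Longrightarrow> \<iota> (partial i f) = d i (\<iota> f)"
    and derivations: "commuting_derivations d"
    and constants: "{c. \<forall>i. d i c = 0} = range (\<lambda>c. \<iota> (\<lambda>_. c))"
    and closed: "differentially_closed d"

text \<open>The field \<open>k = k\<^sub>0(x)\<close> is \<open>'k poly fract\<close>.\<close>

definition const_fract :: "'k::field \<Rightarrow> 'k poly fract" where
  "const_fract c = Fract [:c:] 1"

definition x_fract :: "'k::field poly fract" where
  "x_fract = Fract [:0, 1:] 1"

definition matrix_over_k ::
  "((complex ^ 'r \<Rightarrow> complex) \<Rightarrow> 'k::field) \<Rightarrow> ('n::finite \<Rightarrow> 'n \<Rightarrow> (complex ^ 'r \<Rightarrow> complex) list) \<Rightarrow>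
   ('n \<Rightarrow> 'n \<Rightarrow> (complex ^ 'r \<Rightarrow> complex) list) \<Rightarrow> ('k poly fract) ^ 'n ^ 'n" where
  "matrix_over_k \<iota> num den = (\<chi> i j. Fract (Poly (map \<iota> (num i j))) (Poly (map \<iota> (den i j))))"

text \<open>The derivations \<open>dx\<close>, \<open>dt\<close> of \<open>k\<close> are uniquely determined by the axioms below.
  The PPV-field is the type \<open>'K\<close>, an extension of \<open>k\<close> by means of \<open>h\<close>.\<close>

locale PPV_extension =
  fixes d :: "'r \<Rightarrow> 'k::field \<Rightarrow> 'k"
    and M :: "('k poly fract) ^ 'n ^ 'n"
    and dx :: "'k poly fract \<Rightarrow> 'k poly fract"
    and dt :: "'r \<Rightarrow> 'k poly fract \<Rightarrow> 'k poly fract"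
    and h :: "'k poly fract \<Rightarrow> 'K::field"
    and Dx :: "'K \<Rightarrow> 'K"
    and Dt :: "'r \<Rightarrow> 'K \<Rightarrow> 'K"
    and Z :: "'K ^ 'n ^ 'n"
  assumes dx: "is_derivation dx" "dx x_fract = 1" "\<And>c. dx (const_fract c) = 0"
    and dt: "\<And>i. is_derivation (dt i)" "\<And>i. dt i x_fract = 0"
            "\<And>i c. dt i (const_fract c) = const_fract (d i c)"
    and h: "is_field_hom h" "\<And>f. h (dx f) = Dx (h f)" "\<And>i f. h (dt i f) = Dt i (h f)"
    and Dx: "is_derivation Dx"
    and Dt: "commuting_derivations Dt"
    and Dx_Dt: "\<And>i y. Dx (Dt i y) = Dt i (Dx y)"
    and Z_invertible: "invertible Z"
    and Z_solution: "map_matrix Dx Z = map_matrix h M ** Z"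
    and generated: "\<And>S. range h \<subseteq> S \<Longrightarrow> (\<And>a b. Z $ a $ b \<in> S) \<Longrightarrow>
          (\<And>u v. u \<in> S \<Longrightarrow> v \<in> S \<Longrightarrow> u + v \<in> S \<and> u * v \<in> S) \<Longrightarrow>
          (\<And>u. u \<in> S \<Longrightarrow> - u \<in> S \<and> inverse u \<in> S) \<Longrightarrow>
          (\<And>u. u \<in> S \<Longrightarrow> Dx u \<in> S) \<Longrightarrow> (\<And>u i. u \<in> S \<Longrightarrow> Dt i u \<in> S) \<Longrightarrow> S = UNIV"
    and Dx_constants: "{y. Dx y = 0} = range (\<lambda>c. h (const_fract c))"

definition PPV_automorphism ::
  "('k::field poly fract \<Rightarrow> 'K::field) \<Rightarrow> ('K \<Rightarrow> 'K) \<Rightarrow> ('r \<Rightarrow> 'K \<Rightarrow> 'K) \<Rightarrow> ('K \<Rightarrow> 'K) \<Rightarrow> bool" where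
  "PPV_automorphism h Dx Dt \<sigma> \<longleftrightarrow> bij \<sigma> \<and> is_field_hom \<sigma> \<and> (\<forall>f. \<sigma> (h f) = h f) \<and>
     (\<forall>y. \<sigma> (Dx y) = Dx (\<sigma> y)) \<and> (\<forall>i y. \<sigma> (Dt i y) = Dt i (\<sigma> y))"

definition PPV_group ::
  "('k::field poly fract \<Rightarrow> 'K::field) \<Rightarrow> ('K \<Rightarrow> 'K) \<Rightarrow> ('r \<Rightarrow> 'K \<Rightarrow> 'K) \<Rightarrow> 'K ^ 'n ^ 'n \<Rightarrow> ('k ^ 'n ^ 'n) set" where
  "PPV_group h Dx Dt Z =
     {N. \<exists>\<sigma>. PPV_automorphism h Dx Dt \<sigma> \<and>
        map_matrix \<sigma> Z = Z ** map_matrix (\<lambda>c. h (const_fract c)) N}"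

definition GL :: "('a::field ^ 'n ^ 'n) monoid" where
  "GL = \<lparr>carrier = {M. invertible M}, monoid.mult = (**), one = mat 1\<rparr>"

lemma group_GL: "group (GL :: ('a::field ^ 'n ^ 'n) monoid)"
proof (rule groupI)
  fix M :: "'a ^ 'n ^ 'n"
  assume "M \<in> carrier GL"
  then have "invertible M" by (simp add: GL_def)
  then obtain N where N: "M ** N = mat 1" "N ** M = mat 1"
    unfolding invertible_def by blast
  then have "invertible N" unfolding invertible_def by blast
  with N show "\<exists>N\<in>carrier GL. N \<otimes>\<^bsub>GL\<^esub> M = \<one>\<^bsub>GL\<^esub>"
    by (auto simp: GL_def)
next
  have "invertible (mat 1 :: 'a ^ 'n ^ 'n)"
    unfolding invertible_def by (rule exI[of _ "mat 1"]) simp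
  then show "\<one>\<^bsub>GL\<^esub> \<in> carrier (GL :: ('a ^ 'n ^ 'n) monoid)"
    by (simp add: GL_def)
qed (auto simp: GL_def matrix_mul_assoc invertible_mult)

end

theory Submission
  imports Defs "HOL-Library.Multiset_Order"
begin

text \<open>Write \<open>A(x,s)\<close> for the restriction of the equation to a line in the direction of \<open>t\<^sub>k\<close> and
  \<open>F\<close> for the derivative of \<open>A\<close> at \<open>s = 0\<close>. The derivative \<open>b\<close> of \<open>U(x,s) U(x,0)\<^sup>-\<^sup>1\<close>, where \<open>U\<close> is the
  fundamental solution normalized at \<open>x\<^sub>0\<close>, solves \<open>b' = [A,b] + F\<close>. Projective isomonodromy says that
  the monodromy is conjugate to a fixed one up to scalars, so after adding a solution of the
  homogeneous equation and passing to traceless parts \<open>b\<close> becomes single-valued on \<open>D\<close>. Since the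
  singular points are regular, \<open>b\<close> extends to a rational function of \<open>x\<close>. Hence the linear equation
  \<open>B' = [A,B] + \<partial>\<^sub>k A\<close> modulo scalars has a rational solution at generic parameter values, and by linear
  algebra and differential closedness one over \<open>k\<^sub>0(x)\<close>. Then \<open>Z\<^sup>-\<^sup>1(\<partial>\<^sub>k Z - B Z)\<close> is constant in \<open>x\<close> up to
  scalars, so commutators \<open>M\<close> in the group satisfy \<open>\<partial>\<^sub>k M = [M, E\<^sub>k]\<close> with \<open>E\<^sub>k\<close> over \<open>k\<^sub>0\<close>; over a
  differentially closed field such matrices are simultaneously conjugate to constant ones.\<close>

section \<open>Power series in a multiset of commuting variables\<close>

text \<open>Three obstacles shape the argument. The solutions in the hypothesis need not depend on t
  in any regular way, so the matrices conjugating the monodromy at nearby parameters cannot be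
  differentiated; a compactness argument on spaces of intertwiners replaces their derivative.
  Elements of the abstract field k_0 cannot be evaluated at a parameter, only those of
  \<open>R\<close> can, and neither pole order nor degree of the rational solution is bounded
  uniformly in t. So there is one linear system for each pair of bounds; each system unsolvable over
  k_0 leaves a nonzero witness in \<open>R\<close>, and Baire's theorem finds a parameter where no
  witness vanishes. The matrices E_k come from independent choices and need not satisfy any
  integrability condition; only their radial combination is integrated, in formal power series, and
  differential closedness brings the resulting conjugation back to k_0. Scalars are carried along
  throughout because the functions c_i(t) contribute them; they disappear in commutators.\<close>

typedef 'a mps = "UNIV :: (nat multiset => 'a) set"
 morphisms mcoeff Mps ..

lemma mcoeff_Mps [simp]: "mcoeff (Mps f) = f" by (simp add: Mps_inverse)

lemma mps_eqI: "(!!M. mcoeff f M = mcoeff g M) ==> f = g" by (metis mcoeff_inject ext)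

text \<open>Multisets of naturals are the monomials in countably many variables, addition being
  their product and \<open>size\<close> the total degree. A monomial has only finitely many
  factorizations, so the Cauchy product makes sense without bounding the number of
  variables.\<close>

definition splits :: "nat multiset => (nat multiset \<times> nat multiset) set" where
 "splits M = {(A, B). A + B = M}"

lemma finite_submultisets: "finite {A. A \<subseteq># (M :: 'a multiset)}"
proof (induction M)
 case (add x M)
 have "{A. A \<subseteq># add_mset x M} <= {A. A \<subseteq># M} \<union> add_mset x ` {A. A \<subseteq># M}"
 proof
  fix A assume "A : {A. A \<subseteq># add_mset x M}"
  hence A: "A \<subseteq># add_mset x M" by simp
  show "A : {A. A \<subseteq># M} \<union> add_mset x ` {A. A \<subseteq># M}"
  proof (cases "x \<in># A")
   case True
   then obtain A' where "A = add_mset x A'" by (metis mset_add)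
   with A show ?thesis by auto
  next
   case False
   hence "A \<subseteq># M" using A
    by (metis add_mset_remove_trivial diff_single_eq_union diff_single_trivial subset_eq_diff_conv union_single_eq_diff add_mset_add_single)
   thus ?thesis by simp
  qed
 qed
 thus ?case using add finite_subset by blast
qed simp

lemma splits_image: "splits M = (%A. (A, M - A)) ` {A. A \<subseteq># M}" by (auto simp: splits_def image_iff)

lemma finite_splits [simp, intro]: "finite (splits M)" unfolding splits_image using finite_submultisets by blast

lemma splits_empty [simp]: "splits {#} = {({#}, {#})}" by (auto simp: splits_def)

instantiation mps :: (comm_ring_1) comm_ring_1
begin
definition "0 = Mps (%_. 0)"
definition "1 = Mps (%M. if M = {#} then 1 else 0)"
definition "f + g = Mps (%M. mcoeff f M + mcoeff g M)"
definition "- f = Mps (%M. - mcoeff f M)"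
definition "f - g = Mps (%M. mcoeff f M - mcoeff g M)"
definition "f * g = Mps (%M. \<Sum>(A, B)\<in>splits M. mcoeff f A * mcoeff g B)"
instance
proof
 fix a b c :: "'a mps"
 show "a * b = b * a"
 proof (rule mps_eqI)
  fix M
  show "mcoeff (a * b) M = mcoeff (b * a) M" unfolding times_mps_def mcoeff_Mps
   by (rule sum.reindex_bij_witness[where i = prod.swap and j = prod.swap])
    (auto simp: splits_def mult.commute add.commute)
 qed
 show "a * b * c = a * (b * c)"
 proof (rule mps_eqI)
  fix M
  have "mcoeff (a * b * c) M =
    (\<Sum>(p, C)\<in>splits M. \<Sum>(A, B)\<in>splits p. mcoeff a A * mcoeff b B * mcoeff c C)"
   unfolding times_mps_def mcoeff_Mps by (auto simp: sum_distrib_right split_beta intro!: sum.cong)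
  also have "\<dots> = (\<Sum>(q, r)\<in>Sigma (splits M) (%(p, C). splits p). mcoeff a (fst r) * mcoeff b (snd r) * mcoeff c (snd q))"
   by (subst sum.Sigma[symmetric]) (auto simp: split_beta)
  also have "\<dots> = (\<Sum>(q, r)\<in>Sigma (splits M) (%(A, p). splits p). mcoeff a (fst q) * (mcoeff b (fst r) * mcoeff c (snd r)))"
   by (rule sum.reindex_bij_witness[where
      i = "%(q, r). ((fst q + fst r, snd r), (fst q, fst r))" and
      j = "%(q, r). ((fst r, snd r + snd q), (snd r, snd q))"])
    (auto simp: splits_def add.assoc mult.assoc)
  also have "\<dots> = (\<Sum>(A, p)\<in>splits M. \<Sum>(B, C)\<in>splits p. mcoeff a A * (mcoeff b B * mcoeff c C))"
   by (subst sum.Sigma[symmetric]) (auto simp: split_beta)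
  also have "\<dots> = mcoeff (a * (b * c)) M"
   unfolding times_mps_def mcoeff_Mps by (auto simp: sum_distrib_left split_beta intro!: sum.cong)
  finally show "mcoeff (a * b * c) M = mcoeff (a * (b * c)) M" .
 qed
 show "1 * a = a"
 proof (rule mps_eqI)
  fix M
  have "mcoeff (1 * a) M = (\<Sum>p\<in>splits M. if p = ({#}, M) then mcoeff a M else 0)"
   unfolding times_mps_def one_mps_def mcoeff_Mps by (rule sum.cong) (auto simp: splits_def split: if_splits)
  also have "\<dots> = mcoeff a M" by (subst sum.delta[OF finite_splits]) (simp add: splits_def)
  finally show "mcoeff (1 * a) M = mcoeff a M" .
 qed
 show "(a + b) * c = a * c + b * c"
  by (rule mps_eqI) (auto simp: times_mps_def plus_mps_def distrib_right sum.distrib split_beta)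
 have "mcoeff (0 :: 'a mps) {#} ~= mcoeff 1 {#}" by (simp add: zero_mps_def one_mps_def)
 thus "(0 :: 'a mps) ~= 1" by metis
qed (auto intro!: mps_eqI simp: zero_mps_def plus_mps_def uminus_mps_def minus_mps_def algebra_simps)
end

lemma mcoeff_simps [simp]:
 "mcoeff 0 M = 0" "mcoeff 1 M = (if M = {#} then 1 else 0)"
 "mcoeff (f + g) M = mcoeff f M + mcoeff g M" "mcoeff (- f) M = - mcoeff f M"
 "mcoeff (f - g) M = mcoeff f M - mcoeff g M"
 by (simp_all add: zero_mps_def one_mps_def plus_mps_def uminus_mps_def minus_mps_def)

lemma mcoeff_mult: "mcoeff (f * g) M = (\<Sum>(A, B)\<in>splits M. mcoeff f A * mcoeff g B)" by (simp add: times_mps_def)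

lemma mcoeff_sum [simp]: "mcoeff (sum f S) M = (\<Sum>x\<in>S. mcoeff (f x) M)"
 by (induction S rule: infinite_finite_induct) auto

lemma mcoeff_mult_empty [simp]: "mcoeff (f * g) {#} = mcoeff f {#} * mcoeff g {#}" by (simp add: mcoeff_mult)

text \<open>The multiset order is a well-order on monomials compatible with addition, so the
  coefficient of the product at the sum of the two least monomials is a single nonzero term. As a
  domain the ring has a fraction field, which will serve as differential field extension.\<close>

instance mps :: (idom) idom
proof
 fix f g :: "'a mps"
 assume "f ~= 0" "g ~= 0"
 have least: "\<exists>A. mcoeff h A ~= 0 & (\<forall>M. mcoeff h M ~= 0 --> A <= M)" if "h ~= 0" for h :: "'a mps"
 proof -
  have "\<exists>M. mcoeff h M ~= 0" using that mps_eqI[of h 0] by auto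
  then obtain M where "mcoeff h M ~= 0" by blast
  thus ?thesis using LeastI[of "%M. mcoeff h M ~= 0" M] Least_le[of "%M. mcoeff h M ~= 0"] by blast
 qed
 obtain A0 where A0: "mcoeff f A0 ~= 0" "!!M. mcoeff f M ~= 0 ==> A0 <= M" using least[OF \<open>f ~= 0\<close>] by blast
 obtain B0 where B0: "mcoeff g B0 ~= 0" "!!M. mcoeff g M ~= 0 ==> B0 <= M" using least[OF \<open>g ~= 0\<close>] by blast
 have *: "(A, B) = (A0, B0)" if "A + B = A0 + B0" "mcoeff f A ~= 0" "mcoeff g B ~= 0" for A B
 proof -
  have "A0 <= A" "B0 <= B" using that A0 B0 by auto
  moreover have "\<not> A0 < A" using that \<open>B0 <= B\<close> add_less_le_mono[of A0 A B0 B] by auto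
  ultimately have "A = A0" by auto
  thus ?thesis using that by auto
 qed
 have "mcoeff (f * g) (A0 + B0) =
   (\<Sum>p\<in>splits (A0 + B0). if p = (A0, B0) then mcoeff f A0 * mcoeff g B0 else 0)" unfolding mcoeff_mult
  apply (rule sum.cong[OF refl])
  subgoal for p using *[of "fst p" "snd p"] by (cases p) (auto simp: splits_def)
  done
 also have "\<dots> = mcoeff f A0 * mcoeff g B0" by (subst sum.delta[OF finite_splits]) (simp add: splits_def)
 finally have "mcoeff (f * g) (A0 + B0) ~= 0" using A0(1) B0(1) by simp
 thus "f * g ~= 0" by auto
qed

definition mps_const :: "'a::zero => 'a mps" where
 "mps_const c = Mps (%M. if M = {#} then c else 0)"

definition mps_deriv :: "nat => 'a::comm_ring_1 mps => 'a mps" where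
 "mps_deriv i f = Mps (%M. of_nat (count M i + 1) * mcoeff f (add_mset i M))"

lemma mcoeff_deriv: "mcoeff (mps_deriv i f) M = of_nat (count M i + 1) * mcoeff f (add_mset i M)"
 by (simp add: mps_deriv_def)

text \<open>The Euler operator, formally the sum of x_i times the i-th partial derivative; it is
  given on coefficients because that sum is infinite.\<close>

definition mps_euler :: "'a::comm_ring_1 mps => 'a mps" where
 "mps_euler f = Mps (%M. of_nat (size M) * mcoeff f M)"

lemma mcoeff_euler: "mcoeff (mps_euler f) M = of_nat (size M) * mcoeff f M" by (simp add: mps_euler_def)

lemma mps_deriv_add: "mps_deriv i (f + g) = mps_deriv i f + mps_deriv i g"
 by (rule mps_eqI) (simp add: mcoeff_deriv algebra_simps)

lemma mps_euler_add: "mps_euler (f + g) = mps_euler f + mps_euler g" by (rule mps_eqI) (simp add: mcoeff_euler algebra_simps)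

lemma mps_deriv_commute: "mps_deriv i (mps_deriv j f) = mps_deriv j (mps_deriv i f)"
 by (rule mps_eqI) (auto simp: mcoeff_deriv algebra_simps add_mset_commute)

lemma mps_euler_mult: "mps_euler (f * g) = mps_euler f * g + f * mps_euler g"
proof (rule mps_eqI)
 fix M
 show "mcoeff (mps_euler (f * g)) M = mcoeff (mps_euler f * g + f * mps_euler g) M"
  unfolding mcoeff_simps mcoeff_mult mcoeff_euler sum_distrib_left sum.distrib[symmetric]
  by (rule sum.cong) (auto simp: splits_def algebra_simps)
qed

text \<open>Factorizations of \<open>add_mset i M\<close> whose left factor lacks \<open>i\<close>
  have weight zero; removing one \<open>i\<close> from the left factor matches the others with the
  factorizations of \<open>M\<close>.\<close>

lemma sum_splits_add_mset_fst:
 "(\<Sum>(A, B)\<in>splits (add_mset i M). of_nat (count A i) * h A B :: 'a::comm_ring_1) =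
  (\<Sum>(A, B)\<in>splits M. of_nat (count A i + 1) * h (add_mset i A) B)"
proof -
 have "(\<Sum>(A, B)\<in>splits (add_mset i M). of_nat (count A i) * h A B) =
   (\<Sum>(A, B)\<in>{p : splits (add_mset i M). i \<in># fst p}. of_nat (count A i) * h A B)"
  by (rule sum.mono_neutral_cong_right) (auto, metis count_eq_zero_iff of_nat_0 mult_zero_left)
 also have "\<dots> = (\<Sum>(A, B)\<in>splits M. of_nat (count A i + 1) * h (add_mset i A) B)"
  by (rule sum.reindex_bij_witness[where i = "%(A, B). (add_mset i A, B)" and j = "%(A, B). (A - {#i#}, B)"])
   (auto simp: splits_def)
 finally show ?thesis .
qed

lemma sum_splits_swap: "(\<Sum>(A, B)\<in>splits M. h A B) = (\<Sum>(A, B)\<in>splits M. h B A)"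
 by (rule sum.reindex_bij_witness[where i = prod.swap and j = prod.swap])
  (auto simp: splits_def add.commute)

text \<open>The weight \<open>count M i + 1\<close> of a derivative is the multiplicity of
  \<open>i\<close> in the left factor plus that in the right factor; the two halves give the two
  terms of the product rule.\<close>

lemma mps_deriv_mult: "mps_deriv i (f * g) = mps_deriv i f * g + f * mps_deriv i g"
proof (rule mps_eqI)
 fix M
 have "mcoeff (mps_deriv i (f * g)) M =
  (\<Sum>(A, B)\<in>splits (add_mset i M). of_nat (count A i) * (mcoeff f A * mcoeff g B)) +
  (\<Sum>(A, B)\<in>splits (add_mset i M). of_nat (count B i) * (mcoeff f A * mcoeff g B))"
  unfolding mcoeff_deriv mcoeff_mult sum_distrib_left sum.distrib[symmetric]
  apply (rule sum.cong[OF refl])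
  subgoal for p
  proof (cases p)
   case (Pair A B)
   assume "p : splits (add_mset i M)"
   hence "A + B = add_mset i M" by (simp add: Pair splits_def)
   hence "count A i + count B i = count M i + 1" by (metis count_union count_add_mset Suc_eq_plus1)
   hence "(of_nat (count A i) + of_nat (count B i) :: 'a) = of_nat (count M i + 1)" by (metis of_nat_add)
   thus ?thesis by (simp add: Pair distrib_right[symmetric])
  qed
  done
 also have "(\<Sum>(A, B)\<in>splits (add_mset i M). of_nat (count B i) * (mcoeff f A * mcoeff g B)) =
   (\<Sum>(A, B)\<in>splits (add_mset i M). of_nat (count A i) * (mcoeff f B * mcoeff g A))" by (rule sum_splits_swap)
 also have "\<dots> = (\<Sum>(A, B)\<in>splits M. of_nat (count A i + 1) * (mcoeff f B * mcoeff g (add_mset i A)))"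
  by (rule sum_splits_add_mset_fst)
 also have "\<dots> = (\<Sum>(A, B)\<in>splits M. of_nat (count B i + 1) * (mcoeff f A * mcoeff g (add_mset i B)))"
  by (rule sum_splits_swap)
 also have "(\<Sum>(A, B)\<in>splits (add_mset i M). of_nat (count A i) * (mcoeff f A * mcoeff g B)) =
   (\<Sum>(A, B)\<in>splits M. of_nat (count A i + 1) * (mcoeff f (add_mset i A) * mcoeff g B))"
  by (rule sum_splits_add_mset_fst)
 finally show "mcoeff (mps_deriv i (f * g)) M = mcoeff (mps_deriv i f * g + f * mps_deriv i g) M"
  unfolding mcoeff_simps mcoeff_mult mcoeff_deriv by (simp add: mult_ac del: of_nat_add of_nat_Suc)
qed

text \<open>Formally the sum of x_i times g_i. A monomial receives contributions only from its own
  finitely many variables, so infinitely many \<open>g i\<close> may be nonzero. Applied to a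
  connection it gives the component in the radial direction.\<close>

definition radial :: "(nat => 'a::comm_ring_1 mps) => 'a mps" where
 "radial g = Mps (%M. \<Sum>i\<in>set_mset M. mcoeff (g i) (M - {#i#}))"

lemma mcoeff_radial: "mcoeff (radial g) M = (\<Sum>i\<in>set_mset M. mcoeff (g i) (M - {#i#}))" by (simp add: radial_def)

lemma radial_diff: "radial (%i. f i - g i) = radial f - radial g" by (rule mps_eqI) (simp add: mcoeff_radial sum_subtractf)

lemma radial_sum: "radial (%i. \<Sum>x\<in>S. f x i) = (\<Sum>x\<in>S. radial (f x))"
 by (rule mps_eqI) (simp add: mcoeff_radial sum.swap[of _ S])

text \<open>Euler's identity: the multiplicities of the variables of a monomial add up to its
  degree.\<close>

lemma radial_deriv: "radial (%i. mps_deriv i f) = mps_euler f"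
proof (rule mps_eqI)
 fix M
 have "(\<Sum>i\<in>set_mset M. mcoeff (mps_deriv i f) (M - {#i#})) = (\<Sum>i\<in>set_mset M. of_nat (count M i) * mcoeff f M)"
  by (rule sum.cong) (auto simp: mcoeff_deriv simp del: of_nat_add of_nat_Suc)
 also have "\<dots> = of_nat (size M) * mcoeff f M" by (simp add: size_multiset_overloaded_eq sum_distrib_right)
 finally show "mcoeff (radial (%i. mps_deriv i f)) M = mcoeff (mps_euler f) M" by (simp add: mcoeff_radial mcoeff_euler)
qed

lemma radial_mult_left: "radial (%i. f * g i) = f * radial g"
proof (rule mps_eqI)
 fix M
 have "mcoeff (radial (%i. f * g i)) M =
   (\<Sum>(i, A, B)\<in>Sigma (set_mset M) (%i. splits (M - {#i#})). mcoeff f A * mcoeff (g i) B)"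
  unfolding mcoeff_radial mcoeff_mult by (subst sum.Sigma) (auto simp: split_beta)
 also have "\<dots> = (\<Sum>(p, i)\<in>Sigma (splits M) (%(A, B). set_mset B). mcoeff f (fst p) * mcoeff (g i) (snd p - {#i#}))"
  by (rule sum.reindex_bij_witness[where i = "%(p, i). (i, fst p, snd p - {#i#})" and
     j = "%(i, A, B). ((A, add_mset i B), i)"])
   (auto simp: splits_def)
 also have "\<dots> = mcoeff (f * radial g) M"
  unfolding mcoeff_radial mcoeff_mult sum_distrib_left by (subst sum.Sigma[symmetric]) (auto simp: split_beta)
 finally show "mcoeff (radial (%i. f * g i)) M = mcoeff (f * radial g) M" .
qed

lemma radial_mult_right: "radial (%i. g i * f) = radial g * f" using radial_mult_left[of f g] by (simp add: mult.commute)

lemma mcoeff_radial_empty [simp]: "mcoeff (radial g) {#} = 0" by (simp add: mcoeff_radial)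

section \<open>Derivations and their extension to fraction fields\<close>

lemma is_derivation_add: "is_derivation dl ==> dl (x + y) = dl x + dl y"
 and is_derivation_mult: "is_derivation dl ==> dl (x * y) = dl x * y + x * dl y" by (auto simp: is_derivation_def)

lemma is_derivation_0: assumes "is_derivation dl" shows "dl 0 = 0"
 using is_derivation_add[OF assms, of 0 0] by (metis add.right_neutral add_left_cancel)

lemma is_derivation_1: assumes "is_derivation dl" shows "dl 1 = 0"
 using is_derivation_mult[OF assms, of 1 1] by (metis add.right_neutral add_left_cancel mult_1_left mult_1_right)

lemma is_derivation_minus: assumes "is_derivation dl" shows "dl (- x) = - dl x"
 using is_derivation_add[OF assms, of x "- x"] is_derivation_0[OF assms] by (simp add: minus_unique)

lemma is_derivation_diff: assumes "is_derivation dl" shows "dl (x - y) = dl x - dl y"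
 using is_derivation_add[OF assms, of x "- y"] is_derivation_minus[OF assms, of y] by simp

lemma is_derivation_sum: assumes "is_derivation dl" shows "dl (sum f S) = (\<Sum>x\<in>S. dl (f x))"
 by (induction S rule: infinite_finite_induct)
  (auto simp: is_derivation_0[OF assms] is_derivation_add[OF assms])

lemma is_derivation_inverse:
 assumes "is_derivation dl" shows "dl (inverse x) = - dl x * inverse x * inverse x"
proof (cases "x = 0")
 case False
 hence "dl x * inverse x + x * dl (inverse x) = 0"
  using is_derivation_mult[OF assms, of x "inverse x"] is_derivation_1[OF assms] by simp
 hence "x * dl (inverse x) = - (dl x * inverse x)" by (simp add: eq_neg_iff_add_eq_0 add.commute)
 hence "inverse x * (x * dl (inverse x)) = inverse x * (- (dl x * inverse x))" by simp
 with False show ?thesis by (simp add: mult.assoc[symmetric])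
qed (simp add: is_derivation_0[OF assms])

lemma derivation_fract_unique:
 fixes dl :: "'a::idom fract => 'a fract"
 assumes "is_derivation dl" "is_derivation dl'" "!!a. dl (Fract a 1) = dl' (Fract a 1)"
 shows "dl q = dl' q"
proof (cases q)
 case (Fract a b)
 hence q: "q = Fract a 1 * inverse (Fract b 1)" by simp
 show ?thesis unfolding q by (simp only: is_derivation_mult[OF assms(1)] is_derivation_mult[OF assms(2)]
    is_derivation_inverse[OF assms(1)] is_derivation_inverse[OF assms(2)] assms(3))
qed

text \<open>The quotient rule is stated as a relation \<open>R\<close> between fractions, so that
  independence of the representation can be proved before a function is defined from it.\<close>

lemma derivation_fract_exists:
 fixes dl :: "'a::idom => 'a"
 assumes add: "!!x y. dl (x + y) = dl x + dl y"
  and mult: "!!x y. dl (x * y) = dl x * y + x * dl y"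
 shows "\<exists>D. is_derivation D & (\<forall>a. D (Fract a 1) = Fract (dl a) 1)"
proof -
 define R where "R q r \<longleftrightarrow> (\<exists>a b. b ~= 0 & q = Fract a b & r = Fract (dl a * b - a * dl b) (b * b))" for q r
 have uniq: "r = r'" if "R q r" "R q r'" for q r r'
 proof -
  from that obtain a b a' b' where *: "b ~= 0" "b' ~= 0" "q = Fract a b" "q = Fract a' b'"
   "r = Fract (dl a * b - a * dl b) (b * b)" "r' = Fract (dl a' * b' - a' * dl b') (b' * b')" unfolding R_def by blast
  have e: "a * b' = a' * b" using * by (simp add: eq_fract)
  have d: "dl a * b' + a * dl b' = dl a' * b + a' * dl b" using arg_cong[OF e, of dl] by (simp add: mult)
  \<comment> \<open>The difference of the cross products is a combination of the identity
    \<open>e\<close> and of its derivative \<open>d\<close>.\<close>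
  have "(dl a * b - a * dl b) * (b' * b') - (dl a' * b' - a' * dl b') * (b * b) =
    ((dl a * b' + a * dl b') - (dl a' * b + a' * dl b)) * (b * b') - (a * b' - a' * b) * (b' * dl b + b * dl b')"
   by (simp add: algebra_simps)
  hence "(dl a * b - a * dl b) * (b' * b') = (dl a' * b' - a' * dl b') * (b * b)" by (simp add: e d)
  thus ?thesis using * by (simp add: eq_fract)
 qed
 have R1: "\<exists>r. R q r" for q by (cases q) (auto simp: R_def)
 define D where "D q = (THE r. R q r)" for q
 have DI: "D q = r" if "R q r" for q r unfolding D_def using uniq that by blast
 have D: "D (Fract a b) = Fract (dl a * b - a * dl b) (b * b)" if "b ~= 0" for a b
  by (rule DI) (use that in \<open>auto simp: R_def\<close>)
 have d1: "dl 1 = 0" using mult[of 1 1] by (metis add.right_neutral add_left_cancel mult_1_left mult_1_right)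
 have "is_derivation D" unfolding is_derivation_def
 proof (intro allI conjI)
  fix x y :: "'a fract"
  obtain a b where x: "x = Fract a b" "b ~= 0" by (cases x)
  obtain a' b' where y: "y = Fract a' b'" "b' ~= 0" by (cases y)
  show "D (x + y) = D x + D y" using x y by (simp add: D eq_fract add mult algebra_simps)
  show "D (x * y) = D x * y + x * D y" using x y by (simp add: D eq_fract add mult algebra_simps)
 qed
 moreover have "D (Fract a 1) = Fract (dl a) 1" for a by (simp add: D d1)
 ultimately show ?thesis by blast
qed

lemma is_derivation_commutator:
 assumes "is_derivation f" "is_derivation g"
 shows "is_derivation (%x. f (g x) - g (f x))" using assms unfolding is_derivation_def by (auto simp: algebra_simps)

lemma is_derivation_zero: "is_derivation (%_. 0)" by (simp add: is_derivation_def)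

text \<open>The commutator of two derivations is again a derivation, and a derivation of the
  fraction field is determined by its values on the ring, where the commutator vanishes.\<close>

lemma commuting_derivations_fract_exist:
 fixes dl :: "'r => 'a::idom => 'a"
 assumes add: "!!i x y. dl i (x + y) = dl i x + dl i y"
  and mult: "!!i x y. dl i (x * y) = dl i x * y + x * dl i y"
  and comm: "!!i j x. dl i (dl j x) = dl j (dl i x)"
 shows "\<exists>D. commuting_derivations D & (\<forall>i a. D i (Fract a 1) = Fract (dl i a) 1)"
proof -
 have "\<exists>D. is_derivation D & (\<forall>a. D (Fract a 1) = Fract (dl i a) 1)" for i
  by (rule derivation_fract_exists) (simp_all add: add mult)
 then obtain D where D: "!!i. is_derivation (D i)" "!!i a. D i (Fract a 1) = Fract (dl i a) 1" by metis
 have "D i (D j q) - D j (D i q) = 0" for i j q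
  by (rule derivation_fract_unique[OF is_derivation_commutator[OF D(1) D(1)] is_derivation_zero])
   (simp add: D(2) comm)
 hence "commuting_derivations D" by (simp add: commuting_derivations_def D(1))
 with D(2) show ?thesis by blast
qed

text \<open>An injective coding of differential polynomials inside the coefficient field, built from
  a pairing function \<open>pr\<close> and an embedding \<open>nn\<close> of the naturals; the tags
  0 to 3 record the constructor. Such codes allow an abstract extension to be moved into the type of
  the base field.\<close>

primrec dcode :: "('k \<times> 'k => 'k) => (nat => 'k) => ('k, 'r::countable) diff_poly => 'k" where
 "dcode pr nn (Coeff c) = pr (nn 0, c)"
| "dcode pr nn (Jet n is) = pr (nn 1, nn (to_nat (n, is)))"
| "dcode pr nn (Plus f g) = pr (nn 2, pr (dcode pr nn f, dcode pr nn g))"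
| "dcode pr nn (Times f g) = pr (nn 3, pr (dcode pr nn f, dcode pr nn g))"

lemma inj_dcode:
 fixes pr :: "'k \<times> 'k => 'k"
 assumes "inj pr" "inj nn"
 shows "inj (dcode pr nn :: ('k, 'r::countable) diff_poly => 'k)"
proof -
 have "dcode pr nn f = dcode pr nn g ==> f = g" for f g :: "('k, 'r) diff_poly"
  by (induction f arbitrary: g; case_tac g) (auto simp: inj_eq[OF assms(1)] inj_eq[OF assms(2)])
 thus ?thesis by (auto simp: inj_def)
qed

text \<open>Differentiation on the level of syntax; it shows that the values of differential
  polynomials at a given solution are closed under the derivations.\<close>

primrec dp_deriv :: "('r => 'k => 'k) => 'r => ('k, 'r) diff_poly => ('k, 'r) diff_poly" where
 "dp_deriv d i (Coeff c) = Coeff (d i c)"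
| "dp_deriv d i (Jet n is) = Jet n (i # is)"
| "dp_deriv d i (Plus f g) = Plus (dp_deriv d i f) (dp_deriv d i g)"
| "dp_deriv d i (Times f g) = Plus (Times (dp_deriv d i f) g) (Times f (dp_deriv d i g))"

lemma type_ring_simps [simp]:
 "carrier type_ring = UNIV" "x \<otimes>\<^bsub>type_ring\<^esub> y = x * y" "x \<oplus>\<^bsub>type_ring\<^esub> y = x + y"
 "\<one>\<^bsub>type_ring\<^esub> = 1" "\<zero>\<^bsub>type_ring\<^esub> = 0" by (simp_all add: type_ring_def)

text \<open>A solution in an arbitrary differential field extension lives in the subfield of quotients of
 values of differential polynomials, whose elements can be coded in the base field.\<close>

lemma differentially_closed_solution:
 fixes d :: "'r::countable => 'k::field => 'k" and dl :: "'r => 'F::field => 'F"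
 assumes closed: "differentially_closed d" and inf: "infinite (UNIV :: 'k set)"
  and e: "is_field_hom e" and dl: "commuting_derivations dl" and dle: "!!i c. dl i (e c) = e (d i c)"
  and S: "finite S" and sol: "!!f. f : S ==> diff_poly_eval type_ring dl e y f = 0"
 shows "\<exists>y. \<forall>f\<in>S. diff_poly_eval type_ring d id y f = 0"
proof -
 have "\<exists>f :: 'k \<times> 'k => 'k. bij_betw f (UNIV \<times> UNIV) UNIV"
  using card_of_Times_same_infinite[OF inf] card_of_ordIso by blast
 then obtain pr :: "'k \<times> 'k => 'k" where pr: "inj pr" by (auto simp: bij_betw_def)
 obtain nn :: "nat => 'k" where nn: "inj nn" using infinite_countable_subset[OF inf] by blast
 define ev where "ev = diff_poly_eval type_ring dl e y"
 have ev: "ev (Coeff c) = e c" "ev (Jet n []) = y n" "ev (Plus f g) = ev f + ev g"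
  "ev (Times f g) = ev f * ev g" for c n f g by (simp_all add: ev_def)
 have der: "is_derivation (dl i)" for i using dl by (simp add: commuting_derivations_def)
 have ev_deriv: "dl i (ev f) = ev (dp_deriv d i f)" for i f by (induction f)
   (simp_all add: ev_def dle is_derivation_add[OF der] is_derivation_mult[OF der])
 have e0: "e 0 = 0" and e1: "e 1 = 1"
  using e unfolding is_field_hom_def by (metis add_0 add_left_cancel add.right_neutral, metis)
 have em1: "e (-1) = -1" using e e0 unfolding is_field_hom_def by (metis add.inverse_unique e1 right_minus)
 \<comment> \<open>Denominators of value zero are harmless: the quotient is then 0, which belongs to
   \<open>Q\<close> anyway.\<close>
 define Q where "Q = {ev f / ev g | f g. True}"
 have Q_ev: "ev f : Q" for f
 proof -
  have "ev f = ev f / ev (Coeff 1)" by (simp add: ev e1)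
  thus ?thesis unfolding Q_def by blast
 qed
 have Q0: "0 : Q" and Q1: "1 : Q" using Q_ev[of "Coeff 0"] Q_ev[of "Coeff 1"] by (simp_all add: ev e0 e1)
 have Q_mult: "a * b : Q" if "a : Q" "b : Q" for a b
 proof -
  from that obtain f g f' g' where *: "a = ev f / ev g" "b = ev f' / ev g'" by (auto simp: Q_def)
  hence "a * b = ev (Times f f') / ev (Times g g')" by (simp add: ev)
  thus ?thesis unfolding Q_def by blast
 qed
 have Q_inv: "inverse a : Q" if "a : Q" for a
 proof -
  from that obtain f g where "a = ev f / ev g" by (auto simp: Q_def)
  hence "inverse a = ev g / ev f" by simp
  thus ?thesis unfolding Q_def by blast
 qed
 have Q_add: "a + b : Q" if ab: "a : Q" "b : Q" for a b
 proof (cases "a = 0 \<or> b = 0")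
  case False
  then obtain f g f' g' where *: "a = ev f / ev g" "b = ev f' / ev g'" "ev g ~= 0" "ev g' ~= 0"
   using ab unfolding Q_def by auto
  hence "a + b = ev (Plus (Times f g') (Times f' g)) / ev (Times g g')" by (simp add: ev field_simps)
  thus ?thesis unfolding Q_def by blast
 qed (use ab in auto)
 have Q_minus: "- a : Q" if "a : Q" for a using Q_mult[OF Q_ev[of "Coeff (-1)"] that] by (simp add: ev em1)
 have Q_diff: "a - b : Q" if "a : Q" "b : Q" for a b using Q_add[OF that(1) Q_minus[OF that(2)]] by simp
 have Q_d: "dl i a : Q" if a: "a : Q" for i a
 proof -
  from a obtain f g where a: "a = ev f * inverse (ev g)" by (auto simp: Q_def divide_inverse)
  show ?thesis unfolding a by (simp add: is_derivation_mult[OF der] is_derivation_inverse[OF der] ev_deriv)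
    (intro Q_diff Q_mult Q_inv Q_ev)
 qed
 \<comment> \<open>Each quotient is coded by one chosen representation. The code determines the two
   differential polynomials and hence the quotient, so \<open>ph\<close> is injective on
   \<open>Q\<close>.\<close>
 define ph where "ph a = (case (SOME (f, g). a = ev f / ev g) of (f, g) => pr (dcode pr nn f, dcode pr nn g))" for a
 have phi_ex: "\<exists>f g. a = ev f / ev g & ph a = pr (dcode pr nn f, dcode pr nn g)" if "a : Q" for a
 proof -
  obtain f g where "(SOME (f, g). a = ev f / ev g) = (f, g)" by (meson surj_pair)
  moreover have "case (SOME (f, g). a = ev f / ev g) of (f, g) => a = ev f / ev g"
   by (rule someI_ex) (use that in \<open>auto simp: Q_def\<close>)
  ultimately show ?thesis unfolding ph_def by auto
 qed
 have inj: "inj_on ph Q"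
 proof (rule inj_onI)
  fix a b assume "a : Q" "b : Q" and eq: "ph a = ph b"
  then obtain f g f' g' where *: "a = ev f / ev g" "ph a = pr (dcode pr nn f, dcode pr nn g)"
   "b = ev f' / ev g'" "ph b = pr (dcode pr nn f', dcode pr nn g')" using phi_ex by metis
  hence "dcode pr nn f = dcode pr nn f'" "dcode pr nn g = dcode pr nn g'" using eq pr by (auto simp: inj_eq)
  hence "f = f'" "g = g'" using injD[OF inj_dcode[OF pr nn]] by auto
  thus "a = b" using * by simp
 qed
 define \<psi> where "\<psi> = inv_into Q ph"
 have psi [simp]: "\<psi> (ph a) = a" if "a : Q" for a unfolding \<psi>_def using inj that by simp
 \<comment> \<open>The field structure of \<open>Q\<close> transported along \<open>ph\<close>; the
   carrier is now a subset of the type of the base field, as \<open>differentially_closed\<close>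
   demands.\<close>
 define L :: "'k ring" where "L = \<lparr>carrier = ph ` Q, monoid.mult = (%a b. ph (\<psi> a * \<psi> b)),
   one = ph 1, zero = ph 0, add = (%a b. ph (\<psi> a + \<psi> b))\<rparr>"
 have L: "carrier L = ph ` Q" "!!a b. a \<otimes>\<^bsub>L\<^esub> b = ph (\<psi> a * \<psi> b)" "\<one>\<^bsub>L\<^esub> = ph 1" "\<zero>\<^bsub>L\<^esub> = ph 0"
  "!!a b. a \<oplus>\<^bsub>L\<^esub> b = ph (\<psi> a + \<psi> b)" by (simp_all add: L_def)
 note closure = Q0 Q1 Q_mult Q_inv Q_add Q_minus Q_d Q_ev
 have cring: "cring L"
 proof (rule cringI)
  show "abelian_group L"
   apply (rule abelian_groupI)
      apply (auto simp: L closure add_ac) by (metis add.right_inverse Q_minus add.commute psi)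
  show "comm_monoid L" by (rule comm_monoidI) (auto simp: L closure mult_ac)
 qed (auto simp: L closure algebra_simps)
 have fieldL: "Ring.field L"
 proof (rule cring.cring_fieldI[OF cring])
  show "Units L = carrier L - {\<zero>\<^bsub>L\<^esub>}"
  proof (intro equalityI subsetI)
   fix x assume x: "x : Units L"
   hence xc: "x : carrier L" by (simp add: Units_def)
   then obtain a where a: "x = ph a" "a : Q" by (auto simp: L)
   from x obtain y where "y : carrier L" "y \<otimes>\<^bsub>L\<^esub> x = \<one>\<^bsub>L\<^esub>" by (auto simp: Units_def)
   then obtain b where "b : Q" "ph (b * a) = ph 1" using a by (auto simp: L)
   hence "b * a = 1" using inj a by (meson closure inj_onD)
   hence "a ~= 0" by auto
   hence "x ~= \<zero>\<^bsub>L\<^esub>" using a inj by (auto simp: L inj_on_eq_iff closure)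
   with xc show "x : carrier L - {\<zero>\<^bsub>L\<^esub>}" by simp
  next
   fix x assume "x : carrier L - {\<zero>\<^bsub>L\<^esub>}"
   then obtain a where a: "x = ph a" "a : Q" "a ~= 0" by (auto simp: L)
   thus "x : Units L" unfolding Units_def by (auto simp: L closure intro!: bexI[of _ "inverse a"])
  qed
 qed
 define dl' where "dl' i a = ph (dl i (\<psi> a))" for i a
 have Qe: "e c : Q" for c using Q_ev[of "Coeff c"] by (simp add: ev)
 have comm: "dl i (dl j x) = dl j (dl i x)" for i j x using dl by (auto simp: commuting_derivations_def)
 have "e : ring_hom type_ring (type_ring :: 'F ring)" using e by (auto simp: ring_hom_def is_field_hom_def)
 hence "ph \<circ> e : ring_hom type_ring L" using Qe by (auto simp: ring_hom_def L e1)
 hence ext: "diff_field_extension d L dl' (ph \<circ> e)" unfolding diff_field_extension_def using fieldL Qe comm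
  by (auto simp: L dl'_def closure dle is_derivation_add[OF der] is_derivation_mult[OF der])
 have Qjet: "foldr dl is (y n) : Q" for n "is" using Q_ev[of "Jet n is"] by (simp add: ev_def)
 have jet: "foldr dl' is (ph (y n)) = ph (foldr dl is (y n))" for n "is" by (induction "is") (simp_all add: dl'_def Qjet)
 have eval: "diff_poly_eval L dl' (ph \<circ> e) (%n. ph (y n)) f = ph (ev f)" for f
  by (induction f) (simp_all add: jet L ev closure, simp add: ev_def)
 have "\<exists>(L :: 'k ring) dl e y. diff_field_extension d L dl e & (\<forall>n. y n : carrier L) &
      (\<forall>f\<in>S. diff_poly_eval L dl e y f = \<zero>\<^bsub>L\<^esub>)"
  apply (rule exI[of _ L], rule exI[of _ dl'], rule exI[of _ "ph \<circ> e"], rule exI[of _ "%n. ph (y n)"])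
  using ext Qjet[of "[]"] sol by (auto simp: eval L ev_def)
 with closed S show ?thesis unfolding differentially_closed_def by blast
qed

section \<open>Formal Taylor expansion along commuting derivations and the radial equation\<close>

lemma comp_fun_commute_derivations:
 assumes "!!i j x. D i (D j x) = D j (D i x)"
 shows "comp_fun_commute D" by standard (use assms in \<open>auto simp: fun_eq_iff\<close>)

definition mset_fact :: "nat multiset => nat" where
 "mset_fact M = (\<Prod>i\<in>set_mset M. fact (count M i))"

lemma mset_fact_superset:
 assumes "finite A" "set_mset M <= A" shows "mset_fact M = (\<Prod>i\<in>A. fact (count M i))"
 unfolding mset_fact_def using assms by (intro prod.mono_neutral_left) (auto simp: not_in_iff)

lemma mset_fact_empty [simp]: "mset_fact {#} = 1" by (simp add: mset_fact_def)

lemma mset_fact_add_mset: "mset_fact (add_mset i M) = (count M i + 1) * mset_fact M"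
proof -
 define A where "A = insert i (set_mset M)"
 have A: "finite A" "i : A" by (auto simp: A_def)
 have "mset_fact (add_mset i M) = (\<Prod>j\<in>A. fact (count (add_mset i M) j))"
  by (rule mset_fact_superset) (auto simp: A_def)
 also have "\<dots> = fact (count M i + 1) * (\<Prod>j\<in>A - {i}. fact (count M j))"
  by (subst prod.remove[OF A]) (auto intro!: prod.cong)
 also have "\<dots> = (count M i + 1) * (fact (count M i) * (\<Prod>j\<in>A - {i}. fact (count M j)))"
  by (simp add: algebra_simps)
 also have "fact (count M i) * (\<Prod>j\<in>A - {i}. fact (count M j)) = mset_fact M"
  by (subst prod.remove[OF A, symmetric]) (rule mset_fact_superset[symmetric], auto simp: A_def)
 finally show ?thesis .
qed

text \<open>Iterated derivatives along the monomial divided by the multi-index factorial; since the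
  derivations commute, \<open>fold_mset\<close> is independent of the order. In characteristic 0
  this embeds the differential field into formal power series with their partial
  derivatives.\<close>

definition taylor :: "(nat => 'a::field => 'a) => 'a => 'a mps" where
 "taylor D a = Mps (%M. fold_mset D a M / of_nat (mset_fact M))"

locale char0_derivations =
 fixes D :: "nat => 'a::field => 'a"
 assumes char0: "!!n. n > 0 ==> (of_nat n :: 'a) ~= 0"
  and D: "commuting_derivations D"
begin

lemma derD: "is_derivation (D i)" and commD: "D i (D j x) = D j (D i x)" using D by (auto simp: commuting_derivations_def)

lemma taylor_empty [simp]: "mcoeff (taylor D a) {#} = a" by (simp add: taylor_def)

lemma fold_D: "fold_mset D a (add_mset i M) = fold_mset D (D i a) M"
proof -
 interpret comp_fun_commute D by (rule comp_fun_commute_derivations) (rule commD)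
 show ?thesis by (simp add: fold_mset_fun_left_comm)
qed

lemma deriv_taylor: "mps_deriv i (taylor D a) = taylor D (D i a)"
proof (rule mps_eqI)
 fix M
 have "(of_nat (count M i + 1) :: 'a) ~= 0" by (rule char0) simp
 thus "mcoeff (mps_deriv i (taylor D a)) M = mcoeff (taylor D (D i a)) M"
  by (simp add: mcoeff_deriv taylor_def fold_D mset_fact_add_mset del: of_nat_Suc of_nat_add mult_Suc)
qed

text \<open>In characteristic 0 every coefficient except the constant one can be read off a partial
  derivative. As \<open>taylor\<close> intertwines the derivations, identities between Taylor
  expansions become inductions on the monomial.\<close>

lemma mcoeff_eq_by_deriv:
 assumes "mcoeff (mps_deriv i f) M = mcoeff (mps_deriv i g) M"
 shows "mcoeff f (add_mset i M) = mcoeff (g :: 'a mps) (add_mset i M)"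
proof -
 have "(of_nat (count M i + 1) :: 'a) ~= 0" by (rule char0) simp
 thus ?thesis using assms by (simp add: mcoeff_deriv del: of_nat_Suc of_nat_add)
qed

lemma taylor_add: "taylor D (a + b) = taylor D a + taylor D b"
proof -
 have "mcoeff (taylor D (a + b)) M = mcoeff (taylor D a + taylor D b) M" for M
 proof (induction M arbitrary: a b)
  case (add i M)
  show ?case
   by (rule mcoeff_eq_by_deriv) (use add in \<open>simp add: deriv_taylor mps_deriv_add is_derivation_add[OF derD]\<close>)
 qed simp
 thus ?thesis by (rule mps_eqI)
qed

lemma taylor_mult: "taylor D (a * b) = taylor D a * taylor D b"
proof -
 have "mcoeff (taylor D (a * b)) M = mcoeff (taylor D a * taylor D b) M" for M
 proof (induction M arbitrary: a b)
  case (add i M)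
  show ?case by (rule mcoeff_eq_by_deriv)
    (use add in \<open>simp add: deriv_taylor mps_deriv_mult is_derivation_mult[OF derD] taylor_add\<close>)
 qed simp
 thus ?thesis by (rule mps_eqI)
qed

lemma taylor_0 [simp]: "taylor D 0 = 0" using taylor_add[of 0 0] by (metis add.right_neutral add_left_cancel)

text \<open>A nonzero idempotent of a domain is 1.\<close>

lemma taylor_1 [simp]: "taylor D 1 = 1"
proof -
 have "taylor D 1 * taylor D 1 = taylor D 1 * 1" using taylor_mult[of 1 1] by simp
 moreover have "taylor D 1 ~= 0" by (metis mcoeff_simps(1) taylor_empty zero_neq_one)
 ultimately show ?thesis by (metis mult_left_cancel)
qed

lemma taylor_minus: "taylor D (- a) = - taylor D a" using taylor_add[of a "- a"] by (simp add: minus_unique)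

lemma taylor_diff: "taylor D (a - b) = taylor D a - taylor D b" using taylor_add[of a "- b"] by (simp add: taylor_minus)

lemma taylor_sum: "taylor D (sum f S) = (\<Sum>x\<in>S. taylor D (f x))"
 by (induction S rule: infinite_finite_induct) (auto simp: taylor_add)

end

text \<open>Comparison of the coefficients of \<open>M\<close> in \<theta> \<Phi> = \<Phi> E: on the
  left stands \<open>size M\<close> times the unknown, and on the right the term with
  \<open>A = M\<close> drops out because \<open>E\<close> has no constant term. This leaves a
  recursion over proper submultisets, started at 1.\<close>

function exp_coeff :: "(nat multiset => 'a::field ^ 'n ^ 'n) => nat multiset => 'a ^ 'n ^ 'n" where
 "exp_coeff E M = (if M = {#} then mat 1
   else (\<chi> a b. (\<Sum>A | A \<subset># M. \<Sum>c\<in>UNIV. exp_coeff E A $ a $ c * E (M - A) $ c $ b) / of_nat (size M)))"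
 by auto
termination by (relation "Wellfounded.measure (%(E, M). size M)") (auto simp: mset_subset_size)

declare exp_coeff.simps [simp del]

definition mps_matrix_0 :: "'a::comm_ring_1 mps ^ 'n ^ 'n => 'a ^ 'n ^ 'n" where
 "mps_matrix_0 E = (\<chi> a b. mcoeff (E $ a $ b) {#})"

text \<open>The radial equation \<open>\<theta> \<Phi> = \<Phi> E\<close> for the Euler operator \<open>\<theta>\<close> is solved degree by degree.\<close>

lemma euler_equation_solvable:
 fixes E :: "'a::field mps ^ 'n ^ 'n"
 assumes char0: "!!n. n > 0 ==> (of_nat n :: 'a) ~= 0"
  and E0: "mps_matrix_0 E = 0"
 shows "\<exists>\<Phi>. map_matrix mps_euler \<Phi> = \<Phi> ** E & mps_matrix_0 \<Phi> = mat 1"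
proof -
 define e where "e M = (\<chi> a b. mcoeff (E $ a $ b) M)" for M
 define \<Phi> :: "'a mps ^ 'n ^ 'n" where "\<Phi> = (\<chi> a b. Mps (%M. exp_coeff e M $ a $ b))"
 have e0: "mcoeff (E $ c $ b) {#} = 0" for b c using E0 by (simp add: mps_matrix_0_def vec_eq_iff)
 have "mcoeff ((\<Phi> ** E) $ a $ b) M = of_nat (size M) * exp_coeff e M $ a $ b" for a b M
 proof (cases "M = {#}")
  case True
  thus ?thesis by (simp add: matrix_matrix_mult_def e0)
 next
  case False
  have "mcoeff ((\<Phi> ** E) $ a $ b) M = (\<Sum>c\<in>UNIV. \<Sum>(A, B)\<in>splits M. exp_coeff e A $ a $ c * e B $ c $ b)"
   by (simp add: matrix_matrix_mult_def mcoeff_mult \<Phi>_def e_def)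
  also have "\<dots> = (\<Sum>(A, B)\<in>splits M. \<Sum>c\<in>UNIV. exp_coeff e A $ a $ c * e B $ c $ b)"
   by (subst sum.swap) (simp add: split_beta)
  also have "\<dots> = (\<Sum>A | A \<subseteq># M. \<Sum>c\<in>UNIV. exp_coeff e A $ a $ c * e (M - A) $ c $ b)"
   unfolding splits_image by (subst sum.reindex) (auto simp: inj_on_def)
  also have "\<dots> = (\<Sum>A | A \<subset># M. \<Sum>c\<in>UNIV. exp_coeff e A $ a $ c * e (M - A) $ c $ b)"
   by (rule sum.mono_neutral_right)
    (auto simp: finite_submultisets subset_mset.less_le e0 e_def)
  also have "\<dots> = of_nat (size M) * exp_coeff e M $ a $ b"
  proof -
   have "(of_nat (size M) :: 'a) ~= 0" using False char0[of "size M"] by (simp add: nonempty_has_size)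
   thus ?thesis using False by (subst (2) exp_coeff.simps) simp
  qed
  finally show ?thesis .
 qed
 hence "map_matrix mps_euler \<Phi> = \<Phi> ** E"
  by (auto simp: vec_eq_iff map_matrix_def mcoeff_euler \<Phi>_def intro!: mps_eqI)
 moreover have "mps_matrix_0 \<Phi> = mat 1" by (simp add: mps_matrix_0_def \<Phi>_def exp_coeff.simps vec_eq_iff)
 ultimately show ?thesis by blast
qed

lemma map_matrix_mult_derivation:
 fixes X :: "'a::comm_ring_1 ^ 'n ^ 'm" and Y :: "'a ^ 'p ^ 'n"
 assumes "!!x y. dl (x + y) = dl x + dl y" "!!x y. dl (x * y) = dl x * y + x * dl y"
 shows "map_matrix dl (X ** Y) = map_matrix dl X ** Y + X ** map_matrix dl Y"
proof -
 have "dl 0 = 0" using assms(1)[of 0 0] by (metis add.right_neutral add_left_cancel)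
 hence "dl (sum f S) = (\<Sum>x\<in>S. dl (f x))" for f and S :: "'n set"
  by (induction S rule: infinite_finite_induct) (auto simp: assms)
 thus ?thesis by (simp add: vec_eq_iff map_matrix_def matrix_matrix_mult_def assms sum.distrib)
qed

lemma map_matrix_nth [simp]: "map_matrix f X $ a $ b = f (X $ a $ b)" by (simp add: map_matrix_def)

lemma mps_matrix_0_mult: "mps_matrix_0 (X ** Y) = mps_matrix_0 X ** mps_matrix_0 Y"
 by (simp add: mps_matrix_0_def matrix_matrix_mult_def vec_eq_iff)

lemma euler_eq_0_imp_const:
 assumes char0: "!!n. n > 0 ==> (of_nat n :: 'a::field) ~= 0"
  and "mps_euler f = (0 :: 'a mps)"
 shows "f = mps_const (mcoeff f {#})"
proof (rule mps_eqI)
 fix M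
 have "of_nat (size M) * mcoeff f M = 0" using assms(2) by (metis mcoeff_euler mcoeff_simps(1))
 thus "mcoeff f M = mcoeff (mps_const (mcoeff f {#})) M" using char0[of "size M"] by (auto simp: mps_const_def)
qed

lemma mps_deriv_const [simp]: "mps_deriv i (mps_const c) = 0" by (rule mps_eqI) (simp add: mcoeff_deriv mps_const_def)

lemma matrix_minus_left: "(- (A::'a::comm_ring_1^'n^'m)) ** (C::'a^'p^'n) = - (A ** C)"
 by (simp add: vec_eq_iff matrix_matrix_mult_def sum_negf)

lemma matrix_minus_right: "(A::'a::comm_ring_1^'n^'m) ** (- C) = - (A ** (C::'a^'p^'n))"
 by (simp add: vec_eq_iff matrix_matrix_mult_def sum_negf)

lemma matrix_diff_left: "((A::'a::comm_ring_1^'n^'m) - B) ** (C::'a^'p^'n) = A ** C - B ** C"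
 by (simp add: vec_eq_iff matrix_matrix_mult_def sum_subtractf left_diff_distrib)

lemma matrix_diff_right: "(A::'a::comm_ring_1^'n^'m) ** (B - C) = A ** B - A ** (C::'a^'p^'n)"
 by (simp add: vec_eq_iff matrix_matrix_mult_def sum_subtractf right_diff_distrib)

lemma matrix_add_left: "((A::'a::comm_ring_1^'n^'m) + B) ** (C::'a^'p^'n) = A ** C + B ** C"
 by (simp add: vec_eq_iff matrix_matrix_mult_def sum.distrib distrib_right)

lemma matrix_add_right: "(A::'a::comm_ring_1^'n^'m) ** (B + C) = A ** B + A ** (C::'a^'p^'n)"
 by (simp add: vec_eq_iff matrix_matrix_mult_def sum.distrib distrib_left)

lemmas matrix_ring_simps = matrix_minus_left matrix_minus_right matrix_diff_left matrix_diff_right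
 matrix_add_left matrix_add_right matrix_mul_assoc

context char0_derivations
begin

text \<open>Conjugation by the solution of the radial equation makes the Taylor expansions of all
 matrices that are horizontal for the connections \<open>E\<close> constant.\<close>

lemma horizontal_conjugate_to_constants:
 fixes E :: "nat => 'a ^ 'n ^ 'n"
 shows "\<exists>\<Phi> \<Psi> :: 'a mps ^ 'n ^ 'n. \<Phi> ** \<Psi> = mat 1 &
  (\<forall>N. (\<forall>i. map_matrix (D i) N = N ** E i - E i ** N) -->
   (\<forall>i. map_matrix (mps_deriv i) (\<Phi> ** map_matrix (taylor D) N ** \<Psi>) = 0))"
proof -
 define T where "T = (map_matrix (taylor D) :: 'a ^ 'n ^ 'n => _)"
 \<comment> \<open>Only the radial combination of the \<open>E i\<close> enters, so no compatibility
   between different \<open>E i\<close> is assumed; a common solution of all the separate equations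
   need not exist.\<close>
 define Eh where "Eh = (\<chi> a b. radial (%i. T (E i) $ a $ b))"
 have Eh0: "mps_matrix_0 Eh = 0" by (simp add: mps_matrix_0_def Eh_def vec_eq_iff)
 obtain \<Phi> where \<Phi>: "map_matrix mps_euler \<Phi> = \<Phi> ** Eh" "mps_matrix_0 \<Phi> = mat 1"
  using euler_equation_solvable[OF char0 Eh0] by blast
 \<comment> \<open>The inverse of \<Phi> is produced as the transpose of a solution of the adjoint
   equation: the product \<Phi> \<Psi> is annihilated by the Euler operator and has constant term
   1.\<close>
 have "mps_matrix_0 (- transpose Eh) = 0" using Eh0 by (simp add: mps_matrix_0_def vec_eq_iff transpose_def)
 from euler_equation_solvable[OF char0 this] obtain \<Psi>' where
  \<Psi>': "map_matrix mps_euler \<Psi>' = \<Psi>' ** (- transpose Eh)" "mps_matrix_0 \<Psi>' = mat 1" by blast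
 define \<Psi> where "\<Psi> = transpose \<Psi>'"
 have \<Psi>: "map_matrix mps_euler \<Psi> = - (Eh ** \<Psi>)" "mps_matrix_0 \<Psi> = mat 1"
 proof -
  have "map_matrix mps_euler \<Psi> = transpose (map_matrix mps_euler \<Psi>')"
   by (simp add: \<Psi>_def vec_eq_iff transpose_def)
  also have "\<dots> = - (Eh ** \<Psi>)"
   unfolding \<Psi>' \<Psi>_def matrix_minus_right by (simp add: vec_eq_iff transpose_def matrix_matrix_mult_def mult.commute)
  finally show "map_matrix mps_euler \<Psi> = - (Eh ** \<Psi>)" .
  show "mps_matrix_0 \<Psi> = mat 1"
   using \<Psi>'(2) by (auto simp: \<Psi>_def mps_matrix_0_def vec_eq_iff transpose_def mat_def)
 qed
 have euler_mult: "map_matrix mps_euler (X ** Y) = map_matrix mps_euler X ** Y + X ** map_matrix mps_euler Y"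
  for X Y :: "'a mps ^ 'n ^ 'n" by (rule map_matrix_mult_derivation) (simp_all add: mps_euler_add mps_euler_mult)
 have const: "X = map_matrix mps_const (mps_matrix_0 X)" if "map_matrix mps_euler X = 0" for X :: "'a mps ^ 'n ^ 'n"
  using that euler_eq_0_imp_const[OF char0] by (auto simp: vec_eq_iff mps_matrix_0_def)
 have c1: "map_matrix mps_const (mat 1) = (mat 1 :: 'a mps ^ 'n ^ 'n)"
  by (auto simp: vec_eq_iff mat_def mps_const_def intro!: mps_eqI)
 have "map_matrix mps_euler (\<Phi> ** \<Psi>) = 0" by (simp add: euler_mult \<Phi> \<Psi> matrix_ring_simps)
 hence inv: "\<Phi> ** \<Psi> = mat 1" using const[of "\<Phi> ** \<Psi>"] by (simp add: mps_matrix_0_mult \<Phi> \<Psi> c1)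
 have "map_matrix (mps_deriv i) (\<Phi> ** T N ** \<Psi>) = 0"
  if N: "!!i. map_matrix (D i) N = N ** E i - E i ** N" for N i
 proof -
  have "mps_euler (T N $ a $ b) = (T N ** Eh - Eh ** T N) $ a $ b" for a b
  proof -
   have "mps_deriv i (T N $ a $ b) = (\<Sum>c\<in>UNIV. T N $ a $ c * T (E i) $ c $ b) - (\<Sum>c\<in>UNIV. T (E i) $ a $ c * T N $ c $ b)" for i
   proof -
    have "mps_deriv i (T N $ a $ b) = taylor D (map_matrix (D i) N $ a $ b)" by (simp add: T_def deriv_taylor)
    also have "\<dots> = (\<Sum>c\<in>UNIV. T N $ a $ c * T (E i) $ c $ b) - (\<Sum>c\<in>UNIV. T (E i) $ a $ c * T N $ c $ b)"
     unfolding N by (simp add: matrix_matrix_mult_def taylor_diff taylor_sum taylor_mult T_def)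
    finally show ?thesis .
   qed
   hence "mps_euler (T N $ a $ b) = radial (%i. (\<Sum>c\<in>UNIV. T N $ a $ c * T (E i) $ c $ b) - (\<Sum>c\<in>UNIV. T (E i) $ a $ c * T N $ c $ b))"
    by (simp add: radial_deriv[symmetric])
   also have "\<dots> = (T N ** Eh - Eh ** T N) $ a $ b" unfolding radial_diff radial_sum radial_mult_left radial_mult_right
    by (simp add: matrix_matrix_mult_def Eh_def)
   finally show ?thesis .
  qed
  hence TN: "map_matrix mps_euler (T N) = T N ** Eh - Eh ** T N" by (simp add: vec_eq_iff)
  \<comment> \<open>A series killed by the Euler operator is constant, and therefore killed by every
    single partial derivative. This is how the radial equation controls all directions.\<close>
  have "map_matrix mps_euler (\<Phi> ** T N ** \<Psi>) = 0" by (simp add: euler_mult \<Phi> \<Psi> TN matrix_ring_simps)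
  hence *: "\<Phi> ** T N ** \<Psi> = map_matrix mps_const (mps_matrix_0 (\<Phi> ** T N ** \<Psi>))" by (rule const)
  show ?thesis by (subst *) (simp add: vec_eq_iff)
 qed
 with inv show ?thesis unfolding T_def by blast
qed

end

section \<open>Horizontal matrices over a differentially closed field\<close>

definition dp_sum :: "('k::zero, 'r) diff_poly list => ('k, 'r) diff_poly" where
 "dp_sum fs = foldr Plus fs (Coeff 0)"

lemma dp_sum_eval:
 assumes "e 0 = 0"
 shows "diff_poly_eval type_ring dl e y (dp_sum fs) = (\<Sum>f\<leftarrow>fs. diff_poly_eval type_ring dl e y f)"
 unfolding dp_sum_def by (induction fs) (simp_all add: assms)

text \<open>An entry of a matrix product as a differential polynomial. The syntax has only binary
  sums, so a list enumerating the finite index type is chosen.\<close>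

definition dp_entry ::
 "('n::finite => 'n => ('k::field, 'r) diff_poly) => ('n => 'n => ('k, 'r) diff_poly) => 'n => 'n => ('k, 'r) diff_poly" where
 "dp_entry X Y a b = dp_sum (map (%c. Times (X a c) (Y c b)) (SOME es. set es = UNIV & distinct es))"

lemma dp_entry_eval:
 fixes X Y :: "'n::finite => 'n => ('k::field, 'r) diff_poly"
 assumes "e 0 = 0"
 shows "diff_poly_eval type_ring dl e y (dp_entry X Y a b) =
  ((\<chi> a b. diff_poly_eval type_ring dl e y (X a b)) ** (\<chi> a b. diff_poly_eval type_ring dl e y (Y a b))) $ a $ b"
proof -
 define es where "es = (SOME es. set es = (UNIV :: 'n set) & distinct es)"
 have es: "set es = UNIV & distinct es" unfolding es_def by (rule someI_ex, rule finite_distinct_list) simp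
 have sum_es: "sum_list (map g es) = sum g UNIV" for g :: "'n => 'b::comm_monoid_add"
  using es sum_list_distinct_conv_sum_set[of es g] by (auto simp only: simp_thms)
 show ?thesis unfolding dp_entry_def es_def[symmetric] dp_sum_eval[where e = e, OF assms] map_map sum_es
  by (simp add: matrix_matrix_mult_def)
qed

lemma Fract_sum_1: "Fract (sum f S) 1 = (\<Sum>x\<in>S. Fract (f x) (1::'a::idom))"
proof (induction S rule: infinite_finite_induct)
 case (insert x S)
 have "Fract (f x + sum f S) 1 = Fract (f x) 1 + Fract (sum f S) 1" by simp
 with insert show ?case by (simp del: add_fract)
qed (simp_all add: Zero_fract_def)

lemma invertible_map_matrix_fract:
 fixes X Y :: "'a::idom ^ 'n ^ 'n"
 assumes "X ** Y = mat 1"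
 shows "map_matrix (%a. Fract a 1) X ** map_matrix (%a. Fract a 1) Y = mat 1"
proof -
 have "(\<Sum>k\<in>UNIV. X $ i $ k * Y $ k $ j) = mat 1 $ i $ j" for i j
  using assms by (simp add: matrix_matrix_mult_def vec_eq_iff)
 thus ?thesis by (auto simp: vec_eq_iff matrix_matrix_mult_def mat_def Zero_fract_def One_fract_def Fract_sum_1[symmetric])
qed

locale closed_derivations =
 fixes d :: "'r::finite => 'k::field => 'k"
 assumes char0: "!!n. n > 0 ==> (of_nat n :: 'k) ~= 0"
  and derivations: "commuting_derivations d"
  and closed: "differentially_closed d"
begin

lemma der: "is_derivation (d i)" using derivations by (simp add: commuting_derivations_def)

lemma infinite_field: "infinite (UNIV :: 'k set)"
proof -
 have "m = n" if "(of_nat m :: 'k) = of_nat n" for m n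
 proof (rule ccontr)
  assume "m ~= n"
  hence "(of_nat (max m n - min m n) :: 'k) ~= 0" by (intro char0) auto
  moreover have "(of_nat (max m n - min m n) :: 'k) = of_nat (max m n) - of_nat (min m n)" by (rule of_nat_diff) auto
  ultimately show False using that by (auto simp: max_def min_def split: if_splits)
 qed
 hence "inj (of_nat :: nat => 'k)" by (auto simp: inj_def)
 thus ?thesis using infinite_iff_countable_subset by blast
qed

text \<open>Over the fraction field of the power series ring a conjugating matrix exists. Being
  conjugate to matrices with vanishing derivatives is a finite system of differential equations with
  coefficients in \<open>'k\<close>, so by differential closedness it is solvable in
  \<open>'k\<close> already.\<close>

lemma finite_horizontal_family_constant:
 fixes E :: "'r => 'k ^ 'n ^ 'n" and Ns :: "('k ^ 'n ^ 'n) list"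
 assumes N: "!!N i. N : set Ns ==> map_matrix (d i) N = N ** E i - E i ** N"
 shows "\<exists>C C' :: 'k ^ 'n ^ 'n. C ** C' = mat 1 & (\<forall>N\<in>set Ns. \<forall>i. map_matrix (d i) (C ** N ** C') = 0)"
proof -
 \<comment> \<open>The finite index type is embedded into the naturals. The remaining indices get
   the zero derivation and the zero matrix, which preserves commutation and horizontality.\<close>
 define D where "D n = (if n : range (to_nat :: 'r => nat) then d (from_nat n) else (%_. 0))" for n
 define E' where "E' n = (if n : range (to_nat :: 'r => nat) then E (from_nat n) else 0)" for n
 have D_to_nat: "D (to_nat i) = d i" for i by (simp add: D_def)
 have d0: "d i 0 = 0" for i by (rule is_derivation_0[OF der])
 have "commuting_derivations D" unfolding commuting_derivations_def D_def
  using derivations is_derivation_zero by (auto simp: commuting_derivations_def d0)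
 then interpret D: char0_derivations D by unfold_locales (use char0 in auto)
 have ND: "map_matrix (D n) N = N ** E' n - E' n ** N" if "N : set Ns" for N n
  using N[OF that] by (auto simp: D_def E'_def vec_eq_iff)
 obtain \<Phi> \<Psi> :: "'k mps ^ 'n ^ 'n" where inv: "\<Phi> ** \<Psi> = mat 1"
  and const: "!!N n. N : set Ns ==> map_matrix (mps_deriv n) (\<Phi> ** map_matrix (taylor D) N ** \<Psi>) = 0"
  using D.horizontal_conjugate_to_constants[of E'] ND by metis
 obtain dl :: "'r => 'k mps fract => 'k mps fract" where dl: "commuting_derivations dl"
  and dl_Fract: "!!i a. dl i (Fract a 1) = Fract (mps_deriv (to_nat i) a) 1"
  using commuting_derivations_fract_exist[of "%i. mps_deriv (to_nat i)"]
  by (auto simp: mps_deriv_add mps_deriv_mult mps_deriv_commute)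
 define e where "e c = Fract (taylor D c) 1" for c
 have e0: "e 0 = 0" and e1: "e 1 = 1" and em: "e (-1) = -1"
  by (simp_all add: e_def Zero_fract_def One_fract_def D.taylor_minus)
 have e: "is_field_hom e" by (simp add: is_field_hom_def e1) (simp add: e_def D.taylor_add D.taylor_mult)
 have dle: "dl i (e c) = e (d i c)" for i c by (simp add: e_def dl_Fract D.deriv_taylor D_to_nat)
 define C0 where "C0 = map_matrix (%a. Fract a 1) \<Phi>"
 define C1 where "C1 = map_matrix (%a. Fract a 1) \<Psi>"
 have C01: "C0 ** C1 = mat 1" unfolding C0_def C1_def by (rule invertible_map_matrix_fract[OF inv])
 hence C10: "C1 ** C0 = mat 1" using matrix_left_right_inverse by blast
 define X where "X l = C0 ** map_matrix e (Ns ! l) ** C1" for l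
 have X_eq: "X l = map_matrix (%a. Fract a 1) (\<Phi> ** map_matrix (taylor D) (Ns ! l) ** \<Psi>)" for l
  by (simp add: X_def C0_def C1_def e_def vec_eq_iff matrix_matrix_mult_def Fract_sum_1 sum_distrib_left sum_distrib_right)
 have X_const: "dl i (X l $ a $ b) = 0" if "l < length Ns" for i l a b
 proof -
  have "mps_deriv (to_nat i) ((\<Phi> ** map_matrix (taylor D) (Ns ! l) ** \<Psi>) $ a $ b) = 0"
   using const[of "Ns ! l" "to_nat i"] that by (simp add: vec_eq_iff)
  thus ?thesis by (simp add: X_eq dl_Fract Zero_fract_def)
 qed
 have XC: "X l ** C0 = C0 ** map_matrix e (Ns ! l)" for l by (simp add: X_def matrix_mul_assoc[symmetric] C10)
 \<comment> \<open>The unknowns are numbered by quadruples: a tag (0 for \<open>C\<close>, 1 for its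
   inverse, 2 for a conjugated matrix), the position in the list, and the two matrix
   indices.\<close>
 define vC :: "'n => 'n => nat" where "vC a b = to_nat (0::nat, 0::nat, to_nat a, to_nat b)" for a b
 define vC' :: "'n => 'n => nat" where "vC' a b = to_nat (1::nat, 0::nat, to_nat a, to_nat b)" for a b
 define vX :: "nat => 'n => 'n => nat" where "vX l a b = to_nat (2::nat, l, to_nat a, to_nat b)" for l a b
 define y where "y n = (case from_nat n :: nat \<times> nat \<times> nat \<times> nat of
   (t, l, a, b) => (if t = 0 then C0 else if t = 1 then C1 else X l) $ from_nat a $ from_nat b)" for n
 have y: "y (vC a b) = C0 $ a $ b" "y (vC' a b) = C1 $ a $ b" "y (vX l a b) = X l $ a $ b" for a b l
  by (simp_all add: y_def vC_def vC'_def vX_def)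
 define jC :: "'n => 'n => ('k, 'r) diff_poly" where "jC a b = Jet (vC a b) []" for a b
 define jC' :: "'n => 'n => ('k, 'r) diff_poly" where "jC' a b = Jet (vC' a b) []" for a b
 define jX :: "nat => 'n => 'n => ('k, 'r) diff_poly" where "jX l a b = Jet (vX l a b) []" for l a b
 define minus where "minus f g = Plus f (Times (Coeff (-1)) g)" for f g :: "('k, 'r) diff_poly"
 \<comment> \<open>Three groups of equations: C C' = 1, then X_l C = C N_l, and the vanishing of all
   first derivatives of X_l. The conjugates X_l are unknowns of their own, which keeps the equations
   at most quadratic.\<close>
 define S where "S = (%(a, b). minus (dp_entry jC jC' a b) (Coeff (mat 1 $ a $ b))) ` UNIV \<union>
   (%(l, a, b). minus (dp_entry (jX l) jC a b) (dp_entry jC (%a b. Coeff (Ns ! l $ a $ b)) a b)) ` ({..<length Ns} \<times> UNIV) \<union>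
   (%(l, a, b, i). Jet (vX l a b) [i]) ` ({..<length Ns} \<times> UNIV)"
 have finS: "finite S" unfolding S_def by simp
 have evS: "diff_poly_eval type_ring dl e y f = 0" if "f : S" for f
 proof -
  have eC: "(\<chi> a b. diff_poly_eval type_ring dl e y (jC a b)) = C0"
   and eC': "(\<chi> a b. diff_poly_eval type_ring dl e y (jC' a b)) = C1"
   and eX: "(\<chi> a b. diff_poly_eval type_ring dl e y (jX l a b)) = X l"
   and eN: "(\<chi> a b. diff_poly_eval type_ring dl e y (Coeff (Ns ! l $ a $ b))) = map_matrix e (Ns ! l)" for l
   by (simp_all add: vec_eq_iff jC_def jC'_def jX_def y)
  have "diff_poly_eval type_ring dl e y (minus f g) = diff_poly_eval type_ring dl e y f - diff_poly_eval type_ring dl e y g" for f g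
   by (simp add: minus_def em)
  moreover have "e (mat 1 $ a $ b) = mat 1 $ a $ b" for a b :: 'n by (simp add: mat_def e0 e1)
  ultimately show ?thesis using that X_const unfolding S_def
   by (auto simp: dp_entry_eval[where e = e, OF e0] eC eC' eX eN C01 XC y map_matrix_def)
 qed
 have "\<exists>z. \<forall>f\<in>S. diff_poly_eval type_ring d id z f = 0"
  by (rule differentially_closed_solution[OF closed infinite_field e dl dle finS evS])
 then obtain z where z: "!!f. f : S ==> diff_poly_eval type_ring d id z f = 0" by blast
 define C :: "'k ^ 'n ^ 'n" where "C = (\<chi> a b. z (vC a b))"
 define C' :: "'k ^ 'n ^ 'n" where "C' = (\<chi> a b. z (vC' a b))"
 define Y where "Y l = (\<chi> a b. z (vX l a b))" for l
 have eC: "(\<chi> a b. diff_poly_eval type_ring d id z (jC a b)) = C"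
  and eC': "(\<chi> a b. diff_poly_eval type_ring d id z (jC' a b)) = C'"
  and eX: "(\<chi> a b. diff_poly_eval type_ring d id z (jX l a b)) = Y l"
  and eN: "(\<chi> a b. diff_poly_eval type_ring d id z (Coeff (Ns ! l $ a $ b))) = Ns ! l" for l
  by (simp_all add: vec_eq_iff jC_def jC'_def jX_def C_def C'_def Y_def)
 have em: "diff_poly_eval type_ring d id z (minus f g) = diff_poly_eval type_ring d id z f - diff_poly_eval type_ring d id z g" for f g
  by (simp add: minus_def)
 have id0: "id 0 = (0 :: 'k)" by simp
 have S1: "minus (dp_entry jC jC' a b) (Coeff (mat 1 $ a $ b)) : S" for a b
  unfolding S_def by (rule UnI1, rule UnI1, rule image_eqI[where x = "(a, b)"]) auto
 have S2: "minus (dp_entry (jX l) jC a b) (dp_entry jC (%a b. Coeff (Ns ! l $ a $ b)) a b) : S"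
  if "l < length Ns" for l a b
  unfolding S_def by (rule UnI1, rule UnI2, rule image_eqI[where x = "(l, a, b)"]) (use that in auto)
 have S3: "Jet (vX l a b) [i] : S" if "l < length Ns" for l a b i
  unfolding S_def by (rule UnI2, rule image_eqI[where x = "(l, a, b, i)"]) (use that in auto)
 have CC': "C ** C' = mat 1"
 proof -
  have "(C ** C') $ a $ b = mat 1 $ a $ b" for a b
   using z[OF S1[of a b]] by (simp add: em dp_entry_eval[where e = id, OF id0] eC eC')
  thus ?thesis by (simp add: vec_eq_iff)
 qed
 have YC: "Y l ** C = C ** Ns ! l" if "l < length Ns" for l
 proof -
  have "(Y l ** C) $ a $ b = (C ** Ns ! l) $ a $ b" for a b
   using z[OF S2[OF that, of a b]] by (simp add: em dp_entry_eval[where e = id, OF id0] eC eX eN)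
  thus ?thesis by (simp add: vec_eq_iff)
 qed
 have Yd: "map_matrix (d i) (Y l) = 0" if "l < length Ns" for i l
 proof -
  have "d i (z (vX l a b)) = 0" for a b using z[OF S3[OF that, of a b i]] by simp
  thus ?thesis by (simp add: vec_eq_iff Y_def)
 qed
 have "map_matrix (d i) (C ** N ** C') = 0" if "N : set Ns" for N i
 proof -
  obtain l where l: "l < length Ns" "N = Ns ! l" using \<open>N : set Ns\<close> by (metis in_set_conv_nth)
  have "C ** N ** C' = Y l ** (C ** C')" by (simp only: l(2) YC[OF l(1), symmetric] matrix_mul_assoc)
  hence "C ** N ** C' = Y l" by (simp add: CC')
  thus ?thesis using Yd[OF l(1)] by simp
 qed
 with CC' show ?thesis by blast
qed

text \<open>The coefficients of a horizontal matrix with respect to a basis of horizontal matrices are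
 constants, so that a finite family suffices.\<close>

lemma horizontal_matrices_constant:
 fixes E :: "'r => 'k ^ 'n ^ 'n"
 shows "\<exists>C C' :: 'k ^ 'n ^ 'n. C ** C' = mat 1 &
  (\<forall>N. (\<forall>i. map_matrix (d i) N = N ** E i - E i ** N) --> (\<forall>i. map_matrix (d i) (C ** N ** C') = 0))"
proof -
 define T where "T = {N. \<forall>i. map_matrix (d i) N = N ** E i - E i ** N}"
 define flat :: "'k ^ 'n ^ 'n => 'k ^ ('n \<times> 'n)" where "flat N = (\<chi> p. N $ fst p $ snd p)" for N
 define unflat :: "'k ^ ('n \<times> 'n) => 'k ^ 'n ^ 'n" where "unflat v = (\<chi> a b. v $ (a, b))" for v
 have uf: "unflat (flat N) = N" for N by (simp add: flat_def unflat_def vec_eq_iff)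
 \<comment> \<open>Horizontal matrices lie in a finite-dimensional space over \<open>'k\<close>, so
   a maximal independent family of them is finite.\<close>
 obtain B where B: "B <= flat ` T" "vec.independent B" "flat ` T <= vec.span B" using vec.maximal_independent_subset by blast
 have "finite B" using B(2) by (rule vec.finiteI_independent)
 have uB: "unflat b : T" if "b : B" for b using B(1) that uf by auto
 obtain bs where bs: "set bs = B" using \<open>finite B\<close> finite_list by blast
 have hN: "map_matrix (d i) N = N ** E i - E i ** N" if "N : set (map unflat bs)" for N i
  using that uB by (auto simp: bs T_def)
 have "\<exists>C C' :: 'k ^ 'n ^ 'n. C ** C' = mat 1 &
   (\<forall>N\<in>set (map unflat bs). \<forall>i. map_matrix (d i) (C ** N ** C') = 0)"
  by (rule finite_horizontal_family_constant) (rule hN)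
 then obtain C C' :: "'k ^ 'n ^ 'n" where C: "C ** C' = mat 1"
   "\<forall>N\<in>set (map unflat bs). \<forall>i. map_matrix (d i) (C ** N ** C') = 0" by blast
 from C(2) have C2: "!!b i. b : B ==> map_matrix (d i) (C ** unflat b ** C') = 0" by (simp add: bs)
 have "map_matrix (d i) (C ** N ** C') = 0" if N: "N : T" for N i
 proof -
  have "flat N : vec.span B" using N B(3) by auto
  then obtain u where u: "flat N = (\<Sum>b\<in>B. u b *s b)" unfolding vec.span_finite[OF \<open>finite B\<close>] by auto
  have Nu: "N $ a $ c = (\<Sum>b\<in>B. u b * unflat b $ a $ c)" for a c
   using arg_cong[OF u, of "%v. v $ (a, c)"] by (simp add: flat_def unflat_def)
  have lin: "(X ** N ** Y) $ a $ c = (\<Sum>b\<in>B. u b * (X ** unflat b ** Y) $ a $ c)" for X Y :: "'k ^ 'n ^ 'n" and a c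
  proof -
   have "N = (\<Sum>b\<in>B. (\<chi> a c. u b * unflat b $ a $ c))" by (simp add: vec_eq_iff Nu)
   have "(X ** N ** Y) $ a $ c = (\<Sum>k\<in>UNIV. (\<Sum>j\<in>UNIV. X $ a $ j * (\<Sum>b\<in>B. u b * unflat b $ j $ k)) * Y $ k $ c)"
    by (simp add: matrix_matrix_mult_def Nu)
   also have "\<dots> = (\<Sum>k\<in>UNIV. \<Sum>j\<in>UNIV. \<Sum>b\<in>B. u b * (X $ a $ j * unflat b $ j $ k * Y $ k $ c))"
    by (simp add: sum_distrib_left sum_distrib_right mult_ac)
   also have "\<dots> = (\<Sum>k\<in>UNIV. \<Sum>b\<in>B. \<Sum>j\<in>UNIV. u b * (X $ a $ j * unflat b $ j $ k * Y $ k $ c))"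
    by (rule sum.cong[OF refl]) (rule sum.swap)
   also have "\<dots> = (\<Sum>b\<in>B. \<Sum>k\<in>UNIV. \<Sum>j\<in>UNIV. u b * (X $ a $ j * unflat b $ j $ k * Y $ k $ c))"
    by (rule sum.swap)
   also have "\<dots> = (\<Sum>b\<in>B. u b * (X ** unflat b ** Y) $ a $ c)"
    by (simp add: matrix_matrix_mult_def sum_distrib_left sum_distrib_right mult_ac)
   finally show ?thesis .
  qed
  \<comment> \<open>Differentiating N = \<Sum> u_b b once by the Leibniz rule and once by
    horizontality of all matrices involved leaves \<Sum> d_i(u_b) b = 0; independence of the family
    does the rest.\<close>
  have du: "d i (u b) = 0" if "b : B" for b
  proof -
   have "(\<Sum>b\<in>B. d i (u b) * unflat b $ a $ c) = 0" for a c
   proof -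
    have "d i (N $ a $ c) = (mat 1 ** N ** E i) $ a $ c - (E i ** N ** mat 1) $ a $ c"
     using N by (simp add: T_def vec_eq_iff)
    also have "\<dots> = (\<Sum>b\<in>B. u b * ((mat 1 ** unflat b ** E i) $ a $ c - (E i ** unflat b ** mat 1) $ a $ c))"
     unfolding lin by (simp add: right_diff_distrib sum_subtractf)
    also have "\<dots> = (\<Sum>b\<in>B. u b * d i (unflat b $ a $ c))"
     by (rule sum.cong) (use uB in \<open>auto simp: T_def vec_eq_iff\<close>)
    finally have "d i (N $ a $ c) = (\<Sum>b\<in>B. u b * d i (unflat b $ a $ c))" .
    moreover have "d i (N $ a $ c) = (\<Sum>b\<in>B. d i (u b) * unflat b $ a $ c) + (\<Sum>b\<in>B. u b * d i (unflat b $ a $ c))"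
     unfolding Nu is_derivation_sum[OF der] is_derivation_mult[OF der] sum.distrib ..
    ultimately show ?thesis by simp
   qed
   hence "(\<Sum>b\<in>B. d i (u b) *s b) = 0" by (simp add: vec_eq_iff unflat_def)
   thus ?thesis using vec.independentD[OF B(2) \<open>finite B\<close> subset_refl, of "%b. d i (u b)"] that by blast
  qed
  have "d i ((C ** N ** C') $ a $ c) = 0" for a c
  proof -
   have "d i (\<Sum>b\<in>B. u b * (C ** unflat b ** C') $ a $ c) = 0"
    unfolding is_derivation_sum[OF der] is_derivation_mult[OF der]
    by (rule sum.neutral) (use du C2 in \<open>auto simp: vec_eq_iff\<close>)
   thus ?thesis by (subst lin[of C C' a c])
  qed
  thus ?thesis by (simp add: vec_eq_iff)
 qed
 thus ?thesis using C(1) unfolding T_def by blast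
qed

end

section \<open>The PPV-group acting on the solution matrix\<close>

lemma field_hom_simps:
 assumes "is_field_hom h"
 shows "h 0 = 0" "h 1 = 1" "h (x + y) = h x + h y" "h (x * y) = h x * h y" "h (- x) = - h x"
  "h (x - y) = h x - h y"
proof -
 show *: "h 0 = 0" "h 1 = 1" "h (x + y) = h x + h y" "h (x * y) = h x * h y" for x y using assms unfolding is_field_hom_def
  by (metis add.right_neutral add_left_cancel, simp_all)
 show "h (- x) = - h x" for x using *(3)[of x "- x"] *(1) by (simp add: minus_unique)
 thus "h (x - y) = h x - h y" using *(3)[of x "- y"] by simp
qed

lemma field_hom_sum: "is_field_hom h ==> h (sum f S) = (\<Sum>x\<in>S. h (f x))"
 by (induction S rule: infinite_finite_induct) (auto simp: field_hom_simps)

lemma field_hom_inj: assumes "is_field_hom h" shows "inj h"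
proof (rule injI)
 fix x y assume "h x = h y"
 hence "h ((x - y) * inverse (x - y)) = 0" by (simp add: field_hom_simps[OF assms])
 thus "x = y" using field_hom_simps(2)[OF assms] by (cases "x - y = 0") auto
qed

lemma map_matrix_hom:
 assumes "is_field_hom h"
 shows "map_matrix h (X ** Y) = map_matrix h X ** map_matrix h Y"
  "map_matrix h (X' + Y') = map_matrix h X' + map_matrix h Y'"
  "map_matrix h (X' - Y') = map_matrix h X' - map_matrix h Y'"
  "map_matrix h (mat c) = mat (h c)"
 by (auto simp: vec_eq_iff matrix_matrix_mult_def field_hom_simps[OF assms] field_hom_sum[OF assms] mat_def)

lemma mat_mult_left: "(mat c ** X) $ a $ b = c * (X $ a $ b :: 'a::comm_ring_1)"
 by (simp add: matrix_matrix_mult_def mat_def if_distrib[of "%x. x * _"] cong: if_cong)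

lemma mat_mult_right: "(X ** mat c) $ a $ b = c * (X $ a $ b :: 'a::comm_ring_1)"
 by (simp add: matrix_matrix_mult_def mat_def if_distrib[of "%x. _ * x"] mult.commute cong: if_cong)

lemma mat_commute: "mat c ** X = X ** mat (c :: 'a::comm_ring_1)" by (simp add: vec_eq_iff mat_mult_left mat_mult_right)

lemma mat_0 [simp]: "mat 0 = (0 :: 'a::zero ^ 'n ^ 'n)" by (simp add: mat_def vec_eq_iff)

lemma map_matrix_derivation_mult:
 "is_derivation dl ==> map_matrix dl (X ** Y) = map_matrix dl X ** Y + X ** map_matrix dl Y"
 by (rule map_matrix_mult_derivation) (auto simp: is_derivation_def)

context closed_derivations
begin

text \<open>The scalar term \<open>u\<close> is present because the Lax equation is solved only up
  to a scalar matrix; it measures how an automorphism moves the scalar part of the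
  connection.\<close>

definition horizontal :: "('r => 'k ^ 'n ^ 'n) => ('r => 'k) => 'k ^ 'n ^ 'n => bool" where
 "horizontal E u N \<longleftrightarrow> (\<forall>i. map_matrix (d i) N = N ** E i - E i ** N + mat (u i) ** N)"

lemma horizontal_mult:
 assumes "horizontal E u X" "horizontal E v Y"
 shows "horizontal E (%i. u i + v i) (X ** Y)"
proof -
 have X: "X ** mat (v i) = mat (v i) ** X" for i by (simp only: mat_commute[of "v i" X])
 have add: "mat (a + b) = (mat a + mat b :: 'k ^ 'n ^ 'n)" for a b by (simp add: vec_eq_iff mat_def)
 show ?thesis using assms by (simp add: horizontal_def map_matrix_derivation_mult[OF der] matrix_ring_simps X add)
qed

lemma horizontal_one: "horizontal (E :: 'r => 'k ^ 'n ^ 'n) (%_. 0) (mat 1)"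
proof -
 have "map_matrix (d i) (mat 1) = (0 :: 'k ^ 'n ^ 'n)" for i
  by (auto simp: vec_eq_iff mat_def is_derivation_0[OF der] is_derivation_1[OF der])
 thus ?thesis by (simp add: horizontal_def)
qed

lemma horizontal_inverse:
 assumes X: "horizontal E u X" and inv: "X ** Y = mat 1" "Y ** X = mat 1"
 shows "horizontal E (%i. - u i) Y" unfolding horizontal_def
proof
 fix i
 have 0: "map_matrix (d i) (X ** Y) = 0"
  unfolding inv by (auto simp: vec_eq_iff mat_def is_derivation_0[OF der] is_derivation_1[OF der])
 have "Y ** (map_matrix (d i) X ** Y) + Y ** (X ** map_matrix (d i) Y) = Y ** map_matrix (d i) (X ** Y)"
  by (simp add: map_matrix_derivation_mult[OF der] matrix_ring_simps)
 hence "Y ** (X ** map_matrix (d i) Y) = - (Y ** (map_matrix (d i) X ** Y))"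
  unfolding 0 by (simp add: eq_neg_iff_add_eq_0 add.commute)
 hence "map_matrix (d i) Y = - (Y ** (map_matrix (d i) X ** Y))" by (simp add: matrix_mul_assoc inv)
 also have "\<dots> = - (Y ** ((X ** E i - E i ** X + mat (u i) ** X) ** Y))" using X by (simp add: horizontal_def)
 also have "\<dots> = - ((Y ** X) ** E i ** Y - Y ** E i ** (X ** Y) + Y ** mat (u i) ** (X ** Y))"
  by (simp only: matrix_ring_simps)
 also have "\<dots> = Y ** E i - E i ** Y + mat (- u i) ** Y"
  unfolding inv by (simp add: vec_eq_iff mat_mult_left mat_mult_right)
 finally show "map_matrix (d i) Y = Y ** E i - E i ** Y + mat (- u i) ** Y" .
qed

text \<open>The scalar terms add under products and change sign under inversion, hence cancel in
  every commutator.\<close>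

lemma derived_horizontal:
 fixes G :: "('k ^ 'n ^ 'n) set"
 assumes G: "!!N. N : G ==> invertible N & (\<exists>u. horizontal E u N)"
  and N: "N : derived GL G"
 shows "horizontal E (%_. 0) N"
proof -
 interpret GL: group "GL :: ('k ^ 'n ^ 'n) monoid" by (rule group_GL)
 have GLinv: "X ** (inv\<^bsub>GL\<^esub> X) = mat 1" "(inv\<^bsub>GL\<^esub> X) ** X = mat 1" if "invertible X" for X :: "'k ^ 'n ^ 'n"
  using GL.r_inv[of X] GL.l_inv[of X] that by (simp_all add: GL_def)
 have comm: "invertible X & horizontal E (%_. 0) X" if X: "X : derived_set GL G" for X
 proof -
  obtain N1 N2 where *: "N1 : G" "N2 : G" "X = N1 ** N2 ** (inv\<^bsub>GL\<^esub> N1) ** (inv\<^bsub>GL\<^esub> N2)"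
   using X by (auto simp: GL_def)
  obtain u v where uv: "horizontal E u N1" "horizontal E v N2" using G * by blast
  have i: "invertible N1" "invertible N2" using G * by auto
  have "horizontal E (%i. u i + v i + - u i + - v i) X"
   unfolding * by (intro horizontal_mult uv horizontal_inverse[OF uv(1) GLinv[OF i(1)]] horizontal_inverse[OF uv(2) GLinv[OF i(2)]])
  moreover have "(%i. u i + v i + - u i + - v i) = (%_. 0)" by auto
  moreover have "invertible (inv\<^bsub>GL\<^esub> N1)" "invertible (inv\<^bsub>GL\<^esub> N2)"
   using GLinv[OF i(1)] GLinv[OF i(2)] unfolding invertible_def by blast+
  ultimately show ?thesis using i by (simp add: * invertible_mult)
 qed
 have "N : generate GL (derived_set GL G)" using N by (simp add: derived_def)
 thus ?thesis
 proof induction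
  case one thus ?case using horizontal_one by (simp add: GL_def)
 next
  case (incl X) thus ?case using comm by blast
 next
  case (inv X)
  hence "horizontal E (%_. - 0) (inv\<^bsub>GL\<^esub> X)" using comm[of X] by (intro horizontal_inverse[OF _ GLinv]) auto
  thus ?case by simp
 next
  case (eng X Y)
  thus ?case using horizontal_mult[of E "%_. 0" X "%_. 0" Y] by (simp add: GL_def)
 qed
qed

lemma PPV_group_horizontal:
 fixes h :: "'k poly fract => 'K::field" and Z :: "'K ^ 'n ^ 'n"
 assumes ext: "PPV_extension d M dx dt h Dx Dt Z"
  and B: "!!i. map_matrix dx (B i) = M ** B i - B i ** M + map_matrix (dt i) M - mat (s i)"
 shows "\<exists>E. \<forall>N\<in>PPV_group h Dx Dt Z. invertible N & (\<exists>u. horizontal E u N)"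
proof -
 interpret PPV_extension d M dx dt h Dx Dt Z by (rule ext)
 note hs = field_hom_simps[OF h(1)]
 define ka where "ka = (%c. h (const_fract c))"
 have "is_field_hom (const_fract :: 'k => _)"
  by (simp add: is_field_hom_def const_fract_def One_fract_def pCons_one mult.commute)
 hence ka: "is_field_hom ka" using h(1) by (simp add: is_field_hom_def ka_def)
 have kad: "Dt i (ka c) = ka (d i c)" for i c by (simp add: ka_def flip: h(3) dt(3))
 have Dti: "is_derivation (Dt i)" for i using Dt by (simp add: commuting_derivations_def)
 note K = map_matrix_derivation_mult[OF Dx] map_matrix_derivation_mult[OF Dti]
 obtain Zi where Zi: "Z ** Zi = mat 1" "Zi ** Z = mat 1" using Z_invertible unfolding invertible_def by blast
 define hB where "hB i = map_matrix h (B i)" for i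
 define hM where "hM = map_matrix h M"
 define W where "W i = Zi ** (map_matrix (Dt i) Z - hB i ** Z)" for i
 have ZW: "Z ** W i = map_matrix (Dt i) Z - hB i ** Z" for i by (simp add: W_def matrix_mul_assoc Zi)
 have hM_d: "map_matrix (Dt i) hM = map_matrix h (map_matrix (dt i) M)" for i by (simp add: hM_def vec_eq_iff h(3))
 have hB_d: "map_matrix Dx (hB i) = hM ** hB i - hB i ** hM + map_matrix (Dt i) hM - mat (h (s i))" for i
 proof -
  have "map_matrix Dx (hB i) = map_matrix h (map_matrix dx (B i))" by (simp add: hB_def vec_eq_iff h(2))
  thus ?thesis unfolding B hM_d by (simp add: map_matrix_hom[OF h(1)] hB_def hM_def)
 qed
 have ZD: "map_matrix Dx Z = hM ** Z" using Z_solution by (simp add: hM_def)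
 have W_d: "map_matrix Dx (W i) = mat (h (s i))" for i
 proof -
  have sub: "map_matrix Dx (X - Y) = map_matrix Dx X - map_matrix Dx Y" for X Y :: "'K ^ 'n ^ 'n"
   by (simp add: vec_eq_iff is_derivation_diff[OF Dx])
  have swap: "map_matrix Dx (map_matrix (Dt i) Z) = map_matrix (Dt i) (map_matrix Dx Z)" by (simp add: vec_eq_iff Dx_Dt)
  have "hM ** (Z ** W i) + Z ** map_matrix Dx (W i) = map_matrix Dx (Z ** W i)" by (simp add: K ZD matrix_mul_assoc)
  also have "\<dots> = hM ** (Z ** W i) + mat (h (s i)) ** Z"
   unfolding ZW sub swap ZD K hB_d by (simp add: matrix_ring_simps)
  finally have "Zi ** (Z ** map_matrix Dx (W i)) = Zi ** (mat (h (s i)) ** Z)" by simp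
  thus ?thesis by (simp add: mat_commute matrix_mul_assoc Zi)
 qed
 define a0 :: 'n where "a0 = undefined"
 \<comment> \<open>By \<open>W_d\<close> the derivative of \<open>W i\<close> is scalar. So one
   diagonal entry, taken as the scalar part, differs from every other diagonal entry by a constant
   of \<open>Dx\<close>, and the off-diagonal entries are constants themselves.\<close>
 define w where "w i = W i $ a0 $ a0" for i
 have "\<exists>c. (W i - mat (w i)) $ a $ b = ka c" for i a b
 proof -
  have "Dx (W i $ a $ b) = mat (h (s i)) $ a $ b" for a b using W_d[of i] by (simp add: vec_eq_iff)
  hence "Dx ((W i - mat (w i)) $ a $ b) = 0" by (simp add: is_derivation_diff[OF Dx] is_derivation_0[OF Dx] w_def mat_def)
  thus ?thesis using Dx_constants unfolding ka_def by blast
 qed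
 then obtain e where e: "!!i a b. (W i - mat (w i)) $ a $ b = ka (e i a b)" by metis
 define E :: "'r => 'k ^ 'n ^ 'n" where "E i = (\<chi> a b. e i a b)" for i
 have WE: "W i = map_matrix ka (E i) + mat (w i)" for i using e by (simp add: vec_eq_iff E_def algebra_simps)
 have DtZ: "map_matrix (Dt i) Z = hB i ** Z + Z ** map_matrix ka (E i) + mat (w i) ** Z" for i
  using ZW[of i] by (simp add: WE matrix_ring_simps mat_commute algebra_simps)
 have "invertible N & (\<exists>u. horizontal E u N)" if N: "N : PPV_group h Dx Dt Z" for N
 proof
  obtain sg where sg: "PPV_automorphism h Dx Dt sg" and sgZ: "map_matrix sg Z = Z ** map_matrix ka N"
   using N by (auto simp: PPV_group_def ka_def)
  have hom: "is_field_hom sg" and fix_h: "!!f. sg (h f) = h f"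
   and sgDx: "!!y. sg (Dx y) = Dx (sg y)" and sgDt: "!!i y. sg (Dt i y) = Dt i (sg y)"
   using sg by (auto simp: PPV_automorphism_def)
  have "map_matrix sg Z ** map_matrix sg Zi = mat 1"
   by (simp add: map_matrix_hom[OF hom, symmetric] Zi) (simp add: map_matrix_hom[OF hom] field_hom_simps[OF hom])
  hence "Z ** (map_matrix ka N ** map_matrix sg Zi) = mat 1" by (simp add: sgZ matrix_mul_assoc)
  hence "Zi ** (Z ** (map_matrix ka N ** map_matrix sg Zi)) ** Z = Zi ** Z" by simp
  hence "map_matrix ka N ** (map_matrix sg Zi ** Z) = mat 1" by (simp add: matrix_mul_assoc Zi)
  \<comment> \<open>Invertibility over the smaller field is detected by the determinant, which
    commutes with the embedding \<open>ka\<close>.\<close>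
  hence "det (map_matrix ka N) ~= 0" by (metis det_I det_mul mult_zero_left zero_neq_one)
  moreover have "det (map_matrix ka N) = ka (det N)"
  proof -
   have "ka (prod f S) = (\<Prod>x\<in>S. ka (f x))" for f :: "'n => 'k" and S
    by (induction S rule: infinite_finite_induct) (auto simp: field_hom_simps[OF ka])
   moreover have "ka (of_int k) = of_int k" for k
   proof -
    have "ka (of_nat m) = of_nat m" for m by (induction m) (auto simp: field_hom_simps[OF ka])
    thus ?thesis by (cases k) (auto simp: field_hom_simps[OF ka] simp del: of_nat_Suc)
   qed
   ultimately show ?thesis by (simp add: det_def field_hom_simps[OF ka] field_hom_sum[OF ka])
  qed
  ultimately have "det N ~= 0" using field_hom_simps(1)[OF ka] by auto
  thus "invertible N" by (simp add: invertible_det_nz)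
  \<comment> \<open>The automorphism fixes \<open>Dx (w i)\<close>, which lies in the image of
    \<open>h\<close>; so it changes \<open>w i\<close> only by a constant of
    \<open>Dx\<close>.\<close>
  have "\<exists>c. sg (w i) - w i = ka c" for i
  proof -
   have "Dx (w i) = h (s i)" using W_d[of i] by (simp add: w_def vec_eq_iff mat_def)
   hence "Dx (sg (w i) - w i) = 0" by (simp add: is_derivation_diff[OF Dx] sgDx[symmetric] fix_h)
   thus ?thesis using Dx_constants unfolding ka_def by blast
  qed
  then obtain u where u: "!!i. sg (w i) - w i = ka (u i)" by metis
  have "horizontal E u N" unfolding horizontal_def
  proof
   fix i
   define KN where "KN = map_matrix ka N"
   define KE where "KE = map_matrix ka (E i)"
   have fixB: "map_matrix sg (hB i) = hB i" and fixE: "map_matrix sg KE = KE"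
    by (simp_all add: hB_def KE_def ka_def vec_eq_iff fix_h)
   have dKN: "map_matrix (Dt i) KN = map_matrix ka (map_matrix (d i) N)" by (simp add: KN_def vec_eq_iff kad)
   \<comment> \<open>One matrix is computed in two ways: by letting \<open>sg\<close> commute with
     \<open>Dt i\<close>, and by applying \<open>sg\<close> to the expression \<open>DtZ\<close>,
     whose ingredients other than \<open>Z\<close> and \<open>w i\<close> are fixed.\<close>
   have "map_matrix sg (map_matrix (Dt i) Z) = map_matrix (Dt i) (Z ** KN)" using sgZ by (simp add: vec_eq_iff sgDt KN_def)
   also have "\<dots> = (hB i ** Z + Z ** KE + mat (w i) ** Z) ** KN + Z ** map_matrix (Dt i) KN" by (simp add: K DtZ KE_def)
   finally have 1: "map_matrix sg (map_matrix (Dt i) Z) = (hB i ** Z + Z ** KE + mat (w i) ** Z) ** KN + Z ** map_matrix (Dt i) KN" .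
   have 2: "map_matrix sg (map_matrix (Dt i) Z) = hB i ** (Z ** KN) + (Z ** KN) ** KE + mat (sg (w i)) ** (Z ** KN)"
    using sgZ by (simp add: DtZ map_matrix_hom[OF hom] fixB fixE KE_def[symmetric] KN_def)
   have "Z ** map_matrix (Dt i) KN = Z ** KN ** KE - Z ** KE ** KN + (mat (sg (w i)) - mat (w i)) ** (Z ** KN)"
    using 1 2 by (simp add: matrix_ring_simps algebra_simps)
   also have "\<dots> = Z ** (KN ** KE - KE ** KN + mat (ka (u i)) ** KN)"
   proof -
    have "mat (sg (w i)) - mat (w i) = (mat (ka (u i)) :: 'K ^ 'n ^ 'n)" by (simp add: u[symmetric] vec_eq_iff mat_def)
    moreover have "mat (ka (u i)) ** (Z ** KN) = Z ** (mat (ka (u i)) ** KN)"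
     by (simp only: matrix_mul_assoc mat_commute[of "ka (u i)" Z])
    ultimately show ?thesis by (simp add: matrix_ring_simps)
   qed
   finally have "Zi ** (Z ** map_matrix (Dt i) KN) = Zi ** (Z ** (KN ** KE - KE ** KN + mat (ka (u i)) ** KN))" by simp
   hence "map_matrix (Dt i) KN = KN ** KE - KE ** KN + mat (ka (u i)) ** KN" unfolding matrix_mul_assoc[of Zi Z] Zi by simp
   hence "map_matrix ka (map_matrix (d i) N) = map_matrix ka (N ** E i - E i ** N + mat (u i) ** N)"
    unfolding dKN by (simp add: map_matrix_hom[OF ka] KN_def KE_def)
   thus "map_matrix (d i) N = N ** E i - E i ** N + mat (u i) ** N"
    using field_hom_inj[OF ka] by (simp add: vec_eq_iff inj_eq)
  qed
  thus "\<exists>u. horizontal E u N" by blast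
 qed
 thus ?thesis by blast
qed

theorem derived_PPV_group_constant:
 fixes h :: "'k poly fract => 'K::field" and Z :: "'K ^ 'n ^ 'n"
 assumes "PPV_extension d M dx dt h Dx Dt Z"
  and "!!i. map_matrix dx (B i) = M ** B i - B i ** M + map_matrix (dt i) M - mat (s i)"
 shows "\<exists>C C' :: 'k ^ 'n ^ 'n. C ** C' = mat 1 &
  derived GL (PPV_group h Dx Dt Z) <= carrier GL &
  (\<forall>N\<in>derived GL (PPV_group h Dx Dt Z). \<forall>i. map_matrix (d i) (C ** N ** C') = 0)"
proof -
 obtain E where E: "!!N. N : PPV_group h Dx Dt Z ==> invertible N & (\<exists>u. horizontal E u N)"
  using PPV_group_horizontal[OF assms] by blast
 obtain C C' :: "'k ^ 'n ^ 'n" where C: "C ** C' = mat 1"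
  "!!N i. (!!i. map_matrix (d i) N = N ** E i - E i ** N) ==> map_matrix (d i) (C ** N ** C') = 0"
  using horizontal_matrices_constant[of E] by metis
 have "map_matrix (d i) (C ** N ** C') = 0" if "N : derived GL (PPV_group h Dx Dt Z)" for N i
  using derived_horizontal[OF E that] by (intro C(2)) (simp add: horizontal_def)
 moreover have "derived GL (PPV_group h Dx Dt Z) <= carrier GL"
  by (rule group.derived_in_carrier[OF group_GL]) (use E in \<open>auto simp: GL_def\<close>)
 ultimately show ?thesis using C(1) by blast
qed

end

section \<open>The Lax equation with cleared denominators\<close>

text \<open>The plain product of all denominators serves as common denominator. Unlike a least
  common multiple it is compatible with evaluation at a parameter and with passage to k_0.\<close>

definition cden :: "('n::finite => 'n => 'a::comm_ring_1) => 'a" where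
 "cden de = (\<Prod>p\<in>UNIV. de (fst p) (snd p))"

definition cofac :: "('n::finite => 'n => 'a::comm_ring_1) => 'n => 'n => 'a" where
 "cofac de a b = (\<Prod>p\<in>UNIV - {(a, b)}. de (fst p) (snd p))"

lemma cden_cofac: "cden de = de a b * cofac de a b"
 unfolding cden_def cofac_def by (subst prod.remove[of UNIV "(a, b)"]) auto

definition cnum :: "('n::finite => 'n => 'a::comm_ring_1) => ('n => 'n => 'a) => 'a ^ 'n ^ 'n" where
 "cnum nu de = (\<chi> a b. nu a b * cofac de a b)"

text \<open>The parameter derivative of the matrix of quotients \<open>nu / de\<close>, multiplied
  by the square of the common denominator; the primed arguments are the derivatives of numerators
  and denominators.\<close>

definition cderiv :: "('n::finite => 'n => 'a::comm_ring_1) => ('n => 'n => 'a) => ('n => 'n => 'a) => ('n => 'n => 'a) => 'a ^ 'n ^ 'n" where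
 "cderiv nu de nu' de' = (\<chi> a b. (nu' a b * de a b - nu a b * de' a b) * cofac de a b ^ 2)"

text \<open>With \<open>A = N / q\<close> and \<open>B = b / q^e\<close> the expression \<open>q^(e+2) (B' - [A, B])\<close> is polynomial.\<close>

definition lax_poly :: "nat => 'a::idom poly => 'a poly ^ 'n::finite ^ 'n => 'a poly ^ 'n ^ 'n => 'a poly ^ 'n ^ 'n" where
 "lax_poly e q N b = (\<chi> i j. q ^ 2 * pderiv (b $ i $ j) - of_nat e * q * pderiv q * b $ i $ j
   - q * (N ** b - b ** N) $ i $ j)"

text \<open>A representative modulo scalar matrices, normalized by a zero at one fixed diagonal
  position. It is linear and free of division, so it commutes with reading the same polynomials over
  different rings.\<close>

definition mod_scalar :: "'a::ring_1 ^ 'n ^ 'n => 'a ^ 'n ^ 'n" where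
 "mod_scalar X = (\<chi> i j. X $ i $ j - (if i = j then X $ undefined $ undefined else 0))"

lemma mod_scalar_eq_iff: "mod_scalar X = mod_scalar Y \<longleftrightarrow> (\<exists>s. X = Y + mat s)"
proof
 assume "mod_scalar X = mod_scalar Y"
 hence "X = Y + mat (X $ undefined $ undefined - Y $ undefined $ undefined)"
  by (auto simp: mod_scalar_def vec_eq_iff mat_def algebra_simps split: if_splits)
 thus "\<exists>s. X = Y + mat s" ..
qed (auto simp: mod_scalar_def vec_eq_iff mat_def)

lemma smult_sum_right: "smult c (sum f S) = (\<Sum>x\<in>S. smult c (f x))"
 by (induction S rule: infinite_finite_induct) (auto simp: smult_add_right)

text \<open>Linearity over the constants turns the Lax equation with prescribed pole order and
  degree bound into a linear problem for finitely many coefficients.\<close>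

lemma lax_poly_combination:
 fixes y :: "'c => 'a::idom" and a :: "'c => 'a poly ^ 'n::finite ^ 'n"
 assumes "finite I"
 shows "lax_poly e q N (\<Sum>c\<in>I. (\<chi> i j. smult (y c) (a c $ i $ j))) $ i $ j
  = (\<Sum>c\<in>I. smult (y c) (lax_poly e q N (a c) $ i $ j))"
proof -
 have add: "lax_poly e q N (X + Y) = lax_poly e q N X + lax_poly e q N Y" for X Y
  by (simp add: lax_poly_def vec_eq_iff matrix_ring_simps pderiv_add algebra_simps)
 have zero: "lax_poly e q N 0 = 0" by (simp add: lax_poly_def vec_eq_iff matrix_matrix_mult_def)
 have sum: "lax_poly e q N (sum f I) = (\<Sum>c\<in>I. lax_poly e q N (f c))" for f :: "'c => _"
  by (induction I rule: infinite_finite_induct) (auto simp: add zero)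
 have "lax_poly e q N (\<chi> i j. smult y (X $ i $ j)) $ i $ j = smult y (lax_poly e q N X $ i $ j)" for y X i j
 proof -
  have "(N ** (\<chi> i j. smult y (X $ i $ j))) $ i $ j = smult y ((N ** X) $ i $ j)"
   "((\<chi> i j. smult y (X $ i $ j)) ** N) $ i $ j = smult y ((X ** N) $ i $ j)"
   by (simp_all add: matrix_matrix_mult_def smult_sum_right)
  thus ?thesis by (simp add: lax_poly_def pderiv_smult smult_diff_right right_diff_distrib)
 qed
 thus ?thesis by (simp add: sum)
qed

lemma derivation_power_mult:
 assumes "is_derivation dl" shows "x * dl (x ^ n) = of_nat n * x ^ n * dl x"
proof (induction n)
 case (Suc n)
 have "x * dl (x ^ Suc n) = x * x ^ n * dl x + x * (x * dl (x ^ n))"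
  by (simp add: is_derivation_mult[OF assms] algebra_simps)
 thus ?case unfolding Suc by (simp add: algebra_simps)
qed (simp add: is_derivation_1[OF assms])

lemma Fract_1_hom: "Fract (a * b) (1::'a::idom) = Fract a 1 * Fract b 1" "Fract (a + b) (1::'a) = Fract a 1 + Fract b 1"
 "Fract (a - b) (1::'a) = Fract a 1 - Fract b 1" "Fract (a ^ n) (1::'a) = Fract a 1 ^ n" "Fract (of_nat n) (1::'a) = of_nat n"
 "Fract 0 (1::'a) = 0"
proof -
 show "Fract (a ^ n) (1::'a) = Fract a 1 ^ n"
 proof (induction n)
  case (Suc n)
  have "Fract (a * a ^ n) 1 = Fract a 1 * Fract (a ^ n) (1::'a)" by simp
  thus ?case unfolding power_Suc Suc .
 qed (simp add: One_fract_def)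
qed (auto simp: of_nat_fract Zero_fract_def)

lemma lax_equation_from_poly:
 fixes dx :: "'k::field poly fract => 'k poly fract" and b :: "'k poly ^ 'n::finite ^ 'n"
 assumes dx: "is_derivation dx" "!!p. dx (Fract p 1) = Fract (pderiv p) 1"
  and dt: "is_derivation dt" "!!i j. dt (Fract (nu i j) 1) = Fract (nu' i j) 1"
   "!!i j. dt (Fract (de i j) 1) = Fract (de' i j) 1"
  and de: "!!i j. de i j ~= 0"
  and b: "lax_poly e (cden de) (cnum nu de) b = (\<chi> i j. cden de ^ e * cderiv nu de nu' de' $ i $ j) + mat sg"
 defines "M \<equiv> (\<chi> i j. Fract (nu i j) (de i j))"
 shows "\<exists>B s. map_matrix dx B = M ** B - B ** M + map_matrix dt M - mat s"
proof -
 define Q where "Q = Fract (cden de) 1"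
 have cof0: "cofac de i j ~= 0" for i j using de by (simp add: cofac_def)
 have "cden de ~= 0" using de by (simp add: cden_def)
 hence Q0: "Q ~= 0" by (simp add: Q_def Zero_fract_def eq_fract)
 define c where "c i j = Fract (cofac de i j) 1" for i j
 define n where "n i j = Fract (nu i j) 1" for i j
 define m where "m i j = Fract (de i j) 1" for i j
 have m0: "m i j ~= 0" for i j using de by (simp add: m_def Zero_fract_def eq_fract)
 have Qmc: "Q = m i j * c i j" for i j by (simp add: Q_def m_def c_def cden_cofac[of de i j])
 have c0: "c i j ~= 0" for i j using Q0 Qmc[of i j] by auto
 have M: "M $ i $ j = n i j / m i j" for i j by (simp add: M_def n_def m_def)
 have MN: "Q * M $ i $ j = Fract (cnum nu de $ i $ j) 1" for i j
  using m0 by (simp add: M Qmc[of i j]) (simp add: cnum_def n_def c_def mult.commute)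
 have dtM: "Q ^ 2 * dt (M $ i $ j) = Fract (cderiv nu de nu' de' $ i $ j) 1" for i j
 proof -
  have "M $ i $ j * m i j = n i j" using m0[of i j] by (simp add: M)
  hence "dt (M $ i $ j) * m i j + M $ i $ j * dt (m i j) = dt (n i j)"
   using is_derivation_mult[OF dt(1), of "M $ i $ j" "m i j"] by simp
  hence "m i j * (dt (M $ i $ j) * m i j) = m i j * dt (n i j) - (M $ i $ j * m i j) * dt (m i j)"
   by (simp add: algebra_simps flip: eq_diff_eq)
  also have "M $ i $ j * m i j = n i j" using m0[of i j] by (simp add: M)
  finally have "Q ^ 2 * dt (M $ i $ j) = (dt (n i j) * m i j - n i j * dt (m i j)) * c i j ^ 2"
   by (simp add: Qmc[of i j] power2_eq_square mult_ac)
  thus ?thesis by (simp add: cderiv_def Fract_1_hom c_def n_def m_def dt(2,3) del: add_fract diff_fract mult_fract)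
 qed
 define \<beta> where "\<beta> i j = Fract (b $ i $ j) 1" for i j
 define B where "B = (\<chi> i j. \<beta> i j / Q ^ e)"
 \<comment> \<open>The Lax equation subtracts \<open>mat s\<close>, whereas \<open>sg\<close> stands
   on the right-hand side with a plus sign; hence the minus.\<close>
 define s where "s = - (Fract sg 1 / Q ^ (e + 2))"
 have QB: "Q ^ e * B $ i $ j = \<beta> i j" for i j using Q0 by (simp add: B_def)
 have "Q ^ (e + 2) * dx (B $ i $ j) = Q ^ (e + 2) * (M ** B - B ** M + map_matrix dt M - mat s) $ i $ j" for i j
 proof -
  have "dx (\<beta> i j) = dx (Q ^ e) * B $ i $ j + Q ^ e * dx (B $ i $ j)"
   by (simp add: QB[symmetric] is_derivation_mult[OF dx(1)])
  hence "Q ^ 2 * (Q ^ e * dx (B $ i $ j)) = Q ^ 2 * dx (\<beta> i j) - Q * (Q * dx (Q ^ e)) * B $ i $ j"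
   by (simp add: algebra_simps power2_eq_square)
  also have "\<dots> = Q ^ 2 * dx (\<beta> i j) - of_nat e * Q * dx Q * \<beta> i j"
   unfolding derivation_power_mult[OF dx(1)] by (simp add: QB[symmetric])
  finally have 1: "Q ^ (e + 2) * dx (B $ i $ j) = Q ^ 2 * dx (\<beta> i j) - of_nat e * Q * dx Q * \<beta> i j"
   by (simp add: power_add power2_eq_square mult_ac)
  have 2: "Q ^ (e + 2) * (M ** B - B ** M) $ i $ j = Q * Fract ((cnum nu de ** b - b ** cnum nu de) $ i $ j) 1"
  proof -
   have "Q ^ (e + 1) * (M ** B - B ** M) $ i $ j =
     (\<Sum>k\<in>UNIV. (Q * M $ i $ k) * (Q ^ e * B $ k $ j)) - (\<Sum>k\<in>UNIV. (Q ^ e * B $ i $ k) * (Q * M $ k $ j))"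
    by (simp add: matrix_matrix_mult_def right_diff_distrib sum_distrib_left mult_ac)
   also have "\<dots> = Fract ((cnum nu de ** b - b ** cnum nu de) $ i $ j) 1" unfolding QB MN \<beta>_def
    by (simp add: matrix_matrix_mult_def Fract_1_hom Fract_sum_1 del: add_fract diff_fract mult_fract)
   finally show ?thesis by (simp add: mult.assoc)
  qed
  have 3: "Q ^ (e + 2) * (map_matrix dt M) $ i $ j = Q ^ e * Fract (cderiv nu de nu' de' $ i $ j) 1"
   unfolding dtM[symmetric] by (simp add: power_add power2_eq_square mult_ac)
  have 4: "Q ^ (e + 2) * mat s $ i $ j = - Fract (mat sg $ i $ j) 1" using Q0 by (simp add: s_def mat_def Fract_1_hom(6))
  have "Q ^ 2 * dx (\<beta> i j) - of_nat e * Q * dx Q * \<beta> i j - Q * Fract ((cnum nu de ** b - b ** cnum nu de) $ i $ j) 1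
    = Fract (lax_poly e (cden de) (cnum nu de) b $ i $ j) 1"
   by (simp add: lax_poly_def Fract_1_hom \<beta>_def Q_def dx(2) del: add_fract diff_fract mult_fract)
  also have "\<dots> = Q ^ e * Fract (cderiv nu de nu' de' $ i $ j) 1 + Fract (mat sg $ i $ j) 1"
   unfolding b by (simp add: Fract_1_hom Q_def del: add_fract diff_fract mult_fract)
  finally have 5: "Q ^ 2 * dx (\<beta> i j) - of_nat e * Q * dx Q * \<beta> i j - Q * Fract ((cnum nu de ** b - b ** cnum nu de) $ i $ j) 1
    = Q ^ e * Fract (cderiv nu de nu' de' $ i $ j) 1 + Fract (mat sg $ i $ j) 1" .
  have aux: "a - b - c = y1 + y2 ==> a - b = c + y1 - (- y2)" for a b c y1 y2 :: "'k poly fract" by (simp add: algebra_simps)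
  have "Q ^ (e + 2) * (M ** B - B ** M + map_matrix dt M - mat s) $ i $ j =
    Q ^ (e + 2) * (M ** B - B ** M) $ i $ j + Q ^ (e + 2) * map_matrix dt M $ i $ j - Q ^ (e + 2) * mat s $ i $ j"
   by (simp only: vector_add_component vector_minus_component distrib_left right_diff_distrib)
  thus ?thesis unfolding 1 2 3 4 using aux[OF 5] by (simp only:)
 qed
 hence "map_matrix dx B = M ** B - B ** M + map_matrix dt M - mat s" using Q0 by (simp add: vec_eq_iff)
 thus ?thesis by blast
qed

context PPV_extension
begin

lemma dx_Fract: "dx (Fract p 1) = Fract (pderiv p) 1"
proof (induction p)
 case (pCons a p)
 have *: "Fract (pCons a p) 1 = const_fract a + x_fract * Fract p 1" by (simp add: const_fract_def x_fract_def)
 show ?case unfolding * is_derivation_add[OF dx(1)] is_derivation_mult[OF dx(1)] dx pCons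
  by (simp add: x_fract_def pderiv_pCons)
qed (simp add: Fract_1_hom is_derivation_0[OF dx(1)])

lemma dt_Fract_Poly: "dt i (Fract (Poly cs) 1) = Fract (Poly (map (d i) cs)) 1"
proof (induction cs)
 case (Cons a cs)
 have *: "Fract (pCons a p) 1 = const_fract a + x_fract * Fract p 1" for a :: 'k and p
  by (simp add: const_fract_def x_fract_def)
 show ?case unfolding Poly.simps list.map * is_derivation_add[OF dt(1)] is_derivation_mult[OF dt(1)] dt Cons by simp
qed (simp add: Fract_1_hom is_derivation_0[OF dt(1)])

end

section \<open>Analytic functions of the parameters\<close>

lemma linear_vector_scale: "linear (%s::complex. s *s (v :: complex ^ 'r::finite))"
 by (rule linearI) (auto simp: vec_eq_iff algebra_simps)

lemma mv_holomorphic_on_line: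
 fixes f :: "complex ^ 'r::finite => complex"
 assumes f: "mv_holomorphic_on f P" and s: "t + s *s v : P"
 shows "\<exists>D. ((%s. f (t + s *s v)) has_field_derivative D) (at s)"
proof -
 obtain f' where f': "(f has_derivative f') (at (t + s *s v))" "!!c v. f' (c *s v) = c * f' v"
  using f s unfolding mv_holomorphic_on_def by blast
 have "((%s. s *s v) has_derivative (%s. s *s v)) (at s)"
  by (intro bounded_linear_imp_has_derivative) (simp add: linear_conv_bounded_linear[symmetric] linear_vector_scale)
 hence "((%s. t + s *s v) has_derivative (%s. s *s v)) (at s)" by (auto intro!: derivative_eq_intros)
 from has_derivative_compose[OF this f'(1)]
 have "((%s. f (t + s *s v)) has_derivative (%s. f' (s *s v))) (at s)" .
 moreover have "(%s. f' (s *s v)) = (*) (f' v)" by (auto simp: f' mult.commute)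
 ultimately show ?thesis unfolding has_field_derivative_def by metis
qed

lemma mv_holomorphic_on_line':
 fixes f :: "complex ^ 'r::finite => complex"
 assumes "mv_holomorphic_on f P"
 shows "(%s. f (t + s *s v)) holomorphic_on {s. t + s *s v : P}"
 using mv_holomorphic_on_line[OF assms] unfolding holomorphic_on_def field_differentiable_def
 by (blast intro: has_field_derivative_at_within)

lemma mv_holomorphic_on_continuous:
 fixes f :: "complex ^ 'r::finite => complex"
 assumes "mv_holomorphic_on f P" shows "continuous_on P f" using assms unfolding mv_holomorphic_on_def
 by (meson continuous_at_imp_continuous_on has_derivative_continuous)

text \<open>The interior of the zero set is closed in \<open>P\<close>: a ball around a limit point
  contains an interior zero \<open>q\<close>, and every point of the ball lies on a complex line
  through \<open>q\<close>, to which the identity theorem in one variable applies.\<close>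

lemma mv_holomorphic_identity:
 fixes f :: "complex ^ 'r::finite => complex"
 assumes P: "open P" "connected P" and f: "mv_holomorphic_on f P"
  and U: "open U" "U <= P" "U ~= {}" "!!t. t : U ==> f t = 0" and t: "t : P"
 shows "f t = 0"
proof -
 define Z where "Z = interior {t : P. f t = 0}"
 have Z: "open Z" "Z <= P" "!!t. t : Z ==> f t = 0" unfolding Z_def using interior_subset by auto
 have "U <= Z" unfolding Z_def using U by (intro interior_maximal) auto
 have "closure Z \<inter> P <= Z"
 proof
  fix a assume a: "a : closure Z \<inter> P"
  then obtain r where r: "r > 0" "ball a r <= P" using P(1) openE by blast
  have "a : closure Z" using a by simp
  then obtain q where q: "q : Z" "dist q a < r" using r(1) closure_approachable by blast
  have "f p = 0" if p: "p : ball a r" for p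
  proof -
   define L where "L = {s. q + s *s (p - q) : ball a r}"
   have "L = (%s. s *s (p - q)) -` ball (a - q) r" by (auto simp: L_def dist_norm algebra_simps)
   hence "convex L" using convex_linear_vimage[OF linear_vector_scale] convex_ball by metis
   hence con: "connected L" by (rule convex_connected)
   have cont: "continuous_on UNIV (%s. q + s *s (p - q))" using linear_vector_scale[of "p - q"]
    by (intro continuous_intros linear_continuous_on) (simp add: linear_conv_bounded_linear)
   have "open ((%s. q + s *s (p - q)) -` ball a r)" by (rule open_vimage[OF open_ball cont])
   hence oL: "open L" by (simp add: L_def vimage_def)
   have hol: "(%s. f (q + s *s (p - q))) holomorphic_on L"
    by (rule holomorphic_on_subset[OF mv_holomorphic_on_line'[OF f]]) (use r in \<open>auto simp: L_def\<close>)
   define L0 where "L0 = {s. q + s *s (p - q) : Z} \<inter> L"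
   have "open ((%s. q + s *s (p - q)) -` Z)" by (rule open_vimage[OF Z(1) cont])
   hence oL0: "open L0" using oL by (simp add: L0_def vimage_def open_Int)
   have zero: "0 : L0" using q by (simp add: L0_def L_def dist_commute)
   have one: "1 : L" using p by (simp add: L_def)
   have "L0 ~= {}" using zero by blast
   moreover have "L0 <= L" by (simp add: L0_def)
   moreover have "f (q + s *s (p - q)) = 0" if "s : L0" for s using that Z(3) by (simp add: L0_def)
   ultimately have "f (q + 1 *s (p - q)) = 0"
    using analytic_continuation_open[OF oL0 oL _ con _ hol holomorphic_on_const[of 0]] one by blast
   thus ?thesis by simp
  qed
  hence "ball a r <= Z" unfolding Z_def using r by (intro interior_maximal) auto
  thus "a : Z" using r by auto
 qed
 hence "openin (top_of_set P) Z" "closedin (top_of_set P) Z"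
  using Z by (auto simp: open_openin_trans openin_open_eq P closedin_closed intro!: exI[of _ "closure Z"] dest: subsetD[OF closure_subset])
 hence "Z = {} \<or> Z = P" using P(2) connected_clopen by blast
 thus ?thesis using \<open>U <= Z\<close> U(3) t Z(3) by auto
qed

text \<open>By the identity theorem each nonvanishing set is dense in every ball inside
  \<open>P\<close>, and Baire's theorem intersects countably many of them. One function will arise
  for each pole order and degree bound, so finite intersections would not suffice.\<close>

lemma mv_holomorphic_common_nonzero:
 fixes f :: "'i::countable => complex ^ 'r::finite => complex"
 assumes P: "open P" "connected P" and f: "!!i. mv_holomorphic_on (f i) P" "!!i. \<exists>t\<in>P. f i t ~= 0"
  and U: "open U" "U <= P" "U ~= {}"
 shows "\<exists>t\<in>U. \<forall>i. f i t ~= 0"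
proof -
 have ne: "\<exists>t\<in>V. f i t ~= 0" if "open V" "V <= P" "V ~= {}" for V i
  using mv_holomorphic_identity[OF P f(1) that] f(2) by blast
 obtain a r where r: "r > 0" "cball a r <= U" using U open_contains_cball by blast
 define S where "S = cball a r"
 define \<G> where "\<G> = range (%i. {t : S. f i t ~= 0})"
 have SP: "S <= P" using r U by (auto simp: S_def)
 have "S <= closure (\<Inter>\<G>)"
 proof (rule Baire)
  show "closed S" by (simp add: S_def)
  show "countable \<G>" by (simp add: \<G>_def)
  fix T assume "T : \<G>"
  then obtain i where T: "T = {t : S. f i t ~= 0}" by (auto simp: \<G>_def)
  have "continuous_on S (f i)" using mv_holomorphic_on_continuous[OF f(1)] SP continuous_on_subset by blast
  hence "openin (top_of_set S) (S \<inter> f i -` (- {0}))" by (rule continuous_openin_preimage_gen) auto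
  moreover have "S \<inter> f i -` (- {0}) = T" by (auto simp: T)
  ultimately have 1: "openin (top_of_set S) T" by simp
  have "S <= closure T"
  proof
   fix t assume "t : S"
   show "t : closure T" unfolding closure_approachable
   proof (intro allI impI)
    fix e :: real assume "e > 0"
    have "t : closure (ball a r)" using \<open>t : S\<close> r by (simp add: S_def)
    then obtain y where y: "y : ball a r" "dist y t < e" using \<open>e > 0\<close> closure_approachable by blast
    have "\<exists>t\<in>ball a r \<inter> ball t e. f i t ~= 0"
     by (rule ne) (use y SP in \<open>auto simp: S_def dist_commute\<close>)
    then obtain z where "z : ball a r" "dist t z < e" "f i z ~= 0" by auto
    thus "\<exists>y\<in>T. dist y t < e" by (intro bexI[of _ z]) (auto simp: T S_def dist_commute)
   qed
  qed
  with 1 show "openin (top_of_set S) T & S <= closure T" by simp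
 qed
 hence "\<Inter>\<G> ~= {}" using r by (auto simp: S_def)
 then obtain t where "t : \<Inter>\<G>" by blast
 hence "t : S" "\<forall>i. f i t ~= 0" by (auto simp: \<G>_def)
 thus ?thesis using r(2) unfolding S_def by blast
qed

section \<open>Specialization of equations over k_0 at parameter values\<close>

context closed_base_field
begin

lemma R_uminus: "f : R ==> (%t. - f t) : R" using R_mult[OF R_const[of "-1"], of f] by simp

lemma R_diff: "f : R ==> g : R ==> (%t. f t - g t) : R" using R_add[OF _ R_uminus, of f g] by simp

lemma \<iota>_zero: "\<iota> (%_. 0) = 0"
 using \<iota>_add[OF R_const[of 0] R_const[of 0]] by (metis add.right_neutral add_left_cancel)

lemma \<iota>_uminus: "f : R ==> \<iota> (%t. - f t) = - \<iota> f"
 using \<iota>_add[OF _ R_uminus, of f f] by (simp add: \<iota>_zero minus_unique)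

lemma \<iota>_diff: "f : R ==> g : R ==> \<iota> (%t. f t - g t) = \<iota> f - \<iota> g"
 using \<iota>_add[OF _ R_uminus, of f g] by (simp add: \<iota>_uminus)

lemma R_sum: "(!!x. x : S ==> f x : R) ==> (%t. \<Sum>x\<in>S. f x t) : R"
 by (induction S rule: infinite_finite_induct) (auto intro: R_const R_add)

lemma \<iota>_sum: "(!!x. x : S ==> f x : R) ==> \<iota> (%t. \<Sum>x\<in>S. f x t) = (\<Sum>x\<in>S. \<iota> (f x))"
 by (induction S rule: infinite_finite_induct) (auto simp: \<iota>_zero \<iota>_add R_sum)

lemma \<iota>_eq_0_iff: "f : R ==> \<iota> f = 0 \<longleftrightarrow> (\<forall>t\<in>P. f t = 0)"
 using \<iota>_eq[OF _ R_const[of 0]] by (simp add: \<iota>_zero)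

lemma P_nonempty: "P ~= {}" using \<iota>_eq[OF R_const[of 0] R_const[of 1]] \<iota>_one \<iota>_zero by auto

lemma \<iota>_of_nat: "\<iota> (%_. of_nat n) = of_nat n"
proof (induction n)
 case (Suc n)
 have "\<iota> (%_. of_nat n + 1) = \<iota> (%_. of_nat n) + \<iota> (%_. 1)" by (rule \<iota>_add[OF R_const R_const])
 thus ?case by (simp add: Suc \<iota>_one add.commute)
qed (simp add: \<iota>_zero)

lemma closed_derivations: "closed_derivations d"
proof
 fix n :: nat assume "n > 0"
 thus "(of_nat n :: 'k) ~= 0" using \<iota>_eq_0_iff[OF R_const[of "of_nat n"]] P_nonempty by (auto simp: \<iota>_of_nat)
qed (use derivations closed in auto)

text \<open>Fredholm alternative over the integral domain \<open>R\<close>, by elimination of one unknown at a time: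
 a system that is unsolvable over the field is unsolvable at all parameters where some nonzero
 element of \<open>R\<close> does not vanish.\<close>

lemma linear_system_alternative:
 fixes a :: "'c => 'j => complex ^ 'r => complex"
 assumes "finite I" "!!c j. c : I ==> a c j : R" "!!j. r j : R"
 shows "(\<exists>y. \<forall>j. (\<Sum>c\<in>I. y c * \<iota> (a c j)) = \<iota> (r j)) \<or>
  (\<exists>f\<in>R. \<iota> f ~= 0 & (\<forall>t\<in>P. f t ~= 0 --> \<not> (\<exists>y. \<forall>j. (\<Sum>c\<in>I. y c * a c j t) = r j t)))"
 using assms
\<comment> \<open>The induction is on the unknowns, so infinitely many equations are allowed; there
  will be one for every coefficient of every entry of a polynomial matrix.\<close>
proof (induction I arbitrary: a r rule: finite_induct)
 case empty
 show ?case
 proof (cases "\<forall>j. \<iota> (r j) = 0")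
  case False
  then obtain j where "\<iota> (r j) ~= 0" by blast
  thus ?thesis using empty.prems(2)[of j] by (intro disjI2 bexI[of _ "r j"]) auto
 qed auto
next
 case (insert c0 I)
 show ?case
 proof (cases "\<forall>j. \<iota> (a c0 j) = 0")
  case True
  hence z: "a c0 j t = 0" if "t : P" for j t using that \<iota>_eq_0_iff insert.prems by blast
  have "(\<Sum>c\<in>insert c0 I. y c * \<iota> (a c j)) = (\<Sum>c\<in>I. y c * \<iota> (a c j))" for y j
   using insert.hyps True by simp
  moreover have "(\<Sum>c\<in>insert c0 I. y c * a c j t) = (\<Sum>c\<in>I. y c * a c j t)" if "t : P" for y j t
   using insert.hyps z that by simp
  ultimately show ?thesis using insert.IH[of a r] insert.prems by simp
 next
  case False
  then obtain j0 where p: "\<iota> (a c0 j0) ~= 0" by blast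
  \<comment> \<open>Fraction-free elimination of the unknown \<open>c0\<close> by the pivot equation
    \<open>j0\<close>: the reduced system keeps its coefficients in \<open>R\<close>.\<close>
  define a' where "a' c j t = a c0 j0 t * a c j t - a c j0 t * a c0 j t" for c j t
  define r' where "r' j t = a c0 j0 t * r j t - r j0 t * a c0 j t" for j t
  have aR: "a c j : R" if "c : insert c0 I" for c j using insert.prems that by blast
  note rR = insert.prems(2)
  have a'R: "a' c j : R" if "c : I" for c j unfolding a'_def by (intro R_diff R_mult aR) (use that in auto)
  have r'R: "r' j : R" for j unfolding r'_def by (intro R_diff R_mult aR rR) auto
  have \<iota>a': "\<iota> (a' c j) = \<iota> (a c0 j0) * \<iota> (a c j) - \<iota> (a c j0) * \<iota> (a c0 j)" if "c : I" for c j
   using that unfolding a'_def by (simp add: \<iota>_diff \<iota>_mult R_mult aR)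
  have \<iota>r': "\<iota> (r' j) = \<iota> (a c0 j0) * \<iota> (r j) - \<iota> (r j0) * \<iota> (a c0 j)" for j
   unfolding r'_def by (simp add: \<iota>_diff \<iota>_mult R_mult aR rR)
  from insert.IH[of a' r', OF a'R r'R] show ?thesis
  proof
   assume "\<exists>y. \<forall>j. (\<Sum>c\<in>I. y c * \<iota> (a' c j)) = \<iota> (r' j)"
   then obtain y where y: "!!j. (\<Sum>c\<in>I. y c * \<iota> (a' c j)) = \<iota> (r' j)" by blast
   define y0 where "y0 = (\<iota> (r j0) - (\<Sum>c\<in>I. y c * \<iota> (a c j0))) / \<iota> (a c0 j0)"
   have y0: "\<iota> (a c0 j0) * y0 = \<iota> (r j0) - (\<Sum>c\<in>I. y c * \<iota> (a c j0))" using p by (simp add: y0_def)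
   define z where "z c = (if c = c0 then y0 else y c)" for c
   have "(\<Sum>c\<in>insert c0 I. z c * \<iota> (a c j)) = \<iota> (r j)" for j
   proof -
    have s: "(\<Sum>c\<in>insert c0 I. z c * \<iota> (a c j)) = y0 * \<iota> (a c0 j) + (\<Sum>c\<in>I. y c * \<iota> (a c j))"
     using insert.hyps by (auto simp: z_def intro!: sum.cong)
    have "(\<Sum>c\<in>I. y c * \<iota> (a' c j)) = \<iota> (a c0 j0) * (\<Sum>c\<in>I. y c * \<iota> (a c j)) - \<iota> (a c0 j) * (\<Sum>c\<in>I. y c * \<iota> (a c j0))"
     by (simp add: \<iota>a' sum_distrib_left sum_subtractf[symmetric] algebra_simps cong: sum.cong)
    hence e: "\<iota> (a c0 j0) * (\<Sum>c\<in>I. y c * \<iota> (a c j)) =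
      \<iota> (r' j) + \<iota> (a c0 j) * (\<Sum>c\<in>I. y c * \<iota> (a c j0))" using y by simp
    have "\<iota> (a c0 j0) * (y0 * \<iota> (a c0 j) + (\<Sum>c\<in>I. y c * \<iota> (a c j))) =
      (\<iota> (a c0 j0) * y0) * \<iota> (a c0 j) + \<iota> (a c0 j0) * (\<Sum>c\<in>I. y c * \<iota> (a c j))"
     by (simp add: algebra_simps)
    also have "\<dots> = \<iota> (a c0 j0) * \<iota> (r j)" unfolding y0 e \<iota>r' by (simp add: algebra_simps)
    finally show ?thesis using p unfolding s by simp
   qed
   thus ?thesis by blast
  next
   assume "\<exists>f\<in>R. \<iota> f ~= 0 & (\<forall>t\<in>P. f t ~= 0 --> \<not> (\<exists>y. \<forall>j. (\<Sum>c\<in>I. y c * a' c j t) = r' j t))"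
   then obtain f where f: "f : R" "\<iota> f ~= 0"
    "!!t y. t : P ==> f t ~= 0 ==> \<not> (\<forall>j. (\<Sum>c\<in>I. y c * a' c j t) = r' j t)" by blast
   have "\<not> (\<exists>y. \<forall>j. (\<Sum>c\<in>insert c0 I. y c * a c j t) = r j t)"
    if t: "t : P" "f t * a c0 j0 t ~= 0" for t
   proof
    assume "\<exists>y. \<forall>j. (\<Sum>c\<in>insert c0 I. y c * a c j t) = r j t"
    then obtain y where y: "!!j. y c0 * a c0 j t + (\<Sum>c\<in>I. y c * a c j t) = r j t" using insert.hyps by auto
    have "(\<Sum>c\<in>I. y c * a' c j t) = r' j t" for j
    proof -
     have "(\<Sum>c\<in>I. y c * a' c j t) = a c0 j0 t * (\<Sum>c\<in>I. y c * a c j t) - a c0 j t * (\<Sum>c\<in>I. y c * a c j0 t)"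
      by (simp add: a'_def sum_distrib_left sum_subtractf[symmetric] algebra_simps)
     also have "\<dots> = r' j t" unfolding r'_def y[symmetric] by (simp add: algebra_simps)
     finally show ?thesis .
    qed
    thus False using f(3)[of t y] t by auto
   qed
   moreover have "(%t. f t * a c0 j0 t) : R" "\<iota> (%t. f t * a c0 j0 t) ~= 0"
    using f p aR by (auto intro: R_mult simp: \<iota>_mult)
   ultimately show ?thesis by (intro disjI2) blast
  qed
 qed
qed

text \<open>One polynomial seen twice: as a family of complex polynomials with coefficients in
  \<open>R\<close>, and over k_0 through \<iota>. Closure under the ring operations and
  \<open>pderiv\<close> transfers \<open>lax_poly\<close> and its right-hand side between the two
  readings.\<close>

definition rpoly :: "(complex ^ 'r => complex poly) => 'k poly => bool" where
 "rpoly p q \<longleftrightarrow> (\<forall>i. (%t. coeff (p t) i) : R & coeff q i = \<iota> (%t. coeff (p t) i))"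

lemma rpoly_add: "rpoly p q ==> rpoly p' q' ==> rpoly (%t. p t + p' t) (q + q')" by (auto simp: rpoly_def R_add \<iota>_add)

lemma rpoly_diff: "rpoly p q ==> rpoly p' q' ==> rpoly (%t. p t - p' t) (q - q')"
 by (auto simp: rpoly_def R_diff \<iota>_diff)

lemma rpoly_mult: "rpoly p q ==> rpoly p' q' ==> rpoly (%t. p t * p' t) (q * q')" unfolding rpoly_def
proof
 fix i
 assume p: "\<forall>i. (%t. coeff (p t) i) : R & coeff q i = \<iota> (%t. coeff (p t) i)"
  and p': "\<forall>i. (%t. coeff (p' t) i) : R & coeff q' i = \<iota> (%t. coeff (p' t) i)"
 have R: "(%t. coeff (p t) l * coeff (p' t) (i - l)) : R" for l using p p' by (intro R_mult) auto
 have "\<iota> (%t. coeff (p t) l * coeff (p' t) (i - l)) = coeff q l * coeff q' (i - l)" for l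
  using p p' by (subst \<iota>_mult) auto
 thus "(%t. coeff (p t * p' t) i) : R & coeff (q * q') i = \<iota> (%t. coeff (p t * p' t) i)"
  unfolding coeff_mult using R by (simp add: R_sum \<iota>_sum)
qed

lemma rpoly_monom: "rpoly (%_. monom 1 k) (monom 1 k)" by (auto simp: rpoly_def coeff_monom R_const \<iota>_one \<iota>_zero)

lemma rpoly_0: "rpoly (%_. 0) 0" by (auto simp: rpoly_def R_const \<iota>_zero)

lemma rpoly_of_nat: "rpoly (%_. of_nat n) (of_nat n)"
 by (auto simp: rpoly_def R_const \<iota>_zero \<iota>_of_nat of_nat_poly coeff_pCons split: nat.splits)

lemma rpoly_1: "rpoly (%_. 1) 1" using rpoly_of_nat[of 1] by simp

lemma rpoly_power: "rpoly p q ==> rpoly (%t. p t ^ n) (q ^ n)" by (induction n) (auto intro: rpoly_mult rpoly_1)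

lemma rpoly_sum: "(!!x. x : S ==> rpoly (p x) (q x)) ==> rpoly (%t. \<Sum>x\<in>S. p x t) (\<Sum>x\<in>S. q x)"
 by (induction S rule: infinite_finite_induct) (auto intro: rpoly_add rpoly_0)

lemma rpoly_prod: "(!!x. x : S ==> rpoly (p x) (q x)) ==> rpoly (%t. \<Prod>x\<in>S. p x t) (\<Prod>x\<in>S. q x)"
 by (induction S rule: infinite_finite_induct) (auto intro: rpoly_mult rpoly_1)

lemma rpoly_pderiv: assumes "rpoly p q" shows "rpoly (%t. pderiv (p t)) (pderiv q)" unfolding rpoly_def coeff_pderiv
proof
 fix i
 have "(%t. coeff (p t) (Suc i)) : R" "coeff q (Suc i) = \<iota> (%t. coeff (p t) (Suc i))"
  using assms by (auto simp: rpoly_def)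
 thus "(%t. of_nat (Suc i) * coeff (p t) (Suc i)) : R &
     of_nat (Suc i) * coeff q (Suc i) = \<iota> (%t. of_nat (Suc i) * coeff (p t) (Suc i))"
  using \<iota>_mult[OF R_const[of "of_nat (Suc i)"]] R_mult[OF R_const[of "of_nat (Suc i)"]] \<iota>_of_nat by metis
qed

lemma rpoly_poly_at: assumes "set cs <= R" shows "rpoly (poly_at cs) (Poly (map \<iota> cs))" unfolding rpoly_def
proof
 fix i
 have "coeff (poly_at cs t) i = (if i < length cs then (cs ! i) t else 0)" for t by (simp add: poly_at_def nth_default_def)
 moreover have "cs ! i : R" if "i < length cs" using assms that by auto
 ultimately show "(%t. coeff (poly_at cs t) i) : R & coeff (Poly (map \<iota> cs)) i = \<iota> (%t. coeff (poly_at cs t) i)"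
  by (auto simp: nth_default_def R_const \<iota>_zero)
qed

lemma rpoly_smult_coeff: "rpoly p q ==> (%t. coeff (p t) i) : R"
 "rpoly p q ==> coeff q i = \<iota> (%t. coeff (p t) i)" by (auto simp: rpoly_def)

text \<open>In these names \<open>_at\<close> means evaluated at a parameter value,
  \<open>_k\<close> read over k_0, and a prime the derivative in the parameter direction
  \<open>k\<close>.\<close>

definition den_at where "den_at t = (%i j. poly_at (den i j) t)"
definition num_at where "num_at t = (%i j. poly_at (num i j) t)"
definition den'_at where "den'_at k t = (%i j. poly_at (map (partial k) (den i j)) t)"
definition num'_at where "num'_at k t = (%i j. poly_at (map (partial k) (num i j)) t)"
definition den_k where "den_k = (%i j. Poly (map \<iota> (den i j)))"
definition num_k where "num_k = (%i j. Poly (map \<iota> (num i j)))"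
definition den'_k where "den'_k k = (%i j. Poly (map (d k) (map \<iota> (den i j))))"
definition num'_k where "num'_k k = (%i j. Poly (map (d k) (map \<iota> (num i j))))"

lemma rpoly_den: "rpoly (%t. den_at t i j) (den_k i j)" "rpoly (%t. num_at t i j) (num_k i j)"
 "rpoly (%t. den'_at k t i j) (den'_k k i j)" "rpoly (%t. num'_at k t i j) (num'_k k i j)"
proof -
 have R: "set (num i j) <= R" "set (den i j) <= R" using R_coeffs[of i j] by auto
 show "rpoly (%t. den_at t i j) (den_k i j)" "rpoly (%t. num_at t i j) (num_k i j)"
  using R rpoly_poly_at by (auto simp: den_at_def num_at_def den_k_def num_k_def)
 have "rpoly (poly_at (map (partial k) cs)) (Poly (map (d k) (map \<iota> cs)))" if "set cs <= R" for cs
 proof -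
  have "map \<iota> (map (partial k) cs) = map (d k) (map \<iota> cs)" using that by (auto simp: \<iota>_partial)
  thus ?thesis using rpoly_poly_at[of "map (partial k) cs"] that R_partial by (metis image_subset_iff list.set_map subsetD)
 qed
 thus "rpoly (%t. den'_at k t i j) (den'_k k i j)" "rpoly (%t. num'_at k t i j) (num'_k k i j)"
  using R by (auto simp: den'_at_def num'_at_def den'_k_def num'_k_def)
qed

definition lax_solvable_at :: "'r => complex ^ 'r => bool" where
 "lax_solvable_at k t \<longleftrightarrow> (\<exists>e b sg. lax_poly e (cden (den_at t)) (cnum (num_at t) (den_at t)) b =
   (\<chi> i j. cden (den_at t) ^ e * cderiv (num_at t) (den_at t) (num'_at k t) (den'_at k t) $ i $ j) + mat sg)"

text \<open>Suppose the contrary. For every pole order \<open>e\<close> and degree bound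
  \<open>g\<close> the ansatz is then a linear system without solution over k_0, and some element of
  \<open>R\<close> witnesses this wherever it does not vanish. At a point of \<open>U\<close> where
  all these countably many witnesses are nonzero no solution of any shape exists, against the
  assumption there.\<close>

lemma lax_solvable_over_field:
 assumes P: "open P" "connected P" and U: "open U" "U <= P" "U ~= {}"
  and sol: "!!t. t : U ==> lax_solvable_at k t"
 shows "\<exists>e b sg. lax_poly e (cden den_k) (cnum num_k den_k) b =
   (\<chi> i j. cden den_k ^ e * cderiv num_k den_k (num'_k k) (den'_k k) $ i $ j) + mat sg"
proof (rule ccontr)
 assume unsolvable: "\<not> ?thesis"
 define q where "q t = cden (den_at t)" for t
 define N where "N t = cnum (num_at t) (den_at t)" for t
 define F where "F t = cderiv (num_at t) (den_at t) (num'_at k t) (den'_at k t)" for t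
 define qk where "qk = cden den_k"
 define Nk where "Nk = cnum num_k den_k"
 define Fk where "Fk = cderiv num_k den_k (num'_k k) (den'_k k)"
 have rc: "rpoly (%t. cofac (den_at t) i j) (cofac den_k i j)" for i j unfolding cofac_def by (intro rpoly_prod rpoly_den)
 have rq: "rpoly q qk" unfolding q_def qk_def cden_def by (intro rpoly_prod rpoly_den)
 have rN: "rpoly (%t. N t $ i $ j) (Nk $ i $ j)" for i j
  unfolding N_def Nk_def cnum_def vec_lambda_beta by (intro rpoly_mult rpoly_den rc)
 have rF: "rpoly (%t. F t $ i $ j) (Fk $ i $ j)" for i j
  unfolding F_def Fk_def cderiv_def vec_lambda_beta by (intro rpoly_mult rpoly_diff rpoly_den rpoly_power rc)
 \<comment> \<open>Matrix units times powers of x, a basis of the polynomial matrices.\<close>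
 define E :: "nat \<times> 'n \<times> 'n => complex poly ^ 'n ^ 'n"
  where "E = (%(l, i, j). \<chi> a b. if a = i & b = j then monom 1 l else 0)"
 define Ek :: "nat \<times> 'n \<times> 'n => 'k poly ^ 'n ^ 'n"
  where "Ek = (%(l, i, j). \<chi> a b. if a = i & b = j then monom 1 l else 0)"
 have rE: "rpoly (%t. E c $ i $ j) (Ek c $ i $ j)" for c i j by (cases c) (auto simp: E_def Ek_def rpoly_monom rpoly_0)
 have rL: "rpoly (%t. lax_poly e (q t) (N t) (E c) $ i $ j) (lax_poly e qk Nk (Ek c) $ i $ j)" for e c i j
  unfolding lax_poly_def vec_lambda_beta vector_minus_component matrix_matrix_mult_def
  by (intro rpoly_diff rpoly_mult rpoly_power rpoly_pderiv rpoly_sum rpoly_of_nat rq rN rE)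
 have rS: "rpoly (%t. mod_scalar (X t) $ i $ j) (mod_scalar Xk $ i $ j)"
  if "!!i j. rpoly (%t. X t $ i $ j) (Xk $ i $ j)" for X :: "complex ^ 'r => complex poly ^ 'n ^ 'n" and Xk i j
  unfolding mod_scalar_def vec_lambda_beta by (cases "i = j") (use that in \<open>auto intro: rpoly_diff\<close>)
 define I :: "nat => (nat \<times> 'n \<times> 'n) set" where "I g = {..g} \<times> UNIV" for g
 have fI: "finite (I g)" for g by (simp add: I_def)
 define rhs where "rhs e t = (\<chi> i j. q t ^ e * F t $ i $ j)" for e t
 define rhsk where "rhsk e = (\<chi> i j. qk ^ e * Fk $ i $ j)" for e
 have rR: "rpoly (%t. rhs e t $ i $ j) (rhsk e $ i $ j)" for e i j
  unfolding rhs_def rhsk_def vec_lambda_beta by (intro rpoly_mult rpoly_power rq rF)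
 define a where "a e c jj t = coeff (mod_scalar (lax_poly e (q t) (N t) (E c)) $ fst jj $ fst (snd jj)) (snd (snd jj))"
  for e c t and jj :: "'n \<times> 'n \<times> nat"
 define r where "r e jj t = coeff (mod_scalar (rhs e t) $ fst jj $ fst (snd jj)) (snd (snd jj))"
  for e t and jj :: "'n \<times> 'n \<times> nat"
 have aR: "a e c jj : R" for e c jj unfolding a_def by (rule rpoly_smult_coeff(1)[OF rS[OF rL]])
 have ak: "\<iota> (a e c jj) = coeff (mod_scalar (lax_poly e qk Nk (Ek c)) $ fst jj $ fst (snd jj)) (snd (snd jj))" for e c jj
  unfolding a_def by (rule rpoly_smult_coeff(2)[OF rS[OF rL], symmetric])
 have rrR: "r e jj : R" for e jj unfolding r_def by (rule rpoly_smult_coeff(1)[OF rS[OF rR]])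
 have rk: "\<iota> (r e jj) = coeff (mod_scalar (rhsk e) $ fst jj $ fst (snd jj)) (snd (snd jj))" for e jj
  unfolding r_def by (rule rpoly_smult_coeff(2)[OF rS[OF rR], symmetric])
 have comb: "mod_scalar (lax_poly e q N (\<Sum>c\<in>I g. (\<chi> i j. smult (y c) (X c $ i $ j)))) $ i $ j =
   (\<Sum>c\<in>I g. smult (y c) (mod_scalar (lax_poly e q N (X c)) $ i $ j))"
  for e g i j y and q :: "'a::idom poly" and N :: "'a poly ^ 'n ^ 'n" and X :: "nat \<times> 'n \<times> 'n => 'a poly ^ 'n ^ 'n"
  unfolding mod_scalar_def vec_lambda_beta lax_poly_combination[OF fI] by (auto simp: sum_subtractf smult_diff_right)
 have no: "\<not> (\<exists>y. \<forall>jj. (\<Sum>c\<in>I g. y c * \<iota> (a e c jj)) = \<iota> (r e jj))" for e g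
 proof
  assume "\<exists>y. \<forall>jj. (\<Sum>c\<in>I g. y c * \<iota> (a e c jj)) = \<iota> (r e jj)"
  then obtain y where y: "!!jj. (\<Sum>c\<in>I g. y c * \<iota> (a e c jj)) = \<iota> (r e jj)" by blast
  define b where "b = (\<Sum>c\<in>I g. (\<chi> i j. smult (y c) (Ek c $ i $ j)))"
  have "coeff (mod_scalar (lax_poly e qk Nk b) $ i $ j) l = coeff (mod_scalar (rhsk e) $ i $ j) l" for i j l
   using y[of "(i, j, l)"] unfolding b_def comb ak rk by (simp add: coeff_sum)
  hence "mod_scalar (lax_poly e qk Nk b) = mod_scalar (rhsk e)" by (simp add: vec_eq_iff poly_eq_iff)
  thus False using unsolvable unfolding mod_scalar_eq_iff rhsk_def qk_def Nk_def Fk_def by blast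
 qed
 have "\<exists>f\<in>R. \<iota> f ~= 0 & (\<forall>t\<in>P. f t ~= 0 --> \<not> (\<exists>y. \<forall>jj. (\<Sum>c\<in>I g. y c * a e c jj t) = r e jj t))" for e g
  using linear_system_alternative[OF fI[of g], of "a e" "r e"] aR rrR no by blast
 then obtain f where f: "!!e g. f (e, g) : R" "!!e g. \<iota> (f (e, g)) ~= 0"
  "!!e g t y. t : P ==> f (e, g) t ~= 0 ==> \<not> (\<forall>jj. (\<Sum>c\<in>I g. y c * a e c jj t) = r e jj t)"
 proof -
  assume *: "!!f. \<lbrakk>!!e g. f (e, g) : R; !!e g. \<iota> (f (e, g)) ~= 0;
    !!e g t y. t : P ==> f (e, g) t ~= 0 ==> \<not> (\<forall>jj. (\<Sum>c\<in>I g. y c * a e c jj t) = r e jj t)\<rbrakk> \<Longrightarrow> thesis"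
  assume "!!e g. \<exists>f\<in>R. \<iota> f ~= 0 & (\<forall>t\<in>P. f t ~= 0 --> \<not> (\<exists>y. \<forall>jj. (\<Sum>c\<in>I g. y c * a e c jj t) = r e jj t))"
  then obtain f where f: "!!e g. f e g : R & \<iota> (f e g) ~= 0 & (\<forall>t\<in>P. f e g t ~= 0 --> \<not> (\<exists>y. \<forall>jj. (\<Sum>c\<in>I g. y c * a e c jj t) = r e jj t))"
   by metis
  have f3: "\<not> (\<forall>jj. (\<Sum>c\<in>I g. y c * a e c jj t) = r e jj t)" if "t : P" "f e g t ~= 0" for e g t y
   using f[of e g] that by blast
  show thesis by (rule *[of "%(e, g). f e g"]) (use f f3 in \<open>auto simp del: not_all\<close>)
 qed
 have "\<exists>t\<in>U. \<forall>i. f i t ~= 0"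
 proof (rule mv_holomorphic_common_nonzero[OF P _ _ U])
  show "mv_holomorphic_on (f i) P" for i using f(1) R_holomorphic by (cases i) auto
  show "\<exists>t\<in>P. f i t ~= 0" for i using f(1,2) \<iota>_eq_0_iff by (cases i) blast
 qed
 then obtain t where t: "t : U" "!!i. f i t ~= 0" by blast
 then obtain e b sg where b: "lax_poly e (q t) (N t) b = rhs e t + mat sg"
  using sol unfolding lax_solvable_at_def q_def N_def F_def rhs_def by blast
 \<comment> \<open>The solution at \<open>t\<close> determines its degree bound only now, which is
   why the witnesses had to be nonzero for all bounds at once.\<close>
 define g where "g = Max (range (%(i, j). degree (b $ i $ j)))"
 have g: "degree (b $ i $ j) <= g" for i j unfolding g_def by (rule Max_ge) (auto intro: image_eqI[of _ _ "(i, j)"])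
 define y where "y = (%(l, i, j). coeff (b $ i $ j) l)"
 have "b $ i $ j = (\<Sum>c\<in>I g. (\<chi> i j. smult (y c) (E c $ i $ j))) $ i $ j" for i j
 proof -
  have "(\<Sum>c\<in>I g. (\<chi> i j. smult (y c) (E c $ i $ j))) $ i $ j = (\<Sum>c\<in>I g. smult (y c) (E c $ i $ j))" by simp
  also have "\<dots> = (\<Sum>c\<in>(%l. (l, i, j)) ` {..g}. smult (y c) (E c $ i $ j))"
   by (rule sum.mono_neutral_right) (auto simp: I_def E_def split: if_splits)
  also have "\<dots> = (\<Sum>l\<le>g. monom (coeff (b $ i $ j) l) l)"
   by (subst sum.reindex) (auto simp: inj_on_def y_def E_def smult_monom)
  also have "\<dots> = b $ i $ j" using poly_as_sum_of_monoms'[OF g] .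
  finally show ?thesis ..
 qed
 hence bE: "b = (\<Sum>c\<in>I g. (\<chi> i j. smult (y c) (E c $ i $ j)))" by (simp add: vec_eq_iff)
 have "mod_scalar (lax_poly e (q t) (N t) b) = mod_scalar (rhs e t)" using b mod_scalar_eq_iff by blast
 hence eq: "(\<Sum>c\<in>I g. smult (y c) (mod_scalar (lax_poly e (q t) (N t) (E c)) $ i $ j)) = mod_scalar (rhs e t) $ i $ j" for i j
  unfolding comb[symmetric] bE[symmetric] by simp
 have "(\<Sum>c\<in>I g. y c * a e c jj t) = r e jj t" for jj
  using arg_cong[OF eq[of "fst jj" "fst (snd jj)"], of "%p. coeff p (snd (snd jj))"] by (simp add: a_def r_def coeff_sum)
 thus False using f(3)[of t e g y] t U by blast
qed

lemma derived_PPV_group_constant_of_solvable: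
 assumes P: "open P" "connected P" and U: "open U" "U <= P" "U ~= {}"
  and sol: "!!k t. t : U ==> lax_solvable_at k t"
  and den: "!!i j. \<exists>f\<in>set (den i j). \<exists>t\<in>P. f t ~= 0"
  and ext: "PPV_extension d (matrix_over_k \<iota> num den) dx dt h Dx Dt Z"
 shows "\<exists>C C' :: 'k ^ 'n ^ 'n. C ** C' = mat 1 &
  derived GL (PPV_group h Dx Dt Z) <= carrier GL &
  (\<forall>N\<in>derived GL (PPV_group h Dx Dt Z). \<forall>i. map_matrix (d i) (C ** N ** C') = 0)"
proof -
 interpret X: PPV_extension d "matrix_over_k \<iota> num den" dx dt h Dx Dt Z by (rule ext)
 have den0: "den_k i j ~= 0" for i j
 proof -
  obtain f where f: "f : set (den i j)" "\<exists>t\<in>P. f t ~= 0" using den[of i j] by blast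
  hence "\<iota> f ~= 0" using \<iota>_eq_0_iff R_coeffs[of i j] by blast
  obtain l where l: "l < length (den i j)" "den i j ! l = f" using f(1) by (auto simp: in_set_conv_nth)
  hence "coeff (den_k i j) l = \<iota> f" by (simp add: den_k_def nth_default_def)
  thus ?thesis using \<open>\<iota> f ~= 0\<close> by auto
 qed
 have "\<exists>B s. map_matrix dx B = matrix_over_k \<iota> num den ** B - B ** matrix_over_k \<iota> num den
   + map_matrix (dt k) (matrix_over_k \<iota> num den) - mat s" for k
 proof -
  obtain e b sg where b: "lax_poly e (cden den_k) (cnum num_k den_k) b =
    (\<chi> i j. cden den_k ^ e * cderiv num_k den_k (num'_k k) (den'_k k) $ i $ j) + mat sg"
   using lax_solvable_over_field[OF P U sol] by blast
  have M: "matrix_over_k \<iota> num den = (\<chi> i j. Fract (num_k i j) (den_k i j))"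
   by (simp add: matrix_over_k_def num_k_def den_k_def)
  show ?thesis unfolding M by (rule lax_equation_from_poly[OF X.dx(1) X.dx_Fract X.dt(1) _ _ den0 b])
    (simp_all only: num_k_def num'_k_def den_k_def den'_k_def X.dt_Fract_Poly)
 qed
 then obtain B s where "!!k. map_matrix dx (B k) = matrix_over_k \<iota> num den ** B k - B k ** matrix_over_k \<iota> num den
   + map_matrix (dt k) (matrix_over_k \<iota> num den) - mat (s k)" by metis
 from closed_derivations.derived_PPV_group_constant[OF closed_derivations ext this] show ?thesis .
qed

end

section \<open>Linear differential equations for matrices\<close>

definition mder :: "(complex => complex ^ 'n ^ 'm) => complex ^ 'n ^ 'm => complex => bool" where
 "mder Y Y' z \<longleftrightarrow> (\<forall>i j. ((%u. Y u $ i $ j) has_field_derivative Y' $ i $ j) (at z))"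

definition mholo :: "(complex => complex ^ 'n ^ 'm) => complex set => bool" where
 "mholo Y S \<longleftrightarrow> (\<forall>i j. (%u. Y u $ i $ j) holomorphic_on S)"

lemma mder_const: "mder (%_. C) 0 z" by (simp add: mder_def)

lemma mder_add: "mder X X' z ==> mder Y Y' z ==> mder (%u. X u + Y u) (X' + Y') z"
 by (auto simp: mder_def intro!: derivative_eq_intros)

lemma mder_diff: "mder X X' z ==> mder Y Y' z ==> mder (%u. X u - Y u) (X' - Y') z"
 by (auto simp: mder_def intro!: derivative_eq_intros)

lemma mder_mult: "mder X X' z ==> mder Y Y' z ==> mder (%u. X u ** Y u) (X' ** Y z + X z ** Y') z"
 by (auto simp: mder_def matrix_matrix_mult_def sum.distrib[symmetric] intro!: derivative_eq_intros sum.cong)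

lemma mder_transpose: "mder X X' z ==> mder (%u. transpose (X u)) (transpose X') z" by (auto simp: mder_def transpose_def)

lemma mder_eq: "mder Y Y' z ==> Y' = Y'' ==> mder Y Y'' z" by simp

lemma mder_cong:
 assumes "\<forall>\<^sub>F u in nhds z. X u = Y u" shows "mder X D z \<longleftrightarrow> mder Y D z" unfolding mder_def
 by (intro all_cong1 DERIV_cong_ev refl eventually_mono[OF assms]) auto

lemma mder_chain:
 assumes "mder Y Y' (g z)" "(g has_field_derivative g') (at z)"
 shows "mder (%u. Y (g u)) (mat g' ** Y') z"
 using assms by (auto simp: mder_def mat_mult_left mult.commute[of g'] intro: DERIV_chain2)

lemma mder_imp_mholo: "(!!z. z : S ==> mder Y (Y' z) z) ==> mholo Y S"
 unfolding mholo_def mder_def holomorphic_on_def field_differentiable_def by (blast intro: has_field_derivative_at_within)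

lemma mholo_subset: "mholo Y S ==> T <= S ==> mholo Y T" by (auto simp: mholo_def intro: holomorphic_on_subset)

lemma mholo_mult: "mholo X S ==> mholo Y S ==> mholo (%u. X u ** Y u) S"
 by (auto simp: mholo_def matrix_matrix_mult_def intro!: holomorphic_intros)

lemma mholo_transpose: "mholo X S ==> mholo (%u. transpose (X u)) S" by (auto simp: mholo_def transpose_def)

lemma mholo_uminus: "mholo X S ==> mholo (%u. - X u) S" by (auto simp: mholo_def intro!: holomorphic_intros)

lemma mder_continuous: assumes "mder Y Y' z" shows "isCont Y z"
proof -
 have "isCont (%u. Y u $ i $ j) z" for i j using assms DERIV_isCont unfolding mder_def by blast
 thus ?thesis unfolding isCont_def by (intro vec_tendstoI) simp
qed

lemma mholo_continuous_on: assumes "mholo Y S" shows "continuous_on S Y"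
proof -
 have "continuous_on S (%u. Y u $ i $ j)" for i j using assms holomorphic_on_imp_continuous_on unfolding mholo_def by blast
 thus ?thesis unfolding continuous_on_def by (intro ballI vec_tendstoI) simp
qed

lemma matrix_norm_le_sum: "norm (X :: complex ^ 'n ^ 'm) <= (\<Sum>i\<in>UNIV. \<Sum>j\<in>UNIV. norm (X $ i $ j))"
proof -
 have "norm X <= (\<Sum>i\<in>UNIV. norm (X $ i))" unfolding norm_vec_def by (rule L2_set_le_sum) auto
 also have "\<dots> <= (\<Sum>i\<in>UNIV. \<Sum>j\<in>UNIV. norm (X $ i $ j))"
  by (rule sum_mono) (unfold norm_vec_def, rule L2_set_le_sum, auto)
 finally show ?thesis .
qed

lemma entry_le_norm: "norm (X $ i $ j) <= norm (X :: complex ^ 'n ^ 'm)"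
 using Finite_Cartesian_Product.norm_nth_le[of X i] Finite_Cartesian_Product.norm_nth_le[of "X $ i" j] by linarith

text \<open>A crude constant for submultiplicativity of the Euclidean norm: each of the n^2 entries
  of a product is at most n times the product of the norms.\<close>

definition mconst :: "'n itself => real" where "mconst _ = real CARD('n) ^ 3"

lemma mconst_nonneg: "mconst TYPE('n) \<ge> 0" by (simp add: mconst_def)

lemma mconst_ge_1: "mconst TYPE('n::finite) \<ge> 1" by (simp add: mconst_def)

lemma norm_matrix_mult: "norm ((X :: complex ^ 'n ^ 'n) ** Y) <= mconst TYPE('n) * norm X * norm (Y :: complex ^ 'n ^ 'n)"
proof -
 have "norm ((X ** Y) $ i $ j) <= real CARD('n) * (norm X * norm Y)" for i j
 proof -
  have "norm ((X ** Y) $ i $ j) <= (\<Sum>k\<in>UNIV. norm (X $ i $ k * Y $ k $ j))"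
   by (simp add: matrix_matrix_mult_def norm_sum)
  also have "\<dots> <= (\<Sum>k\<in>(UNIV::'n set). norm X * norm Y)"
   unfolding norm_mult by (intro sum_mono mult_mono entry_le_norm) auto
  finally show ?thesis by simp
 qed
 hence "(\<Sum>i\<in>UNIV. \<Sum>j\<in>UNIV. norm ((X ** Y) $ i $ j)) <= (\<Sum>i\<in>(UNIV::'n set). \<Sum>j\<in>(UNIV::'n set). real CARD('n) * (norm X * norm Y))"
  by (intro sum_mono)
 also have "\<dots> = mconst TYPE('n) * norm X * norm Y" by (simp add: mconst_def power3_eq_cube)
 finally show ?thesis using matrix_norm_le_sum[of "X ** Y"] by linarith
qed

lemma norm_mat_mult: "norm (mat c ** (X :: complex ^ 'n ^ 'n)) = norm c * norm X"
proof -
 have "norm ((mat c ** X) $ i) = norm c * norm (X $ i)" for i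
  by (simp add: norm_vec_def[of "X $ i"] norm_vec_def[of "(mat c ** X) $ i"] mat_mult_left norm_mult L2_set_right_distrib)
 thus ?thesis by (simp add: norm_vec_def[of X] norm_vec_def[of "mat c ** X"] L2_set_right_distrib)
qed

lemma has_vector_derivative_vec:
 fixes f :: "real => 'a::real_normed_vector ^ 'n"
 assumes "!!i. ((%x. f x $ i) has_vector_derivative f' $ i) (at x)"
 shows "(f has_vector_derivative f') (at x)"
proof -
 have "((%y. (f y - (f x + (y - x) *\<^sub>R f')) /\<^sub>R norm (y - x)) \<longlongrightarrow> 0) (at x)"
 proof (rule vec_tendstoI)
  fix i
  have "((%y. (f y $ i - (f x $ i + (y - x) *\<^sub>R f' $ i)) /\<^sub>R norm (y - x)) \<longlongrightarrow> 0) (at x)"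
   using assms[of i] unfolding has_vector_derivative_def has_derivative_within by (simp add: inverse_eq_divide)
  thus "((%y. ((f y - (f x + (y - x) *\<^sub>R f')) /\<^sub>R norm (y - x)) $ i) \<longlongrightarrow> 0 $ i) (at x)" by simp
 qed
 thus ?thesis unfolding has_vector_derivative_def has_derivative_within
  by (auto intro: bounded_linear_scaleR_left simp: inverse_eq_divide)
qed

lemma mder_curve:
 assumes "mder Y Y' (g x)" "(g has_vector_derivative g') (at x)"
 shows "((%x. Y (g x)) has_vector_derivative (mat g' ** (Y' :: complex ^ 'n ^ 'n))) (at x)"
 by (intro has_vector_derivative_vec)
  (use assms in \<open>auto simp: mder_def mat_mult_left intro: field_vector_diff_chain_at[unfolded o_def]\<close>)

lemma gronwall:
 fixes f :: "real => 'a::real_inner"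
 assumes T: "0 <= T" and K: "K \<ge> 0" and N: "N \<ge> 0"
  and f: "!!x. x : {0..T} ==> (f has_vector_derivative f' x) (at x)"
  and b: "!!x. x : {0..T} ==> norm (f' x) <= K * norm (f x) + c * exp (N * x)"
 shows "norm (f T) ^ 2 <= exp ((2 * K + 1 + 2 * N) * T) * (norm (f 0) ^ 2 + c ^ 2 * T)"
proof -
 define L where "L = 2 * K + 1 + 2 * N"
 define v where "v x = f x \<bullet> f x" for x
 have v: "v x = norm (f x) ^ 2" for x by (simp add: v_def power2_norm_eq_inner)
 have dv: "(v has_real_derivative 2 * (f x \<bullet> f' x)) (at x)" if "x : {0..T}" for x
 proof -
  have "(f has_derivative (%h. h *\<^sub>R f' x)) (at x)" using f[OF that] by (simp add: has_vector_derivative_def)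
  from has_derivative_inner[OF this this] show ?thesis unfolding v_def has_field_derivative_def
   by (rule has_derivative_eq_rhs) (auto simp: inner_commute)
 qed
 have dv_le: "2 * (f x \<bullet> f' x) <= (2 * K + 1) * v x + c ^ 2 * exp (2 * N * x)" if "x : {0..T}" for x
 proof -
  have "f x \<bullet> f' x <= norm (f x) * norm (f' x)" by (rule norm_cauchy_schwarz)
  also have "\<dots> <= norm (f x) * (K * norm (f x) + c * exp (N * x))" by (intro mult_left_mono b that) auto
  finally have 1: "2 * (f x \<bullet> f' x) <= 2 * K * v x + 2 * norm (f x) * (c * exp (N * x))"
   by (simp add: v power2_eq_square algebra_simps)
  have "2 * norm (f x) * (c * exp (N * x)) <= norm (f x) ^ 2 + (c * exp (N * x)) ^ 2"
   using sum_squares_bound[of "norm (f x)" "c * exp (N * x)"] by simp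
  also have "(c * exp (N * x)) ^ 2 = c ^ 2 * exp (2 * N * x)"
   by (simp add: power_mult_distrib mult.assoc flip: exp_of_nat_mult)
  finally show ?thesis using 1 by (simp add: v algebra_simps)
 qed
 \<comment> \<open>After multiplication by \<open>exp (- L * x)\<close> the inhomogeneous term is at
   most \<open>c ^ 2\<close>, so subtracting \<open>c ^ 2 * x\<close> leaves a nonincreasing
   function.\<close>
 define w where "w x = exp (- L * x) * v x - c ^ 2 * x" for x
 have "w T <= w 0"
 proof (rule DERIV_nonpos_imp_nonincreasing[OF T])
  fix x assume "0 <= x" "x <= T"
  hence x: "x : {0..T}" by simp
  have "(w has_real_derivative (- L * exp (- L * x) * v x + exp (- L * x) * (2 * (f x \<bullet> f' x)) - c ^ 2)) (at x)"
   unfolding w_def by (auto intro!: derivative_eq_intros dv[OF x])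
  moreover have "- L * exp (- L * x) * v x + exp (- L * x) * (2 * (f x \<bullet> f' x)) - c ^ 2 <= 0"
  proof -
   have "exp (- L * x) * (2 * (f x \<bullet> f' x)) <= exp (- L * x) * (L * v x + c ^ 2 * exp (2 * N * x))"
   proof (rule mult_left_mono)
    have "0 <= 2 * N * v x" using N by (simp add: v)
    thus "2 * (f x \<bullet> f' x) <= L * v x + c ^ 2 * exp (2 * N * x)" using dv_le[OF x] by (simp add: L_def algebra_simps)
   qed simp
   moreover have "exp (- L * x) * exp (2 * N * x) <= 1"
   proof -
    have "(2 * N) * x <= L * x" using x K by (intro mult_right_mono) (auto simp: L_def)
    thus ?thesis by (simp add: exp_add[symmetric])
   qed
   hence "c ^ 2 * (exp (- L * x) * exp (2 * N * x)) <= c ^ 2 * 1" by (intro mult_left_mono) auto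
   ultimately show ?thesis by (simp add: algebra_simps)
  qed
  ultimately show "\<exists>y. (w has_real_derivative y) (at x) & y <= 0" by blast
 qed
 hence "exp (- L * T) * v T <= v 0 + c ^ 2 * T" by (simp add: w_def)
 hence le: "exp (L * T) * (exp (- L * T) * v T) <= exp (L * T) * (v 0 + c ^ 2 * T)" by (intro mult_left_mono) auto
 have "exp (L * T) * (exp (- L * T) * v T) = v T" by (simp add: exp_minus mult.assoc[symmetric])
 from le[unfolded this] show ?thesis unfolding v L_def .
qed

lemma norm_sylvester_le:
 fixes P Q X :: "complex ^ 'n ^ 'n"
 shows  "norm (P ** X - X ** Q) <= mconst TYPE('n) * (norm P + norm Q) * norm X"
 using norm_triangle_ineq4[of "P ** X" "X ** Q"] norm_matrix_mult[of P X] norm_matrix_mult[of X Q]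
 by (simp add: algebra_simps)

lemma line_has_vector_derivative:
 "((%x. p + of_real x * (q - p)) has_vector_derivative (q - p :: complex)) (at x)"
 by (auto intro!: derivative_eq_intros simp: has_vector_derivative_def scaleR_conv_of_real)

lemma line_in_convex:
 assumes "convex S" "p : S" "q : S" "x : {0..1}"
 shows "p + of_real x * (q - p) : (S :: complex set)"
 using convexD_alt[OF assms(1-3), of x] assms(4) by (simp add: scaleR_conv_of_real algebra_simps)

lemma line_in_segment: "x : {0..1} ==> p + of_real x * (q - p) : closed_segment p (q :: complex)"
 by (auto simp: in_segment scaleR_conv_of_real algebra_simps intro!: exI[of _ x])

text \<open>The equation X' = P X - X Q + F is the common form of all equations used: fundamental
  solutions for Q = F = 0, their inverses for P = F = 0, and the linearized equation for P = Q. The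
  segment is parametrized over the unit interval, so its length enters the constants.\<close>

lemma sylvester_gronwall:
 fixes X :: "complex => complex ^ 'n ^ 'n"
 assumes X: "!!z. z : closed_segment p q ==> mder X (P z ** X z - X z ** Q z + F z) z"
  and P: "!!z. z : closed_segment p q ==> norm (P z) <= KP" "!!z. z : closed_segment p q ==> norm (Q z) <= KQ"
   "!!z. z : closed_segment p q ==> norm (F z) <= \<epsilon>"
 shows "norm (X q) ^ 2 <= exp (2 * (mconst TYPE('n) * (KP + KQ) * norm (q - p)) + 1) * (norm (X p) ^ 2 + (\<epsilon> * norm (q - p)) ^ 2)"
proof -
 define K where "K = mconst TYPE('n) * (KP + KQ) * norm (q - p)"
 define l where "l x = p + of_real x * (q - p)" for x
 have l: "l x : closed_segment p q" if "x : {0..1}" for x using line_in_segment that by (simp add: l_def)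
 have K0: "KP \<ge> 0" "KQ \<ge> 0" using P(1,2)[of p] by (auto intro: order_trans[OF norm_ge_zero])
 have "norm (X (l 1)) ^ 2 <= exp ((2 * K + 1 + 2 * 0) * 1) * (norm (X (l 0)) ^ 2 + (\<epsilon> * norm (q - p)) ^ 2 * 1)"
 proof (rule gronwall)
  show "K \<ge> 0" using K0 mconst_nonneg[where 'n = 'n] by (simp add: K_def)
  fix x :: real assume x: "x : {0..1}"
  let ?D = "P (l x) ** X (l x) - X (l x) ** Q (l x) + F (l x)"
  show "((%x. X (l x)) has_vector_derivative (mat (q - p) ** ?D)) (at x)"
   by (rule mder_curve[where g = l and x = x, OF X[OF l[OF x]]]) (unfold l_def, rule line_has_vector_derivative)
  have "norm ?D <= mconst TYPE('n) * (norm (P (l x)) + norm (Q (l x))) * norm (X (l x)) + norm (F (l x))"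
   using norm_triangle_ineq[of "P (l x) ** X (l x) - X (l x) ** Q (l x)" "F (l x)"]
    norm_sylvester_le[of "P (l x)" "X (l x)" "Q (l x)"] by linarith
  also have "\<dots> <= mconst TYPE('n) * (KP + KQ) * norm (X (l x)) + \<epsilon>"
   by (intro add_mono mult_right_mono mult_left_mono P l x) (auto simp: mconst_nonneg)
  finally have "norm (q - p) * norm ?D <= norm (q - p) * (mconst TYPE('n) * (KP + KQ) * norm (X (l x)) + \<epsilon>)"
   by (intro mult_left_mono) auto
  thus "norm (mat (q - p) ** ?D) <= K * norm (X (l x)) + \<epsilon> * norm (q - p) * exp (0 * x)"
   unfolding norm_mat_mult by (simp add: K_def algebra_simps)
 qed auto
 thus ?thesis by (simp add: l_def K_def)
qed

lemma sylvester_unique: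
 fixes X Y :: "complex => complex ^ 'n ^ 'n"
 assumes S: "convex S" "p : S" "q : S" and PQ: "continuous_on S P" "continuous_on S Q"
  and X: "!!z. z : S ==> mder X (P z ** X z - X z ** Q z + F z) z"
  and Y: "!!z. z : S ==> mder Y (P z ** Y z - Y z ** Q z + F z) z"
  and eq: "X p = Y p"
 shows "X q = Y q"
proof -
 have seg: "closed_segment p q <= S" using S by (simp add: closed_segment_subset)
 have "bounded (P ` closed_segment p q)" "bounded (Q ` closed_segment p q)"
  using PQ seg by (auto intro!: compact_imp_bounded compact_continuous_image intro: continuous_on_subset)
 then obtain KP KQ where K: "!!z. z : closed_segment p q ==> norm (P z) <= KP" "!!z. z : closed_segment p q ==> norm (Q z) <= KQ"
  unfolding bounded_iff by (meson image_eqI)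
 have "mder (%z. X z - Y z) (P z ** (X z - Y z) - (X z - Y z) ** Q z + 0) z" if "z : closed_segment p q" for z
  by (rule mder_eq[OF mder_diff[OF X Y]]) (use that seg in \<open>auto simp: matrix_ring_simps\<close>)
 from sylvester_gronwall[of p q _ P Q "%_. 0", OF this K, of 0]
 have "norm (X q - Y q) ^ 2 <= 0" using eq by simp
 thus ?thesis by simp
qed

lemma primitive_matrix:
 assumes S: "open S" "convex S" "z0 : S" and F: "mholo F S"
 shows "\<exists>H. (\<forall>z\<in>S. mder H (F z) z) & H z0 = 0"
proof -
 have "\<exists>g. (\<forall>z\<in>S. (g has_field_derivative F z $ i $ j) (at z)) & g z0 = 0" for i j
 proof -
  obtain g where g: "!!z. z : S ==> (g has_field_derivative F z $ i $ j) (at z within S)"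
   using holomorphic_convex_primitive'[OF S(2,1)] F unfolding mholo_def by blast
  hence "((%z. g z - g z0) has_field_derivative F z $ i $ j) (at z)" if "z : S" for z
  proof -
   have "(g has_field_derivative F z $ i $ j) (at z)" using g[OF that] at_within_open[OF that S(1)] by simp
   thus ?thesis using DERIV_diff[OF _ DERIV_const] by fastforce
  qed
  thus ?thesis by (intro exI[of _ "%z. g z - g z0"]) auto
 qed
 then obtain g where "!!i j. (\<forall>z\<in>S. (g i j has_field_derivative F z $ i $ j) (at z)) & g i j z0 = 0" by metis
 thus ?thesis by (intro exI[of _ "%z. \<chi> i j. g i j z"]) (auto simp: mder_def vec_eq_iff)
qed

text \<open>Picard iteration.\<close>

lemma linear_ode_solvable:
 fixes a :: "complex => complex ^ 'n ^ 'n"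
 assumes S: "open S" "convex S" "z0 : S" and a: "mholo a S"
 shows "\<exists>Y. (\<forall>z\<in>S. mder Y (a z ** Y z) z) & Y z0 = mat 1"
proof -
 define ka where "ka = mconst TYPE('n)"
 define nxtf where "nxtf X = (SOME H. (\<forall>z\<in>S. mder H (a z ** X z) z) & H z0 = 0)" for X :: "complex => complex ^ 'n ^ 'n"
 \<comment> \<open>\<open>T n\<close> is the n-th term of the series of iterated integrals, not a
   partial sum.\<close>
 define T where "T = rec_nat (%_. mat 1) (%n X. nxtf X)"
 have T0: "T 0 = (%_. mat 1)" and TS: "T (Suc n) = nxtf (T n)" for n by (simp_all add: T_def)
 have nxt: "(\<forall>z\<in>S. mder (nxtf X) (a z ** X z) z) & nxtf X z0 = 0" if "mholo X S" for X
  using someI_ex[OF primitive_matrix[OF S mholo_mult[OF a that]]] unfolding nxtf_def .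
 have hol: "mholo (T n) S" for n
 proof (induction n)
  case 0 thus ?case by (auto simp: T0 mholo_def)
 next
  case (Suc n) thus ?case using nxt[OF Suc] by (auto simp: TS intro: mder_imp_mholo)
 qed
 define T' where "T' n z = (case n of 0 => 0 | Suc m => a z ** T m z)" for n z
 have TD: "mder (T n) (T' n z) z" if "z : S" for n z using nxt[OF hol] that by (cases n) (auto simp: T'_def T0 TS mder_const)
 have Tz0: "T (Suc n) z0 = 0" for n using nxt[OF hol] by (simp add: TS)
 have bound: "norm (T n z) <= norm (mat 1 :: complex ^ 'n ^ 'n) * (ka * M * norm (z - z0)) ^ n / fact n"
  if z: "z : S" and M: "!!x. x : {0..1} ==> norm (a (z0 + of_real x * (z - z0))) <= M" for n z M
 proof -
  define l where "l x = z0 + of_real x * (z - z0)" for x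
  have l: "l x : S" if "x : {0..1}" for x using line_in_convex[OF S(2,3) z that] by (simp add: l_def)
  define C where "C = ka * M * norm (z - z0)"
  define n1 where "n1 = norm (mat 1 :: complex ^ 'n ^ 'n)"
  have M0: "M \<ge> 0" using order_trans[OF norm_ge_zero M[of 0]] by simp
  have ka0: "ka \<ge> 0" by (simp add: ka_def mconst_nonneg)
  have "norm (T n (l x)) <= n1 * (C * x) ^ n / fact n" if "x : {0..1}" for x using that
  proof (induction n arbitrary: x)
   case 0 thus ?case by (simp add: T0 n1_def)
  next
   case (Suc n)
   show ?case
   proof (cases "x = 0")
    case True thus ?thesis by (simp add: l_def Tz0)
   next
    case False
    hence x: "0 < x" "x <= 1" using Suc.prems by auto
    have der: "((%x. T (Suc n) (l x)) has_vector_derivative (mat (z - z0) ** (a (l y) ** T n (l y)))) (at y)"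
     if "y : {0..1}" for y
    proof (rule mder_curve)
     show "mder (T (Suc n)) (a (l y) ** T n (l y)) (l y)" using TD[OF l[OF that], of "Suc n"] by (simp add: T'_def)
     show "(l has_vector_derivative z - z0) (at y)" unfolding l_def by (rule line_has_vector_derivative)
    qed
    define ph where "ph y = n1 * (C * y) ^ Suc n / fact (Suc n)" for y :: real
    have "norm (T (Suc n) (l x) - T (Suc n) (l 0)) <= ph x - ph 0"
    proof (rule differentiable_bound_general[OF x(1)])
     show "continuous_on {0..x} (%x. T (Suc n) (l x))"
      by (intro continuous_at_imp_continuous_on ballI has_vector_derivative_continuous[OF der]) (use x in auto)
     show "continuous_on {0..x} ph" unfolding ph_def by (intro continuous_intros) auto
    next
     fix y assume y: "0 < y" "y < x"
     hence y1: "y : {0..1}" using x by auto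
     show "((%x. T (Suc n) (l x)) has_vector_derivative (mat (z - z0) ** (a (l y) ** T n (l y)))) (at y)"
      by (rule der[OF y1])
     have "(ph has_real_derivative (n1 * (real (Suc n) * (C * y) ^ n * C) / fact (Suc n))) (at y)"
     proof -
      have "((%y. C * y) has_real_derivative C) (at y)" by (auto intro!: derivative_eq_intros)
      from DERIV_cdivide[OF DERIV_cmult[OF DERIV_power[OF this, of "Suc n"], of n1], of "fact (Suc n)"]
      show ?thesis unfolding ph_def by (simp add: mult_ac del: of_nat_Suc power_Suc fact_Suc)
     qed
     thus "(ph has_vector_derivative (n1 * C * (C * y) ^ n / fact n)) (at y)"
      by (simp add: has_real_derivative_iff_has_vector_derivative field_simps del: of_nat_Suc)
     have "norm (mat (z - z0) ** (a (l y) ** T n (l y))) <= norm (z - z0) * (ka * M * (n1 * (C * y) ^ n / fact n))"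
      unfolding norm_mat_mult
     proof (rule mult_left_mono)
      have "norm (a (l y) ** T n (l y)) <= ka * norm (a (l y)) * norm (T n (l y))"
       unfolding ka_def by (rule norm_matrix_mult)
      also have "\<dots> <= ka * M * (n1 * (C * y) ^ n / fact n)"
       using M[OF y1] by (intro mult_mono Suc.IH[OF y1] ka0 mult_nonneg_nonneg M0) (auto simp: l_def ka0)
      finally show "norm (a (l y) ** T n (l y)) <= ka * M * (n1 * (C * y) ^ n / fact n)" .
     qed simp
     also have "\<dots> = n1 * C * (C * y) ^ n / fact n" by (simp add: C_def)
     finally show "norm (mat (z - z0) ** (a (l y) ** T n (l y))) <= n1 * C * (C * y) ^ n / fact n" .
    qed
    thus ?thesis by (simp add: ph_def l_def Tz0)
   qed
  qed
  from this[of 1] show ?thesis by (simp add: l_def C_def n1_def)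
 qed
 \<comment> \<open>All segments from \<open>z0\<close> to a small ball around \<open>x\<close> lie
   in one compact set \<open>K\<close>, so a single bound on \<open>a\<close> gives a summable
   majorant near \<open>x\<close>.\<close>
 have local: "\<exists>d h. 0 < d & summable h & (\<forall>\<^sub>F n in sequentially. \<forall>y\<in>ball x d \<inter> S. norm (T n y $ i $ j) <= h n)"
  if x: "x : S" for x i j
 proof -
  obtain d where d: "d > 0" "cball x d <= S" using S(1) x open_contains_cball by blast
  define K where "K = (%(t, z). z0 + of_real t * (z - z0)) ` ({0..1::real} \<times> cball x d)"
  have "compact K" unfolding K_def
   by (intro compact_continuous_image compact_Times) (auto simp: split_beta intro!: continuous_intros)
  moreover have "K <= S" using line_in_convex[OF S(2,3)] d by (auto simp: K_def)
  ultimately have "bounded (a ` K)"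
   using mholo_continuous_on[OF a] by (intro compact_imp_bounded compact_continuous_image) (auto intro: continuous_on_subset)
  then obtain M where M: "!!z. z : K ==> norm (a z) <= M" unfolding bounded_iff by blast
  have "z0 : K" unfolding K_def using d by (force intro: image_eqI[of _ _ "(0, x)"])
  hence M0: "M \<ge> 0" using order_trans[OF norm_ge_zero M[of z0]] by simp
  define r where "r = ka * M * (norm (x - z0) + d)"
  define h where "h n = norm (mat 1 :: complex ^ 'n ^ 'n) * (inverse (fact n) * r ^ n)" for n
  have "summable h" unfolding h_def using summable_exp[of r] by (intro summable_mult)
  moreover have "norm (T n y $ i $ j) <= h n" if y: "y : ball x d \<inter> S" for n y
  proof -
   have "norm (T n y $ i $ j) <= norm (T n y)" by (rule entry_le_norm)
   also have "\<dots> <= norm (mat 1 :: complex ^ 'n ^ 'n) * (ka * M * norm (y - z0)) ^ n / fact n"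
   proof (rule bound)
    fix t :: real assume "t : {0..1}"
    thus "norm (a (z0 + of_real t * (y - z0))) <= M"
     using y by (intro M) (auto simp: K_def intro!: image_eqI[where x = "(t, y)"])
   qed (use y in auto)
   also have "\<dots> <= norm (mat 1 :: complex ^ 'n ^ 'n) * r ^ n / fact n"
   proof -
    have "norm (y - z0) <= norm (x - z0) + d"
     using norm_triangle_ineq[of "y - x" "x - z0"] y by (simp add: dist_norm norm_minus_commute)
    thus ?thesis unfolding r_def by (intro divide_right_mono mult_left_mono power_mono) (auto simp: M0 ka_def mconst_nonneg)
   qed
   finally show ?thesis by (simp add: h_def field_simps)
  qed
  ultimately show ?thesis using d by (intro exI[of _ d] exI[of _ h]) auto
 qed
 have "\<exists>g g'. \<forall>x\<in>S. (%n. T n x $ i $ j) sums g x & (%n. T' n x $ i $ j) sums g' x & (g has_field_derivative g' x) (at x)" for i j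
  by (rule series_and_derivative_comparison_local[OF S(1)]) (use TD local in \<open>auto simp: mder_def\<close>)
 then obtain g g' where g: "!!i j x. x : S ==> (%n. T n x $ i $ j) sums g i j x"
  "!!i j x. x : S ==> (%n. T' n x $ i $ j) sums g' i j x"
  "!!i j x. x : S ==> (g i j has_field_derivative g' i j x) (at x)" by metis
 define Y where "Y z = (\<chi> i j. g i j z)" for z
 have "g' i j z = (a z ** Y z) $ i $ j" if "z : S" for i j z
 proof -
  have "(%n. \<Sum>k\<in>UNIV. a z $ i $ k * T n z $ k $ j) sums (\<Sum>k\<in>UNIV. a z $ i $ k * g k j z)"
   by (intro sums_sum sums_mult g that)
  hence "(%n. T' (Suc n) z $ i $ j) sums (a z ** Y z) $ i $ j" by (simp add: T'_def matrix_matrix_mult_def Y_def)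
  hence "(%n. T' n z $ i $ j) sums (a z ** Y z) $ i $ j" by (subst (asm) sums_Suc_iff) (simp add: T'_def)
  thus ?thesis using g(2)[OF that] sums_unique2 by blast
 qed
 hence "mder Y (a z ** Y z) z" if "z : S" for z using g(3) that by (auto simp: mder_def Y_def)
 moreover have "Y z0 = mat 1"
 proof -
  have "g i j z0 = mat 1 $ i $ j" for i j
  proof -
   have "(%n. T n z0 $ i $ j) sums (\<Sum>n\<in>{0}. T n z0 $ i $ j)" by (rule sums_finite) (auto simp: Tz0 gr0_conv_Suc)
   thus ?thesis using sums_unique2[OF g(1)[OF S(3), of i j]] by (simp add: T0)
  qed
  thus ?thesis by (simp add: Y_def vec_eq_iff)
 qed
 ultimately show ?thesis by blast
qed

lemma mder_zero_constant:
 assumes "convex S" "p : S" "q : S" "!!z. z : S ==> mder Y 0 z"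
 shows "Y p = Y q"
proof -
 have "Y p $ i $ j = Y q $ i $ j" for i j
 proof -
  have "((%u. Y u $ i $ j) has_field_derivative 0) (at z within S)" if "z : S" for z
   using assms(4)[OF that] by (auto simp: mder_def intro: has_field_derivative_at_within)
  from has_field_derivative_zero_constant[OF assms(1) this] show ?thesis using assms by metis
 qed
 thus ?thesis by (simp add: vec_eq_iff)
qed

text \<open>The inverse of the fundamental matrix is found as the transpose of a solution of the
  adjoint equation; the product W Y has derivative 0.\<close>

lemma fundamental_pair:
 fixes a :: "complex => complex ^ 'n ^ 'n"
 assumes S: "open S" "convex S" "z0 : S" and a: "mholo a S"
 shows "\<exists>Y W. (\<forall>z\<in>S. mder Y (a z ** Y z) z & mder W (- (W z ** a z)) z & W z ** Y z = mat 1 & Y z ** W z = mat 1)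
  & Y z0 = mat 1 & W z0 = mat 1"
proof -
 obtain Y where Y: "!!z. z : S ==> mder Y (a z ** Y z) z" "Y z0 = mat 1" using linear_ode_solvable[OF S a] by blast
 have "mholo (%z. - transpose (a z)) S" by (intro mholo_uminus mholo_transpose a)
 from linear_ode_solvable[OF S this] obtain V where
  V: "!!z. z : S ==> mder V (- transpose (a z) ** V z) z" "V z0 = mat 1" by blast
 define W where "W z = transpose (V z)" for z
 have W: "mder W (- (W z ** a z)) z" if "z : S" for z
 proof -
  have "transpose (- transpose (a z) ** V z) = - (W z ** a z)"
   by (simp add: W_def vec_eq_iff transpose_def matrix_matrix_mult_def mult.commute sum_negf)
  thus ?thesis using mder_transpose[OF V(1)[OF that]] unfolding W_def by metis
 qed
 have "W z ** Y z = mat 1" if z: "z : S" for z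
 proof -
  have "mder (%z. W z ** Y z) 0 z" if "z : S" for z
   by (rule mder_eq[OF mder_mult[OF W Y(1)]]) (use that in \<open>auto simp: matrix_ring_simps\<close>)
  from mder_zero_constant[OF S(2) z S(3) this] show ?thesis by (simp add: W_def V Y)
 qed
 hence "W z ** Y z = mat 1 & Y z ** W z = mat 1" if "z : S" for z using that matrix_left_right_inverse by blast
 thus ?thesis using W Y V(2) by (intro exI[of _ Y] exI[of _ W]) (auto simp: W_def)
qed

text \<open>Variation of constants: with fundamental pairs for \<open>P\<close> and \<open>Q\<close>
  the ansatz X = Y (c + H) W' reduces the equation to a primitive of W F Y'.\<close>

lemma sylvester_solvable:
 fixes P Q F :: "complex => complex ^ 'n ^ 'n"
 assumes S: "open S" "convex S" "z0 : S" and PQF: "mholo P S" "mholo Q S" "mholo F S"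
 shows "\<exists>X. (\<forall>z\<in>S. mder X (P z ** X z - X z ** Q z + F z) z) & X z0 = c"
proof -
 obtain Y W where Y: "!!z. z : S ==> mder Y (P z ** Y z) z" "!!z. z : S ==> mder W (- (W z ** P z)) z"
  "!!z. z : S ==> W z ** Y z = mat 1" "!!z. z : S ==> Y z ** W z = mat 1" "Y z0 = mat 1" "W z0 = mat 1"
  using fundamental_pair[OF S PQF(1)] by blast
 obtain Y' W' where Y': "!!z. z : S ==> mder Y' (Q z ** Y' z) z" "!!z. z : S ==> mder W' (- (W' z ** Q z)) z"
  "!!z. z : S ==> W' z ** Y' z = mat 1" "!!z. z : S ==> Y' z ** W' z = mat 1" "Y' z0 = mat 1" "W' z0 = mat 1"
  using fundamental_pair[OF S PQF(2)] by blast
 have "mholo (%z. W z ** F z ** Y' z) S" by (intro mholo_mult mder_imp_mholo[OF Y(2)] mder_imp_mholo[OF Y'(1)] PQF(3))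
 from primitive_matrix[OF S this] obtain H where
  H: "!!z. z : S ==> mder H (W z ** F z ** Y' z) z" "H z0 = 0" by blast
 define X where "X z = Y z ** (c + H z) ** W' z" for z
 have "mder X (P z ** X z - X z ** Q z + F z) z" if z: "z : S" for z unfolding X_def
 proof (rule mder_eq[OF mder_mult[OF mder_mult[OF Y(1)[OF z] mder_add[OF mder_const H(1)[OF z]]] Y'(2)[OF z]]])
  have "Y z ** (W z ** F z ** Y' z) ** W' z = (Y z ** W z) ** F z ** (Y' z ** W' z)" by (simp add: matrix_mul_assoc)
  hence "Y z ** (W z ** F z ** Y' z) ** W' z = F z" using Y(4)[OF z] Y'(4)[OF z] by simp
  thus "(P z ** Y z ** (c + H z) + Y z ** (0 + W z ** F z ** Y' z)) ** W' z + Y z ** (c + H z) ** - (W' z ** Q z) =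
   P z ** (Y z ** (c + H z) ** W' z) - Y z ** (c + H z) ** W' z ** Q z + F z" by (simp add: matrix_ring_simps)
 qed
 moreover have "X z0 = c" by (simp add: X_def Y Y' H)
 ultimately show ?thesis by blast
qed

section \<open>Local systems\<close>

text \<open>The properties of solution sheaves on which continuation depends: near every point each
  prescribed value extends to a section, and sections agreeing at one point agree. Values are of
  arbitrary type, so paths, homotopies and monodromy are treated once for all the equations
  below.\<close>

locale local_system =
 fixes X :: "'x::topological_space set" and sec :: "('x => 'v) => 'x set => bool"
 assumes sec_open: "sec f N ==> open N"
  and sec_restrict: "sec f N ==> open N' ==> N' <= N ==> sec f N'"
  and good_nbhd: "x : X ==> open W ==> x : W ==>
   \<exists>N. open N & x : N & N <= W & path_connected N & (\<forall>y\<in>N. \<forall>v. \<exists>f. sec f N & f y = v) &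
    (\<forall>f g. sec f N --> sec g N --> (\<exists>y\<in>N. f y = g y) --> (\<forall>y\<in>N. f y = g y))"
begin

text \<open>Continuation of a section along \<open>ph\<close>. The source is a subset of any metric
  space, so that intervals, squares of homotopies and the half plane over a punctured disk fall
  under one notion.\<close>

definition lift :: "'a::metric_space set => ('a => 'x) => ('a => 'v) => bool" where
 "lift H ph u \<longleftrightarrow> (\<forall>z\<in>H. \<exists>f N. sec f N & ph z : N & (\<exists>e>0. \<forall>z'\<in>H. dist z' z < e --> u z' = f (ph z')))"

lemma liftE:
 assumes "lift H ph u" "z : H"
 obtains f N e where "sec f N" "ph z : N" "e > 0" "!!z'. z' : H ==> dist z' z < e ==> u z' = f (ph z')"
 using assms unfolding lift_def by blast

lemma section_exists:
 assumes "x : X" "open W" "x : W"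
 obtains f N where "sec f N" "x : N" "N <= W" "f x = v" "path_connected N"
  "!!g. sec g N ==> \<exists>y\<in>N. f y = g y ==> \<forall>y\<in>N. f y = g y" using good_nbhd[OF assms] assms(3) by metis

lemma section_through:
 assumes "x : X" shows "\<exists>f N. sec f N & x : N & f x = v" using good_nbhd[OF assms open_UNIV UNIV_I] by metis

lemma sections_agree_locally:
 assumes f: "sec f N" "sec g M" and x: "x : N" "x : M" "x : X" and eq: "f x = g x"
 obtains W where "open W" "x : W" "W <= N \<inter> M" "!!y. y : W ==> f y = g y"
proof -
 have "open (N \<inter> M)" using f sec_open by blast
 then obtain W where W: "open W" "x : W" "W <= N \<inter> M"
   "(\<forall>f g. sec f W --> sec g W --> (\<exists>y\<in>W. f y = g y) --> (\<forall>y\<in>W. f y = g y))"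
  using good_nbhd[OF x(3), of "N \<inter> M"] x by auto
 moreover have "sec f W" "sec g W" using W f by (auto intro: sec_restrict)
 ultimately show ?thesis using that[of W] eq by blast
qed

lemma preimage_nbhd:
 assumes "continuous_on H ph" "z : H" "open W" "ph z : W"
 obtains e where "e > 0" "!!z'. z' : H ==> dist z' z < e ==> ph z' : W"
proof -
 obtain A where A: "open A" "A \<inter> H = ph -` W \<inter> H"
  using assms(1,3) unfolding continuous_on_open_invariant by blast
 hence "z : A" using assms by auto
 then obtain e where "e > 0" "ball z e <= A" using A(1) openE by blast
 thus ?thesis using A(2) by (intro that[of e]) (auto simp: dist_commute subset_iff)
qed

text \<open>Agreement of two lifts is a locally constant condition on the connected source.\<close>

lemma lift_unique:
 assumes H: "connected H" and ph: "continuous_on H ph" "ph ` H <= X"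
  and u: "lift H ph u" "lift H ph u'" and z0: "z0 : H" "u z0 = u' z0" and z: "z : H"
 shows "u z = u' z"
proof -
 have "(u z0 = u' z0) = (u z = u' z)"
 proof (rule connected_local_const[OF H z0(1) z], rule ballI)
  fix a assume a: "a : H"
  obtain f N e where f: "sec f N" "ph a : N" "e > 0" "!!z'. z' : H ==> dist z' a < e ==> u z' = f (ph z')"
   using liftE[OF u(1) a] by blast
  obtain g M e' where g: "sec g M" "ph a : M" "e' > 0" "!!z'. z' : H ==> dist z' a < e' ==> u' z' = g (ph z')"
   using liftE[OF u(2) a] by blast
  have "open (N \<inter> M)" using f g sec_open by blast
  moreover have "ph a : X" using a ph by auto
  ultimately obtain W where W: "open W" "ph a : W" "W <= N \<inter> M"
    "\<forall>f g. sec f W --> sec g W --> (\<exists>y\<in>W. f y = g y) --> (\<forall>y\<in>W. f y = g y)"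
   using good_nbhd[of "ph a" "N \<inter> M"] f(2) g(2) by blast
  have sW: "sec f W" "sec g W" using W f g by (auto intro: sec_restrict)
  obtain d where d: "d > 0" "!!z'. z' : H ==> dist z' a < d ==> ph z' : W" using preimage_nbhd[OF ph(1) a W(1,2)] by blast
  have "(u a = u' a) = (u b = u' b)" if b: "b : H" "dist b a < min d (min e e')" for b
  proof -
   have "u a = f (ph a)" "u' a = g (ph a)" "u b = f (ph b)" "u' b = g (ph b)" using f(3,4) g(3,4) a b by auto
   moreover have "ph b : W" using d b by auto
   ultimately show ?thesis using W(2,4) sW by metis
  qed
  moreover have "min d (min e e') > 0" using d f g by simp
  ultimately show "\<forall>\<^sub>F b in at a within H. (u a = u' a) = (u b = u' b)" unfolding eventually_at by blast
 qed
 thus ?thesis using z0 by simp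
qed

lemma lift_compose:
 assumes "lift H ph u" "continuous_on H' \<psi>" "\<psi> ` H' <= H"
 shows "lift H' (%z. ph (\<psi> z)) (%z. u (\<psi> z))" unfolding lift_def
proof
 fix z assume z: "z : H'"
 hence "\<psi> z : H" using assms by auto
 from liftE[OF assms(1) this] obtain f N e where f: "sec f N" "ph (\<psi> z) : N" "e > 0"
  "!!z'. z' : H ==> dist z' (\<psi> z) < e ==> u z' = f (ph z')" by blast
 obtain d where "d > 0" "!!z'. z' : H' ==> dist z' z < d ==> dist (\<psi> z') (\<psi> z) < e"
  using assms(2) z f(3) unfolding continuous_on_iff by blast
 thus "\<exists>f N. sec f N & ph (\<psi> z) : N & (\<exists>e>0. \<forall>z'\<in>H'. dist z' z < e --> u (\<psi> z') = f (ph (\<psi> z')))"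
  using f assms(3) by (intro exI[of _ f] exI[of _ N] conjI exI[of _ d]) auto
qed

lemma lift_subset: "lift H ph u ==> H' <= H ==> lift H' ph u" using lift_compose[of H ph u H' "%z. z"] by auto

lemma lift_section:
 assumes "sec f N" "!!z. z : H ==> ph z : N" shows "lift H ph (%z. f (ph z))"
 unfolding lift_def using assms by (auto intro!: exI[of _ f] exI[of _ N] exI[of _ "1::real"])

lemma lift_glue:
 fixes a b c :: real
 assumes ph: "continuous_on {a..c} ph" "ph ` {a..c} <= X" and ab: "a <= b" "b <= c"
  and u: "lift {a..b} ph u" "lift {b..c} ph u'" "u b = u' b"
 shows "lift {a..c} ph (%t. if t <= b then u t else u' t)" unfolding lift_def
proof
 fix t assume t: "t : {a..c}"
 consider "t < b" | "t = b" | "t > b" by linarith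
 thus "\<exists>f N. sec f N & ph t : N & (\<exists>e>0. \<forall>z'\<in>{a..c}. dist z' t < e --> (if z' <= b then u z' else u' z') = f (ph z'))"
 proof cases
  case 1
  then obtain f N e where f: "sec f N" "ph t : N" "e > 0" "!!z'. z' : {a..b} ==> dist z' t < e ==> u z' = f (ph z')"
   using liftE[OF u(1), of t] t by auto
  thus ?thesis using 1 by (intro exI[of _ f] exI[of _ N] conjI exI[of _ "min e (b - t)"]) (auto simp: dist_real_def)
 next
  case 3
  then obtain f N e where f: "sec f N" "ph t : N" "e > 0" "!!z'. z' : {b..c} ==> dist z' t < e ==> u' z' = f (ph z')"
   using liftE[OF u(2), of t] t by auto
  thus ?thesis using 3 by (intro exI[of _ f] exI[of _ N] conjI exI[of _ "min e (t - b)"]) (auto simp: dist_real_def)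
 next
  case 2
  obtain f N e where f: "sec f N" "ph b : N" "e > 0" "!!z'. z' : {a..b} ==> dist z' b < e ==> u z' = f (ph z')"
   using liftE[OF u(1), of b] ab by auto
  obtain g M e' where g: "sec g M" "ph b : M" "e' > 0" "!!z'. z' : {b..c} ==> dist z' b < e' ==> u' z' = g (ph z')"
   using liftE[OF u(2), of b] ab by auto
  have "f (ph b) = g (ph b)" using f(3) f(4)[of b] g(3) g(4)[of b] u(3) ab by auto
  moreover have "ph b : X" using ph(2) t 2 by auto
  ultimately obtain W where W: "open W" "ph b : W" "!!y. y : W ==> f y = g y"
   using sections_agree_locally[OF f(1) g(1) f(2) g(2)] by metis
  obtain d where d: "d > 0" "!!z'. z' : {a..c} ==> dist z' b < d ==> ph z' : W"
   using preimage_nbhd[OF ph(1), of b W] W t 2 by metis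
  have "(if z' <= b then u z' else u' z') = f (ph z')" if "z' : {a..c}" "dist z' b < min d (min e e')" for z'
   using f(4)[of z'] g(4)[of z'] d(2)[of z'] W(3)[of "ph z'"] that by auto
  thus ?thesis using f d g 2 by (intro exI[of _ f] exI[of _ N] conjI exI[of _ "min d (min e e')"]) auto
 qed
qed

text \<open>Bisection: existence of lifts with every initial value is inherited from two adjacent
  intervals through gluing, and holds on intervals mapped into one good neighbourhood.\<close>

lemma lift_path_exists:
 fixes a b :: real
 assumes "a <= b" and ph: "continuous_on {a..b} ph" "ph ` {a..b} <= X"
 shows "\<exists>u. lift {a..b} ph u & u a = v"
proof -
 define Q where "Q s t \<longleftrightarrow> (\<forall>v. {s..t} <= {a..b} --> s <= t --> (\<exists>u. lift {s..t} ph u & u s = v))" for s t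
 have "Q a b"
 proof (rule Bolzano[OF assms(1)])
  fix p q r :: real
  assume 1: "Q p q" and 2: "Q q r" and pq: "p <= q" "q <= r"
  show "Q p r" unfolding Q_def
  proof (intro allI impI)
   fix v assume sub: "{p..r} <= {a..b}"
   hence "{p..q} <= {a..b}" "{q..r} <= {a..b}" using pq by auto
   then obtain u where u: "lift {p..q} ph u" "u p = v" using 1 pq unfolding Q_def by blast
   obtain u' where u': "lift {q..r} ph u'" "u' q = u q" using 2 pq unfolding Q_def using \<open>{q..r} <= {a..b}\<close> by blast
   have "lift {p..r} ph (%t. if t <= q then u t else u' t)" by (rule lift_glue[OF _ _ pq u(1) u'(1)])
     (use sub ph u' in \<open>auto intro: continuous_on_subset\<close>)
   thus "\<exists>u. lift {p..r} ph u & u p = v" using u pq by (intro exI[of _ "%t. if t <= q then u t else u' t"]) auto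
  qed
 next
  fix x assume x: "a <= x" "x <= b"
  hence "ph x : X" using ph by auto
  from good_nbhd[OF this open_UNIV UNIV_I] obtain N where N: "open N" "ph x : N"
   "\<forall>y\<in>N. \<forall>v. \<exists>f. sec f N & f y = v" by metis
  obtain d where d: "d > 0" "!!z'. z' : {a..b} ==> dist z' x < d ==> ph z' : N"
   using preimage_nbhd[OF ph(1), of x N] N x by auto
  have "\<exists>u. lift {s..t} ph u & u s = v" if st: "s <= x" "x <= t" "t - s < d" "{s..t} <= {a..b}" for s t v
  proof -
   have in_N: "ph z : N" if "z : {s..t}" for z using that st by (intro d(2)) (auto simp: dist_real_def)
   have "s : {s..t}" using st by simp
   then obtain f where "sec f N" "f (ph s) = v" using N(3) in_N by blast
   thus ?thesis using lift_section[of f N "{s..t}" ph] in_N by blast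
  qed
  thus "\<exists>d>0. \<forall>s t. s <= x & x <= t & t - s < d --> Q s t" using d(1) unfolding Q_def by blast
 qed
 thus ?thesis using assms(1) unfolding Q_def by blast
qed

text \<open>Lifts along the segments from \<open>z0\<close> are collected at their endpoints; what
  needs proof is that near each \<open>z1\<close> these end values belong to one section.\<close>

lemma lift_convex_exists:
 fixes H :: "'a::real_normed_vector set"
 assumes H: "convex H" "z0 : H" and ph: "continuous_on H ph" "ph ` H <= X"
 shows "\<exists>u. lift H ph u & u z0 = v"
proof -
 define sg where "sg t z = (1 - t) *\<^sub>R z0 + t *\<^sub>R z" for t :: real and z
 have sgH: "sg t z : H" if "z : H" "t : {0..1}" for t z
  using convexD_alt[OF H(1) H(2) that(1), of t] that by (simp add: sg_def)
 have cont1: "continuous_on {0..1} (%t. ph (sg t z))" if "z : H" for z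
  by (rule continuous_on_compose2[OF ph(1)]) (use sgH that in \<open>auto simp: sg_def intro!: continuous_intros\<close>)
 have cont2: "continuous_on ({0..1} \<times> H) (%p. ph (sg (fst p) (snd p)))"
  by (rule continuous_on_compose2[OF ph(1)]) (use sgH in \<open>auto simp: sg_def intro!: continuous_intros\<close>)
 have img: "(%t. ph (sg t z)) ` {0..1} <= X" if "z : H" for z using ph sgH that by auto
 have "\<exists>u. lift {0..1} (%t. ph (sg t z)) u & u 0 = v" if "z : H" for z
  by (rule lift_path_exists) (use cont1 img that in auto)
 then obtain U where U: "!!z. z : H ==> lift {0..1} (%t. ph (sg t z)) (U z)" "!!z. z : H ==> U z 0 = v" by metis
 have "\<exists>f N. sec f N & ph z1 : N & (\<exists>e>0. \<forall>z\<in>H. dist z z1 < e --> U z 1 = f (ph z))" if z1: "z1 : H" for z1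
 proof -
  \<comment> \<open>\<open>Q a b\<close> says that agreement of the lifts with one section at time
    \<open>a\<close>, for endpoints near \<open>z1\<close>, passes to agreement with some section at
    time \<open>b\<close>. It is additive over adjacent intervals, hence accessible to
    bisection.\<close>
  define Q where "Q a b \<longleftrightarrow> (0 <= a --> a <= b --> b <= 1 --> (\<forall>f N. sec f N --> ph (sg a z1) : N -->
    (\<exists>dl>0. \<exists>g M. sec g M & ph (sg b z1) : M & (\<forall>z\<in>H. dist z z1 < dl --> U z a = f (ph (sg a z)) --> U z b = g (ph (sg b z))))))" for a b
  have "Q 0 1"
  proof (rule Bolzano)
   fix a b c assume 1: "Q a b" and 2: "Q b c" and abc: "a <= b" "b <= c"
   show "Q a c" unfolding Q_def
   proof (intro impI allI)
    fix f N assume ac: "0 <= a" "a <= c" "c <= 1" and f: "sec f N" "ph (sg a z1) : N"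
    obtain dl g M where g: "dl > 0" "sec g M" "ph (sg b z1) : M"
     "!!z. z : H ==> dist z z1 < dl ==> U z a = f (ph (sg a z)) ==> U z b = g (ph (sg b z))"
     using 1 f ac abc unfolding Q_def by (meson order_trans)
    obtain dl' g' M' where g': "dl' > 0" "sec g' M'" "ph (sg c z1) : M'"
     "!!z. z : H ==> dist z z1 < dl' ==> U z b = g (ph (sg b z)) ==> U z c = g' (ph (sg c z))"
     using 2 g(2,3) ac abc unfolding Q_def by (meson order_trans)
    show "\<exists>dl>0. \<exists>g M. sec g M & ph (sg c z1) : M & (\<forall>z\<in>H. dist z z1 < dl --> U z a = f (ph (sg a z)) --> U z c = g (ph (sg c z)))"
     using g g' by (intro exI[of _ "min dl dl'"] conjI exI[of _ g'] exI[of _ M']) auto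
   qed
  next
   fix x :: real assume x: "0 <= x" "x <= 1"
   have "ph (sg x z1) : X" using ph sgH x z1 by auto
   from good_nbhd[OF this open_UNIV UNIV_I] obtain N0 where N0: "open N0" "ph (sg x z1) : N0"
    "\<forall>y\<in>N0. \<forall>v. \<exists>f. sec f N0 & f y = v" by metis
   obtain e where e: "e > 0" "!!p. p : {0..1} \<times> H ==> dist p (x, z1) < e ==> ph (sg (fst p) (snd p)) : N0"
    using preimage_nbhd[OF cont2, of "(x, z1)" N0] N0 x z1 by auto
   have inN0: "ph (sg t z) : N0" if "t : {0..1}" "\<bar>t - x\<bar> < e / 2" "z : H" "dist z z1 < e / 2" for t z
   proof -
    have "dist (t, z) (x, z1) <= \<bar>t - x\<bar> + dist z z1"
     using sqrt_sum_squares_le_sum[of "\<bar>t - x\<bar>" "dist z z1"] by (simp add: dist_Pair_Pair dist_real_def)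
    thus ?thesis using e(2)[of "(t, z)"] that by auto
   qed
   have "Q a b" if ab: "a <= x" "x <= b" "b - a < e / 2" for a b unfolding Q_def
   proof (intro impI allI)
    fix f N assume ac: "0 <= a" "a <= b" "b <= 1" and f: "sec f N" "ph (sg a z1) : N"
    have N0': "ph (sg t z) : N0" if "t : {a..b}" "z : H" "dist z z1 < e / 2" for t z
    proof (rule inN0)
     show "\<bar>t - x\<bar> < e / 2" using that(1) ab unfolding abs_less_iff atLeastAtMost_iff by linarith
    qed (use that ac ab in auto)
    have a1: "ph (sg a z1) : N0" using N0'[of a z1] z1 ac e by auto
    then obtain g where g: "sec g N0" "g (ph (sg a z1)) = f (ph (sg a z1))" using N0(3) by blast
    have "ph (sg a z1) : X" using ph sgH ac z1 by auto
    then obtain W where W: "open W" "ph (sg a z1) : W" "!!y. y : W ==> g y = f y"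
     using sections_agree_locally[OF g(1) f(1) a1 f(2) _ g(2)] by metis
    have "continuous_on H (%z. ph (sg a z))"
     by (rule continuous_on_compose2[OF ph(1)]) (use sgH ac in \<open>auto simp: sg_def intro!: continuous_intros\<close>)
    from preimage_nbhd[OF this z1 W(1,2)] obtain d where d: "d > 0"
     "!!z. z : H ==> dist z z1 < d ==> ph (sg a z) : W" by blast
    have "U z b = g (ph (sg b z))" if z: "z : H" "dist z z1 < min d (e / 2)" "U z a = f (ph (sg a z))" for z
    proof (rule lift_unique[of "{a..b}" "%t. ph (sg t z)" "U z" "%t. g (ph (sg t z))" a])
     show "continuous_on {a..b} (%t. ph (sg t z))" using cont1[OF z(1)] ac by (auto intro: continuous_on_subset)
     show "(%t. ph (sg t z)) ` {a..b} <= X" using img[OF z(1)] ac by force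
     show "lift {a..b} (%t. ph (sg t z)) (U z)" using U(1)[OF z(1)] ac by (auto intro: lift_subset)
     show "lift {a..b} (%t. ph (sg t z)) (%t. g (ph (sg t z)))" by (rule lift_section[OF g(1)]) (use N0' z in auto)
     show "U z a = g (ph (sg a z))" using z W(3) d(2) by auto
    qed (use ac in auto)
    moreover have "ph (sg b z1) : N0" using N0'[of b z1] z1 ac e by auto
    ultimately show "\<exists>dl>0. \<exists>g M. sec g M & ph (sg b z1) : M & (\<forall>z\<in>H. dist z z1 < dl --> U z a = f (ph (sg a z)) --> U z b = g (ph (sg b z)))"
     using g(1) d(1) e(1) by (intro exI[of _ "min d (e / 2)"] conjI exI[of _ g] exI[of _ N0]) auto
   qed
   thus "\<exists>d>0. \<forall>a b. a <= x & x <= b & b - a < d --> Q a b" using e(1) by (intro exI[of _ "e / 2"]) auto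
  qed simp
  have "ph z0 : X" using ph H by auto
  then obtain f N where f: "sec f N" "ph z0 : N" "f (ph z0) = v" using section_through[of "ph z0" v] by blast
  have s0: "sg 0 z = z0" and s1: "sg 1 z = z" for z by (simp_all add: sg_def)
  have "\<exists>dl>0. \<exists>g M. sec g M & ph z1 : M & (\<forall>z\<in>H. dist z z1 < dl --> U z 0 = f (ph z0) --> U z 1 = g (ph z))"
   using \<open>Q 0 1\<close> f(1,2) unfolding Q_def s0 s1 by auto
  then obtain dl g M where "dl > 0" "sec g M" "ph z1 : M"
   "!!z. z : H ==> dist z z1 < dl ==> U z 0 = f (ph z0) ==> U z 1 = g (ph z)" by blast
  thus ?thesis using U(2) f(3) by (intro exI[of _ g] exI[of _ M] conjI exI[of _ dl]) auto
 qed
 hence "lift H ph (%z. U z 1)" unfolding lift_def by blast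
 moreover have "U z0 1 = v"
 proof -
  have c: "sg t z0 = z0" for t by (simp add: sg_def algebra_simps)
  have X: "ph z0 : X" using ph H by auto
  then obtain f N where f: "sec f N" "ph z0 : N" "f (ph z0) = v" using section_through[of "ph z0" v] by blast
  have sec: "lift {0..1} (%t::real. ph z0) (%t. f (ph z0))" by (rule lift_section[OF f(1)]) (use f in simp)
  have "U z0 1 = (%t. f (ph z0)) 1"
   by (rule lift_unique[OF _ _ _ _ sec, of "U z0" 0]) (use U[OF H(2)] f X in \<open>auto simp: c\<close>)
  thus ?thesis using f by simp
 qed
 ultimately show ?thesis by blast
qed

definition transport :: "(real => 'x) => 'v => 'v => bool" where
 "transport p v w \<longleftrightarrow> (\<exists>u. lift {0..1} p u & u 0 = v & u 1 = w)"

lemma transport_exists: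
 "path p ==> path_image p <= X ==> \<exists>w. transport p v w"
 using lift_path_exists[of 0 1 p v] unfolding transport_def path_def path_image_def by auto

lemma transport_unique:
 assumes "path p" "path_image p <= X" "transport p v w" "transport p v w'"
 shows "w = w'"
proof -
 obtain u u' where u: "lift {0..1} p u" "u 0 = v" "u 1 = w" "lift {0..1} p u'" "u' 0 = v" "u' 1 = w'"
  using assms(3,4) unfolding transport_def by blast
 have "u 1 = u' 1"
  by (rule lift_unique[of "{0..1}" p u u' 0]) (use u assms in \<open>auto simp: path_def path_image_def\<close>)
 thus ?thesis using u by simp
qed

lemma transport_reverse:
 assumes "transport p v w" shows "transport (reversepath p) w v"
proof -
 obtain u where u: "lift {0..1} p u" "u 0 = v" "u 1 = w" using assms unfolding transport_def by blast
 have "lift {0..1} (%t. p (1 - t)) (%t. u (1 - t))" by (rule lift_compose[OF u(1)]) (auto intro!: continuous_intros)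
 thus ?thesis using u unfolding transport_def reversepath_def by (intro exI[of _ "%t. u (1 - t)"]) auto
qed

lemma transport_const: "x : X ==> transport (%_. x) v v"
proof -
 assume "x : X"
 then obtain f N where f: "sec f N" "x : N" "f x = v" using section_through[of x v] by blast
 hence "lift {0..1} (%_. x) (%_. f x)" by (intro lift_section) auto
 thus ?thesis using f unfolding transport_def by auto
qed

lemma transport_join:
 assumes p: "path p" "path_image p <= X" and q: "path q" "path_image q <= X" and pq: "pathfinish p = pathstart q"
  and v: "transport p v w" "transport q w x"
 shows "transport (p +++ q) v x"
proof -
 obtain u where u: "lift {0..1} p u" "u 0 = v" "u 1 = w" using v unfolding transport_def by blast
 obtain u' where u': "lift {0..1} q u'" "u' 0 = w" "u' 1 = x" using v unfolding transport_def by blast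
 have 1: "lift {0..1/2} (%t. p (2 * t)) (%t. u (2 * t))" by (rule lift_compose[OF u(1)]) (auto intro!: continuous_intros)
 have 2: "lift {1/2..1} (%t. q (2 * t - 1)) (%t. u' (2 * t - 1))"
  by (rule lift_compose[OF u'(1)]) (auto intro!: continuous_intros)
 have 1: "lift {0..1/2} (p +++ q) (%t. u (2 * t))" using 1 unfolding lift_def by (auto simp: joinpaths_def)
 have e: "(p +++ q) t = q (2 * t - 1)" if "t : {1/2..1}" for t
 proof (cases "t = 1/2")
  case True
  hence "2 * t = 1" by simp
  thus ?thesis using pq by (simp add: joinpaths_def pathfinish_def pathstart_def)
 qed (use that in \<open>auto simp: joinpaths_def\<close>)
 have 2: "lift {1/2..1} (p +++ q) (%t. u' (2 * t - 1))" using 2 e unfolding lift_def by metis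
 have "lift {0..1} (p +++ q) (%t. if t <= 1/2 then u (2 * t) else u' (2 * t - 1))"
 proof (rule lift_glue[OF _ _ _ _ 1 2])
  show "continuous_on {0..1} (p +++ q)" using path_join_imp[OF p(1) q(1) pq] by (simp add: path_def)
  show "(p +++ q) ` {0..1} <= X" using path_image_join_subset[of p q] p q by (auto simp: path_image_def)
 qed (use u u' in auto)
 thus ?thesis using u u' unfolding transport_def
  by (intro exI[of _ "%t. if t <= 1/2 then u (2 * t) else u' (2 * t - 1)"]) auto
qed

text \<open>The homotopy is lifted over the whole square. On the two sides where it rests at an
  endpoint the lift is constant, so the edges for \<open>p\<close> and \<open>q\<close> have the
  same initial and final values.\<close>

lemma transport_homotopic:
 assumes hom: "homotopic_paths X p q" and v: "transport p v w"
 shows "transport q v w"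
proof -
 obtain h where h: "continuous_on ({0..1} \<times> {0..1}) h" "h ` ({0..1} \<times> {0..1}) <= X"
  "!!t. t : {0..1} ==> h (0, t) = p t" "!!t. t : {0..1} ==> h (1, t) = q t"
  "!!s. s : {0..1::real} ==> h (s, 0) = p 0" "!!s. s : {0..1::real} ==> h (s, 1) = p 1"
  using hom unfolding homotopic_paths_def homotopic_with_def
  by (auto simp: pathstart_def pathfinish_def image_subset_iff Pi_iff)
 have ends: "p 0 : X" "p 1 : X"
 proof -
  have "h (0, 0) : X" "h (0, 1) : X" using h(2) by auto
  thus "p 0 : X" "p 1 : X" using h(3)[of 0] h(3)[of 1] by auto
 qed
 obtain u where u: "lift ({0..1} \<times> {0..1}) h u" "u (0, 0) = v"
  using lift_convex_exists[OF convex_Times _ h(1,2), of "(0, 0)" v] by auto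
 have cong: "lift {0..1::real} \<psi> g" if "lift {0..1} ph g" "!!t. t : {0..1} ==> ph t = \<psi> t" for ph \<psi> g
  using that unfolding lift_def by (metis)
 have row: "lift {0..1} (%t. h (s, t)) (%t. u (s, t))" "lift {0..1} (%t. h (t, s)) (%t. u (t, s))" if "s : {0..1}" for s
  by (rule lift_compose[OF u(1)], use that in \<open>auto intro!: continuous_intros\<close>)+
 have const: "u (t, e) = u (0, e)" if "t : {0..1}" "e : {0, 1}" for t e
 proof -
  have "p e : X" using ends that by auto
  then obtain f N where f: "sec f N" "p e : N" "f (p e) = u (0, e)" using section_through[of "p e"] by blast
  have "lift {0..1} (%_. p e) (%t. u (t, e))" by (rule cong[OF row(2)]) (use that h(5,6) in auto)
  moreover have "lift {0..1} (%_. p e) (%_::real. f (p e))" by (rule lift_section[OF f(1)]) (use f in auto)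
  ultimately have "u (t, e) = f (p e)" by (rule lift_unique[of "{0..1}" "%_. p e" "%t. u (t, e)" "%_. f (p e)" 0, rotated 3])
    (use f that \<open>p e : X\<close> in auto)
  thus ?thesis using f by simp
 qed
 have "lift {0..1} p (%t. u (0, t))" by (rule cong[OF row(1)]) (use h(3) in auto)
 hence "transport p v (u (0, 1))" using u unfolding transport_def by blast
 moreover have "path p" "path_image p <= X" using homotopic_paths_imp_path[OF hom] homotopic_paths_imp_subset[OF hom] by auto
 ultimately have "u (0, 1) = w" using transport_unique v by blast
 moreover have "lift {0..1} q (%t. u (1, t))" by (rule cong[OF row(1)]) (use h(4) in auto)
 ultimately show ?thesis using u const[of 1 0] const[of 1 1] unfolding transport_def by auto
qed

text \<open>The value at \<open>x\<close> is the transport of \<open>v0\<close> along any path; two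
  choices of path differ by a loop at \<open>x0\<close>, which fixes \<open>v0\<close>.\<close>

lemma global_section_exists:
 assumes x0: "x0 : X" and X: "open X" "!!x. x : X ==> \<exists>p. path p & path_image p <= X & pathstart p = x0 & pathfinish p = x"
  and loops: "!!p. path p ==> path_image p <= X ==> pathstart p = x0 ==> pathfinish p = x0 ==> transport p v0 v0"
 shows "\<exists>b. b x0 = v0 & (\<forall>x\<in>X. \<exists>f N. sec f N & x : N & (\<forall>y\<in>N. b y = f y))"
proof -
 define R where "R x w \<longleftrightarrow> (\<exists>p. path p & path_image p <= X & pathstart p = x0 & pathfinish p = x & transport p v0 w)" for x w
 have ex: "\<exists>w. R x w" if "x : X" for x using X(2)[OF that] transport_exists unfolding R_def by metis
 have uniq: "w = w'" if R: "R x w" "R x w'" for x w w'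
 proof -
  obtain p where p: "path p" "path_image p <= X" "pathstart p = x0" "pathfinish p = x" "transport p v0 w"
   using R(1) by (auto simp: R_def)
  obtain q where q: "path q" "path_image q <= X" "pathstart q = x0" "pathfinish q = x" "transport q v0 w'"
   using R(2) by (auto simp: R_def)
  have "transport (p +++ reversepath q) v0 v0" by (rule loops) (use p q in \<open>auto simp: path_image_join\<close>)
  obtain z where z: "transport (reversepath q) w z" using transport_exists[of "reversepath q" w] q by auto
  have "transport (p +++ reversepath q) v0 z" by (rule transport_join[OF _ _ _ _ _ p(5) z]) (use p q in auto)
  hence "z = v0"
   using transport_unique[OF _ _ _ \<open>transport (p +++ reversepath q) v0 v0\<close>] p q by (auto simp: path_image_join)
  hence "transport q v0 w" using transport_reverse[OF z] by simp
  thus ?thesis using transport_unique q by blast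
 qed
 define b where "b x = (THE w. R x w)" for x
 have bI: "b x = w" if "R x w" for x w unfolding b_def by (rule the_equality) (use that uniq in auto)
 have bR: "R x (b x)" if xX: "x : X" for x
 proof -
  obtain w where "R x w" using ex[OF xX] by blast
  thus ?thesis using bI by metis
 qed
 have "R x0 v0" unfolding R_def using x0 transport_const[OF x0]
  by (intro exI[of _ "%_. x0"]) (auto simp: path_def path_image_def pathstart_def pathfinish_def)
 moreover have "\<exists>f N. sec f N & x : N & (\<forall>y\<in>N. b y = f y)" if x: "x : X" for x
 proof -
  obtain f N where f: "sec f N" "x : N" "N <= X" "f x = b x" "path_connected N" using section_exists[OF x X(1) x] by metis
  have "b y = f y" if y: "y : N" for y
  proof (rule bI)
   obtain q where q: "path q" "path_image q <= N" "pathstart q = x" "pathfinish q = y"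
    using f(2,5) y unfolding path_connected_def by blast
   obtain p where p: "path p" "path_image p <= X" "pathstart p = x0" "pathfinish p = x" "transport p v0 (b x)"
    using bR[OF x] by (auto simp: R_def)
   have "lift {0..1} q (%t. f (q t))" by (rule lift_section[OF f(1)]) (use q in \<open>auto simp: path_image_def\<close>)
   hence "transport q (b x) (f y)"
    unfolding transport_def using q f by (intro exI[of _ "%t. f (q t)"]) (auto simp: pathstart_def pathfinish_def)
   hence "transport (p +++ q) v0 (f y)" by (intro transport_join[OF p(1,2) q(1) _ _ p(5)]) (use p q f in auto)
   thus "R y (f y)" unfolding R_def using p q f by (intro exI[of _ "p +++ q"]) (auto simp: path_image_join)
  qed
  thus ?thesis using f by blast
 qed
 ultimately show ?thesis using bI by (intro exI[of _ b]) auto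
qed

end

section \<open>Differential equations on the sphere\<close>

text \<open>Both charts under one name, so that statements are proved for either at once; the
  transition map is z \<mapsto> 1/z in both directions.\<close>

definition chart :: "bool => complex => riemann_sphere" where
 "chart k = (if k then inf_chart else Pt)"

lemma chart_simps [simp]: "chart True = inf_chart" "chart False = Pt" by (simp_all add: chart_def)

lemma inf_chart_simps [simp]: "inf_chart 0 = Infty" "w ~= 0 ==> inf_chart w = Pt (1 / w)"
 "inf_chart w = Infty \<longleftrightarrow> w = 0" by (simp_all add: inf_chart_def)

lemma inf_chart_eq_Pt: "inf_chart w = Pt z \<longleftrightarrow> w ~= 0 & z = 1 / w" by (auto simp: inf_chart_def)

lemma chart_inj: "chart k z = chart k w \<longleftrightarrow> z = w" by (cases k) (auto simp: inf_chart_def)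

lemma chart_switch: "z ~= 0 ==> chart k (1 / z) = chart (\<not> k) z" by (cases k) auto

lemma chart_eq_other: "chart k z = chart (\<not> k) w \<longleftrightarrow> w ~= 0 & z = 1 / w"
 by (cases k) (auto simp: inf_chart_def)

lemma chart_cases: obtains k z where "x = chart k z" by (cases x) (metis chart_simps inf_chart_simps(1))+

lemma open_chart_vimage: "open S ==> open (chart k -` S)" by (cases k) (auto simp: open_riemann_sphere_def)

lemma open_sphere_iff: "open S \<longleftrightarrow> (\<forall>k. open (chart k -` S))"
 by (metis chart_simps open_riemann_sphere_def)

lemma continuous_chart: "continuous_on A (chart k)"
proof -
 have "continuous_on UNIV (chart k)" unfolding continuous_on_open_vimage[OF open_UNIV] using open_chart_vimage by simp
 thus ?thesis using continuous_on_subset by blast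
qed

lemma open_inverse_image:
 assumes "open U" shows "open {w::complex. w ~= 0 & 1 / w : U}"
proof -
 have "continuous_on (- {0::complex}) (%w. 1 / w)" by (intro continuous_intros) auto
 hence "open (- {0} \<inter> (%w::complex. 1 / w) -` U)" by (rule continuous_open_preimage) (use assms in auto)
 moreover have "- {0} \<inter> (%w::complex. 1 / w) -` U = {w. w ~= 0 & 1 / w : U}" by auto
 ultimately show ?thesis by simp
qed

lemma open_chart_image: assumes "open U" shows "open (chart k ` U)" unfolding open_sphere_iff
proof
 fix l
 show "open (chart l -` chart k ` U)"
 proof (cases "l = k")
  case True
  have "chart k -` chart k ` U = U" by (auto simp: chart_inj)
  thus ?thesis using assms True by simp
 next
  case False
  hence l: "l = (\<not> k)" by auto
  have "chart l -` chart k ` U = {w. w ~= 0 & 1 / w : U}"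
   unfolding l by (auto simp: chart_eq_other chart_switch image_iff) (metis chart_eq_other)+
  thus ?thesis using open_inverse_image[OF assms] by simp
 qed
qed

lemma chart_nbhd:
 assumes "open W" "chart k z : W"
 obtains r where "r > 0" "cball z r <= chart k -` W"
proof -
 have "open (chart k -` W)" "z : chart k -` W" using open_chart_vimage assms by auto
 then obtain r where "r > 0" "cball z r <= chart k -` W" using open_contains_cball by blast
 thus thesis by (rule that)
qed

instance riemann_sphere :: t2_space
proof
 fix x y :: riemann_sphere
 assume ne: "x ~= y"
 have *: "\<exists>U V. open U & open V & chart k z : U & chart k w : V & U \<inter> V = {}" if zw: "z ~= w" for k z w
 proof -
  obtain U V where "open U" "open V" "z : U" "w : V" "U \<inter> V = {}" using hausdorff[OF zw] by blast
  thus ?thesis by (intro exI[of _ "chart k ` U"] exI[of _ "chart k ` V"]) (auto simp: open_chart_image chart_inj)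
 qed
 have **: "\<exists>U V. open U & open V & Infty : U & Pt z : V & U \<inter> V = {}" for z
 proof -
  \<comment> \<open>A finite point whose coordinate at infinity is smaller than \<open>c\<close> has
    affine coordinate larger than \<open>norm z + 1\<close>.\<close>
  define c where "c = 1 / (norm z + 1)"
  have c: "c > 0" by (simp add: c_def add_nonneg_pos)
  have "chart True ` ball 0 c \<inter> chart False ` ball 0 (norm z + 1) = {}"
  proof (rule equals0I)
   fix x assume "x : chart True ` ball 0 c \<inter> chart False ` ball 0 (norm z + 1)"
   then obtain w v where wv: "norm w < c" "norm v < norm z + 1" "inf_chart w = Pt v" by auto
   hence "w ~= 0" "v * w = 1" by (auto simp: inf_chart_eq_Pt)
   hence "norm v * norm w = 1" by (metis norm_mult norm_one)
   moreover have "norm v * norm w < (norm z + 1) * c"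
    using wv \<open>w ~= 0\<close> by (intro mult_strict_mono) (auto simp: add_nonneg_pos)
   ultimately show False using c by (simp add: c_def add_nonneg_eq_0_iff)
  qed
  moreover have "Infty : chart True ` ball 0 c" by (rule image_eqI[of _ _ 0]) (use c in auto)
  moreover have "Pt z : chart False ` ball 0 (norm z + 1)" by (rule image_eqI[of _ _ z]) auto
  ultimately show ?thesis by (intro exI[of _ "chart True ` ball 0 c"] exI[of _ "chart False ` ball 0 (norm z + 1)"] conjI
     open_chart_image open_ball)
 qed
 show "\<exists>U V. open U & open V & x : U & y : V & U \<inter> V = {}"
 proof (cases x; cases y)
  fix z w assume "x = Pt z" "y = Pt w" thus ?thesis using *[of z w False] ne by auto
 next
  fix z assume "x = Pt z" "y = Infty" thus ?thesis using **[of z] by blast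
 next
  fix z assume "x = Infty" "y = Pt z" thus ?thesis using **[of z] by blast
 qed (use ne in auto)
qed

text \<open>No nonempty open set consists of the point at infinity alone, so a separation of the
  sphere would induce one of the plane.\<close>

lemma sphere_connected: "connected (UNIV :: riemann_sphere set)"
proof (rule connectedI)
 fix A B :: "riemann_sphere set"
 assume AB: "open A" "open B" "A \<inter> UNIV ~= {}" "B \<inter> UNIV ~= {}" "A \<inter> B \<inter> UNIV = {}" "UNIV <= A \<union> B"
 have no: False if A: "open A" "A ~= {}" "Pt -` A = {}" for A :: "riemann_sphere set"
 proof -
  have "A = {Infty}"
  proof -
   have "x = Infty" if "x : A" for x using that A(3) by (cases x) auto
   thus ?thesis using A(2) by blast
  qed
  hence "inf_chart -` A = {0}" by (auto simp: inf_chart_def split: if_splits)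
  moreover have "open (inf_chart -` A)" using A(1) by (simp add: open_riemann_sphere_def)
  ultimately show False using not_open_singleton[of "0::complex"] by simp
 qed
 have "open (Pt -` A)" "open (Pt -` B)" using AB by (auto simp: open_riemann_sphere_def)
 moreover have "Pt -` A \<inter> Pt -` B = {}" "Pt -` A \<union> Pt -` B = UNIV" using AB by auto
 moreover have "Pt -` A ~= {}" "Pt -` B ~= {}" using no AB by auto
 ultimately show False using connectedD[OF connected_UNIV, of "Pt -` A" "Pt -` B"] by auto
qed

text \<open>The coefficients behave like matrix-valued differential forms: passing to w = 1/x
  multiplies them by the derivative -1/w^2, which makes the equation independent of the
  chart.\<close>

locale sphere_ode =
 fixes X :: "riemann_sphere set" and P Q F :: "bool => complex => complex ^ 'n::finite ^ 'n"
 assumes X_open: "open X"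
  and holo: "!!k. mholo (P k) (chart k -` X)" "!!k. mholo (Q k) (chart k -` X)" "!!k. mholo (F k) (chart k -` X)"
  and switch: "!!w. w ~= 0 ==> inf_chart w : X ==> P True w = mat (- 1 / w\<^sup>2) ** P False (1 / w)"
   "!!w. w ~= 0 ==> inf_chart w : X ==> Q True w = mat (- 1 / w\<^sup>2) ** Q False (1 / w)"
   "!!w. w ~= 0 ==> inf_chart w : X ==> F True w = mat (- 1 / w\<^sup>2) ** F False (1 / w)"
begin

definition rhs :: "bool => complex => complex ^ 'n ^ 'n => complex ^ 'n ^ 'n" where
 "rhs k z y = P k z ** y - y ** Q k z + F k z"

definition sec :: "(riemann_sphere => complex ^ 'n ^ 'n) => riemann_sphere set => bool" where
 "sec f N \<longleftrightarrow> open N & N <= X &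
   (\<forall>k z. chart k z : N --> mder (%u. f (chart k u)) (rhs k z (f (chart k z))) z)"

lemma switch_general:
 assumes "w ~= 0" "chart k w : X"
 shows "rhs k w y = mat (- 1 / w\<^sup>2) ** rhs (\<not> k) (1 / w) y"
proof -
 have m: "y ** (mat c ** Z) = mat c ** (y ** Z)" for c Z by (simp add: matrix_mul_assoc mat_commute[of c y])
 have mm: "mat a ** (mat b ** Z) = mat (a * b) ** Z" for a b and Z :: "complex ^ 'n ^ 'n"
  by (simp add: vec_eq_iff mat_mult_left)
 have T: "rhs True w y = mat (- 1 / w\<^sup>2) ** rhs False (1 / w) y" if "w ~= 0" "inf_chart w : X" for w
  unfolding rhs_def switch[OF that] by (simp add: matrix_diff_right matrix_add_right m matrix_mul_assoc[symmetric])
 show ?thesis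
 proof (cases k)
  case True thus ?thesis using T assms by simp
 next
  case False
  hence "inf_chart (1 / w) : X" using assms by simp
  from T[OF _ this] assms have "rhs True (1 / w) y = mat (- 1 / (1 / w)\<^sup>2) ** rhs False w y" by simp
  hence "mat (- 1 / w\<^sup>2) ** rhs True (1 / w) y = mat ((- 1 / w\<^sup>2) * (- 1 / (1 / w)\<^sup>2)) ** rhs False w y"
   by (simp only: mm)
  also have "(- 1 / w\<^sup>2) * (- 1 / (1 / w)\<^sup>2) = 1" using assms by (simp add: field_simps power2_eq_square)
  finally show ?thesis using False by simp
 qed
qed

lemma mder_switch:
 assumes "mder (%u. f (chart k u)) (rhs k z (f (chart k z))) z" "chart k z = chart l w" "chart k z : X"
 shows "mder (%u. f (chart l u)) (rhs l w (f (chart l w))) w"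
proof (cases "l = k")
 case True thus ?thesis using assms chart_inj by auto
next
 case False
 hence l: "l = (\<not> k)" by auto
 hence w: "w ~= 0" "z = 1 / w" using assms(2) by (auto simp: chart_eq_other)
 have "((%u. 1 / u) has_field_derivative (- 1 / w\<^sup>2)) (at w)"
  using w by (auto intro!: derivative_eq_intros simp: power2_eq_square)
 from mder_chain[of "%u. f (chart k u)" _ "%u. 1 / u" w, OF _ this] assms(1)
 have *: "mder (%u. f (chart k (1 / u))) (mat (- 1 / w\<^sup>2) ** rhs k z (f (chart k z))) w" by (simp add: w)
 have "\<forall>\<^sub>F u in nhds w. u ~= 0" using w by (intro t1_space_nhds)
 hence "\<forall>\<^sub>F u in nhds w. f (chart l u) = f (chart k (1 / u))"
  by (rule eventually_mono) (simp add: l chart_switch)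
 from mder_cong[OF this] * have "mder (%u. f (chart l u)) (mat (- 1 / w\<^sup>2) ** rhs k z (f (chart k z))) w" by simp
 moreover have "rhs l w (f (chart l w)) = mat (- 1 / w\<^sup>2) ** rhs k z (f (chart k z))"
  using switch_general[OF w(1), of l] assms(2,3) w l by simp
 ultimately show ?thesis by simp
qed

lemma sec_mder: "sec f N ==> chart k z : N ==> mder (%u. f (chart k u)) (rhs k z (f (chart k z))) z" by (auto simp: sec_def)

lemma secI_chart:
 assumes S: "open S" "S <= chart k -` X" and f: "!!z. z : S ==> mder (%u. f (chart k u)) (rhs k z (f (chart k z))) z"
 shows "sec f (chart k ` S)" unfolding sec_def
proof (intro conjI allI impI)
 fix l w assume "chart l w : chart k ` S"
 then obtain z where "z : S" "chart k z = chart l w" by auto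
 thus "mder (%u. f (chart l u)) (rhs l w (f (chart l w))) w" using mder_switch[OF f[of z], of l w] S by auto
qed (use S open_chart_image in auto)

lemma chart_section_exists:
 assumes S: "open S" "convex S" "S <= chart k -` X" and y: "y : S"
 shows "\<exists>f. sec f (chart k ` S) & f (chart k y) = v"
proof -
 obtain Y where Y: "!!z. z : S ==> mder Y (P k z ** Y z - Y z ** Q k z + F k z) z" "Y y = v"
  using sylvester_solvable[OF S(1,2) y, of "P k" "Q k" "F k" v] holo mholo_subset[OF _ S(3)] by blast
 define f where "f x = Y (inv_into UNIV (chart k) x)" for x
 have f: "f (chart k z) = Y z" for z by (simp add: f_def inv_f_f inj_def chart_inj)
 have "sec f (chart k ` S)" by (rule secI_chart[OF S(1,3)]) (use Y in \<open>simp add: f rhs_def\<close>)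
 thus ?thesis using Y(2) f by auto
qed

lemma chart_section_unique:
 assumes S: "convex S" and f: "sec f N" "sec g N" "chart k ` S <= N"
  and y: "y : S" "f (chart k y) = g (chart k y)" and z: "z : S"
 shows "f (chart k z) = g (chart k z)"
proof (rule sylvester_unique[OF S y(1) z, of "P k" "Q k" "%u. f (chart k u)" "F k" "%u. g (chart k u)"])
 have "S <= chart k -` X" using f unfolding sec_def by blast
 thus "continuous_on S (P k)" "continuous_on S (Q k)" using holo mholo_continuous_on continuous_on_subset by blast+
next
 fix u assume "u : S"
 hence "chart k u : N" using f(3) by auto
 thus "mder (%u. f (chart k u)) (P k u ** f (chart k u) - f (chart k u) ** Q k u + F k u) u"
  "mder (%u. g (chart k u)) (P k u ** g (chart k u) - g (chart k u) ** Q k u + F k u) u"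
  using sec_mder f(1,2) unfolding rhs_def by blast+
qed (rule y(2))

sublocale local_system X sec
proof
 fix f N assume "sec f N" thus "open N" by (simp add: sec_def)
next
 fix f N N' assume "sec f N" "open N'" "N' <= N" thus "sec f N'" by (auto simp: sec_def)
next
 fix x W assume x: "x : X" "open W" "x : W"
 obtain k z where xz: "x = chart k z" by (rule chart_cases)
 obtain r where r: "r > 0" "cball z r <= chart k -` (W \<inter> X)"
  using chart_nbhd[of "W \<inter> X" k z] x X_open xz by auto
 define N where "N = chart k ` ball z r"
 have sub: "ball z r <= chart k -` X" using r(2) by (auto simp: subset_iff)
 have "ball z r <= chart k -` W" using r(2) by (auto simp: subset_iff)
 hence "N <= W" by (auto simp: N_def)
 moreover have "path_connected N"
  unfolding N_def by (intro path_connected_continuous_image continuous_chart convex_imp_path_connected convex_ball)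
 moreover have "\<forall>y\<in>N. \<forall>v. \<exists>f. sec f N & f y = v"
  using chart_section_exists[OF open_ball convex_ball sub] unfolding N_def by blast
 moreover have "\<forall>f g. sec f N --> sec g N --> (\<exists>y\<in>N. f y = g y) --> (\<forall>y\<in>N. f y = g y)"
  using chart_section_unique[OF convex_ball, of _ N _ k z r] unfolding N_def by blast
 moreover have "open N" "x : N" using r xz by (auto simp: N_def open_chart_image)
 ultimately show "\<exists>N. open N & x : N & N <= W & path_connected N & (\<forall>y\<in>N. \<forall>v. \<exists>f. sec f N & f y = v) &
    (\<forall>f g. sec f N --> sec g N --> (\<exists>y\<in>N. f y = g y) --> (\<forall>y\<in>N. f y = g y))"
  by (intro exI[of _ N] conjI)
qed

lemma lift_chart_section:
 fixes a b :: real
 assumes "a <= b" and S: "open S" "convex S" "S <= chart k -` X"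
  and ph: "continuous_on {a..b} ph" "ph ` {a..b} <= chart k ` S" and u: "lift {a..b} ph u"
 obtains f where "sec f (chart k ` S)" "!!t. t : {a..b} ==> u t = f (ph t)"
proof -
 have "ph a : chart k ` S" using ph(2) assms(1) by auto
 then obtain y where y: "y : S" "ph a = chart k y" by auto
 obtain f where f: "sec f (chart k ` S)" "f (chart k y) = u a" using chart_section_exists[OF S y(1)] by blast
 have "u t = f (ph t)" if t: "t : {a..b}" for t
 proof (rule lift_unique[of "{a..b}" ph u "%t. f (ph t)" a])
  have "chart k ` S <= X" using S(3) by auto
  thus "ph ` {a..b} <= X" using ph(2) by (rule order_trans[rotated])
  show "lift {a..b} ph (%t. f (ph t))" by (rule lift_section[OF f(1)]) (use ph(2) in auto)
 qed (use assms(1) ph u f y t in auto)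
 thus ?thesis using f(1) that by blast
qed

end

text \<open>Continuous dependence on the parameter, carried along the path by bisection. On a short
  piece inside one chart disk the difference of the continuations for \<open>s\<close> and for 0
  satisfies the equation for \<open>s\<close> with an inhomogeneity made of the coefficient
  differences, and Gronwall's inequality bounds it.\<close>

lemma lift_limit:
 fixes P Q F :: "complex => bool => complex => complex ^ 'n::finite ^ 'n"
 assumes ode: "\<forall>\<^sub>F s in at 0. sphere_ode X (P s) (Q s) (F s)" and ode0: "sphere_ode X (P 0) (Q 0) (F 0)"
  and lim: "!!k K. compact K ==> K <= chart k -` X ==> uniform_limit K (%s. P s k) (P 0 k) (at 0)"
   "!!k K. compact K ==> K <= chart k -` X ==> uniform_limit K (%s. Q s k) (Q 0 k) (at 0)"
   "!!k K. compact K ==> K <= chart k -` X ==> uniform_limit K (%s. F s k) (F 0 k) (at 0)"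
  and p: "path p" "path_image p <= X"
  and u: "\<forall>\<^sub>F s in at 0. local_system.lift (sphere_ode.sec X (P s) (Q s) (F s)) {0..1} p (u s)"
  and u0: "local_system.lift (sphere_ode.sec X (P 0) (Q 0) (F 0)) {0..1} p (u 0)"
  and init: "((%s. u s 0) \<longlongrightarrow> u 0 0) (at 0)"
 shows "((%s. u s 1) \<longlongrightarrow> u 0 1) (at (0::complex))"
proof -
 interpret Z: sphere_ode X "P 0" "Q 0" "F 0" by (rule ode0)
 define R where "R a b \<longleftrightarrow> (0 <= a --> a <= b --> b <= 1 -->
   ((%s. u s a) \<longlongrightarrow> u 0 a) (at 0) --> ((%s. u s b) \<longlongrightarrow> u 0 b) (at 0))" for a b :: real
 have "R 0 1"
 proof (rule Bolzano)
  fix x :: real assume x: "0 <= x" "x <= 1"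
  have px: "p x : X" using p x by (auto simp: path_image_def)
  obtain k z where z: "p x = chart k z" by (rule chart_cases)
  obtain r where r: "r > 0" "cball z r <= chart k -` X" using chart_nbhd[of X k z] px Z.X_open z by auto
  have sub: "ball z r <= chart k -` X" using r(2) by (auto simp: subset_iff)
  obtain d where d: "d > 0" "!!t. t : {0..1} ==> dist t x < d ==> p t : chart k ` ball z r"
   using Z.preimage_nbhd[of "{0..1}" p x "chart k ` ball z r"] p(1) x r(1) z
   unfolding path_def by (auto simp: open_chart_image)
  have "R a b" if ab: "a <= x" "x <= b" "b - a < d" for a b unfolding R_def
  proof (intro impI)
   assume ab1: "0 <= a" "a <= b" "b <= 1" and lima: "((%s. u s a) \<longlongrightarrow> u 0 a) (at 0)"
   have pin: "p t : chart k ` ball z r" if "t : {a..b}" for t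
    by (rule d(2)) (use that ab ab1 in \<open>auto simp: dist_real_def\<close>)
   have pc: "continuous_on {a..b} p" using p(1) ab1 unfolding path_def by (auto intro: continuous_on_subset)
   obtain ya yb where y: "p a = chart k ya" "ya : ball z r" "p b = chart k yb" "yb : ball z r"
    using pin[of a] pin[of b] ab1 by auto
   have sect: "\<exists>Y. (\<forall>w\<in>ball z r. mder Y (P s k w ** Y w - Y w ** Q s k w + F s k w) w) & Y ya = u s a & Y yb = u s b"
    if "sphere_ode X (P s) (Q s) (F s)" "local_system.lift (sphere_ode.sec X (P s) (Q s) (F s)) {0..1} p (u s)" for s
   proof -
    interpret S: sphere_ode X "P s" "Q s" "F s" by (rule that(1))
    have "S.lift {a..b} p (u s)" using S.lift_subset[OF that(2)] ab1 by auto
    then obtain f where f: "S.sec f (chart k ` ball z r)" "!!t. t : {a..b} ==> u s t = f (p t)"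
     using S.lift_chart_section[OF ab1(2) open_ball convex_ball sub pc] pin by blast
    show ?thesis using S.sec_mder[OF f(1)] f(2)[of a] f(2)[of b] y ab1
     by (intro exI[of _ "%w. f (chart k w)"]) (auto simp: S.rhs_def)
   qed
   obtain Y0 where Y0: "!!w. w : ball z r ==> mder Y0 (P 0 k w ** Y0 w - Y0 w ** Q 0 k w + F 0 k w) w"
    "Y0 ya = u 0 a" "Y0 yb = u 0 b" using sect[OF ode0 u0] by blast
   define C where "C = closed_segment ya yb"
   have C: "compact C" "C <= ball z r" using y by (auto simp: C_def closed_segment_subset)
   hence CX: "C <= chart k -` X" using sub by blast
   have bd: "\<exists>K>0. \<forall>w\<in>C. norm (f w) <= K" if "continuous_on C f" for f :: "complex => complex ^ 'n ^ 'n"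
   proof -
    have "bounded (f ` C)" using that C(1) by (intro compact_imp_bounded compact_continuous_image)
    thus ?thesis unfolding bounded_pos by auto
   qed
   have "continuous_on C (P 0 k)" "continuous_on C (Q 0 k)"
    using mholo_continuous_on[OF Z.holo(1)] mholo_continuous_on[OF Z.holo(2)] CX continuous_on_subset by blast+
   moreover have "continuous_on C Y0" using mder_continuous[OF Y0(1)] C(2) by (intro continuous_at_imp_continuous_on) blast
   ultimately obtain KP KQ KY where K: "KP > 0" "KQ > 0" "KY > 0" "!!w. w : C ==> norm (P 0 k w) <= KP"
    "!!w. w : C ==> norm (Q 0 k w) <= KQ" "!!w. w : C ==> norm (Y0 w) <= KY" using bd by metis
   define c where "c = mconst TYPE('n)"
   have c0: "c > 0" using mconst_ge_1[where 'n = 'n] by (simp add: c_def)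
   define E where "E = exp (2 * (c * ((KP + 1) + (KQ + 1)) * norm (yb - ya)) + 1)"
   define L where "L = (2 * c * KY + 1) * norm (yb - ya)"
   have main: "\<forall>\<^sub>F s in at 0. norm (u s b - u 0 b) ^ 2 <= E * (norm (u s a - u 0 a) ^ 2 + (\<epsilon> * L) ^ 2)"
    if \<epsilon>: "\<epsilon> > 0" "\<epsilon> <= 1" for \<epsilon>
    using ode u uniform_limitD[OF lim(1)[OF C(1) CX] \<epsilon>(1)] uniform_limitD[OF lim(2)[OF C(1) CX] \<epsilon>(1)]
     uniform_limitD[OF lim(3)[OF C(1) CX] \<epsilon>(1)]
   proof eventually_elim
    case (elim s)
    obtain Y where Y: "!!w. w : ball z r ==> mder Y (P s k w ** Y w - Y w ** Q s k w + F s k w) w"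
     "Y ya = u s a" "Y yb = u s b" using sect[OF elim(1,2)] by blast
    define G where "G w = (P s k w - P 0 k w) ** Y0 w - Y0 w ** (Q s k w - Q 0 k w) + (F s k w - F 0 k w)" for w
    have "norm (Y yb - Y0 yb) ^ 2 <= exp (2 * (mconst TYPE('n) * ((KP + 1) + (KQ + 1)) * norm (yb - ya)) + 1) *
      (norm (Y ya - Y0 ya) ^ 2 + ((\<epsilon> * (2 * c * KY + 1)) * norm (yb - ya)) ^ 2)"
    proof (rule sylvester_gronwall[where P = "P s k" and Q = "Q s k" and F = G])
     fix w assume w: "w : closed_segment ya yb"
     hence wC: "w : C" by (simp add: C_def)
     hence wb: "w : ball z r" using C by blast
     show "mder (%w. Y w - Y0 w) (P s k w ** (Y w - Y0 w) - (Y w - Y0 w) ** Q s k w + G w) w"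
      by (rule mder_eq[OF mder_diff[OF Y(1)[OF wb] Y0(1)[OF wb]]]) (simp add: G_def matrix_ring_simps)
     have e: "norm (P s k w - P 0 k w) < \<epsilon>" "norm (Q s k w - Q 0 k w) < \<epsilon>" "norm (F s k w - F 0 k w) < \<epsilon>"
      using elim(3-5) wC by (auto simp: dist_norm)
     have "norm (P s k w) <= norm (P 0 k w) + norm (P s k w - P 0 k w)" by (metis norm_triangle_sub)
     thus "norm (P s k w) <= KP + 1" using e(1) K(4)[OF wC] \<epsilon> by linarith
     have "norm (Q s k w) <= norm (Q 0 k w) + norm (Q s k w - Q 0 k w)" by (metis norm_triangle_sub)
     thus "norm (Q s k w) <= KQ + 1" using e(2) K(5)[OF wC] \<epsilon> by linarith
     have "norm (G w) <= norm ((P s k w - P 0 k w) ** Y0 w - Y0 w ** (Q s k w - Q 0 k w)) + norm (F s k w - F 0 k w)"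
      unfolding G_def by (rule norm_triangle_ineq)
     also have "\<dots> <= c * (\<epsilon> + \<epsilon>) * KY + \<epsilon>"
     proof (rule add_mono)
      have "norm ((P s k w - P 0 k w) ** Y0 w - Y0 w ** (Q s k w - Q 0 k w)) \<le>
        c * (norm (P s k w - P 0 k w) + norm (Q s k w - Q 0 k w)) * norm (Y0 w)" unfolding c_def by (rule norm_sylvester_le)
      also have "\<dots> <= c * (\<epsilon> + \<epsilon>) * KY"
       using e c0 \<epsilon> K(6)[OF wC] by (intro mult_mono add_mono) auto
      finally show "norm ((P s k w - P 0 k w) ** Y0 w - Y0 w ** (Q s k w - Q 0 k w)) <= c * (\<epsilon> + \<epsilon>) * KY" .
     qed (use e in auto)
     finally show "norm (G w) <= \<epsilon> * (2 * c * KY + 1)" by (simp add: algebra_simps)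
    qed
    thus ?case by (simp add: Y Y0 E_def L_def c_def mult.assoc)
   qed
   have E0: "E > 0" by (simp add: E_def)
   show "((%s. u s b) \<longlongrightarrow> u 0 b) (at 0)"
   proof (rule tendstoI)
    fix e :: real assume e: "e > 0"
    \<comment> \<open>Chosen so that the contribution of the coefficient differences, multiplied by
      the Gronwall factor \<open>E\<close>, is at most (e/2)^2.\<close>
    define \<epsilon> where "\<epsilon> = min 1 (e / (2 * (sqrt E * (\<bar>L\<bar> + 1))))"
    have \<epsilon>: "\<epsilon> > 0" "\<epsilon> <= 1" using e E0 by (auto simp: \<epsilon>_def intro!: divide_pos_pos mult_pos_pos)
    have eL: "E * (\<epsilon> * L) ^ 2 <= (e / 2) ^ 2"
    proof -
     have "sqrt E * (\<epsilon> * \<bar>L\<bar>) <= sqrt E * (\<epsilon> * (\<bar>L\<bar> + 1))" using E0 \<epsilon> by (intro mult_left_mono) auto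
     also have "\<dots> = \<epsilon> * (sqrt E * (\<bar>L\<bar> + 1))" by simp
     also have "\<dots> <= e / (2 * (sqrt E * (\<bar>L\<bar> + 1))) * (sqrt E * (\<bar>L\<bar> + 1))"
      using E0 by (intro mult_right_mono) (auto simp: \<epsilon>_def)
     also have "\<dots> = e / 2"
     proof -
      have "sqrt E * (\<bar>L\<bar> + 1) > 0" using E0 by (intro mult_pos_pos) auto
      thus ?thesis by (simp add: field_simps)
     qed
     finally have "(sqrt E * (\<epsilon> * \<bar>L\<bar>)) ^ 2 <= (e / 2) ^ 2" using E0 \<epsilon> by (intro power_mono) auto
     thus ?thesis using E0 by (simp add: power_mult_distrib)
    qed
    have "\<forall>\<^sub>F s in at 0. dist (u s a) (u 0 a) < e / (2 * sqrt E)"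
     using tendstoD[OF lima, of "e / (2 * sqrt E)"] e E0 by simp
    thus "\<forall>\<^sub>F s in at 0. dist (u s b) (u 0 b) < e" using main[OF \<epsilon>]
    proof eventually_elim
     case (elim s)
     have "norm (u s a - u 0 a) ^ 2 < (e / (2 * sqrt E)) ^ 2"
      using elim(1) by (intro power_strict_mono) (auto simp: dist_norm)
     also have "\<dots> = (e / 2) ^ 2 / E" using E0 by (simp add: power_divide power_mult_distrib)
     finally have "E * norm (u s a - u 0 a) ^ 2 < (e / 2) ^ 2" using E0 by (simp add: pos_less_divide_eq mult.commute)
     hence "norm (u s b - u 0 b) ^ 2 < (e / 2) ^ 2 + (e / 2) ^ 2" using elim(2) eL by (simp add: distrib_left)
     also have "\<dots> <= e ^ 2" by (simp add: power2_eq_square)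
     finally show ?case using e by (simp add: dist_norm power_less_imp_less_base)
    qed
   qed
  qed
  thus "\<exists>d>0. \<forall>a b. a <= x & x <= b & b - a < d --> R a b" using d(1) by blast
 qed (auto simp: R_def)
 thus ?thesis using init by (simp add: R_def)
qed

text \<open>The intertwiners \<open>V\<close> with \<open>V N(0) = N(s) V\<close> form spaces of constant
 dimension, so that some \<open>I - R(s)\<close> with \<open>R(s)\<close> orthogonal to the centralizer and of size \<open>O(s)\<close> is
 an intertwiner, and the quotients \<open>R(s)/s\<close> accumulate at a solution.\<close>

lemma conjugacy_class_tangent:
 fixes N :: "nat => complex => complex ^ 'n::finite ^ 'n" and N' :: "nat => complex ^ 'n ^ 'n"
 assumes conj: "\<forall>\<^sub>F s in at 0. \<exists>C C'. C ** C' = mat 1 & C' ** C = mat 1 & (\<forall>i<m. C ** N i 0 = N i s ** C)"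
  and der: "!!i. i < m ==> ((%s. mat (1 / s) ** (N i s - N i 0)) \<longlongrightarrow> N' i) (at 0)"
 shows "\<exists>E. \<forall>i<m. N' i = E ** N i 0 - N i 0 ** E"
proof -
 define L where "L s V i = V ** N i 0 - N i s ** V" for s i and V :: "complex ^ 'n ^ 'n"
 define q where "q s V = (\<Sum>i<m. norm (L s V i))" for s V
 define W where "W s = {V. \<forall>i<m. L s V i = 0}" for s
 have scale: "(r *\<^sub>R V) ** Z = r *\<^sub>R (V ** Z)" "Z ** (r *\<^sub>R V) = r *\<^sub>R (Z ** V)" for r and V Z :: "complex ^ 'n ^ 'n"
  by (simp_all add: vec_eq_iff matrix_matrix_mult_def scaleR_sum_right)
 have linL: "L s (V + V') i = L s V i + L s V' i" "L s (r *\<^sub>R V) i = r *\<^sub>R L s V i"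
  "L s (V - V') i = L s V i - L s V' i" for s V V' i r by (simp_all add: L_def matrix_ring_simps scale scaleR_diff_right)
 have linL0: "L s 0 i = 0" for s i by (simp add: L_def matrix_matrix_mult_def vec_eq_iff)
 have subW: "subspace (W s)" for s by (auto simp: W_def subspace_def linL linL0)
 \<comment> \<open>\<open>W 0\<close> is the common centralizer of the matrices at s = 0;
   \<open>U\<close> is its orthogonal complement as a real vector space.\<close>
 define U where "U = {y : UNIV. \<forall>x\<in>W 0. orthogonal x y}"
 have dimU: "dim U + dim (W 0) = DIM(complex ^ 'n ^ 'n)"
  unfolding U_def using dim_subspace_orthogonal_to_vectors[OF subW[of 0] subspace_UNIV] by simp
 have subU: "subspace U" by (auto simp: U_def subspace_def orthogonal_clauses)
 have cmul: "continuous_on UNIV (%V :: complex ^ 'n ^ 'n. V ** Z)" "continuous_on UNIV (%V. Z ** (V :: complex ^ 'n ^ 'n))" for Z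
  by (intro linear_continuous_on linear_conv_bounded_linear[THEN iffD1] linearI; simp add: matrix_ring_simps scale)+
 have contL: "continuous_on UNIV (%V. L s V i)" for s i unfolding L_def by (intro continuous_on_diff cmul)
 have contq: "continuous_on UNIV (q s)" for s unfolding q_def by (intro continuous_intros contL)
 \<comment> \<open>On the unit sphere of \<open>U\<close> the function \<open>q 0\<close> is
   positive, since a zero would lie in \<open>W 0\<close> as well; compactness gives the bound. If
   that sphere is empty, \<open>U\<close> is 0 and the constant 1 serves.\<close>
 obtain c where c: "c > 0" "!!V. V : U ==> c * norm V <= q 0 V"
 proof (cases "U \<inter> sphere 0 1 = {}")
  case True
  have z: "V = 0" if VU: "V : U" for V
  proof (rule ccontr)
   assume "V ~= 0"
   hence "(1 / norm V) *\<^sub>R V : U \<inter> sphere 0 1" using subU VU by (simp add: subspace_def)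
   thus False using True by blast
  qed
  have "1 * norm V <= q 0 V" if "V : U" for V
   using z[OF that] sum_nonneg[of "{..<m}" "%i. norm (L 0 V i)"] by (simp add: q_def)
  thus ?thesis by (intro that[of 1]) auto
 next
  case False
  have "compact (U \<inter> sphere 0 1)" using closed_subspace[OF subU] by (simp add: closed_Int_compact)
  from continuous_attains_inf[OF this False continuous_on_subset[OF contq[of 0] subset_UNIV]]
  obtain V0 where V0: "V0 : U \<inter> sphere 0 1" "!!V. V : U \<inter> sphere 0 1 ==> q 0 V0 <= q 0 V" by blast
  have "q 0 V0 > 0"
  proof (rule ccontr)
   assume "\<not> 0 < q 0 V0"
   hence "q 0 V0 = 0" by (simp add: q_def sum_nonneg order_antisym not_less)
   hence "V0 : W 0" unfolding q_def W_def by (subst (asm) sum_nonneg_eq_0_iff) auto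
   hence "orthogonal V0 V0" using V0(1) by (auto simp: U_def)
   thus False using V0(1) by (simp add: orthogonal_self)
  qed
  moreover have "q 0 V0 * norm V <= q 0 V" if "V : U" for V
  proof (cases "V = 0")
   case False
   hence "(1 / norm V) *\<^sub>R V : U \<inter> sphere 0 1" using subU that by (simp add: subspace_def)
   from V0(2)[OF this] have "q 0 V0 <= q 0 V / norm V" by (simp add: q_def linL sum_divide_distrib)
   thus ?thesis using False by (simp add: pos_le_divide_eq)
  qed (simp add: q_def sum_nonneg)
  ultimately show ?thesis by (intro that[of "q 0 V0"])
 qed
 define ka where "ka = mconst TYPE('n)"
 have ka: "ka \<ge> 1" by (simp add: ka_def mconst_ge_1)
 define D where "D s = (\<Sum>i<m. norm (N i s - N i 0))" for s
 define K where "K = (\<Sum>i<m. norm (N' i)) + 1"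
 have K: "K > 0" by (simp add: K_def add_nonneg_pos sum_nonneg)
 have D: "\<forall>\<^sub>F s in at 0. D s <= K * norm s"
 proof -
  have "((%s. \<Sum>i<m. norm (mat (1 / s) ** (N i s - N i 0))) \<longlongrightarrow> (\<Sum>i<m. norm (N' i))) (at 0)"
   by (intro tendsto_intros der) auto
  hence "\<forall>\<^sub>F s in at 0. (\<Sum>i<m. norm (mat (1 / s) ** (N i s - N i 0))) < K"
   by (rule order_tendstoD) (simp add: K_def)
  moreover have "\<forall>\<^sub>F s in at (0::complex). s ~= 0" by (simp add: eventually_at_filter)
  ultimately show ?thesis
  proof eventually_elim
   case (elim s)
   hence "D s / norm s < K" by (simp add: norm_mat_mult norm_divide D_def sum_divide_distrib)
   thus ?case using elim by (simp add: pos_divide_less_eq less_imp_le)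
  qed
 qed
 have small2: "\<forall>\<^sub>F s in at 0. ka * D s < c / 2"
 proof -
  have "((%s. ka * (K * norm s)) \<longlongrightarrow> 0) (at (0::complex))"
   by (intro tendsto_mult_right_zero tendsto_norm_zero tendsto_ident_at)
  hence "\<forall>\<^sub>F s in at (0::complex). ka * (K * norm s) < c / 2" by (rule order_tendstoD) (use c in simp)
  with D show ?thesis
  proof eventually_elim
   case (elim s)
   have "ka * D s <= ka * (K * norm s)" using elim ka by (intro mult_left_mono) auto
   thus ?case using elim by simp
  qed
 qed
 define Good where "Good s R \<longleftrightarrow> norm R <= (2 * K / c) * norm s & (\<forall>i<m. R ** N i 0 - N i s ** R = N i 0 - N i s)" for s R
 have ex: "\<forall>\<^sub>F s in at 0. \<exists>R. Good s R" using conj D small2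
 proof eventually_elim
  case (elim s)
  then obtain C C' where C: "C ** C' = mat 1" "C' ** C = mat 1" "!!i. i < m ==> C ** N i 0 = N i s ** C" by blast
  have qs: "c / 2 * norm V <= q s V" if "V : U" for V
  proof -
   have "norm (L 0 V i) <= norm (L s V i) + ka * norm (N i s - N i 0) * norm V" for i
   proof -
    have "L 0 V i = L s V i + (N i s - N i 0) ** V" by (simp add: L_def matrix_ring_simps)
    thus ?thesis using norm_triangle_ineq[of "L s V i" "(N i s - N i 0) ** V"] norm_matrix_mult[of "N i s - N i 0" V]
     by (simp add: ka_def)
   qed
   hence "q 0 V <= (\<Sum>i<m. norm (L s V i) + ka * norm (N i s - N i 0) * norm V)" unfolding q_def by (intro sum_mono)
   also have "\<dots> = q s V + ka * D s * norm V" by (simp add: q_def D_def sum.distrib sum_distrib_left sum_distrib_right)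
   also have "\<dots> <= q s V + c / 2 * norm V" using elim(3) by (intro add_left_mono mult_right_mono) auto
   finally show ?thesis using c(2)[OF that] by (simp add: algebra_simps)
  qed
  have UW: "U \<inter> W s = {0}"
  proof
   show "U \<inter> W s <= {0}"
   proof
    fix V assume V: "V : U \<inter> W s"
    hence "q s V = 0" by (simp add: q_def W_def)
    hence "c / 2 * norm V <= 0" using qs[of V] V by simp
    thus "V : {0}" using c(1) by (simp add: mult_le_0_iff)
   qed
  qed (use subU subW in \<open>auto simp: subspace_def\<close>)
  \<comment> \<open>Left multiplication by one invertible intertwiner maps the centralizer onto all
    intertwiners. Hence the dimension is constant, although \<open>C\<close> need not approach 1 as
    s tends to 0.\<close>
  have "W s = (%V. C ** V) ` W 0"
  proof (intro equalityI subsetI)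
   fix V assume V: "V : W s"
   have "C' ** V : W 0"
   proof -
    have "(C' ** V) ** N i 0 = N i 0 ** (C' ** V)" if i: "i < m" for i
    proof -
     have "V ** N i 0 = N i s ** V" using V i by (simp add: W_def L_def)
     hence "(C' ** V) ** N i 0 = C' ** (N i s ** V)" by (simp add: matrix_mul_assoc[symmetric])
     also have "\<dots> = C' ** (N i s ** (C ** (C' ** V)))" by (simp add: matrix_mul_assoc C)
     also have "\<dots> = C' ** (C ** N i 0) ** (C' ** V)" by (simp add: C(3)[OF i] matrix_mul_assoc)
     also have "\<dots> = N i 0 ** (C' ** V)" by (simp add: matrix_mul_assoc C)
     finally show ?thesis .
    qed
    thus ?thesis by (simp add: W_def L_def)
   qed
   moreover have "V = C ** (C' ** V)" by (simp add: matrix_mul_assoc C)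
   ultimately show "V : (%V. C ** V) ` W 0" by blast
  next
   fix V assume "V : (%V. C ** V) ` W 0"
   then obtain V' where V': "V = C ** V'" "V' : W 0" by blast
   have "V ** N i 0 = N i s ** V" if i: "i < m" for i
   proof -
    have "V ** N i 0 = C ** (V' ** N i 0)" by (simp add: V' matrix_mul_assoc)
    also have "\<dots> = C ** (N i 0 ** V')" using V'(2) i by (simp add: W_def L_def)
    also have "\<dots> = (C ** N i 0) ** V'" by (simp add: matrix_mul_assoc)
    also have "\<dots> = N i s ** V" by (simp add: C(3)[OF i] V' matrix_mul_assoc)
    finally show ?thesis .
   qed
   thus "V : W s" by (simp add: W_def L_def)
  qed
  moreover have "linear (%V :: complex ^ 'n ^ 'n. C ** V)" by (rule linearI) (simp_all add: matrix_ring_simps scale)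
  moreover have "inj (%V :: complex ^ 'n ^ 'n. C ** V)"
  proof (rule injI)
   fix x y assume "C ** x = C ** y"
   hence "C' ** (C ** x) = C' ** (C ** y)" by simp
   thus "x = y" by (simp add: matrix_mul_assoc C)
  qed
  ultimately have dimW: "dim (W s) = dim (W 0)" using dim_image_eq[of "%V. C ** V" "W 0"] by (simp add: inj_on_subset)
  \<comment> \<open>By dimensions \<open>U\<close> and \<open>W s\<close> are complementary, so the
    identity splits as R + V. The intertwiner V = 1 - R differs from 1 by \<open>R\<close>, which
    the bound on \<open>U\<close> shows to be small.\<close>
  define Sm where "Sm = {x + y | x y. x : U & y : W s}"
  have "dim Sm + dim (U \<inter> W s) = dim U + dim (W s)" unfolding Sm_def by (rule dim_sums_Int[OF subU subW])
  hence "dim Sm = DIM(complex ^ 'n ^ 'n)" using dimU dimW UW by simp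
  hence "span Sm = UNIV" using dim_eq_full by blast
  moreover have "subspace Sm" unfolding Sm_def by (rule subspace_sums[OF subU subW])
  ultimately have "Sm = UNIV" using span_eq_iff[of Sm] by blast
  then obtain R V where RV: "mat 1 = R + V" "R : U" "V : W s" unfolding Sm_def by blast
  have "L s (mat 1) i = L s R i" if "i < m" for i using RV(3) that by (simp add: RV(1) linL W_def)
  hence LR: "L s R i = N i 0 - N i s" if "i < m" for i using that by (simp add: L_def)
  have "c / 2 * norm R <= q s R" by (rule qs[OF RV(2)])
  also have "q s R = D s" unfolding q_def D_def by (rule sum.cong) (auto simp: LR norm_minus_commute)
  finally have "norm R <= (2 * K / c) * norm s" using elim(2) c(1) by (simp add: field_simps)
  thus ?case using LR unfolding Good_def L_def by blast
 qed
 then obtain dl where dl: "dl > 0" "!!s. s ~= 0 ==> norm s < dl ==> \<exists>R. Good s R"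
  unfolding eventually_at by (auto simp: dist_norm)
 \<comment> \<open>The shift by 2 keeps every term below \<open>dl\<close> in absolute
   value.\<close>
 define s :: "nat => complex" where "s k = of_real (dl / (real k + 2))" for k
 have s: "s k ~= 0" "norm (s k) < dl" for k
 proof -
  have "dl / (real k + 2) > 0" using dl(1) by simp
  hence "dl / (real k + 2) ~= 0" by linarith
  thus "s k ~= 0" unfolding s_def of_real_eq_0_iff .
  have "dl * 1 < dl * (real k + 2)" by (intro mult_strict_left_mono dl) simp
  hence "dl / (real k + 2) < dl" using dl(1) by (simp add: pos_divide_less_eq)
  thus "norm (s k) < dl" using \<open>dl / (real k + 2) > 0\<close> by (simp only: s_def norm_of_real)
 qed
 obtain R where R: "!!k. Good (s k) (R k)" using dl(2)[OF s] by metis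
 \<comment> \<open>Bounded by \<open>2 * K / c\<close>, so a subsequence converges; its limit solves
   the equation up to sign.\<close>
 define E where "E k = mat (1 / s k) ** R k" for k
 have "E k : cball 0 (2 * K / c)" for k
 proof -
  have "norm (E k) = norm (R k) / norm (s k)" by (simp add: E_def norm_mat_mult norm_divide)
  also have "\<dots> <= 2 * K / c" using R[of k] s(1)[of k] by (simp add: Good_def pos_divide_le_eq)
  finally show ?thesis by simp
 qed
 then obtain E0 r where r: "strict_mono r" "(E \<circ> r) \<longlonglongrightarrow> E0"
  using compact_cball[of 0 "2 * K / c", unfolded compact_def] by metis
 have "s \<longlonglongrightarrow> 0"
 proof -
  have "(%k. dl / (real k + 2)) \<longlonglongrightarrow> 0" by real_asymp
  hence "(%k. complex_of_real (dl / (real k + 2))) \<longlonglongrightarrow> of_real 0" by (rule tendsto_of_real)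
  thus ?thesis unfolding s_def by simp
 qed
 hence "filterlim s (at 0) sequentially" using s(1) by (simp add: filterlim_at)
 hence fl: "filterlim (s \<circ> r) (at 0) sequentially"
  using filterlim_compose[OF _ filterlim_subseq[OF r(1)]] by (simp add: o_def)
 have "- N' i = E0 ** N i 0 - N i 0 ** E0" if i: "i < m" for i
 proof -
  have d: "((%k. mat (1 / s (r k)) ** (N i (s (r k)) - N i 0)) \<longlonglongrightarrow> N' i)"
   using filterlim_compose[OF der[OF i] fl] by (simp add: o_def)
  have "(%k. norm (N i (s (r k)) - N i 0)) \<longlonglongrightarrow> 0"
  proof -
   have "(%k. norm (s (r k)) * norm (mat (1 / s (r k)) ** (N i (s (r k)) - N i 0))) \<longlonglongrightarrow> norm (0::complex) * norm (N' i)"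
    using \<open>s \<longlonglongrightarrow> 0\<close> r(1) by (intro tendsto_mult tendsto_norm d) (auto dest: LIMSEQ_subseq_LIMSEQ simp: o_def)
   thus ?thesis using s(1) by (simp add: norm_mat_mult norm_divide)
  qed
  hence Ns: "(%k. N i (s (r k))) \<longlonglongrightarrow> N i 0" by (simp add: tendsto_norm_zero_iff LIM_zero_iff)
  have Er: "(%k. E (r k)) \<longlonglongrightarrow> E0" using r(2) by (simp add: o_def)
  have mult: "(%k. X k ** Y k) \<longlonglongrightarrow> X0 ** Y0" if "X \<longlonglongrightarrow> X0" "Y \<longlonglongrightarrow> Y0" for X Y and X0 Y0 :: "complex ^ 'n ^ 'n"
   unfolding matrix_matrix_mult_def by (intro tendsto_vec_lambda tendsto_sum tendsto_mult tendsto_vec_nth that)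
  have lim: "(%k. E (r k) ** N i 0 - N i (s (r k)) ** E (r k)) \<longlonglongrightarrow> E0 ** N i 0 - N i 0 ** E0"
   by (intro tendsto_diff mult Er Ns tendsto_const)
  have "E k ** N i 0 - N i (s k) ** E k = - (mat (1 / s k) ** (N i (s k) - N i 0))" for k
  proof -
   have "R k ** N i 0 - N i (s k) ** R k = N i 0 - N i (s k)" using R[of k] i by (simp add: Good_def)
   hence "mat (1 / s k) ** (R k ** N i 0 - N i (s k) ** R k) = mat (1 / s k) ** (N i 0 - N i (s k))" by simp
   moreover have "N i (s k) ** (mat (1 / s k) ** R k) = mat (1 / s k) ** (N i (s k) ** R k)"
    by (simp only: matrix_mul_assoc mat_commute[of "1 / s k" "N i (s k)"])
   ultimately show ?thesis by (simp add: E_def matrix_ring_simps)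
  qed
  hence "(%k. - (mat (1 / s (r k)) ** (N i (s (r k)) - N i 0))) \<longlonglongrightarrow> E0 ** N i 0 - N i 0 ** E0"
   using lim by simp
  moreover have "(%k. - (mat (1 / s (r k)) ** (N i (s (r k)) - N i 0))) \<longlonglongrightarrow> - N' i"
   by (intro tendsto_minus d)
  ultimately show ?thesis using LIMSEQ_unique by blast
 qed
 hence "N' i = (- E0) ** N i 0 - N i 0 ** (- E0)" if "i < m" for i
  using that by (simp add: matrix_ring_simps) (metis minus_diff_eq minus_minus)
 thus ?thesis by blast
qed

section \<open>Moebius maps and extension of sections over disks\<close>

lemma open_moebius_vimage:
 assumes det: "a * d ~= b * c" and S: "open S"
 shows "open (moebius a b c d -` S)"
proof -
 have eq: "moebius a b c d -` S =
   ((- {u. c * u + d = 0}) \<inter> (%u. (a * u + b) / (c * u + d)) -` (Pt -` S)) \<union>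
   ((- {u. a * u + b = 0}) \<inter> (%u. (c * u + d) / (a * u + b)) -` (inf_chart -` S))"
 proof -
  have "a * u + b ~= 0" if "c * u + d = 0" for u
  proof
   assume "a * u + b = 0"
   hence "c * (a * u + b) - a * (c * u + d) = 0" using that by simp
   hence "b * c - a * d = 0" by (simp add: algebra_simps)
   thus False using det by simp
  qed
  thus ?thesis by (auto simp: moebius_def inf_chart_def split: if_splits)
 qed
 have cl: "open (- {u. p * u + q = (0::complex)})" for p q by (intro open_Compl closed_Collect_eq continuous_intros)
 have "open ((- {u. c * u + d = 0}) \<inter> (%u. (a * u + b) / (c * u + d)) -` (Pt -` S))"
  by (rule continuous_open_preimage[OF _ cl]) (use S in \<open>auto simp: open_riemann_sphere_def intro!: continuous_intros\<close>)
 moreover have "open ((- {u. a * u + b = 0}) \<inter> (%u. (c * u + d) / (a * u + b)) -` (inf_chart -` S))"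
  by (rule continuous_open_preimage[OF _ cl]) (use S in \<open>auto simp: open_riemann_sphere_def intro!: continuous_intros\<close>)
 ultimately show ?thesis unfolding eq by blast
qed

lemma continuous_moebius: "a * d ~= b * c ==> continuous_on A (moebius a b c d)"
proof -
 assume "a * d ~= b * c"
 hence "continuous_on UNIV (moebius a b c d)"
  unfolding continuous_on_open_vimage[OF open_UNIV] using open_moebius_vimage by simp
 thus ?thesis using continuous_on_subset by blast
qed

lemma moebius_eq_Pt:
 assumes det: "a * d ~= b * c"
 shows "moebius a b c d u = Pt z \<longleftrightarrow> a - c * z ~= 0 & u = (d * z - b) / (a - c * z)"
proof
 assume "moebius a b c d u = Pt z"
 hence cd: "c * u + d ~= 0" and z: "z * (c * u + d) = a * u + b" by (auto simp: moebius_def split: if_splits)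
 have ac: "a - c * z ~= 0"
 proof
  assume "a - c * z = 0"
  moreover have "(a - c * z) * (c * u + d) = a * (c * u + d) - c * (z * (c * u + d))" by (simp add: algebra_simps)
  ultimately have "a * (c * u + d) - c * (a * u + b) = 0" using z by simp
  thus False using det by (simp add: algebra_simps)
 qed
 moreover have "u * (a - c * z) = d * z - b" using z by (simp add: algebra_simps)
 ultimately show "a - c * z ~= 0 & u = (d * z - b) / (a - c * z)" by (simp add: eq_divide_eq)
next
 assume *: "a - c * z ~= 0 & u = (d * z - b) / (a - c * z)"
 hence "c * u + d = (a * d - b * c) / (a - c * z)" "a * u + b = z * (a * d - b * c) / (a - c * z)"
  by (simp_all add: field_simps)
 thus "moebius a b c d u = Pt z" using * det by (simp add: moebius_def)
qed

text \<open>Exchanging numerator and denominator is the passage to the other chart, so statements at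
  infinity reduce to the affine part.\<close>

lemma moebius_swap:
 assumes "a * d ~= b * c"
 shows "inf_chart w = moebius a b c d u \<longleftrightarrow> Pt w = moebius c d a b u"
proof (cases "c * u + d = 0")
 case True
 have "a * u + b ~= 0"
 proof
  assume "a * u + b = 0"
  hence "a * (c * u + d) - c * (a * u + b) = 0" using True by simp
  thus False using assms by (simp add: algebra_simps)
 qed
 thus ?thesis using True by (simp add: moebius_def)
next
 case False
 thus ?thesis by (cases "a * u + b = 0"; cases "w = 0") (auto simp: moebius_def inf_chart_eq_Pt field_simps)
qed

lemma open_moebius_image:
 assumes det: "a * d ~= b * c" and U: "open U"
 shows "open (moebius a b c d ` U)"
proof -
 have P: "open (Pt -` moebius a b c d ` U)" if "a * d ~= b * c" for a b c d
 proof -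
  have "Pt -` moebius a b c d ` U = (- {z. a - c * z = 0}) \<inter> (%z. (d * z - b) / (a - c * z)) -` U"
  proof -
   have "Pt z = moebius a b c d u \<longleftrightarrow> a - c * z ~= 0 & u = (d * z - b) / (a - c * z)" for z u
    using moebius_eq_Pt[OF that] by metis
   thus ?thesis by (auto simp: image_iff)
  qed
  moreover have "open (- {z. a - c * z = 0})" by (intro open_Compl closed_Collect_eq continuous_intros)
  ultimately show ?thesis using U by (auto intro!: continuous_open_preimage continuous_intros)
 qed
 have "inf_chart -` moebius a b c d ` U = Pt -` moebius c d a b ` U" by (auto simp: image_iff moebius_swap[OF det])
 thus ?thesis using P[OF det] P[of c b d a] P[of c b a d] det unfolding open_riemann_sphere_def by (metis mult.commute)
qed

lemma moebius_inj:
 assumes det: "a * d ~= b * c" and eq: "moebius a b c d u = moebius a b c d v"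
 shows "u = v"
proof (cases "moebius a b c d u")
 case (Pt z) thus ?thesis using eq moebius_eq_Pt[OF det] by metis
next
 case Infty
 hence "c * u + d = 0" "c * v + d = 0" using eq by (auto simp: moebius_def split: if_splits)
 moreover have "c ~= 0" using calculation det by auto
 ultimately have "c * u = c * v" by (metis add_right_cancel)
 thus ?thesis using \<open>c ~= 0\<close> by simp
qed

context sphere_ode
begin

lemma sec_local:
 assumes D: "open D" "D <= X" and loc: "!!x. x : D ==> \<exists>f N. sec f N & x : N & (\<forall>y\<in>N. b y = f y)"
 shows "sec b D" unfolding sec_def
proof (intro conjI allI impI D)
 fix k z assume "chart k z : D"
 then obtain f N where f: "sec f N" "chart k z : N" "!!y. y : N ==> b y = f y" using loc by blast
 have "open (chart k -` N)" using f(1) open_chart_vimage sec_open by blast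
 from eventually_nhds_in_open[OF this, of z] have "\<forall>\<^sub>F u in nhds z. chart k u : N" using f(2) by simp
 hence "\<forall>\<^sub>F u in nhds z. b (chart k u) = f (chart k u)" by (rule eventually_mono) (rule f(3))
 from mder_cong[OF this] sec_mder[OF f(1,2)] show "mder (%u. b (chart k u)) (rhs k z (b (chart k z))) z" using f by simp
qed

text \<open>The punctured disk is parametrized by the left half plane via the exponential function and a
 disk automorphism that moves the puncture to the centre. The section lifts to the half plane, and
 the lift is periodic because it comes from \<open>D\<close> near the boundary.\<close>

lemma extend_over_disk:
 assumes det: "a * d ~= b * c" and rh: "rh > 1" and u0: "norm u0 <= 1"
  and D: "open D" "sec \<beta> D" "moebius a b c d ` (ball 0 rh - cball 0 1) <= D"
  and X: "moebius a b c d ` ball 0 rh - {moebius a b c d u0} <= X"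
 shows "\<exists>\<beta>'. sec \<beta>' (moebius a b c d ` ball 0 rh - {moebius a b c d u0}) &
  (\<forall>x\<in>moebius a b c d ` (ball 0 rh - cball 0 1). \<beta>' x = \<beta> x)"
proof -
 define M where "M = moebius a b c d"
 \<comment> \<open>The larger disk is scaled to the unit disk. \<open>uu\<close> maps the unit disk
   onto it with 0 going to the puncture \<open>u0\<close>, and \<open>vv\<close> is the inverse
   map.\<close>
 define w0 where "w0 = u0 / of_real rh"
 have w0: "norm w0 < 1" using rh u0 by (simp add: w0_def norm_divide)
 define uu where "uu v = of_real rh * Moebius_function 0 (- w0) v" for v
 define vv where "vv u = Moebius_function 0 w0 (u / of_real rh)" for u
 have uu_ball: "uu v : ball 0 rh" if "norm v < 1" for v
  using Moebius_function_norm_lt_1[of "- w0" v 0] that w0 rh by (simp add: uu_def norm_mult)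
 have vv_ball: "norm (vv u) < 1" if "u : ball 0 rh" for u
  unfolding vv_def by (rule Moebius_function_norm_lt_1) (use that w0 rh in \<open>auto simp: norm_divide\<close>)
 have vvuu: "vv (uu v) = v" if "norm v < 1" for v
  using Moebius_function_compose[of w0 "- w0" v] that w0 rh by (simp add: uu_def vv_def)
 have uuvv: "uu (vv u) = u" if "u : ball 0 rh" for u using Moebius_function_compose[of "- w0" w0 "u / of_real rh"] that w0 rh
  by (simp add: uu_def vv_def norm_divide)
 have uu0: "uu 0 = u0" using rh by (simp add: uu_def Moebius_function_def w0_def)
 have holo_uu: "uu holomorphic_on ball 0 1"
  unfolding uu_def using w0 by (intro holomorphic_intros Moebius_function_holomorphic) auto
 have holo_vv: "vv holomorphic_on ball 0 rh"
 proof -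
  have "Moebius_function 0 w0 \<circ> (%u. u / of_real rh) holomorphic_on ball 0 rh"
   by (rule holomorphic_on_compose_gen[OF _ Moebius_function_holomorphic[OF w0]])
    (use rh in \<open>auto intro!: holomorphic_intros simp: norm_divide\<close>)
  thus ?thesis by (simp add: vv_def[abs_def] o_def)
 qed
 define H where "H = {ze::complex. Re ze < 0}"
 have H: "open H" "convex H" by (simp_all add: H_def open_halfspace_Re_lt convex_halfspace_Re_lt)
 have expH: "norm (exp ze) < 1" if "ze : H" for ze using that by (simp add: H_def)
 define e where "e ze = uu (exp ze)" for ze
 have holo_e: "e holomorphic_on H"
 proof -
  have "uu \<circ> exp holomorphic_on H"
   by (rule holomorphic_on_compose_gen[OF _ holo_uu]) (auto intro!: holomorphic_intros dest: expH)
  thus ?thesis by (simp add: e_def[abs_def] o_def)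
 qed
 have e_ball: "e ze : ball 0 rh - {u0}" if "ze : H" for ze
 proof -
  have "e ze ~= u0"
  proof
   assume "e ze = u0"
   hence "vv (uu (exp ze)) = vv (uu 0)" by (simp add: e_def uu0)
   thus False using vvuu[OF expH[OF that]] vvuu[of 0] by simp
  qed
  thus ?thesis using uu_ball[OF expH[OF that]] by (simp add: e_def)
 qed
 have e_surj: "\<exists>ze\<in>H. e ze = u" if u: "u : ball 0 rh - {u0}" for u
 proof -
  have "vv u ~= 0" using uuvv[of u] u uu0 by auto
  hence "exp (Ln (vv u)) = vv u" by simp
  moreover have "Ln (vv u) : H" using vv_ball[of u] u \<open>vv u ~= 0\<close> by (simp add: H_def)
  ultimately show ?thesis using uuvv[of u] u by (intro bexI[of _ "Ln (vv u)"]) (auto simp: e_def)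
 qed
 have e_inj: "exp ze = exp ze'" if "ze : H" "ze' : H" "e ze = e ze'" for ze ze'
  using vvuu[OF expH[OF that(1)]] vvuu[OF expH[OF that(2)]] that(3) by (metis e_def)
 define ph where "ph ze = M (e ze)" for ze
 have phX: "ph ` H <= X"
 proof
  fix x assume "x : ph ` H"
  then obtain ze where ze: "ze : H" "x = M (e ze)" by (auto simp: ph_def)
  have "e ze ~= u0" using e_ball[OF ze(1)] by blast
  hence "M (e ze) ~= M u0" using moebius_inj[OF det, of "e ze" u0] unfolding M_def by metis
  moreover have "M (e ze) : M ` ball 0 rh" using e_ball[OF ze(1)] by auto
  ultimately show "x : X" using subsetD[OF X[folded M_def], of x] ze(2) by simp
 qed
 have cont_e: "continuous_on H e" using holo_e by (rule holomorphic_on_imp_continuous_on)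
 have cont_ph: "continuous_on H ph"
  unfolding ph_def M_def by (rule continuous_on_compose2[OF continuous_moebius[OF det] cont_e]) auto
 obtain r where r: "0 < r" "r < 1" "!!u. u : cball 0 1 ==> norm (vv u) <= r"
 proof -
  have sub: "cball 0 1 <= ball 0 rh" using rh by auto
  have "continuous_on (cball 0 1) (%u. norm (vv u))"
   by (intro continuous_on_norm continuous_on_subset[OF holomorphic_on_imp_continuous_on[OF holo_vv] sub])
  from continuous_attains_sup[OF compact_cball _ this]
  obtain x where x: "x : cball 0 1" "!!y. y : cball 0 1 ==> norm (vv y) <= norm (vv x)" by auto
  have "norm (vv x) < 1" using vv_ball x(1) sub by blast
  thus thesis using x(2) by (intro that[of "max (norm (vv x)) (1/2)"]) (auto simp: le_max_iff_disj)
 qed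
 \<comment> \<open>The strip where the modulus of exp exceeds \<open>r\<close>: it is mapped outside
   the closed unit disk, that is, into the annulus contained in \<open>D\<close>.\<close>
 define T where "T = {ze. ln r < Re ze} \<inter> H"
 have T: "convex T" "T <= H" unfolding T_def H_def by (auto intro!: convex_Int convex_halfspace_Re_gt convex_halfspace_Re_lt)
 have phT: "ph ze : M ` (ball 0 rh - cball 0 1)" if "ze : T" for ze
 proof -
  have ze: "ze : H" "ln r < Re ze" using that by (auto simp: T_def)
  have "e ze \<notin> cball 0 1"
  proof
   assume "e ze : cball 0 1"
   hence "norm (exp ze) <= r" using r(3) vvuu[OF expH[OF ze(1)]] by (metis e_def)
   hence "exp (Re ze) <= exp (ln r)" using r(1) by simp
   thus False using ze(2) by simp
  qed
  thus ?thesis using e_ball[OF ze(1)] by (auto simp: ph_def)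
 qed
 define ze1 where "ze1 = complex_of_real (ln r / 2)"
 have lnr: "ln r < 0" using r by simp
 have ze1: "ze1 : T" using lnr by (simp add: ze1_def T_def H_def)
 hence ze1H: "ze1 : H" using T by blast
 obtain u where u: "lift H ph u" "u ze1 = \<beta> (ph ze1)" using lift_convex_exists[OF H(2) ze1H cont_ph phX] by blast
 have uT: "u ze = \<beta> (ph ze)" if "ze : T" for ze
 proof (rule lift_unique[OF convex_connected[OF T(1)], of ph u "%ze. \<beta> (ph ze)" ze1])
  show "lift T ph (%ze. \<beta> (ph ze))" by (rule lift_section[OF D(2)]) (use phT D(3) in \<open>auto simp: M_def\<close>)
  show "lift T ph u" by (rule lift_subset[OF u(1) T(2)])
  show "continuous_on T ph" "ph ` T <= X" using cont_ph phX T(2) by (auto intro: continuous_on_subset)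
 qed (use u that ze1 in auto)
 \<comment> \<open>Both sides are lifts of the same map; inside the strip \<open>T\<close> they are
   given by \<beta>, hence agree there and so everywhere.\<close>
 have per1: "u (ze + 2 * of_real pi * \<i>) = u ze" if "ze : H" for ze
 proof (rule lift_unique[OF convex_connected[OF H(2)] cont_ph phX _ u(1) ze1H _ that])
  have ep: "ph (ze + 2 * of_real pi * \<i>) = ph ze" for ze by (simp add: ph_def e_def exp_add)
  have "lift H (%ze. ph (ze + 2 * of_real pi * \<i>)) (%ze. u (ze + 2 * of_real pi * \<i>))"
   by (rule lift_compose[OF u(1)]) (auto simp: H_def intro!: continuous_intros)
  thus "lift H ph (%ze. u (ze + 2 * of_real pi * \<i>))" by (simp add: ep)
  have "ze1 + 2 * of_real pi * \<i> : T" using ze1 by (simp add: T_def H_def)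
  thus "u (ze1 + 2 * of_real pi * \<i>) = u ze1" using uT ze1 ep by simp
 qed
 have pern: "u (ze + of_nat n * (2 * of_real pi * \<i>)) = u ze" if "ze : H" for ze n
 proof (induction n)
  case (Suc n)
  have "ze + of_nat n * (2 * of_real pi * \<i>) : H" using that by (simp add: H_def)
  from per1[OF this] Suc show ?case by (simp add: algebra_simps)
 qed simp
 have per: "u ze = u ze'" if z: "ze : H" "ze' : H" "exp ze = exp ze'" for ze ze'
 proof -
  obtain n :: int where n: "ze = ze' + (of_int (2 * n) * of_real pi) * \<i>" using z(3) by (auto simp: exp_eq)
  show ?thesis
  proof (cases n)
   case (nonneg k)
   hence "ze = ze' + of_nat k * (2 * of_real pi * \<i>)" using n by simp
   thus ?thesis using pern[OF z(2)] by simp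
  next
   case (neg k)
   hence "(of_int n :: complex) = - of_nat (Suc k)" by simp
   hence "ze' = ze + of_nat (Suc k) * (2 * of_real pi * \<i>)" unfolding n by (simp del: of_nat_Suc)
   thus ?thesis using pern[OF z(1), of "Suc k"] by (simp only:)
  qed
 qed
 define \<beta>' where "\<beta>' x = u (SOME ze. ze : H & ph ze = x)" for x
 have \<beta>': "\<beta>' (ph ze) = u ze" if "ze : H" for ze
 proof -
  define ze' where "ze' = (SOME ze'. ze' : H & ph ze' = ph ze)"
  have "ze' : H & ph ze' = ph ze" unfolding ze'_def by (rule someI[of _ ze]) (use that in simp)
  hence "exp ze' = exp ze" using e_inj[of ze' ze] that moebius_inj[OF det] by (auto simp: ph_def M_def)
  thus ?thesis using per \<open>ze' : H & _\<close> that unfolding \<beta>'_def ze'_def by blast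
 qed
 define Om where "Om = M ` ball 0 rh - {M u0}"
 have "open Om" unfolding Om_def M_def by (intro open_delete open_moebius_image det open_ball)
 have Om: "\<exists>ze\<in>H. x = ph ze" if xO: "x : Om" for x
 proof -
  obtain w where w: "w : ball 0 rh" "x = M w" using xO by (auto simp: Om_def)
  hence "w : ball 0 rh - {u0}" using xO by (auto simp: Om_def)
  with w show ?thesis using e_surj unfolding ph_def by metis
 qed
 have nonconst: "\<not> e constant_on H"
 proof
  assume "e constant_on H"
  then obtain y where y: "!!ze. ze : H ==> e ze = y" unfolding constant_on_def by blast
  have "exp (-1) = exp (-2 :: complex)" by (rule e_inj) (use y in \<open>auto simp: H_def\<close>)
  hence "exp (Re (-1)) = exp (Re (-2))" by (metis norm_exp_eq_Re)
  thus False by simp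
 qed
 have "sec \<beta>' Om"
 proof (rule sec_local[OF \<open>open Om\<close>])
  show "Om <= X" using X by (simp add: Om_def M_def)
  fix x assume "x : Om"
  then obtain ze0 where ze0: "ze0 : H" "x = ph ze0" using Om by blast
  from liftE[OF u(1) ze0(1)] obtain f N \<epsilon> where f: "sec f N" "ph ze0 : N" "\<epsilon> > 0"
   "!!ze. ze : H ==> dist ze ze0 < \<epsilon> ==> u ze = f (ph ze)" by blast
  define B where "B = ball ze0 \<epsilon> \<inter> H"
  \<comment> \<open>Openness turns the local description of the lift on the half plane into one on a
    neighbourhood in the punctured disk.\<close>
  have "open (e ` B)"
   by (rule open_mapping_thm[OF holo_e H(1) convex_connected[OF H(2)] _ _ nonconst]) (use H in \<open>auto simp: B_def\<close>)
  hence oW: "open (ph ` B)" using open_moebius_image[OF det, of "e ` B"] by (simp add: ph_def[abs_def] M_def image_image)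
  have "sec f (N \<inter> ph ` B)" by (rule sec_restrict[OF f(1)]) (use oW f(1) sec_open in auto)
  moreover have "x : N \<inter> ph ` B" using f ze0 by (auto simp: B_def)
  moreover have "\<beta>' y = f y" if "y : N \<inter> ph ` B" for y
   using that \<beta>' f(4) by (auto simp: B_def dist_commute)
  ultimately show "\<exists>f N. sec f N & x : N & (\<forall>y\<in>N. \<beta>' y = f y)" by blast
 qed
 moreover have "\<beta>' x = \<beta> x" if "x : M ` (ball 0 rh - cball 0 1)" for x
 proof -
  define A where "A = {w::complex. 1 < norm (w - 0) & norm (w - 0) < rh}"
  have A: "ball 0 rh - cball 0 1 = A" by (auto simp: A_def)
  have conA: "connected A" unfolding A_def by (rule connected_annulus) simp
  have MA: "M w : Om" "M w : D" if "w : A" for w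
  proof -
   show "M w : D" using D(3) that A unfolding M_def by blast
   have "w ~= u0" using that u0 by (auto simp: A_def)
   hence "M w ~= M u0" using moebius_inj[OF det, of w u0] unfolding M_def by metis
   thus "M w : Om" using that A by (auto simp: Om_def)
  qed
  have "ph ze1 : M ` A" using phT[OF ze1] A by simp
  then obtain w1 where w1: "w1 : A" "M w1 = ph ze1" by auto
  obtain w where w: "w : A" "x = M w" using \<open>x : M ` _\<close> A by auto
  have "\<beta>' (M w) = \<beta> (M w)"
  proof (rule lift_unique[OF conA, of M "%w. \<beta>' (M w)" "%w. \<beta> (M w)" w1])
   show "continuous_on A M" unfolding M_def by (rule continuous_moebius[OF det])
   show "M ` A <= X" using MA \<open>sec \<beta>' Om\<close> by (auto simp: sec_def)
   show "lift A M (%w. \<beta>' (M w))" by (rule lift_section[OF \<open>sec \<beta>' Om\<close>]) (rule MA)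
   show "lift A M (%w. \<beta> (M w))" by (rule lift_section[OF D(2)]) (rule MA)
   show "\<beta>' (M w1) = \<beta> (M w1)" using w1 \<beta>'[OF ze1H] u(2) by simp
  qed (use w w1 in auto)
  thus ?thesis using w by simp
 qed
 ultimately show ?thesis unfolding Om_def M_def by blast
qed

end

text \<open>Multiplication by high powers of z - al removes the singularities, and an entire
  function of polynomial growth is a polynomial by Liouville's theorem.\<close>

lemma rational_of_growth:
 fixes f :: "complex => complex"
 assumes S: "finite S" and f: "f holomorphic_on - S"
  and pole: "!!al. al : S ==> \<exists>C N r. r > 0 & (\<forall>h. 0 < norm h & norm h < r --> norm (f (al + h)) * norm h ^ N <= C)"
  and infty: "\<exists>C N A. \<forall>z. A <= norm z --> norm (f z) <= C * norm z ^ N"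
 shows "\<exists>p N. \<forall>z. z \<notin> S --> f z * (\<Prod>al\<in>S. (z - al) ^ N) = poly p z"
proof -
 obtain C N r where CN: "!!al. al : S ==> r al > 0"
  "!!al h. al : S ==> 0 < norm h ==> norm h < r al ==> norm (f (al + h)) * norm h ^ N al <= C al" using pole by metis
 \<comment> \<open>Two orders more than the growth requires: the product is then O(|h|^2), hence
   differentiable with derivative 0 when given the value 0 at the point. The inserted 0 covers empty
   \<open>S\<close>.\<close>
 define M where "M = Max (insert 0 (N ` S)) + 2"
 have M: "N al + 2 <= M" if "al : S" for al using that S by (simp add: M_def)
 define q where "q z = (\<Prod>al\<in>S. (z - al) ^ M)" for z
 define g where "g z = (if z : S then 0 else f z * q z)" for z
 have "(g has_field_derivative 0) (at al)" if al: "al : S" for al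
 proof -
  define q1 where "q1 z = (\<Prod>\<beta>\<in>S - {al}. (z - \<beta>) ^ M)" for z
  have q: "q z = (z - al) ^ M * q1 z" for z unfolding q_def q1_def using S al by (subst prod.remove[of S al]) auto
  have "continuous_on (cball 0 1) (%h. q1 (al + h))" unfolding q1_def by (intro continuous_intros)
  hence "bounded ((%h. q1 (al + h)) ` cball 0 1)" by (intro compact_imp_bounded compact_continuous_image) auto
  then obtain K where K: "K > 0" "!!h. norm h <= 1 ==> norm (q1 (al + h)) <= K" unfolding bounded_pos by auto
  have "\<forall>\<^sub>F h in at 0. norm ((g (al + h) - g al) / h) <= \<bar>C al\<bar> * K * norm h"
  proof -
   have "\<forall>\<^sub>F h in at (0::complex). dist h 0 < min (r al) 1 & h ~= 0"
    using CN(1)[OF al] by (auto simp: eventually_at intro!: exI[of _ "min (r al) 1"])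
   thus ?thesis
   proof eventually_elim
    case (elim h)
    hence h: "0 < norm h" "norm h < r al" "norm h <= 1" by auto
    show ?case
    proof (cases "al + h : S")
     case True thus ?thesis using al K by (simp add: g_def)
    next
     case False
     have "norm h ^ M <= norm h ^ (N al + 2)" using h M[OF al] by (intro power_decreasing) auto
     hence "norm (f (al + h)) * norm h ^ M <= norm (f (al + h)) * norm h ^ (N al + 2)" by (intro mult_left_mono) auto
     also have "\<dots> = (norm (f (al + h)) * norm h ^ N al) * norm h ^ 2" by (simp add: power_add power2_eq_square)
     also have "\<dots> <= \<bar>C al\<bar> * norm h ^ 2" using CN(2)[OF al h(1,2)] by (intro mult_right_mono) auto
     finally have "(norm (f (al + h)) * norm h ^ M) * norm (q1 (al + h)) <= (\<bar>C al\<bar> * norm h ^ 2) * K"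
      by (rule mult_mono) (use K h in auto)
     hence "norm (g (al + h)) <= \<bar>C al\<bar> * norm h ^ 2 * K"
      using False by (simp add: g_def q norm_mult norm_power mult.assoc)
     hence "norm (g (al + h)) / norm h <= (\<bar>C al\<bar> * norm h ^ 2 * K) / norm h"
      using h by (intro divide_right_mono) auto
     thus ?thesis using al h by (simp add: g_def norm_divide power2_eq_square mult_ac)
    qed
   qed
  qed
  moreover have "((%h::complex. \<bar>C al\<bar> * K * norm h) \<longlongrightarrow> 0) (at 0)"
   by (intro tendsto_mult_right_zero tendsto_norm_zero tendsto_ident_at)
  ultimately have "((%h. (g (al + h) - g al) / h) \<longlongrightarrow> 0) (at 0)" by (rule Lim_null_comparison)
  thus ?thesis by (simp add: DERIV_def)
 qed
 moreover have "\<exists>D. (g has_field_derivative D) (at z)" if z: "z \<notin> S" for z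
 proof -
  have oS: "open (- S)" using S by (intro open_Compl finite_imp_closed)
  have "(%z. f z * q z) holomorphic_on - S" unfolding q_def by (intro holomorphic_intros f)
  then obtain D where D: "((%z. f z * q z) has_field_derivative D) (at z)"
   using z oS unfolding holomorphic_on_open[OF oS] by auto
  have "\<forall>\<^sub>F w in nhds z. f w * q w = g w"
   using eventually_nhds_in_open[OF oS, of z] z by (auto elim!: eventually_mono simp: g_def)
  from DERIV_cong_ev[OF refl this refl] D show ?thesis by blast
 qed
 ultimately have hol: "g holomorphic_on UNIV" unfolding holomorphic_on_open[OF open_UNIV] by metis
 obtain C' N' A where inf: "!!z. A <= norm z ==> norm (f z) <= C' * norm z ^ N'" using infty by blast
 define B where "B = Max (insert 0 (norm ` S))"
 have B: "norm al <= B" if "al : S" for al using that S by (simp add: B_def)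
 have B0: "B \<ge> 0" using S by (simp add: B_def)
 define A' where "A' = max (max A B) 1"
 have gb: "norm (g z) <= (\<bar>C'\<bar> * 2 ^ (M * card S)) * norm z ^ (N' + M * card S)" if z: "A' <= norm z" for z
 proof -
  have zA: "A <= norm z" "B <= norm z" "1 <= norm z" using z by (auto simp: A'_def)
  have "norm (q z) = (\<Prod>al\<in>S. norm (z - al) ^ M)" by (simp add: q_def norm_power flip: prod_norm)
  also have "\<dots> <= (\<Prod>al\<in>S. (2 * norm z) ^ M)"
  proof (rule prod_mono, safe)
   fix al assume "al : S"
   hence "norm (z - al) <= 2 * norm z" using norm_triangle_ineq4[of z al] B zA by fastforce
   thus "norm (z - al) ^ M <= (2 * norm z) ^ M" by (intro power_mono) auto
  qed auto
  also have "\<dots> = 2 ^ (M * card S) * norm z ^ (M * card S)" by (simp add: power_mult_distrib power_mult)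
  finally have qb: "norm (q z) <= 2 ^ (M * card S) * norm z ^ (M * card S)" .
  have fb: "norm (f z) <= \<bar>C'\<bar> * norm z ^ N'"
  proof -
   have "C' * norm z ^ N' <= \<bar>C'\<bar> * norm z ^ N'" by (intro mult_right_mono) auto
   thus ?thesis using inf[OF zA(1)] by linarith
  qed
  have "norm (g z) <= norm (f z) * norm (q z)" by (simp add: g_def norm_mult)
  also have "\<dots> <= (\<bar>C'\<bar> * norm z ^ N') * (2 ^ (M * card S) * norm z ^ (M * card S))"
   by (intro mult_mono fb qb) auto
  finally show ?thesis by (simp add: power_add mult_ac)
 qed
 define n where "n = N' + M * card S"
 define p where "p = (\<Sum>k\<le>n. monom ((deriv ^^ k) g 0 / fact k) k)"
 have "g z = poly p z" for z using Liouville_polynomial[OF hol, of A' "\<bar>C'\<bar> * 2 ^ (M * card S)" n z] gb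
  by (simp add: p_def poly_sum poly_monom n_def)
 hence "f z * (\<Prod>al\<in>S. (z - al) ^ M) = poly p z" if "z \<notin> S" for z using that by (metis g_def q_def)
 thus ?thesis by blast
qed

section \<open>Growth at regular singular points\<close>

text \<open>Moderate growth at 0, a condition on absolute values only. It is stable under sums and
  products and amounts to at most a pole once holomorphy near the point is known.\<close>

definition pole_growth :: "(complex => complex) => bool" where
 "pole_growth f \<longleftrightarrow> (\<exists>C N. \<forall>\<^sub>F h in at 0. norm (f h) * norm h ^ N <= C)"

lemma eventually_norm_le_1: "\<forall>\<^sub>F h in at (0::complex). norm h <= 1"
 unfolding eventually_at by (intro exI[of _ 1]) auto

lemma pole_growthE:
 assumes "pole_growth f"
 obtains C N where "C \<ge> 0" "!!M. N <= M ==> \<forall>\<^sub>F h in at 0. norm (f h) * norm h ^ M <= C"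
proof -
 obtain C N where CN: "\<forall>\<^sub>F h in at 0. norm (f h) * norm h ^ N <= C"
  using assms unfolding pole_growth_def by blast
 have "\<forall>\<^sub>F h in at 0. norm (f h) * norm h ^ M <= \<bar>C\<bar>" if "N <= M" for M using CN eventually_norm_le_1
 proof eventually_elim
  case (elim h)
  have "norm (f h) * norm h ^ M <= norm (f h) * norm h ^ N" by (intro mult_left_mono power_decreasing that elim) auto
  thus ?case using elim by linarith
 qed
 thus ?thesis using that[of "\<bar>C\<bar>" N] by auto
qed

lemma pole_growth_add:
 assumes "pole_growth f" "pole_growth g" shows "pole_growth (%h. f h + g h)"
proof -
 obtain C N where f: "C \<ge> 0" "!!M. N <= M ==> \<forall>\<^sub>F h in at 0. norm (f h) * norm h ^ M <= C"
  using pole_growthE[OF assms(1)] by metis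
 obtain C' N' where g: "C' \<ge> 0" "!!M. N' <= M ==> \<forall>\<^sub>F h in at 0. norm (g h) * norm h ^ M <= C'"
  using pole_growthE[OF assms(2)] by metis
 have "\<forall>\<^sub>F h in at 0. norm (f h + g h) * norm h ^ max N N' <= C + C'"
  using f(2)[OF max.cobounded1, of N'] g(2)[OF max.cobounded2, of N]
 proof eventually_elim
  case (elim h)
  have "norm (f h + g h) * norm h ^ max N N' <= (norm (f h) + norm (g h)) * norm h ^ max N N'"
   by (intro mult_right_mono norm_triangle_ineq) auto
  thus ?case using elim by (simp add: algebra_simps)
 qed
 thus ?thesis unfolding pole_growth_def by blast
qed

lemma pole_growth_mult:
 assumes "pole_growth f" "pole_growth g" shows "pole_growth (%h. f h * g h)"
proof -
 obtain C N where f: "C \<ge> 0" "!!M. N <= M ==> \<forall>\<^sub>F h in at 0. norm (f h) * norm h ^ M <= C"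
  using pole_growthE[OF assms(1)] by metis
 obtain C' N' where g: "C' \<ge> 0" "!!M. N' <= M ==> \<forall>\<^sub>F h in at 0. norm (g h) * norm h ^ M <= C'"
  using pole_growthE[OF assms(2)] by metis
 have "\<forall>\<^sub>F h in at 0. norm (f h * g h) * norm h ^ (N + N') <= C * C'"
  using f(2)[OF order_refl] g(2)[OF order_refl]
 proof eventually_elim
  case (elim h)
  have "norm (f h * g h) * norm h ^ (N + N') = (norm (f h) * norm h ^ N) * (norm (g h) * norm h ^ N')"
   by (simp add: norm_mult power_add)
  also have "\<dots> <= C * C'" by (intro mult_mono elim f) auto
  finally show ?case .
 qed
 thus ?thesis unfolding pole_growth_def by blast
qed

lemma pole_growth_0: "pole_growth (%_. 0)" unfolding pole_growth_def by (intro exI[of _ 0] always_eventually) auto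

lemma pole_growth_sum: "(!!x. x : I ==> pole_growth (f x)) ==> pole_growth (%h. \<Sum>x\<in>I. f x h)"
 by (induction I rule: infinite_finite_induct) (auto intro: pole_growth_add pole_growth_0)

lemma pole_growth_cong:
 assumes "pole_growth f" "\<forall>\<^sub>F h in at 0. f h = g h" shows "pole_growth g"
proof -
 obtain C N where "\<forall>\<^sub>F h in at 0. norm (f h) * norm h ^ N <= C" using assms(1) unfolding pole_growth_def by blast
 hence "\<forall>\<^sub>F h in at 0. norm (g h) * norm h ^ N <= C" using assms(2) by eventually_elim auto
 thus ?thesis unfolding pole_growth_def by blast
qed

lemma pole_growth_matrix_mult:
 fixes X Y :: "complex => complex ^ 'n ^ 'n"
 assumes "!!i j. pole_growth (%h. X h $ i $ j)" "!!i j. pole_growth (%h. Y h $ i $ j)"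
 shows "pole_growth (%h. (X h ** Y h) $ i $ j)"
proof -
 have "pole_growth (%h. \<Sum>k\<in>UNIV. X h $ i $ k * Y h $ k $ j)"
  by (rule pole_growth_sum, rule pole_growth_mult, rule assms(1), rule assms(2))
 thus ?thesis by (simp add: matrix_matrix_mult_def)
qed

lemma pole_growth_matrix:
 fixes X :: "complex => complex ^ 'n ^ 'n"
 assumes "!!i j. pole_growth (%h. X h $ i $ j)"
 obtains C N where "C \<ge> 0" "\<forall>\<^sub>F h in at 0. norm (X h) * norm h ^ N <= C"
proof -
 have pg: "pole_growth (%h. \<Sum>i\<in>UNIV. \<Sum>j\<in>UNIV. of_real (norm (X h $ i $ j)))"
  by (rule pole_growth_sum, rule pole_growth_sum) (use assms in \<open>simp add: pole_growth_def\<close>)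
 obtain C N where C: "C \<ge> 0" "\<forall>\<^sub>F h in at 0. norm (\<Sum>i\<in>UNIV. \<Sum>j\<in>UNIV. complex_of_real (norm (X h $ i $ j))) * norm h ^ N <= C"
  by (rule pole_growthE[OF pg]) (use order_refl in blast)
 have "\<forall>\<^sub>F h in at 0. norm (X h) * norm h ^ N <= C" using C(2)
 proof eventually_elim
  case (elim h)
  have "(\<Sum>i\<in>UNIV. \<Sum>j\<in>UNIV. complex_of_real (norm (X h $ i $ j))) = of_real (\<Sum>i\<in>UNIV. \<Sum>j\<in>UNIV. norm (X h $ i $ j))"
   by simp
  hence "norm (\<Sum>i\<in>UNIV. \<Sum>j\<in>UNIV. complex_of_real (norm (X h $ i $ j))) = \<bar>\<Sum>i\<in>UNIV. \<Sum>j\<in>UNIV. norm (X h $ i $ j)\<bar>"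
   by (simp only: norm_of_real)
  hence "norm (X h) <= norm (\<Sum>i\<in>UNIV. \<Sum>j\<in>UNIV. complex_of_real (norm (X h $ i $ j)))"
   using matrix_norm_le_sum[of "X h"] by linarith
  hence "norm (X h) * norm h ^ N <= norm (\<Sum>i\<in>UNIV. \<Sum>j\<in>UNIV. complex_of_real (norm (X h $ i $ j))) * norm h ^ N"
   by (intro mult_right_mono) auto
  thus ?case using elim by linarith
 qed
 thus ?thesis using C(1) that by blast
qed

lemma pole_growth_entry:
 fixes X :: "complex => complex ^ 'n ^ 'n"
 assumes "\<forall>\<^sub>F h in at 0. norm (X h) * norm h ^ N <= C"
 shows "pole_growth (%h. X h $ i $ j)" unfolding pole_growth_def
proof (intro exI)
 show "\<forall>\<^sub>F h in at 0. norm (X h $ i $ j) * norm h ^ N <= C" using assms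
 proof eventually_elim
  case (elim h)
  have "norm (X h $ i $ j) * norm h ^ N <= norm (X h) * norm h ^ N" by (intro mult_right_mono entry_le_norm) auto
  thus ?case using elim by linarith
 qed
qed

lemma laurent_bound:
 assumes f: "f has_laurent_expansion L" and L: "!!k. k < - int N ==> fls_nth L k = 0"
 shows "\<exists>C. \<forall>\<^sub>F h in at 0. norm (f h) * norm h ^ N <= C"
proof -
 have 1: "(%x. f x * x powi int N) has_laurent_expansion (fls_shift (- int N) L)" by (rule has_laurent_expansion_shift[OF f])
 have "fls_subdegree (fls_shift (- int N) L) \<ge> 0" by (rule fls_subdegree_ge0I) (use L in auto)
 from has_laurent_expansion_imp_tendsto_0[OF 1 this]
 have "((%x. norm (f x * x powi int N)) \<longlongrightarrow> norm (fls_nth (fls_shift (- int N) L) 0)) (at 0)"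
  by (rule tendsto_norm)
 hence "\<forall>\<^sub>F x in at 0. norm (f x * x powi int N) < norm (fls_nth (fls_shift (- int N) L) 0) + 1"
  by (rule order_tendstoD) simp
 thus ?thesis
  by (intro exI[of _ "norm (fls_nth (fls_shift (- int N) L) 0) + 1"]) (auto elim!: eventually_mono simp: norm_mult norm_power)
qed

lemma laurent_pole_growth:
 assumes f: "f has_laurent_expansion L" shows "pole_growth f"
proof -
 have "fls_nth L k = 0" if "k < - int (nat (- fls_subdegree L))" for k using that by (intro fls_eq0_below_subdegree) linarith
 from laurent_bound[OF f this] show ?thesis unfolding pole_growth_def by blast
qed

text \<open>After splitting off the exact power of x - al from \<open>q\<close> the remaining
  quotient is bounded near the point.\<close>

lemma algebraic_pole_growth:
 fixes f :: "complex => complex"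
 assumes "q ~= 0" "\<forall>\<^sub>F h in at 0. f h * poly q (al + h) = poly p (al + h)"
 shows "pole_growth f"
proof -
 obtain r where r: "q = [:- al, 1:] ^ Polynomial.order al q * r" "\<not> [:- al, 1:] dvd r"
  using order_decomp[OF assms(1)] by blast
 have r0: "poly r al ~= 0" using r(2) by (simp add: poly_eq_0_iff_dvd)
 have "((%h. poly p (al + h) / poly r (al + h)) \<longlongrightarrow> poly p (al + 0) / poly r (al + 0)) (at 0)"
  by (intro tendsto_intros) (use r0 in auto)
 hence "((%h. norm (poly p (al + h) / poly r (al + h))) \<longlongrightarrow> norm (poly p al / poly r al)) (at 0)"
  by (intro tendsto_norm) simp
 hence 1: "\<forall>\<^sub>F h in at 0. norm (poly p (al + h) / poly r (al + h)) < norm (poly p al / poly r al) + 1"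
  by (rule order_tendstoD) simp
 have "((%h. poly r (al + h)) \<longlongrightarrow> poly r (al + 0)) (at 0)" by (intro tendsto_intros)
 hence 2: "\<forall>\<^sub>F h in at 0. poly r (al + h) ~= 0" using r0 by (intro tendsto_imp_eventually_ne) auto
 have "\<forall>\<^sub>F h in at 0. norm (f h) * norm h ^ Polynomial.order al q <= norm (poly p al / poly r al) + 1"
  using 1 2 assms(2)
 proof eventually_elim
  case (elim h)
  have "f h * (h ^ Polynomial.order al q * poly r (al + h)) = poly p (al + h)"
   using elim(3) by (subst (asm) r(1)) (simp add: poly_power)
  hence "f h * h ^ Polynomial.order al q = poly p (al + h) / poly r (al + h)" using elim(2) by (simp add: field_simps)
  hence "norm (f h) * norm h ^ Polynomial.order al q = norm (poly p (al + h) / poly r (al + h))"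
   by (metis norm_mult norm_power)
  thus ?case using elim(1) by linarith
 qed
 thus ?thesis unfolding pole_growth_def by blast
qed

text \<open>On the ray h = h0 exp(-x) the simple pole of \<open>ta\<close> is absorbed by dh = -h
  dx: the coefficient becomes bounded and the inhomogeneity grows at most exponentially. Gronwall's
  inequality bounds \<beta> by an exponential in x, that is, by a power of 1/|h|, uniformly over all
  directions.\<close>

lemma fuchsian_growth:
 fixes \<beta> ta G :: "complex => complex ^ 'n::finite ^ 'n"
 assumes r: "r > 0" and ode: "!!h. h ~= 0 ==> norm h < r ==> mder \<beta> (ta h ** \<beta> h - \<beta> h ** ta h + G h) h"
  and ta: "!!h. h ~= 0 ==> norm h < r ==> norm (ta h) * norm h <= K"
  and G: "!!h. h ~= 0 ==> norm h < r ==> norm (G h) * norm h ^ N <= C"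
 shows "\<exists>C' N'. \<forall>\<^sub>F h in at 0. norm (\<beta> h) * norm h ^ N' <= C'"
proof -
 define rh where "rh = min (r / 2) (1 / 2)"
 have rh: "rh > 0" "rh < r" "rh < 1" using r by (auto simp: rh_def)
 have K0: "K \<ge> 0" using ta[of "of_real rh"] rh by (intro order_trans[OF _ ta[of "of_real rh"]]) auto
 have C0: "C \<ge> 0" using G[of "of_real rh"] rh by (intro order_trans[OF _ G[of "of_real rh"]]) auto
 have "continuous_on (sphere 0 rh) \<beta>"
 proof (rule continuous_at_imp_continuous_on, intro ballI)
  fix h assume "h : sphere (0::complex) rh"
  hence "h ~= 0" "norm h < r" using rh by auto
  thus "isCont \<beta> h" using mder_continuous[OF ode] by blast
 qed
 hence "bounded (\<beta> ` sphere 0 rh)" by (intro compact_imp_bounded compact_continuous_image) auto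
 then obtain M where M: "M > 0" "!!h. norm h = rh ==> norm (\<beta> h) <= M" unfolding bounded_pos by auto
 \<comment> \<open>The factor 2 comes from the two products in the commutator.\<close>
 define ka where "ka = 2 * mconst TYPE('n) * K"
 have ka0: "ka \<ge> 0" using K0 mconst_nonneg[where 'n = 'n] by (simp add: ka_def)
 define c where "c = C * (1 / rh) ^ N"
 have c0: "c \<ge> 0" using C0 rh by (simp add: c_def)
 \<comment> \<open>The Gronwall exponent for the squared norm, increased by one because the factor
   M^2 + c^2 T is estimated by a multiple of exp T.\<close>
 define L where "L = nat \<lceil>2 * ka + 2 + 2 * real N\<rceil>"
 have L: "2 * ka + 2 + 2 * real N <= real L" unfolding L_def by linarith
 have main: "norm (\<beta> h) * norm h ^ L <= (M + c) * (rh + 1) ^ L" if h: "h ~= 0" "norm h < rh" for h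
 proof -
  define T where "T = ln (rh / norm h)"
  have T: "exp T = rh / norm h" "T \<ge> 0" using h rh by (auto simp: T_def)
  define h0 where "h0 = of_real (rh / norm h) * h"
  have h0: "norm h0 = rh" using h rh by (simp add: h0_def norm_mult norm_divide)
  define p where "p x = h0 * of_real (exp (- x))" for x
  have np: "norm (p x) = rh * exp (- x)" for x by (simp add: p_def norm_mult h0)
  have p: "p x ~= 0" "norm (p x) < r" "norm (p x) <= 1" if "x \<ge> 0" for x
  proof -
   have "rh * exp (- x) <= rh * 1" using rh that by (intro mult_left_mono) auto
   thus "norm (p x) < r" "norm (p x) <= 1" using rh unfolding np by linarith+
   show "p x ~= 0" using np[of x] rh by (metis exp_gt_zero mult_pos_pos norm_zero less_irrefl)
  qed
  have dp: "(p has_vector_derivative (- p x)) (at x)" for x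
   unfolding p_def by (auto intro!: derivative_eq_intros has_vector_derivative_mult_right has_vector_derivative_of_real)
  have "norm (\<beta> (p T)) ^ 2 <= exp ((2 * ka + 1 + 2 * real N) * T) * (norm (\<beta> (p 0)) ^ 2 + c ^ 2 * T)"
  proof (rule gronwall[OF T(2) ka0])
   show "0 <= real N" by simp
   fix x assume x: "x : {0..T}"
   hence x0: "x \<ge> 0" by simp
   let ?D = "ta (p x) ** \<beta> (p x) - \<beta> (p x) ** ta (p x) + G (p x)"
   show "((%x. \<beta> (p x)) has_vector_derivative (mat (- p x) ** ?D)) (at x)"
    by (rule mder_curve[where g = p and x = x, OF ode[OF p(1,2)[OF x0]] dp])
   have "norm ?D <= mconst TYPE('n) * (norm (ta (p x)) + norm (ta (p x))) * norm (\<beta> (p x)) + norm (G (p x))"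
    using norm_triangle_ineq[of "ta (p x) ** \<beta> (p x) - \<beta> (p x) ** ta (p x)" "G (p x)"]
     norm_sylvester_le[of "ta (p x)" "\<beta> (p x)" "ta (p x)"] by linarith
   hence "norm (p x) * norm ?D <= norm (p x) * (mconst TYPE('n) * (norm (ta (p x)) + norm (ta (p x))) * norm (\<beta> (p x)) + norm (G (p x)))"
    by (intro mult_left_mono) auto
   also have "\<dots> = 2 * mconst TYPE('n) * (norm (ta (p x)) * norm (p x)) * norm (\<beta> (p x)) + norm (p x) * norm (G (p x))"
    by (simp add: algebra_simps)
   also have "\<dots> <= ka * norm (\<beta> (p x)) + 1 * norm (G (p x))" unfolding ka_def
    by (intro add_mono mult_right_mono mult_left_mono ta p x0) (auto simp: mconst_nonneg)
   also have "norm (G (p x)) <= c * exp (real N * x)"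
   proof -
    have "norm (G (p x)) * (rh * exp (- x)) ^ N <= C" using G[OF p(1,2)[OF x0]] by (simp add: np)
    moreover have "(rh * exp (- x)) ^ N = rh ^ N / exp (real N * x)"
     by (simp add: power_mult_distrib exp_of_nat_mult exp_minus power_inverse divide_inverse)
    ultimately have "norm (G (p x)) * (rh ^ N / exp (real N * x)) <= C" by (simp only:)
    hence "norm (G (p x)) * rh ^ N <= C * exp (real N * x)" by (simp add: pos_divide_le_eq)
    thus ?thesis using rh by (simp add: c_def power_divide pos_le_divide_eq)
   qed
   finally show "norm (mat (- p x) ** ?D) <= ka * norm (\<beta> (p x)) + c * exp (real N * x)" by (simp add: norm_mat_mult)
  qed
  hence 1: "norm (\<beta> (p T)) ^ 2 <= exp ((2 * ka + 1 + 2 * real N) * T) * (norm (\<beta> (p 0)) ^ 2 + c ^ 2 * T)" .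
  have pT: "p T = h" using h rh by (simp add: p_def h0_def exp_minus T(1))
  have "norm (\<beta> (p 0)) <= M" by (rule M(2)) (simp add: np)
  hence "norm (\<beta> (p 0)) ^ 2 <= M ^ 2" by (intro power_mono) auto
  hence "exp ((2 * ka + 1 + 2 * real N) * T) * (norm (\<beta> (p 0)) ^ 2 + c ^ 2 * T) <= exp ((2 * ka + 1 + 2 * real N) * T) * (M ^ 2 + c ^ 2 * T)"
   by (intro mult_left_mono) auto
  with 1 have "norm (\<beta> h) ^ 2 <= exp ((2 * ka + 1 + 2 * real N) * T) * (M ^ 2 + c ^ 2 * T)"
   unfolding pT by (rule order_trans)
  also have "\<dots> <= exp ((2 * ka + 1 + 2 * real N) * T) * ((M ^ 2 + c ^ 2) * exp T)"
  proof (intro mult_left_mono)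
   have "1 <= exp T" "T <= exp T" using T(2) exp_ge_add_one_self[of T] by linarith+
   hence "M ^ 2 * 1 + c ^ 2 * T <= M ^ 2 * exp T + c ^ 2 * exp T" by (intro add_mono mult_left_mono) auto
   thus "M ^ 2 + c ^ 2 * T <= (M ^ 2 + c ^ 2) * exp T" by (simp add: algebra_simps)
  qed simp
  also have "\<dots> = (M ^ 2 + c ^ 2) * (exp ((2 * ka + 1 + 2 * real N) * T) * exp T)" by (simp only: mult_ac)
  also have "exp ((2 * ka + 1 + 2 * real N) * T) * exp T = exp ((2 * ka + 2 + 2 * real N) * T)"
   unfolding exp_add[symmetric] by (simp add: algebra_simps)
  also have "(M ^ 2 + c ^ 2) * exp ((2 * ka + 2 + 2 * real N) * T) <= (M + c) ^ 2 * exp (2 * (real L * T))"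
  proof (intro mult_mono)
   show "M ^ 2 + c ^ 2 <= (M + c) ^ 2" using M c0 by (simp add: power2_sum)
   have "(2 * ka + 2 + 2 * real N) * T <= real L * T" by (intro mult_right_mono L T)
   also have "\<dots> <= 2 * (real L * T)" using T(2) by simp
   finally show "exp ((2 * ka + 2 + 2 * real N) * T) <= exp (2 * (real L * T))" by simp
  qed auto
  also have "\<dots> = ((M + c) * exp (real L * T)) ^ 2" by (simp only: power_mult_distrib exp_double)
  finally have "norm (\<beta> h) <= (M + c) * exp (real L * T)" by (rule power2_le_imp_le) (use M c0 in auto)
  also have "exp (real L * T) = (rh / norm h) ^ L" by (simp only: exp_of_nat_mult T)
  finally have "norm (\<beta> h) * norm h ^ L <= (M + c) * rh ^ L" using h by (simp add: power_divide field_simps)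
  also have "\<dots> <= (M + c) * (rh + 1) ^ L" using M c0 rh by (intro mult_left_mono power_mono) auto
  finally show ?thesis .
 qed
 have "\<forall>\<^sub>F h in at 0. norm (\<beta> h) * norm h ^ L <= (M + c) * (rh + 1) ^ L"
  unfolding eventually_at by (intro exI[of _ rh]) (use main rh in auto)
 thus ?thesis by blast
qed


definition fls_at :: "complex fls ^ 'n ^ 'n => complex => complex ^ 'n ^ 'n" where
 "fls_at S h = (\<chi> i j. eval_fls (S $ i $ j) h)"

lemma eventually_fls_mult:
 fixes S T U :: "complex fls ^ 'n::finite ^ 'n"
 assumes "!!i j. fls_conv_radius (S $ i $ j) > 0" "!!i j. fls_conv_radius (T $ i $ j) > 0" "S ** T = U"
 shows "\<forall>\<^sub>F h in at 0. fls_at S h ** fls_at T h = fls_at U h"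
proof -
 have "\<forall>\<^sub>F h in at 0. (fls_at S h ** fls_at T h) $ i $ j = fls_at U h $ i $ j" for i j
 proof -
  have "(%h. \<Sum>k\<in>UNIV. eval_fls (S $ i $ k) h * eval_fls (T $ k $ j) h) has_laurent_expansion (\<Sum>k\<in>UNIV. S $ i $ k * T $ k $ j)"
   by (intro has_laurent_expansion_sum has_laurent_expansion_mult eval_fls_has_laurent_expansion assms)
  also have "(\<Sum>k\<in>UNIV. S $ i $ k * T $ k $ j) = U $ i $ j"
   using assms(3) by (simp add: matrix_matrix_mult_def vec_eq_iff)
  finally have "\<forall>\<^sub>F h in at 0. eval_fls (U $ i $ j) h = (\<Sum>k\<in>UNIV. eval_fls (S $ i $ k) h * eval_fls (T $ k $ j) h)"
   unfolding has_laurent_expansion_def by blast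
  thus ?thesis by eventually_elim (simp add: fls_at_def matrix_matrix_mult_def)
 qed
 hence "\<forall>\<^sub>F h in at 0. \<forall>i j. (fls_at S h ** fls_at T h) $ i $ j = fls_at U h $ i $ j"
  by (simp add: eventually_all_finite)
 thus ?thesis by eventually_elim (simp add: vec_eq_iff)
qed

lemma eventually_fls_mder:
 fixes S :: "complex fls ^ 'n::finite ^ 'n"
 assumes "!!i j. fls_conv_radius (S $ i $ j) > 0"
 shows "\<forall>\<^sub>F h in at 0. mder (fls_at S) (fls_at (map_matrix fls_deriv S) h) h"
proof -
 have "\<forall>\<^sub>F h in at 0. h : eball 0 (fls_conv_radius (S $ i $ j)) - {0}" for i j
  using assms[of i j] by (intro eventually_at_in_open) (auto simp: zero_ereal_def)
 hence "\<forall>\<^sub>F h in at 0. \<forall>i j. h : eball 0 (fls_conv_radius (S $ i $ j)) - {0}"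
  by (intro eventually_all_finite)
 thus ?thesis
 proof eventually_elim
  case (elim h)
  thus ?case unfolding mder_def by (auto simp: fls_at_def map_matrix_nth intro!: has_field_derivative_eval_fls)
 qed
qed

lemma mder_unique: "mder X D z ==> mder X D' z ==> D = D'" unfolding mder_def vec_eq_iff using DERIV_unique by blast

text \<open>The gauge transformation that makes the system Fuchsian turns the Sylvester equation into one
 whose coefficient has a simple pole.\<close>

lemma regular_singular_growth:
 fixes b A F :: "complex => complex ^ 'n::finite ^ 'n" and L S S' :: "complex fls ^ 'n ^ 'n"
 assumes A: "!!i j. (%h. A (al + h) $ i $ j) has_laurent_expansion L $ i $ j"
  and S: "!!i j. fls_conv_radius (S $ i $ j) > 0" "!!i j. fls_conv_radius (S' $ i $ j) > 0"
   "S ** S' = mat 1" "S' ** S = mat 1"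
  and reg: "!!i j k. k < - 1 ==> fls_nth ((S' ** L ** S - S' ** map_matrix fls_deriv S) $ i $ j) k = 0"
  and ode: "\<forall>\<^sub>F h in at 0. mder b (A (al + h) ** b (al + h) - b (al + h) ** A (al + h) + F (al + h)) (al + h)"
  and F: "!!i j. pole_growth (%h. F (al + h) $ i $ j)"
 shows "pole_growth (%h. b (al + h) $ i $ j)"
proof -
 define s s' sd where "s = fls_at S" and "s' = fls_at S'" and "sd = fls_at (map_matrix fls_deriv S)"
 define sd' where "sd' = fls_at (map_matrix fls_deriv S')"
 \<comment> \<open>\<open>ta\<close> is the gauge transform of the coefficient, with at most a
   simple pole by \<open>reg\<close>; \<beta> and \<open>G\<close> are the corresponding conjugates
   of the solution and of the inhomogeneity.\<close>
 define ta where "ta h = s' h ** A (al + h) ** s h - s' h ** sd h" for h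
 define \<beta> where "\<beta> h = s' h ** b (al + h) ** s h" for h
 define G where "G h = s' h ** F (al + h) ** s h" for h
 have one: "fls_at (mat 1) h = mat 1" for h by (simp add: fls_at_def vec_eq_iff mat_def)
 have ss: "\<forall>\<^sub>F h in at 0. s h ** s' h = mat 1" "\<forall>\<^sub>F h in at 0. s' h ** s h = mat 1"
  using eventually_fls_mult[OF S(1,2,3)] eventually_fls_mult[OF S(2,1,4)] by (simp_all add: one s_def s'_def)
 have exps: "(%h. s h $ i $ j) has_laurent_expansion S $ i $ j" "(%h. s' h $ i $ j) has_laurent_expansion S' $ i $ j"
  "(%h. sd h $ i $ j) has_laurent_expansion map_matrix fls_deriv S $ i $ j" for i j
  using S(1,2) by (auto simp: s_def s'_def sd_def fls_at_def map_matrix_nth intro!: eval_fls_has_laurent_expansion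
    less_le_trans[OF S(1) fls_conv_radius_deriv])
 have mult: "(%h. (X h ** Y h) $ i $ j) has_laurent_expansion (U ** V) $ i $ j"
  if "!!i j. (%h. X h $ i $ j) has_laurent_expansion U $ i $ j" "!!i j. (%h. Y h $ i $ j) has_laurent_expansion V $ i $ j"
  for X Y :: "complex => complex ^ 'n ^ 'n" and U V i j
  by (simp add: matrix_matrix_mult_def) (intro has_laurent_expansion_sum has_laurent_expansion_mult that)
 have "(%h. ta h $ i $ j) has_laurent_expansion (S' ** L ** S - S' ** map_matrix fls_deriv S) $ i $ j" for i j
  unfolding ta_def vector_minus_component by (intro has_laurent_expansion_diff mult exps A)
 hence "\<exists>C. \<forall>\<^sub>F h in at 0. norm (ta h $ i $ j) * norm h ^ 1 <= C" for i j
  by (rule laurent_bound) (use reg in auto)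
 then obtain C where C: "!!i j. \<forall>\<^sub>F h in at 0. norm (ta h $ i $ j) * norm h ^ 1 <= C i j" by metis
 have "\<forall>\<^sub>F h in at 0. \<forall>i j. norm (ta h $ i $ j) * norm h ^ 1 <= C i j"
  using C by (simp add: eventually_all_finite)
 hence ta: "\<forall>\<^sub>F h in at 0. norm (ta h) * norm h <= (\<Sum>i\<in>UNIV. \<Sum>j\<in>UNIV. C i j)"
 proof eventually_elim
  case (elim h)
  have "norm (ta h) * norm h <= (\<Sum>i\<in>UNIV. \<Sum>j\<in>UNIV. norm (ta h $ i $ j)) * norm h"
   by (intro mult_right_mono matrix_norm_le_sum) auto
  also have "\<dots> = (\<Sum>i\<in>UNIV. \<Sum>j\<in>UNIV. norm (ta h $ i $ j) * norm h)" by (simp add: sum_distrib_right)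
  also have "\<dots> <= (\<Sum>i\<in>UNIV. \<Sum>j\<in>UNIV. C i j)" by (intro sum_mono) (use elim in simp)
  finally show ?case .
 qed
 have pg: "pole_growth (%h. s h $ i $ j)" "pole_growth (%h. s' h $ i $ j)" for i j using exps laurent_pole_growth by blast+
 have "pole_growth (%h. G h $ i $ j)" for i j unfolding G_def by (intro pole_growth_matrix_mult pg F)
 from pole_growth_matrix[OF this] obtain CG N where G: "\<forall>\<^sub>F h in at 0. norm (G h) * norm h ^ N <= CG" by blast
 have der: "\<forall>\<^sub>F h in at 0. mder \<beta> (ta h ** \<beta> h - \<beta> h ** ta h + G h) h"
 proof -
  have "\<forall>\<^sub>F h in at 0. mder s (sd h) h" "\<forall>\<^sub>F h in at 0. mder s' (sd' h) h"
   using eventually_fls_mder[OF S(1)] eventually_fls_mder[OF S(2)] by (simp_all add: s_def s'_def sd_def sd'_def)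
  moreover have "\<forall>\<^sub>F h in at 0. \<forall>\<^sub>F x in nhds h. s' x ** s x = mat 1"
  proof -
   obtain T where T: "open T" "0 : T" "!!x. x : T ==> x ~= 0 ==> s' x ** s x = mat 1"
    using ss(2) unfolding eventually_at_topological by blast
   have "\<forall>\<^sub>F h in at 0. h : T - {0}" by (rule eventually_at_in_open[OF T(1,2)])
   thus ?thesis
   proof eventually_elim
    case (elim h)
    have "\<forall>\<^sub>F x in nhds h. x : T - {0}" by (rule eventually_nhds_in_open) (use T elim in auto)
    thus ?case by eventually_elim (use T in auto)
   qed
  qed
  ultimately show ?thesis using ss ode
  proof eventually_elim
   case (elim h)
   \<comment> \<open>Differentiating s' s = 1 expresses the derivative of the inverse by that of
     \<open>s\<close>.\<close>
   have "mder (%x. s' x ** s x) (sd' h ** s h + s' h ** sd h) h" by (rule mder_mult[OF elim(2,1)])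
   hence "mder (%x. mat 1 :: complex ^ 'n ^ 'n) (sd' h ** s h + s' h ** sd h) h" using mder_cong[OF elim(3)] by blast
   hence "sd' h ** s h + s' h ** sd h = 0" using mder_unique mder_const by blast
   hence "sd' h ** s h = - (s' h ** sd h)" by (simp add: add_eq_0_iff)
   hence "sd' h ** (s h ** s' h) = - (s' h ** sd h) ** s' h" by (simp add: matrix_mul_assoc)
   hence sd': "sd' h = - (s' h ** sd h ** s' h)" using elim(4) by (simp add: matrix_minus_left)
   let ?A = "A (al + h)" and ?b = "b (al + h)" and ?F = "F (al + h)"
   have mb: "mder (%u. b (al + u)) (?A ** ?b - ?b ** ?A + ?F) h"
   proof -
    have "((%u. al + u) has_field_derivative 1) (at h)" by (auto intro!: derivative_eq_intros)
    from mder_chain[of b _ "%u. al + u" h 1, OF elim(6) this] show ?thesis by simp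
   qed
   have m: "mder \<beta> ((sd' h ** ?b + s' h ** (?A ** ?b - ?b ** ?A + ?F)) ** s h + s' h ** ?b ** sd h) h"
    unfolding \<beta>_def by (intro mder_mult mb elim(1,2))
   have t1: "ta h ** \<beta> h = s' h ** ?A ** ?b ** s h - s' h ** sd h ** s' h ** ?b ** s h"
   proof -
    have "s' h ** ?A ** s h ** (s' h ** ?b ** s h) = s' h ** ?A ** (s h ** s' h) ** ?b ** s h"
     by (simp only: matrix_mul_assoc)
    thus ?thesis using elim(4) by (simp add: ta_def \<beta>_def matrix_ring_simps matrix_mul_assoc)
   qed
   have t2: "\<beta> h ** ta h = s' h ** ?b ** ?A ** s h - s' h ** ?b ** sd h"
   proof -
    have "s' h ** ?b ** s h ** (s' h ** ?A ** s h) = s' h ** ?b ** (s h ** s' h) ** ?A ** s h"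
     "s' h ** ?b ** s h ** (s' h ** sd h) = s' h ** ?b ** (s h ** s' h) ** sd h" by (simp_all only: matrix_mul_assoc)
    thus ?thesis using elim(4) by (simp add: ta_def \<beta>_def matrix_ring_simps)
   qed
   show ?case by (rule mder_eq[OF m]) (simp add: t1 t2 G_def sd' matrix_ring_simps)
  qed
 qed
 have "\<forall>\<^sub>F h in at 0. mder \<beta> (ta h ** \<beta> h - \<beta> h ** ta h + G h) h & norm (ta h) * norm h <= (\<Sum>i\<in>UNIV. \<Sum>j\<in>UNIV. C i j)
   & norm (G h) * norm h ^ N <= CG" using der ta G by eventually_elim auto
 then obtain r where r: "r > 0" "!!h. h ~= 0 ==> norm h < r ==> mder \<beta> (ta h ** \<beta> h - \<beta> h ** ta h + G h) h &
   norm (ta h) * norm h <= (\<Sum>i\<in>UNIV. \<Sum>j\<in>UNIV. C i j) & norm (G h) * norm h ^ N <= CG"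
  unfolding eventually_at by (auto simp: dist_norm)
 obtain C' N' where "\<forall>\<^sub>F h in at 0. norm (\<beta> h) * norm h ^ N' <= C'"
  using fuchsian_growth[of r \<beta> ta G "\<Sum>i\<in>UNIV. \<Sum>j\<in>UNIV. C i j" N CG] r by blast
 hence "pole_growth (%h. \<beta> h $ i $ j)" for i j by (rule pole_growth_entry)
 hence "pole_growth (%h. (s h ** \<beta> h ** s' h) $ i $ j)" by (intro pole_growth_matrix_mult pg)
 moreover have "\<forall>\<^sub>F h in at 0. (s h ** \<beta> h ** s' h) $ i $ j = b (al + h) $ i $ j" using ss(1)
 proof eventually_elim
  case (elim h)
  have "s h ** \<beta> h ** s' h = (s h ** s' h) ** b (al + h) ** (s h ** s' h)" by (simp only: \<beta>_def matrix_mul_assoc)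
  thus ?case using elim by simp
 qed
 ultimately show ?thesis by (rule pole_growth_cong)
qed

section \<open>Difference quotients of the coefficients in the parameter\<close>

lemma poly_at_Cons: "poly (poly_at (f # cs) s) x = f s + x * poly (poly_at cs s) x" by (simp add: poly_at_def)

lemma uniform_limit_of_tendsto: "(f \<longlongrightarrow> l) F ==> uniform_limit K (%s _. f s) (%_. l) F"
 unfolding uniform_limit_iff tendsto_iff by (auto elim: eventually_mono)

lemma bounded_poly_image:
 assumes "bounded (K :: complex set)" shows "bounded (poly p ` K)"
proof -
 have "compact (poly p ` closure K)"
  using assms by (intro compact_continuous_image continuous_intros) (simp add: compact_closure)
 thus ?thesis by (meson bounded_subset closure_subset compact_imp_bounded image_mono)
qed

lemma uniform_limit_linear_factor:
 assumes K: "bounded (K :: complex set)" and f: "(f \<longlongrightarrow> l) F" and g: "uniform_limit K g (poly p) F"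
 shows "uniform_limit K (%s x. f s + x * g s x) (%x. l + x * poly p x) F"
 by (intro uniform_limit_add uniform_limit_of_tendsto f uniform_lim_mult uniform_limit_const g bounded_poly_image K)
  (use K in simp)

lemma poly_at_limit:
 assumes K: "bounded K" and cs: "!!f. f : set cs ==> isCont f 0"
 shows "uniform_limit K (%s. poly (poly_at cs s)) (poly (poly_at cs (0::complex))) (at 0)" using cs
proof (induction cs)
 case Nil thus ?case by (simp add: poly_at_def uniform_limit_const)
next
 case (Cons f cs)
 have "(f \<longlongrightarrow> f 0) (at 0)" using Cons.prems[of f] by (simp add: isCont_def)
 from uniform_limit_linear_factor[OF K this Cons.IH] show ?case using Cons.prems by (simp add: poly_at_def)
qed

lemma poly_at_difference_limit:
 assumes K: "bounded K" and cs: "!!f. f : set cs ==> f field_differentiable (at 0)"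
 shows "uniform_limit K (%s x. (poly (poly_at cs s) x - poly (poly_at cs 0) x) / s)
  (poly (Poly (map (%f. deriv f 0) cs))) (at (0::complex))" using cs
proof (induction cs)
 case Nil thus ?case by (simp add: poly_at_def uniform_limit_const)
next
 case (Cons f cs)
 have "DERIV f 0 :> deriv f 0" using Cons.prems[of f] by (simp add: DERIV_deriv_iff_field_differentiable)
 hence "((%s. (f s - f 0) / s) \<longlongrightarrow> deriv f 0) (at 0)" by (simp add: DERIV_def)
 from uniform_limit_linear_factor[OF K this Cons.IH]
 have *: "uniform_limit K (%s x. (f s - f 0) / s + x * ((poly (poly_at cs s) x - poly (poly_at cs 0) x) / s))
  (%x. deriv f 0 + x * poly (Poly (map (%f. deriv f 0) cs)) x) (at 0)" using Cons.prems by simp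
 have "(%s x. (f s - f 0) / s + x * ((poly (poly_at cs s) x - poly (poly_at cs 0) x) / s)) =
   (%s x. (poly (poly_at (f # cs) s) x - poly (poly_at (f # cs) 0) x) / s)"
  by (simp add: fun_eq_iff poly_at_Cons diff_divide_distrib add_divide_distrib algebra_simps)
 with * show ?case by (simp add: poly_at_Cons)
qed

text \<open>Where the denominator vanishes, the difference quotients are controlled by the maximum modulus
 principle on a circle that avoids the roots.\<close>

lemma difference_quotient_limit:
 fixes f :: "complex => complex => complex"
 assumes diff: "!!h. h : set cs \<union> set ds ==> h field_differentiable (at 0)"
  and de: "poly_at ds 0 ~= 0" and rh0: "rh0 > 0"
  and f: "\<forall>\<^sub>F s in at 0. f s holomorphic_on ball q rh0 & (\<forall>x\<in>ball q rh0. poly (poly_at ds s) x * f s x = poly (poly_at cs s) x)"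
  and f0: "f 0 holomorphic_on ball q rh0" "!!x. x : ball q rh0 ==> poly (poly_at ds 0) x * f 0 x = poly (poly_at cs 0) x"
 shows "\<exists>rh>0. \<exists>F. F holomorphic_on ball q rh & uniform_limit (cball q rh) (%s x. (f s x - f 0 x) / s) F (at 0) &
  (\<forall>x\<in>ball q rh. poly (poly_at ds 0) x ^ 2 * F x =
    poly (Poly (map (%h. deriv h 0) cs)) x * poly (poly_at ds 0) x - poly (poly_at cs 0) x * poly (Poly (map (%h. deriv h 0) ds)) x)"
proof -
 define pn pd pn' pd' where "pn = poly_at cs" and "pd = poly_at ds"
  and "pn' = Poly (map (%h. deriv h 0) cs)" and "pd' = Poly (map (%h. deriv h 0) ds)"
 define g where "g s x = (f s x - f 0 x) / s" for s x
 \<comment> \<open>The limit predicted by the quotient rule; it is meaningful only off the roots of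
   the denominator at s = 0.\<close>
 define G where "G x = poly (pn' * pd 0 - pn 0 * pd') x * inverse (poly (pd 0) x * poly (pd 0) x)" for x
 have cont: "isCont h 0" if "h : set cs \<union> set ds" for h
  using diff[OF that] by (rule field_differentiable_imp_continuous_at)
 have s0: "\<forall>\<^sub>F s in at (0::complex). s ~= 0" by (auto simp: eventually_at_filter)
 have ident: "g s x * (poly (pd s) x * poly (pd 0) x) =
   (poly (pn s) x - poly (pn 0) x) / s * poly (pd 0) x - poly (pn 0) x * ((poly (pd s) x - poly (pd 0) x) / s)"
  if "s ~= 0" "x : ball q rh0" "poly (pd s) x * f s x = poly (pn s) x" for s x
 proof -
  have "poly (pn s) x = poly (pd s) x * f s x" "poly (pn 0) x = poly (pd 0) x * f 0 x"
   using that f0(2)[OF that(2)] by (simp_all add: pn_def pd_def)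
  thus ?thesis using that(1) by (simp add: g_def field_simps)
 qed
 have lims: "uniform_limit K (%s. poly (pn s)) (poly (pn 0)) (at 0)" "uniform_limit K (%s. poly (pd s)) (poly (pd 0)) (at 0)"
  "uniform_limit K (%s x. (poly (pn s) x - poly (pn 0) x) / s) (poly pn') (at 0)"
  "uniform_limit K (%s x. (poly (pd s) x - poly (pd 0) x) / s) (poly pd') (at 0)" if "bounded K" for K
  unfolding pn_def pd_def pn'_def pd'_def by (intro poly_at_limit poly_at_difference_limit that cont diff; simp)+
 have num: "uniform_limit K (%s x. (poly (pn s) x - poly (pn 0) x) / s * poly (pd 0) x - poly (pn 0) x * ((poly (pd s) x - poly (pd 0) x) / s))
   (%x. poly pn' x * poly (pd 0) x - poly (pn 0) x * poly pd' x) (at 0)" if "bounded K" for K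
  by (intro uniform_limit_minus uniform_lim_mult uniform_limit_const lims bounded_poly_image that)
 have quot: "uniform_limit K g G (at 0)" if K: "compact K" "K <= ball q rh0" "!!x. x : K ==> poly (pd 0) x ~= 0" for K
 proof (cases "K = {}")
  case True thus ?thesis by simp
 next
  case False
  have bK: "bounded K" using K(1) compact_imp_bounded by blast
  have "continuous_on K (%x. norm (poly (pd 0) x))" by (intro continuous_intros)
  from continuous_attains_inf[OF K(1) False this] obtain x0 where
   x0: "x0 : K" "!!x. x : K ==> norm (poly (pd 0) x0) <= norm (poly (pd 0) x)" by blast
  define b where "b = norm (poly (pd 0) x0)"
  have b: "b > 0" "!!x. x : K ==> b <= norm (poly (pd 0) x)" using x0 K(3)[OF x0(1)] by (auto simp: b_def)
  have pd0: "uniform_limit K (%s x. poly (pd s) x * poly (pd 0) x) (%x. poly (pd 0) x * poly (pd 0) x) (at 0)"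
   by (intro uniform_lim_mult uniform_limit_const lims bounded_poly_image bK)
  have b2: "b * b <= norm (poly (pd 0) x * poly (pd 0) x)" if "x : K" for x
   unfolding norm_mult by (intro mult_mono b that) (use b in auto)
  have inv: "uniform_limit K (%s x. inverse (poly (pd s) x * poly (pd 0) x)) (inverse \<circ> (%x. poly (pd 0) x * poly (pd 0) x)) (at 0)"
   by (rule uniform_lim_inverse[OF pd0 b2]) (use b in auto)
  have bi: "bounded ((inverse \<circ> (%x. poly (pd 0) x * poly (pd 0) x)) ` K)" unfolding bounded_iff
  proof (intro exI ballI)
   fix y assume "y : (inverse \<circ> (%x. poly (pd 0) x * poly (pd 0) x)) ` K"
   then obtain x where x: "x : K" "y = inverse (poly (pd 0) x * poly (pd 0) x)" by auto
   show "norm y <= inverse (b * b)" unfolding x(2) norm_inverse by (rule le_imp_inverse_le[OF b2[OF x(1)]]) (use b in auto)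
  qed
  have bn: "bounded ((%x. poly pn' x * poly (pd 0) x - poly (pn 0) x * poly pd' x) ` K)"
   using bounded_poly_image[OF bK, of "pn' * pd 0 - pn 0 * pd'"] by simp
  have L: "uniform_limit K (%s x. ((poly (pn s) x - poly (pn 0) x) / s * poly (pd 0) x - poly (pn 0) x * ((poly (pd s) x - poly (pd 0) x) / s)) *
    inverse (poly (pd s) x * poly (pd 0) x))
    (%x. (poly pn' x * poly (pd 0) x - poly (pn 0) x * poly pd' x) * (inverse \<circ> (%x. poly (pd 0) x * poly (pd 0) x)) x) (at 0)"
   by (rule uniform_lim_mult[OF num[OF bK] inv bn bi])
  have ev: "\<forall>\<^sub>F s in at 0. \<forall>x\<in>K. ((poly (pn s) x - poly (pn 0) x) / s * poly (pd 0) x - poly (pn 0) x * ((poly (pd s) x - poly (pd 0) x) / s)) *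
    inverse (poly (pd s) x * poly (pd 0) x) = g s x" using f s0 uniform_limitD[OF lims(2)[OF bK] b(1)]
  proof eventually_elim
   case (elim s)
   show ?case
   proof
    fix x assume x: "x : K"
    have "poly (pd s) x ~= 0" using elim(3) b(2)[OF x] x by (auto simp: dist_norm)
    hence nz: "poly (pd s) x * poly (pd 0) x ~= 0" using K(3)[OF x] by simp
    have xb: "x : ball q rh0" using K(2) x by blast
    have "poly (pd s) x * f s x = poly (pn s) x" using elim(1) xb unfolding pn_def pd_def by blast
    from ident[OF elim(2) xb this] nz
    show "((poly (pn s) x - poly (pn 0) x) / s * poly (pd 0) x - poly (pn 0) x * ((poly (pd s) x - poly (pd 0) x) / s)) *
     inverse (poly (pd s) x * poly (pd 0) x) = g s x" by (simp add: divide_inverse[symmetric] divide_eq_eq)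
   qed
  qed
  show ?thesis by (rule uniform_limit_cong[THEN iffD1, OF ev _ L]) (simp add: G_def)
 qed
 have fin: "finite {x. poly (pd 0) x = 0}" using de by (intro poly_roots_finite) (simp add: pd_def)
 obtain dl where dl: "dl > 0" "!!x. poly (pd 0) x = 0 ==> x ~= q ==> dl <= dist q x"
  using finite_set_avoid[OF fin, of q] by blast
 \<comment> \<open>A radius below the distance to every other root, so that the circle around
   \<open>q\<close> avoids all roots even when \<open>q\<close> is one of them.\<close>
 define rh where "rh = min dl rh0 / 2"
 have rh: "rh > 0" "rh < dl" "rh < rh0" using dl rh0 by (auto simp: rh_def)
 have nz: "poly (pd 0) x ~= 0" if "x ~= q" "dist q x < dl" for x using dl(2)[of x] that by auto
 have "poly (pd 0) x ~= 0" if "x : sphere q rh" for x using nz[of x] that rh by (cases "x = q") auto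
 moreover have "compact (sphere q rh)" "sphere q rh <= ball q rh0" using rh by auto
 ultimately have sph: "uniform_limit (sphere q rh) g G (at 0)" using quot by blast
 have holG: "G holomorphic_on ball q (min dl rh0) - {q}" unfolding G_def using nz by (intro holomorphic_intros) auto
 have holg: "\<forall>\<^sub>F s in at 0. g s holomorphic_on ball q rh0"
  using f s0 unfolding g_def[abs_def] by eventually_elim (auto intro!: holomorphic_intros f0(1))
 have "continuous_on (sphere q rh) G"
  by (rule holomorphic_on_imp_continuous_on, rule holomorphic_on_subset[OF holG]) (use rh in auto)
 hence "bounded (G ` sphere q rh)" by (intro compact_imp_bounded compact_continuous_image) auto
 then obtain M where M: "!!x. x : sphere q rh ==> norm (G x) <= M" unfolding bounded_iff by blast
 have maxmod: "norm (h x) <= C" if "h holomorphic_on ball q (min dl rh0)" "!!x. x : sphere q rh ==> norm (h x) <= C" "x : cball q rh" for h x C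
 proof (rule maximum_modulus_frontier[of h "cball q rh"])
  have "cball q rh <= ball q (min dl rh0)" using rh by auto
  thus "continuous_on (closure (cball q rh)) h" "h holomorphic_on interior (cball q rh)"
   using that(1) rh by (auto intro!: holomorphic_on_imp_continuous_on elim!: holomorphic_on_subset)
 qed (use that in auto)
 have sub: "ball q (min dl rh0) <= ball q rh0" by auto
 have bd: "\<forall>\<^sub>F s in at 0. \<forall>x\<in>cball q rh. norm (g s x) <= M + 1"
  using holg uniform_limitD[OF sph zero_less_one]
 proof eventually_elim
  case (elim s)
  have "norm (g s x) <= M + 1" if "x : sphere q rh" for x
   using M[OF that] elim(2)[rule_format, OF that] norm_triangle_ineq2[of "g s x" "G x"] by (simp add: dist_norm)
  thus ?case using maxmod[OF holomorphic_on_subset[OF elim(1) sub]] by blast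
 qed
 have bG: "norm (G x) <= M + 1" if x: "x : cball q rh - {q}" for x
 proof -
  have "uniform_limit {x} g G (at 0)" by (rule quot) (use x rh nz in auto)
  hence "((%s. g s x) \<longlongrightarrow> G x) (at 0)" by simp
  moreover have "\<forall>\<^sub>F s in at 0. norm (g s x) <= M + 1" using bd by eventually_elim (use x in auto)
  ultimately show ?thesis by (rule Lim_norm_ubound[OF trivial_limit_at])
 qed
 have "\<forall>\<^sub>F x in at q. norm (G x) <= M + 1"
  unfolding eventually_at by (intro exI[of _ rh]) (use rh bG in \<open>auto simp: dist_commute\<close>)
 \<comment> \<open>\<open>G\<close> inherits a bound near \<open>q\<close> from the difference
   quotients, so the possible singularity there is removable.\<close>
 then obtain F where F: "F holomorphic_on ball q (min dl rh0)" "!!x. x : ball q (min dl rh0) - {q} ==> F x = G x"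
  using holomorphic_on_extend_bounded[OF holG] dl rh0 by (metis centre_in_ball interior_open min_less_iff_conj open_ball)
 have FG: "F x = G x" if "x : sphere q rh" for x using F(2)[of x] that rh by auto
 have lim: "uniform_limit (cball q rh) g F (at 0)"
 proof (rule uniform_limitI)
  fix e :: real assume e: "e > 0"
  have "\<forall>\<^sub>F s in at 0. \<forall>x\<in>sphere q rh. dist (g s x) (G x) < e / 2" by (rule uniform_limitD[OF sph]) (use e in simp)
  thus "\<forall>\<^sub>F s in at 0. \<forall>x\<in>cball q rh. dist (g s x) (F x) < e" using holg
  proof eventually_elim
   case (elim s)
   have "norm (g s x - F x) <= e / 2" if "x : cball q rh" for x
   proof (rule maxmod[of "%x. g s x - F x", OF _ _ that])
    show "(%x. g s x - F x) holomorphic_on ball q (min dl rh0)"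
     by (intro holomorphic_intros F(1) holomorphic_on_subset[OF elim(2) sub])
    show "norm (g s x - F x) <= e / 2" if "x : sphere q rh" for x
     using elim(1)[rule_format, OF that] FG[OF that] by (simp add: dist_norm)
   qed
   thus ?case using e by (force simp: dist_norm)
  qed
 qed
 have eq: "poly (pd 0) x ^ 2 * F x = poly pn' x * poly (pd 0) x - poly (pn 0) x * poly pd' x" if x: "x : ball q rh" for x
 proof -
  have xb: "x : ball q rh0" using x rh by auto
  have "uniform_limit {x} g F (at 0)" by (rule uniform_limit_on_subset[OF lim]) (use x in auto)
  hence "((%s. g s x) \<longlongrightarrow> F x) (at 0)" by simp
  moreover have "((%s. poly (pd s) x) \<longlongrightarrow> poly (pd 0) x) (at 0)" using lims(2)[of "{x}"] by simp
  ultimately have 1: "((%s. g s x * (poly (pd s) x * poly (pd 0) x)) \<longlongrightarrow> F x * (poly (pd 0) x * poly (pd 0) x)) (at 0)"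
   by (intro tendsto_intros)
  have 2: "((%s. (poly (pn s) x - poly (pn 0) x) / s * poly (pd 0) x - poly (pn 0) x * ((poly (pd s) x - poly (pd 0) x) / s))
    \<longlongrightarrow> poly pn' x * poly (pd 0) x - poly (pn 0) x * poly pd' x) (at 0)" using num[of "{x}"] by simp
  have "\<forall>\<^sub>F s in at 0. g s x * (poly (pd s) x * poly (pd 0) x) = (poly (pn s) x - poly (pn 0) x) / s * poly (pd 0) x - poly (pn 0) x * ((poly (pd s) x - poly (pd 0) x) / s)"
   using f s0
  proof eventually_elim
   case (elim s)
   show ?case by (rule ident[OF elim(2) xb]) (use elim(1) xb in \<open>auto simp: pn_def pd_def\<close>)
  qed
  from tendsto_cong[OF this] 1 2 have "F x * (poly (pd 0) x * poly (pd 0) x) = poly pn' x * poly (pd 0) x - poly (pn 0) x * poly pd' x"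
   using LIM_unique by blast
  thus ?thesis by (simp add: power2_eq_square mult_ac)
 qed
 have "F holomorphic_on ball q rh" by (rule holomorphic_on_subset[OF F(1)]) (use rh in auto)
 thus ?thesis using rh(1) lim eq unfolding g_def pn_def pd_def pn'_def pd'_def by blast
qed

text \<open>Locally uniform limits must coincide with the pointwise limit, so the local data glue; a
  compact set is covered by finitely many disks.\<close>

lemma locally_uniform_limit:
 fixes g :: "complex => complex => complex"
 assumes loc: "!!q. q : X ==> \<exists>rh>0. \<exists>F. F holomorphic_on ball q rh & uniform_limit (cball q rh) g F (at 0)"
 shows "!!K. compact K ==> K <= X ==> uniform_limit K g (%x. Lim (at 0) (%s. g s x)) (at (0::complex))"
  and "(%x. Lim (at 0) (%s. g s x)) holomorphic_on X"
proof -
 define L where "L x = Lim (at (0::complex)) (%s. g s x)" for x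
 obtain rh where rh: "!!q. q : X ==> rh q > (0::real)"
  "!!q. q : X ==> \<exists>F. F holomorphic_on ball q (rh q) & uniform_limit (cball q (rh q)) g F (at 0)" using loc by metis
 have L: "L holomorphic_on ball q (rh q) & uniform_limit (cball q (rh q)) g L (at 0)" if q: "q : X" for q
 proof -
  obtain F where F: "F holomorphic_on ball q (rh q)" "uniform_limit (cball q (rh q)) g F (at 0)" using rh(2)[OF q] by blast
  have "F x = L x" if "x : cball q (rh q)" for x
  proof -
   have "uniform_limit {x} g F (at 0)" by (rule uniform_limit_on_subset[OF F(2)]) (use that in auto)
   hence "((%s. g s x) \<longlongrightarrow> F x) (at 0)" by simp
   thus ?thesis unfolding L_def by (simp add: tendsto_Lim)
  qed
  thus ?thesis using F holomorphic_cong[of "ball q (rh q)" _ F L] uniform_limit_cong'[of "cball q (rh q)" g g F L] by auto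
 qed
 show "uniform_limit K g (%x. Lim (at 0) (%s. g s x)) (at 0)" if K: "compact K" "K <= X" for K
 proof -
  have "K <= (\<Union>q\<in>K. ball q (rh q))" using K rh(1) by force
  then obtain K' where K': "K' <= K" "finite K'" "K <= (\<Union>q\<in>K'. ball q (rh q))"
   using compactE_image[OF K(1), of K "%q. ball q (rh q)"] by auto
  have "uniform_limit (\<Union>q\<in>K'. cball q (rh q)) g L (at 0)"
   by (rule uniform_limit_on_UNION[OF K'(2)]) (use L K' K in blast)
  moreover have "K <= (\<Union>q\<in>K'. cball q (rh q))" using K'(3) by force
  ultimately show ?thesis unfolding L_def by (rule uniform_limit_on_subset)
 qed
 have "L analytic_on X" unfolding analytic_on_def using L rh(1) by blast
 thus "(%x. Lim (at 0) (%s. g s x)) holomorphic_on X" unfolding L_def by (rule analytic_imp_holomorphic)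
qed

section \<open>The coefficient matrix on the sphere\<close>

definition chart_system :: "(complex => 'p => complex ^ 'n ^ 'n) => bool => complex => 'p => complex ^ 'n ^ 'n" where
 "chart_system A ka = (if ka then at_inf A else A)"

text \<open>Outside \<open>D\<close> the values of \<open>A\<close> at isolated points may be
  arbitrary, and at the origin of the chart at infinity the formula for \<open>at_inf\<close>
  divides by zero. Taking limits yields a coefficient that is holomorphic at every nonsingular
  point.\<close>

definition coeff_at :: "(complex => 'p => complex ^ 'n ^ 'n) => 'p => bool => complex => complex ^ 'n ^ 'n" where
 "coeff_at A t ka z = (\<chi> i j. Lim (at z) (%x. chart_system A ka x t $ i $ j))"

lemma filterlim_inverse_at:
 fixes w :: complex
 assumes "w ~= 0" shows "filterlim (%x. 1 / x) (at (1 / w)) (at w)"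
proof -
 have "((%x. 1 / x) \<longlongrightarrow> 1 / w) (at w)" using assms by (intro tendsto_intros)
 moreover have "\<forall>\<^sub>F x in at w. 1 / x ~= 1 / w" using assms by (auto simp: eventually_at_filter)
 ultimately show ?thesis by (simp add: filterlim_at)
qed

lemma eventually_inverse_at:
 fixes w :: complex
 assumes "w ~= 0" "\<forall>\<^sub>F x in at (1 / w). Q x" shows "\<forall>\<^sub>F x in at w. Q (1 / x)"
 using filterlim_inverse_at[OF assms(1)] assms(2) unfolding filterlim_iff by blast

lemma regular_switch:
 fixes A :: "complex => 'p => complex ^ 'n::finite ^ 'n"
 assumes "w ~= 0" "g analytic_on {1 / w}" "\<forall>\<^sub>F x in at (1 / w). A x t $ i $ j = g x"
 shows "(%x. - g (1 / x) / x\<^sup>2) analytic_on {w}" "\<forall>\<^sub>F x in at w. at_inf A x t $ i $ j = - g (1 / x) / x\<^sup>2"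
proof -
 have "(%x. 1 / x) analytic_on {w}" using assms(1) by (intro analytic_intros) auto
 hence "(g \<circ> (%x. 1 / x)) analytic_on {w}" by (rule analytic_on_compose) (use assms(2) in simp)
 thus "(%x. - g (1 / x) / x\<^sup>2) analytic_on {w}" using assms(1) by (intro analytic_intros) (auto simp: o_def)
 show "\<forall>\<^sub>F x in at w. at_inf A x t $ i $ j = - g (1 / x) / x\<^sup>2"
  using eventually_inverse_at[OF assms(1,3)] by eventually_elim (simp add: at_inf_def)
qed

lemma regular_in_chart:
 fixes A :: "complex => 'p => complex ^ 'n::finite ^ 'n"
 assumes "\<not> singular_point A t (chart ka z)"
 shows "\<exists>g. g analytic_on {z} & (\<forall>\<^sub>F x in at z. chart_system A ka x t $ i $ j = g x)"
proof (cases ka)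
 case False thus ?thesis using assms by (simp add: chart_system_def)
next
 case True
 show ?thesis
 proof (cases "z = 0")
  case True thus ?thesis using assms \<open>ka\<close> by (simp add: chart_system_def)
 next
  case False
  then obtain g where g: "g analytic_on {1 / z}" "\<forall>\<^sub>F x in at (1 / z). A x t $ i $ j = g x"
   using assms \<open>ka\<close> by auto
  from regular_switch[where A = A and i = i and j = j and t = t, OF False this] show ?thesis using \<open>ka\<close> by (auto simp: chart_system_def)
 qed
qed

lemma coeff_at_eq:
 fixes A :: "complex => 'p => complex ^ 'n::finite ^ 'n"
 assumes "g analytic_on {z}" "\<forall>\<^sub>F x in at z. chart_system A ka x t $ i $ j = g x"
 shows "\<forall>\<^sub>F x in nhds z. coeff_at A t ka x $ i $ j = g x"
proof -
 obtain S where S: "open S" "z : S" "g holomorphic_on S" using assms(1) by (auto simp: analytic_at)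
 obtain T where T: "open T" "z : T" "!!x. x : T ==> x ~= z ==> chart_system A ka x t $ i $ j = g x"
  using assms(2) unfolding eventually_at_topological by blast
 have "\<forall>\<^sub>F x in nhds z. x : S \<inter> T" by (rule eventually_nhds_in_open) (use S T in auto)
 thus ?thesis
 proof eventually_elim
  case (elim x)
  have "isCont g x" using S elim by (meson IntD1 continuous_on_eq_continuous_at holomorphic_on_imp_continuous_on)
  hence 1: "(g \<longlongrightarrow> g x) (at x)" by (simp add: isCont_def)
  have "\<forall>\<^sub>F y in at x. y : T & y ~= z"
  proof (cases "x = z")
   case True thus ?thesis using T unfolding eventually_at_topological by blast
  next
   case False
   have "\<forall>\<^sub>F y in at x. y : T - {z} - {x}" by (rule eventually_at_in_open) (use T elim False in auto)
   thus ?thesis by eventually_elim auto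
  qed
  hence "\<forall>\<^sub>F y in at x. chart_system A ka y t $ i $ j = g y" by eventually_elim (use T in auto)
  hence "((%y. chart_system A ka y t $ i $ j) \<longlongrightarrow> g x) (at x)" using 1 by (simp add: tendsto_cong)
  thus ?case by (simp add: coeff_at_def tendsto_Lim)
 qed
qed

lemma coeff_at_regular:
 fixes A :: "complex => 'p => complex ^ 'n::finite ^ 'n"
 assumes "\<not> singular_point A t (chart ka z)"
 shows "\<exists>g. g analytic_on {z} & (\<forall>\<^sub>F x in at z. chart_system A ka x t $ i $ j = g x) & (\<forall>\<^sub>F x in nhds z. coeff_at A t ka x $ i $ j = g x)"
proof -
 obtain g where g: "g analytic_on {z}" "\<forall>\<^sub>F x in at z. chart_system A ka x t $ i $ j = g x"
  using regular_in_chart[OF assms, of i j] by blast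
 from coeff_at_eq[where A = A and i = i and j = j and t = t, OF this] g show ?thesis by blast
qed

lemma coeff_at_holomorphic:
 fixes A :: "complex => 'p => complex ^ 'n::finite ^ 'n"
 assumes "!!z. z : S ==> \<not> singular_point A t (chart ka z)"
 shows "mholo (coeff_at A t ka) S" unfolding mholo_def
proof (intro allI)
 fix i j
 have "(%x. coeff_at A t ka x $ i $ j) field_differentiable (at z)" if z: "z : S" for z
 proof -
  obtain g where g: "g analytic_on {z}" "\<forall>\<^sub>F x in nhds z. coeff_at A t ka x $ i $ j = g x"
   using coeff_at_regular[OF assms[OF z], of i j] by blast
  have "g field_differentiable (at z)" using g(1) by (rule analytic_on_imp_differentiable_at) simp
  thus ?thesis unfolding field_differentiable_def using DERIV_cong_ev[OF refl g(2) refl] by blast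
 qed
 thus "(%x. coeff_at A t ka x $ i $ j) holomorphic_on S" by (simp add: holomorphic_on_def field_differentiable_at_within)
qed

lemma coeff_at_switch:
 fixes A :: "complex => 'p => complex ^ 'n::finite ^ 'n"
 assumes w: "w ~= 0" and reg: "\<not> singular_point A t (inf_chart w)"
 shows "coeff_at A t True w = mat (- 1 / w\<^sup>2) ** coeff_at A t False (1 / w)"
proof -
 have "coeff_at A t True w $ i $ j = (- 1 / w\<^sup>2) * coeff_at A t False (1 / w) $ i $ j" for i j
 proof -
  have "\<not> singular_point A t (chart False (1 / w))" using reg w by simp
  from coeff_at_regular[OF this, of i j] obtain g where g: "g analytic_on {1 / w}"
   "\<forall>\<^sub>F x in at (1 / w). A x t $ i $ j = g x" "\<forall>\<^sub>F x in nhds (1 / w). coeff_at A t False x $ i $ j = g x"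
   by (auto simp: chart_system_def)
  have 1: "coeff_at A t False (1 / w) $ i $ j = g (1 / w)" using g(3) by (rule eventually_nhds_x_imp_x)
  have "\<forall>\<^sub>F x in nhds w. coeff_at A t True x $ i $ j = - g (1 / x) / x\<^sup>2"
   by (rule coeff_at_eq) (use regular_switch[where A = A and i = i and j = j and t = t, OF w g(1,2)] in \<open>simp_all add: chart_system_def\<close>)
  hence "coeff_at A t True w $ i $ j = - g (1 / w) / w\<^sup>2" by (rule eventually_nhds_x_imp_x)
  thus ?thesis using 1 by simp
 qed
 thus ?thesis by (simp add: vec_eq_iff mat_mult_left)
qed

lemma joint_holomorphic_slice:
 assumes "joint_holomorphic_on f (S \<times> P)" "open S" "t : P"
 shows "(%x. f x t) holomorphic_on S" unfolding holomorphic_on_open[OF assms(2)]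
proof
 fix x assume "x : S"
 then obtain f' where f': "((%(x, t). f x t) has_derivative f') (at (x, t))" "!!c u v. f' (c * u, c *s v) = c * f' (u, v)"
  using assms unfolding joint_holomorphic_on_def by blast
 have "((%x. (x, t)) has_derivative (%u. (u, 0))) (at x)" by (auto intro!: derivative_eq_intros)
 from has_derivative_compose[OF this f'(1)] have "((%x. f x t) has_derivative (%u. f' (u, 0))) (at x)" by simp
 moreover have "(%u. f' (u, 0)) = (*) (f' (1, 0))"
 proof
  fix u have "f' (u * 1, u *s 0) = u * f' (1, 0)" by (rule f'(2))
  moreover have "u *s (0 :: complex ^ 'b) = 0" by (simp add: vec_eq_iff)
  ultimately show "f' (u, 0) = f' (1, 0) * u" by (simp add: mult.commute)
 qed
 ultimately show "\<exists>D. ((%x. f x t) has_field_derivative D) (at x)" unfolding has_field_derivative_def by auto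
qed


text \<open>Reversing a coefficient list replaces p(x) by a power of w times p(1/w). The prefixed
  zeros multiply by further powers of w so that the quotient is exactly -A(1/w)/w^2 whatever the two
  lengths are; common factors stay.\<close>

definition chart_num :: "(complex ^ 'r => complex) list => (complex ^ 'r => complex) list => bool => (complex ^ 'r => complex) list" where
 "chart_num ns ds ka = (if ka then replicate (length ds) (%_. 0) @ map (%f t. - f t) (rev ns) else ns)"

definition chart_den :: "(complex ^ 'r => complex) list => (complex ^ 'r => complex) list => bool => (complex ^ 'r => complex) list" where
 "chart_den ns ds ka = (if ka then replicate (length ns + 2) (%_. 0) @ rev ds else ds)"

lemma poly_Poly_append: "poly (Poly (xs @ ys)) x = poly (Poly xs) x + x ^ length xs * poly (Poly ys) (x :: complex)"
 by (induction xs) (auto simp: algebra_simps)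

lemma poly_Poly_zeros: "poly (Poly (replicate k 0)) (x :: complex) = 0" by (induction k) auto

text \<open>The extra factor w on the left avoids the exponent \<open>length xs - 1\<close>, which
  would be wrong for the empty list.\<close>

lemma poly_Poly_rev: "w ~= 0 ==> w * poly (Poly (rev xs)) w = w ^ length xs * poly (Poly xs) (1 / w :: complex)"
proof (induction xs)
 case (Cons a xs)
 have "w * poly (Poly (rev (a # xs))) w = w * poly (Poly (rev xs)) w + w * (w ^ length xs * a)"
  by (simp add: poly_Poly_append algebra_simps)
 thus ?case using Cons by (simp add: field_simps)
qed simp

lemma poly_Poly_uminus: "poly (Poly (map (%f. - f t) xs)) x = - poly (Poly (map (%f. f t) xs)) (x :: complex)"
 by (induction xs) auto

lemma chart_quotient_identity:
 fixes a :: complex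
 assumes w: "w ~= 0" and eq: "poly (poly_at ds t) (1 / w) * a = poly (poly_at ns t) (1 / w)"
 shows "poly (poly_at (chart_den ns ds True) t) w * (- a / w\<^sup>2) = poly (poly_at (chart_num ns ds True) t) w"
proof -
 define l k where "l = length ns" and "k = length ds"
 have d: "w * poly (poly_at (chart_den ns ds True) t) w = w ^ (l + 2) * (w ^ k * poly (poly_at ds t) (1 / w))"
  using poly_Poly_rev[OF w, of "map (%f. f t) ds"]
  by (simp add: poly_at_def chart_den_def map_replicate poly_Poly_append poly_Poly_zeros rev_map l_def k_def mult_ac)
 have n: "w * poly (poly_at (chart_num ns ds True) t) w = - (w ^ k * (w ^ l * poly (poly_at ns t) (1 / w)))"
 proof -
  have "w * poly (poly_at (chart_num ns ds True) t) w = w ^ k * (- (w * poly (Poly (rev (map (%f. f t) ns))) w))"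
   by (simp add: poly_at_def chart_num_def map_replicate poly_Poly_append poly_Poly_zeros o_def rev_map poly_Poly_uminus k_def mult_ac)
  thus ?thesis using poly_Poly_rev[OF w, of "map (%f. f t) ns"] by (simp add: poly_at_def l_def)
 qed
 have "w * (poly (poly_at (chart_den ns ds True) t) w * (- a / w\<^sup>2)) = (w ^ (l + 2) * (w ^ k * poly (poly_at ds t) (1 / w))) * (- a / w\<^sup>2)"
  unfolding d[symmetric] by simp
 also have "\<dots> = - (w ^ k * (w ^ l * (poly (poly_at ds t) (1 / w) * a)))"
  using w by (simp add: power_add power2_eq_square field_simps)
 also have "\<dots> = w * poly (poly_at (chart_num ns ds True) t) w" unfolding eq n ..
 finally show ?thesis unfolding mult_cancel_left using w by blast
qed

lemma Poly_nonzero: "Poly xs ~= 0 \<longleftrightarrow> (\<exists>x\<in>set xs. x ~= (0::complex))" by (induction xs) auto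

lemma chart_den_nonzero: "poly_at ds t ~= 0 ==> poly_at (chart_den ns ds ka) t ~= 0"
 by (auto simp: poly_at_def chart_den_def Poly_nonzero)

lemma uniform_limit_matrix:
 fixes g :: "'s => 'x => complex ^ 'n::finite ^ 'n" and L :: "'x => complex ^ 'n ^ 'n"
 assumes "!!i j. uniform_limit K (%s x. g s x $ i $ j) (%x. L x $ i $ j) F"
 shows "uniform_limit K g L F"
proof (rule uniform_limitI)
 fix e :: real assume e: "e > 0"
 define n where "n = real (CARD('n) * CARD('n))"
 have n: "n > 0" by (simp add: n_def)
 have "\<forall>\<^sub>F s in F. \<forall>i j. \<forall>x\<in>K. dist (g s x $ i $ j) (L x $ i $ j) < e / (2 * n)"
  by (intro eventually_all_finite uniform_limitD[OF assms]) (use e n in auto)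
 thus "\<forall>\<^sub>F s in F. \<forall>x\<in>K. dist (g s x) (L x) < e"
 proof eventually_elim
  case (elim s)
  show ?case
  proof
   fix x assume x: "x : K"
   have "norm (g s x - L x) <= (\<Sum>i\<in>UNIV. \<Sum>j\<in>UNIV. norm ((g s x - L x) $ i $ j))" by (rule matrix_norm_le_sum)
   also have "\<dots> <= (\<Sum>i\<in>(UNIV :: 'n set). \<Sum>j\<in>(UNIV :: 'n set). e / (2 * n))"
    by (intro sum_mono) (use elim x in \<open>auto simp: dist_norm less_imp_le\<close>)
   also have "\<dots> = e / 2" using n by (simp add: n_def)
   finally show "dist (g s x) (L x) < e" using e by (simp add: dist_norm)
  qed
 qed
qed

text \<open>The parameter derivative of the coefficient in the direction of t_k, in either chart.
  Its holomorphy in x will follow from locally uniform convergence of the difference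
  quotients.\<close>

definition var_at :: "(complex => complex ^ 'r => complex ^ 'n ^ 'n) => complex ^ 'r => 'r => bool => complex => complex ^ 'n ^ 'n" where
 "var_at A t k ka z = (\<chi> i j. Lim (at 0) (%s. (coeff_at A (t + s *s axis k 1) ka z $ i $ j - coeff_at A t ka z $ i $ j) / s))"

context regular_singular_system
begin

definition Sing :: "complex ^ 'r => riemann_sphere set" where
 "Sing t = (%i. \<xi> i t) ` {..<m}"

lemma regular_on_D:
 assumes t: "t : P" and x: "x : D"
 shows "\<not> singular_point A t x"
proof (cases x)
 case (Pt z)
 have o: "open (Pt -` D)" using D_open open_chart_vimage[of D False] by simp
 have "\<exists>g. g analytic_on {z} & (\<forall>\<^sub>F x in at z. A x t $ i $ j = g x)" for i j
 proof (intro exI[of _ "%x. A x t $ i $ j"] conjI)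
  have "(%x. A x t $ i $ j) holomorphic_on Pt -` D"
   using analytic joint_holomorphic_slice[OF _ o t] unfolding analytic_equation_on_def by blast
  thus "(%x. A x t $ i $ j) analytic_on {z}" unfolding analytic_at using o x Pt by auto
 qed simp
 thus ?thesis using Pt by simp
next
 case Infty
 have o: "open (inf_chart -` D)" using D_open open_chart_vimage[of D True] by simp
 have "\<exists>g. g analytic_on {0} & (\<forall>\<^sub>F x in at 0. at_inf A x t $ i $ j = g x)" for i j
 proof -
  obtain B where B: "joint_holomorphic_on B ((inf_chart -` D) \<times> P)"
   "!!w t. w ~= 0 ==> inf_chart w : D ==> t : P ==> B w t = at_inf A w t $ i $ j"
   using analytic unfolding analytic_equation_on_def by blast
  have "(%w. B w t) holomorphic_on inf_chart -` D" by (rule joint_holomorphic_slice[OF B(1) o t])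
  hence "(%w. B w t) analytic_on {0}" unfolding analytic_at using o x Infty by auto
  moreover have "\<forall>\<^sub>F w in at 0. w : inf_chart -` D - {0}" by (rule eventually_at_in_open[OF o]) (use x Infty in simp)
  hence "\<forall>\<^sub>F w in at 0. at_inf A w t $ i $ j = B w t" by eventually_elim (use B(2) t in auto)
  ultimately show ?thesis by (intro exI[of _ "%w. B w t"]) auto
 qed
 thus ?thesis using Infty by simp
qed

lemma regular_off_Sing:
 assumes t: "t : P" and x: "x \<notin> Sing t" shows "\<not> singular_point A t x"
proof (cases "x : D")
 case True thus ?thesis using regular_on_D t by blast
next
 case False
 then obtain i where i: "i < m" "x : B i" using compl_D by blast
 hence "x ~= \<xi> i t" using x by (auto simp: Sing_def)
 thus ?thesis using unique_singular[OF i(1) t] i(2) by blast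
qed

lemma Sing_disjoint_D: assumes "t : P" shows "Sing t \<inter> D = {}"
proof -
 have "\<xi> i t : B i" if "i < m" for i using unique_singular[OF that assms] by blast
 thus ?thesis using compl_D by (auto simp: Sing_def)
qed

lemma coeff_at_D:
 assumes t: "t : P" and z: "Pt z : D" shows "coeff_at A t False z = A z t"
proof -
 have o: "open (Pt -` D)" using D_open open_chart_vimage[of D False] by simp
 have "coeff_at A t False z $ i $ j = A z t $ i $ j" for i j
 proof -
  have "(%x. A x t $ i $ j) holomorphic_on Pt -` D"
   using analytic joint_holomorphic_slice[OF _ o t] unfolding analytic_equation_on_def by blast
  hence "(%x. A x t $ i $ j) analytic_on {z}" unfolding analytic_at using o z by auto
  hence "\<forall>\<^sub>F x in nhds z. coeff_at A t False x $ i $ j = A x t $ i $ j"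
   by (rule coeff_at_eq) (simp add: chart_system_def)
  thus ?thesis by (rule eventually_nhds_x_imp_x)
 qed
 thus ?thesis by (simp add: vec_eq_iff)
qed

lemma infinite_D: "infinite (Pt -` D)"
proof -
 have o: "open (chart ka -` D)" for ka by (rule open_chart_vimage[OF D_open])
 have "\<exists>z. Pt z : D"
 proof (cases x0)
  case (Pt z) thus ?thesis using x0_in by auto
 next
  case Infty
  hence "0 : inf_chart -` D" using x0_in by simp
  hence "\<forall>\<^sub>F w in at 0. w : inf_chart -` D - {0}" using eventually_at_in_open[OF o[of True]] by simp
  hence "\<exists>w. w : inf_chart -` D - {0}" by (rule eventually_happens'[OF at_neq_bot])
  thus ?thesis by auto
 qed
 then obtain z where z: "z : Pt -` D" by auto
 show ?thesis
 proof
  assume "finite (Pt -` D)"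
  moreover have "z islimpt (Pt -` D)" using z o[of False] by (simp add: interior_limit_point interior_open)
  ultimately show False by (simp add: islimpt_finite)
 qed
qed

text \<open>Inside \<open>D\<close> the relation between numerator and denominator is assumed. The
  entry is rational in x and \<open>D\<close> contains infinitely many finite points, so a
  polynomial identity carries the relation to all but finitely many x.\<close>

lemma eventually_quotient:
 assumes t: "t : P"
 shows "\<exists>S. finite S & (\<forall>x. x \<notin> S --> poly (poly_at (den i j) t) x * A x t $ i $ j = poly (poly_at (num i j) t) x)"
proof -
 obtain u v where v: "v ~= 0" "!!x. poly v x ~= 0 ==> A x t $ i $ j = poly u x / poly v x"
  using entries_rational[OF t] unfolding rational_function_def by blast
 have fin: "finite {x. poly v x = 0}" using v(1) by (rule poly_roots_finite)
 have "poly (poly_at (den i j) t * u - poly_at (num i j) t * v) x = 0" if "x : Pt -` D - {x. poly v x = 0}" for x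
 proof -
  have "poly (poly_at (num i j) t) x = poly (poly_at (den i j) t) x * (poly u x / poly v x)"
   using that v(2)[of x] entries_quotient[OF t, of x i j] by auto
  thus ?thesis using that by simp
 qed
 hence "Pt -` D - {x. poly v x = 0} <= {x. poly (poly_at (den i j) t * u - poly_at (num i j) t * v) x = 0}" by blast
 moreover have "infinite (Pt -` D - {x. poly v x = 0})" using infinite_D fin by simp
 ultimately have "infinite {x. poly (poly_at (den i j) t * u - poly_at (num i j) t * v) x = 0}" using finite_subset by blast
 hence eq: "poly_at (den i j) t * u - poly_at (num i j) t * v = 0" using poly_roots_finite by blast
 have "poly (poly_at (den i j) t) x * A x t $ i $ j = poly (poly_at (num i j) t) x" if "poly v x ~= 0" for x
 proof -
  have "poly (poly_at (den i j) t * u - poly_at (num i j) t * v) x = 0" using eq by simp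
  hence "poly (poly_at (den i j) t) x * poly u x = poly (poly_at (num i j) t) x * poly v x" by simp
  hence "poly (poly_at (den i j) t) x * (poly u x / poly v x) = poly (poly_at (num i j) t) x"
   using that by (simp add: nonzero_divide_eq_eq)
  thus ?thesis using v(2)[OF that] by simp
 qed
 thus ?thesis using fin by blast
qed

lemma chart_quotient:
 assumes t: "t : P" and z: "chart ka z \<notin> Sing t"
 shows "poly (poly_at (chart_den (num i j) (den i j) ka) t) z * coeff_at A t ka z $ i $ j = poly (poly_at (chart_num (num i j) (den i j) ka) t) z"
proof -
 let ?d = "poly_at (chart_den (num i j) (den i j) ka) t" and ?n = "poly_at (chart_num (num i j) (den i j) ka) t"
 obtain S where S: "finite S" "!!x. x \<notin> S ==> poly (poly_at (den i j) t) x * A x t $ i $ j = poly (poly_at (num i j) t) x"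
  using eventually_quotient[OF t] by blast
 have fin: "finite (S \<union> {0} \<union> (%x. 1 / x) ` S)" using S(1) by simp
 have "open (- (S \<union> {0} \<union> (%x. 1 / x) ` S - {z}))" using fin by (intro open_Compl finite_imp_closed) auto
 hence "\<forall>\<^sub>F x in at z. x : - (S \<union> {0} \<union> (%x. 1 / x) ` S - {z}) - {z}" by (rule eventually_at_in_open) auto
 hence ev: "\<forall>\<^sub>F x in at z. poly ?d x * chart_system A ka x t $ i $ j = poly ?n x"
 proof eventually_elim
  case (elim x)
  hence x: "x \<notin> S" "x ~= 0" "1 / x \<notin> S" by (auto simp: image_iff)
  show ?case
  proof (cases ka)
   case True
   thus ?thesis using chart_quotient_identity[OF x(2) S(2)[OF x(3)]] by (simp add: chart_system_def at_inf_def)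
  next
   case False
   thus ?thesis using S(2)[OF x(1)] by (simp add: chart_system_def chart_den_def chart_num_def)
  qed
 qed
 obtain g where g: "g analytic_on {z}" "\<forall>\<^sub>F x in at z. chart_system A ka x t $ i $ j = g x" "\<forall>\<^sub>F x in nhds z. coeff_at A t ka x $ i $ j = g x"
  using coeff_at_regular[OF regular_off_Sing[OF t z]] by blast
 have "isCont g z" using g(1) by (intro field_differentiable_imp_continuous_at analytic_on_imp_differentiable_at[of _ "{z}"]) auto
 hence "((%x. poly ?d x * g x - poly ?n x) \<longlongrightarrow> poly ?d z * g z - poly ?n z) (at z)"
  unfolding isCont_def by (intro tendsto_intros)
 moreover have "\<forall>\<^sub>F x in at z. poly ?d x * g x - poly ?n x = 0" using ev g(2) by eventually_elim simp
 ultimately have "((%x. 0) \<longlongrightarrow> poly ?d z * g z - poly ?n z) (at z)" using tendsto_cong by fastforce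
 hence "poly ?d z * g z - poly ?n z = 0" using LIM_unique tendsto_const by blast
 moreover have "coeff_at A t ka z $ i $ j = g z" using g(3) by (rule eventually_nhds_x_imp_x)
 ultimately show ?thesis by simp
qed


lemma \<xi>_continuous:
 assumes t: "t : P" and i: "i < m" and W: "open W" "\<xi> i t : W"
 shows "\<forall>\<^sub>F t' in nhds t. \<xi> i t' : W"
proof -
 obtain ka U al where U: "open U" "t : U" "!!t'. t' : U ==> \<xi> i t' = chart ka (al t')" "mv_holomorphic_on al U"
 proof (cases "\<xi> i t = Infty")
  case True
  then obtain U al where U: "open U" "t : U" "\<forall>t\<in>U. \<xi> i t = inf_chart (al t)" "param_regular_singular U al (at_inf A)"
   using regular_singular[OF i t] unfolding param_regular_singular_near_def by auto
  have h: "mv_holomorphic_on al U" using U(4) unfolding param_regular_singular_def by blast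
  show ?thesis by (rule that[of U True al]) (use U h in auto)
 next
  case False
  then obtain U al where U: "open U" "t : U" "\<forall>t\<in>U. \<xi> i t = Pt (al t)" "param_regular_singular U al A"
   using regular_singular[OF i t] unfolding param_regular_singular_near_def by auto
  have h: "mv_holomorphic_on al U" using U(4) unfolding param_regular_singular_def by blast
  show ?thesis by (rule that[of U False al]) (use U h in auto)
 qed
 have "continuous_on U (%t. chart ka (al t))"
  by (rule continuous_on_compose2[OF continuous_chart[of UNIV] mv_holomorphic_on_continuous[OF U(4)]]) simp
 hence "open ((%t. chart ka (al t)) -` W \<inter> U)" using continuous_on_open_vimage[OF U(1)] W(1) by blast
 hence "\<forall>\<^sub>F t' in nhds t. t' : (%t. chart ka (al t)) -` W \<inter> U"
  by (rule eventually_nhds_in_open) (use U W in auto)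
 thus ?thesis by eventually_elim (use U(3) in auto)
qed

text \<open>The singular points move continuously, so one neighbourhood of a regular point stays
  free of them for all nearby parameters. On it the difference quotients in the parameter can be
  formed.\<close>

lemma Sing_avoid:
 assumes t: "t : P" and x: "x \<notin> Sing t"
 obtains W where "open W" "x : W" "\<forall>\<^sub>F t' in nhds t. W \<inter> Sing t' = {}"
proof -
 have "\<exists>W. open W & x : W & (\<forall>\<^sub>F t' in nhds t. \<xi> i t' \<notin> W)" if i: "i < m" for i
 proof -
  have "x ~= \<xi> i t" using x i by (auto simp: Sing_def)
  from hausdorff[OF this] obtain V W where VW: "open V" "open W" "x : V" "\<xi> i t : W" "V \<inter> W = {}" by blast
  have "\<forall>\<^sub>F t' in nhds t. \<xi> i t' \<notin> V"
   using \<xi>_continuous[OF t i VW(2,4)] by eventually_elim (use VW(5) in blast)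
  thus ?thesis using VW by blast
 qed
 hence "\<forall>i. \<exists>W. i < m --> open W & x : W & (\<forall>\<^sub>F t' in nhds t. \<xi> i t' \<notin> W)" by blast
 from choice[OF this] obtain W where "\<forall>i. i < m --> open (W i) & x : W i & (\<forall>\<^sub>F t' in nhds t. \<xi> i t' \<notin> W i)" ..
 hence W: "!!i. i < m ==> open (W i)" "!!i. i < m ==> x : W i" "!!i. i < m ==> \<forall>\<^sub>F t' in nhds t. \<xi> i t' \<notin> W i"
  by simp_all
 have "\<forall>\<^sub>F t' in nhds t. \<forall>i\<in>{..<m}. \<xi> i t' \<notin> W i"
  by (intro eventually_ball_finite) (use W in auto)
 hence "\<forall>\<^sub>F t' in nhds t. (\<Inter>i<m. W i) \<inter> Sing t' = {}" by eventually_elim (auto simp: Sing_def)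
 moreover have "open (\<Inter>i<m. W i)" using W by (intro open_INT) auto
 ultimately show ?thesis using W(2) by (intro that[of "\<Inter>i<m. W i"]) auto
qed

lemma line_tendsto: "((%s::complex. t + s *s (v :: complex ^ 'r)) \<longlongrightarrow> t) (at 0)"
proof -
 have "linear (%s::complex. s *s v)" by (rule linear_vector_scale)
 hence "((%s. s *s v) \<longlongrightarrow> 0 *s v) (at 0)"
  by (metis linear_continuous_at linear_conv_bounded_linear isCont_def)
 thus ?thesis using tendsto_add[OF tendsto_const[of t]] by fastforce
qed

lemma eventually_line:
 assumes "\<forall>\<^sub>F t' in nhds t. Q t'" shows "\<forall>\<^sub>F s in at (0::complex). Q (t + s *s (v :: complex ^ 'r))"
 using line_tendsto[of t v] assms unfolding filterlim_iff by blast

lemma difference_quotient_at: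
 assumes t: "t : P" and de: "!!i j. poly_at (den i j) t ~= 0" and q: "chart ka q \<notin> Sing t"
 shows "\<exists>rh>0. \<exists>F. F holomorphic_on ball q rh &
  uniform_limit (cball q rh) (%s x. (coeff_at A (t + s *s axis k 1) ka x $ i $ j - coeff_at A t ka x $ i $ j) / s) F (at 0) &
  (\<forall>x\<in>ball q rh. poly (poly_at (chart_den (num i j) (den i j) ka) t) x ^ 2 * F x =
    poly (poly_at (map (partial k) (chart_num (num i j) (den i j) ka)) t) x * poly (poly_at (chart_den (num i j) (den i j) ka) t) x
    - poly (poly_at (chart_num (num i j) (den i j) ka) t) x * poly (poly_at (map (partial k) (chart_den (num i j) (den i j) ka)) t) x)"
proof -
 let ?cs = "chart_num (num i j) (den i j) ka" and ?ds = "chart_den (num i j) (den i j) ka"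
 define l where "l f s = f (t + s *s axis k 1)" for f :: "complex ^ 'r => complex" and s :: complex
 define f where "f s x = coeff_at A (t + s *s axis k 1) ka x $ i $ j" for s x
 have t0: "t + 0 *s axis k 1 = t" by simp
 have la: "poly_at (map l cs) s = poly_at cs (t + s *s axis k 1)" for cs s by (simp add: poly_at_def l_def o_def)
 have ld: "Poly (map (%h. deriv h 0) (map l cs)) = poly_at (map (partial k) cs) t" for cs
  by (simp add: poly_at_def l_def[abs_def] o_def partial_def[abs_def])
 obtain W where W: "open W" "chart ka q : W" "\<forall>\<^sub>F t' in nhds t. W \<inter> Sing t' = {}"
  using Sing_avoid[OF t q] by blast
 obtain rh0 where rh0: "rh0 > 0" "cball q rh0 <= chart ka -` W" using chart_nbhd[OF W(1,2)] by blast
 have reg: "f s holomorphic_on ball q rh0 & (\<forall>x\<in>ball q rh0. poly (poly_at (map l ?ds) s) x * f s x = poly (poly_at (map l ?cs) s) x)"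
  if s: "t + s *s axis k 1 : P" "W \<inter> Sing (t + s *s axis k 1) = {}" for s
 proof
  have ns: "chart ka x \<notin> Sing (t + s *s axis k 1)" if "x : ball q rh0" for x
  proof -
   have "chart ka x : W" using rh0(2) that by (auto simp: subset_iff)
   thus ?thesis using s(2) by blast
  qed
  have "mholo (coeff_at A (t + s *s axis k 1) ka) (ball q rh0)"
   by (rule coeff_at_holomorphic) (use ns regular_off_Sing[OF s(1)] in blast)
  thus "f s holomorphic_on ball q rh0" by (simp add: mholo_def f_def[abs_def])
  show "\<forall>x\<in>ball q rh0. poly (poly_at (map l ?ds) s) x * f s x = poly (poly_at (map l ?cs) s) x"
   using chart_quotient[OF s(1) ns] by (simp add: la f_def)
 qed
 have "\<forall>\<^sub>F t' in nhds t. t' : P" by (rule eventually_nhds_in_open[OF P_open t])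
 from eventually_line[OF this] eventually_line[OF W(3)]
 have ev: "\<forall>\<^sub>F s in at 0. f s holomorphic_on ball q rh0 & (\<forall>x\<in>ball q rh0. poly (poly_at (map l ?ds) s) x * f s x = poly (poly_at (map l ?cs) s) x)"
  by eventually_elim (rule reg)
 have "W \<inter> Sing t = {}" using W(3) by (rule eventually_nhds_x_imp_x)
 hence r0: "f 0 holomorphic_on ball q rh0" "!!x. x : ball q rh0 ==> poly (poly_at (map l ?ds) 0) x * f 0 x = poly (poly_at (map l ?cs) 0) x"
  using reg[of 0] t by auto
 have hol: "mv_holomorphic_on h P" if "h : set ?cs \<union> set ?ds" for h
 proof -
  have z: "mv_holomorphic_on (%_. 0) P" unfolding mv_holomorphic_on_def by (auto intro!: exI[of _ "%_. 0"])
  have m: "mv_holomorphic_on (%t. - f t) P" if f: "mv_holomorphic_on f P" for f :: "complex ^ 'r => complex"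
   unfolding mv_holomorphic_on_def
  proof
   fix t assume "t : P"
   then obtain f' where "(f has_derivative f') (at t)" "\<forall>c v. f' (c *s v) = c * f' v"
    using f unfolding mv_holomorphic_on_def by blast
   thus "\<exists>f'. ((%t. - f t) has_derivative f') (at t) & (\<forall>c v. f' (c *s v) = c * f' v)"
    by (intro exI[of _ "%v. - f' v"]) (auto intro!: derivative_eq_intros)
  qed
  show ?thesis using that z coeffs_holomorphic[of _ i j] m by (auto simp: chart_num_def chart_den_def split: if_splits)
 qed
 have diff: "h field_differentiable (at 0)" if h: "h : set (map l ?cs) \<union> set (map l ?ds)" for h
 proof -
  obtain h' where h': "h' : set ?cs \<union> set ?ds" "h = l h'" using h by auto
  have "t + 0 *s axis k 1 : P" using t by simp
  from mv_holomorphic_on_line[OF hol[OF h'(1)] this] show ?thesis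
   unfolding h'(2) l_def[abs_def] field_differentiable_def by blast
 qed
 have "poly_at (map l ?ds) 0 ~= 0" unfolding la t0 by (rule chart_den_nonzero[OF de])
 from difference_quotient_limit[OF diff this rh0(1) ev r0] show ?thesis unfolding ld la t0 f_def by blast
qed


context
 fixes t :: "complex ^ 'r" and k :: 'r
 assumes t: "t : P" and de: "!!i j. poly_at (den i j) t ~= 0"
begin

lemma var_at_loc:
 assumes q: "q : chart ka -` (- Sing t)"
 shows "\<exists>rh>0. \<exists>F. F holomorphic_on ball q rh &
  uniform_limit (cball q rh) (%s x. (coeff_at A (t + s *s axis k 1) ka x $ i $ j - coeff_at A t ka x $ i $ j) / s) F (at 0)"
proof -
 have "chart ka q \<notin> Sing t" using q by simp
 from difference_quotient_at[OF t de this, of k i j] show ?thesis by blast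
qed

lemma var_at_holomorphic: "mholo (var_at A t k ka) (chart ka -` (- Sing t))"
 unfolding mholo_def var_at_def by (auto intro!: locally_uniform_limit(2) var_at_loc)

lemma var_at_limit_entry:
 assumes K: "compact K" "K <= chart ka -` (- Sing t)"
 shows "uniform_limit K (%s x. (coeff_at A (t + s *s axis k 1) ka x $ i $ j - coeff_at A t ka x $ i $ j) / s)
   (%x. var_at A t k ka x $ i $ j) (at 0)"
 using locally_uniform_limit(1)[OF var_at_loc[where ka = ka and i = i and j = j] K] by (simp add: var_at_def)

lemma var_at_limit:
 assumes K: "compact K" "K <= chart ka -` (- Sing t)"
 shows "uniform_limit K (%s x. mat (1 / s) ** (coeff_at A (t + s *s axis k 1) ka x - coeff_at A t ka x)) (var_at A t k ka) (at 0)"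
 by (rule uniform_limit_matrix) (use var_at_limit_entry[OF K] in \<open>simp add: mat_mult_left\<close>)

lemma coeff_at_limit:
 assumes K: "compact K" "K <= chart ka -` (- Sing t)"
 shows "uniform_limit K (%s. coeff_at A (t + s *s axis k 1) ka) (coeff_at A t ka) (at 0)"
proof (rule uniform_limit_matrix)
 fix i j
 let ?g = "%s x. (coeff_at A (t + s *s axis k 1) ka x $ i $ j - coeff_at A t ka x $ i $ j) / s"
 have "continuous_on K (%x. var_at A t k ka x $ i $ j)" using var_at_holomorphic K(2) unfolding mholo_def
  by (meson holomorphic_on_imp_continuous_on continuous_on_subset)
 hence "bounded ((%x. var_at A t k ka x $ i $ j) ` K)" using K(1) by (intro compact_imp_bounded compact_continuous_image)
 moreover have "bounded ((%x. 0 :: complex) ` K)" by (rule bounded_subset[of "{0}"]) auto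
 ultimately have "uniform_limit K (%s x. s * ?g s x) (%x. 0 * var_at A t k ka x $ i $ j) (at 0)"
  by (intro uniform_lim_mult uniform_limit_of_tendsto var_at_limit_entry K tendsto_ident_at)
 hence 1: "uniform_limit K (%s x. s * ?g s x + coeff_at A t ka x $ i $ j) (%x. 0 * var_at A t k ka x $ i $ j + coeff_at A t ka x $ i $ j) (at 0)"
  by (rule uniform_limit_add[OF _ uniform_limit_const])
 have s0: "\<forall>\<^sub>F s in at (0::complex). s ~= 0" by (auto simp: eventually_at_filter)
 have ev: "\<forall>\<^sub>F s in at 0. \<forall>x\<in>K. s * ?g s x + coeff_at A t ka x $ i $ j = coeff_at A (t + s *s axis k 1) ka x $ i $ j"
  using s0 by eventually_elim simp
 show "uniform_limit K (%s x. coeff_at A (t + s *s axis k 1) ka x $ i $ j) (%x. coeff_at A t ka x $ i $ j) (at 0)"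
  by (rule uniform_limit_cong[THEN iffD1, OF ev _ 1]) simp
qed

lemma var_at_quotient:
 assumes q: "chart ka q \<notin> Sing t"
 shows "poly (poly_at (chart_den (num i j) (den i j) ka) t) q ^ 2 * var_at A t k ka q $ i $ j =
    poly (poly_at (map (partial k) (chart_num (num i j) (den i j) ka)) t) q * poly (poly_at (chart_den (num i j) (den i j) ka) t) q
    - poly (poly_at (chart_num (num i j) (den i j) ka) t) q * poly (poly_at (map (partial k) (chart_den (num i j) (den i j) ka)) t) q"
proof -
 obtain rh F where F: "rh > 0"
  "uniform_limit (cball q rh) (%s x. (coeff_at A (t + s *s axis k 1) ka x $ i $ j - coeff_at A t ka x $ i $ j) / s) F (at 0)"
  "\<forall>x\<in>ball q rh. poly (poly_at (chart_den (num i j) (den i j) ka) t) x ^ 2 * F x =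
    poly (poly_at (map (partial k) (chart_num (num i j) (den i j) ka)) t) x * poly (poly_at (chart_den (num i j) (den i j) ka) t) x
    - poly (poly_at (chart_num (num i j) (den i j) ka) t) x * poly (poly_at (map (partial k) (chart_den (num i j) (den i j) ka)) t) x"
  using difference_quotient_at[OF t de q, of k i j] by blast
 have "uniform_limit {q} (%s x. (coeff_at A (t + s *s axis k 1) ka x $ i $ j - coeff_at A t ka x $ i $ j) / s) F (at 0)"
  by (rule uniform_limit_on_subset[OF F(2)]) (use F(1) in auto)
 hence "F q = var_at A t k ka q $ i $ j" by (simp add: var_at_def tendsto_Lim)
 moreover have "q : ball q rh" using F(1) by simp
 ultimately show ?thesis using F(3) by metis
qed

lemma var_at_switch:
 assumes w: "w ~= 0" and q: "inf_chart w \<notin> Sing t"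
 shows "var_at A t k True w = mat (- 1 / w\<^sup>2) ** var_at A t k False (1 / w)"
proof -
 have "var_at A t k True w $ i $ j = (- 1 / w\<^sup>2) * var_at A t k False (1 / w) $ i $ j" for i j
 proof -
  let ?c = "%s. coeff_at A (t + s *s axis k 1)"
  have "uniform_limit {w} (%s x. (?c s True x $ i $ j - coeff_at A t True x $ i $ j) / s) (%x. var_at A t k True x $ i $ j) (at 0)"
   by (rule var_at_limit_entry) (use q in auto)
  hence 1: "((%s. (?c s True w $ i $ j - coeff_at A t True w $ i $ j) / s) \<longlongrightarrow> var_at A t k True w $ i $ j) (at 0)" by simp
  have "uniform_limit {1 / w} (%s x. (?c s False x $ i $ j - coeff_at A t False x $ i $ j) / s) (%x. var_at A t k False x $ i $ j) (at 0)"
   by (rule var_at_limit_entry) (use q w in auto)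
  hence "((%s. (?c s False (1 / w) $ i $ j - coeff_at A t False (1 / w) $ i $ j) / s) \<longlongrightarrow> var_at A t k False (1 / w) $ i $ j) (at 0)" by simp
  hence 2: "((%s. (- 1 / w\<^sup>2) * ((?c s False (1 / w) $ i $ j - coeff_at A t False (1 / w) $ i $ j) / s)) \<longlongrightarrow> (- 1 / w\<^sup>2) * var_at A t k False (1 / w) $ i $ j) (at 0)"
   by (rule tendsto_mult_left)
  obtain W where W: "open W" "inf_chart w : W" "\<forall>\<^sub>F t' in nhds t. W \<inter> Sing t' = {}" using Sing_avoid[OF t q] by blast
  have sw: "coeff_at A t' True w $ i $ j = (- 1 / w\<^sup>2) * coeff_at A t' False (1 / w) $ i $ j" if "t' : P" "W \<inter> Sing t' = {}" for t'
  proof -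
   have "inf_chart w \<notin> Sing t'" using that W(2) by blast
   from coeff_at_switch[OF w regular_off_Sing[OF that(1) this]] show ?thesis by (simp add: mat_mult_left)
  qed
  have "\<forall>\<^sub>F t' in nhds t. t' : P" by (rule eventually_nhds_in_open[OF P_open t])
  from eventually_line[OF this, of "axis k 1"] eventually_line[OF W(3), of "axis k 1"]
  have "\<forall>\<^sub>F s in at 0. (?c s True w $ i $ j - coeff_at A t True w $ i $ j) / s = (- 1 / w\<^sup>2) * ((?c s False (1 / w) $ i $ j - coeff_at A t False (1 / w) $ i $ j) / s)"
  proof eventually_elim
   case (elim s)
   have "W \<inter> Sing t = {}" using W(3) by (rule eventually_nhds_x_imp_x)
   thus ?case using sw[OF elim] sw[OF t] by (simp add: algebra_simps diff_divide_distrib)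
  qed
  from tendsto_cong[OF this] 1 2 show ?thesis using LIM_unique by blast
 qed
 thus ?thesis by (simp add: vec_eq_iff mat_mult_left)
qed

end

end

section \<open>Analytic continuation, monodromy and the topology of \<open>D\<close>\<close>

lemma lift_combine:
 assumes ls: "local_system X s1" "local_system X s2" "local_system X s3"
  and op: "!!f g N. s1 f N ==> s2 g N ==> s3 (%x. op (f x) (g x)) N"
  and u: "local_system.lift s1 H ph u" "local_system.lift s2 H ph v"
 shows "local_system.lift s3 H ph (%z. op (u z) (v z))" unfolding local_system.lift_def[OF ls(3)]
proof
 interpret S1: local_system X s1 by (rule ls)
 interpret S2: local_system X s2 by (rule ls)
 fix z assume z: "z : H"
 obtain f N e where f: "s1 f N" "ph z : N" "e > 0" "!!z'. z' : H ==> dist z' z < e ==> u z' = f (ph z')"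
  using S1.liftE[OF u(1) z] by blast
 obtain g M e' where g: "s2 g M" "ph z : M" "e' > 0" "!!z'. z' : H ==> dist z' z < e' ==> v z' = g (ph z')"
  using S2.liftE[OF u(2) z] by blast
 have o: "open (N \<inter> M)" using S1.sec_open[OF f(1)] S2.sec_open[OF g(1)] by blast
 have "s3 (%x. op (f x) (g x)) (N \<inter> M)"
  by (rule op) (use S1.sec_restrict[OF f(1) o] S2.sec_restrict[OF g(1) o] in auto)
 moreover have "\<exists>e>0. \<forall>z'\<in>H. dist z' z < e --> op (u z') (v z') = op (f (ph z')) (g (ph z'))"
  by (intro exI[of _ "min e e'"]) (use f g in auto)
 ultimately show "\<exists>f N. s3 f N & ph z : N & (\<exists>e>0. \<forall>z'\<in>H. dist z' z < e --> op (u z') (v z') = f (ph z'))"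
  using f(2) g(2) by (intro exI[of _ "%x. op (f x) (g x)"] exI[of _ "N \<inter> M"]) auto
qed

text \<open>Analytic continuation of a solution agrees with its lift: the points where the continued germs
 are solutions through the lift form an open and closed set by the identity theorem.\<close>

lemma (in sphere_ode) continuation_lift:
 fixes Y Y1 :: "riemann_sphere => complex ^ 'n ^ 'n"
 assumes Y: "sec Y N0" "\<gamma> 0 : N0" and \<gamma>: "path \<gamma>" "path_image \<gamma> <= X"
  and cont: "!!a b. analytic_continuation \<gamma> (%x. Y x $ a $ b) (%x. Y1 x $ a $ b)"
  and u: "lift {0..1} \<gamma> u" "u 0 = Y (\<gamma> 0)"
 shows "u 1 = Y1 (\<gamma> 1)"
proof -
 define Pr where "Pr a b F N \<longleftrightarrow> (\<forall>s\<in>{0..1}. open (N s) & \<gamma> s : N s & sphere_holomorphic_on (F s) (N s)) &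
    (\<forall>s\<in>{0..1}. \<exists>\<epsilon>>0. \<forall>s'\<in>{0..1}. \<bar>s' - s\<bar> < \<epsilon> --> \<gamma> s' : N s & (\<forall>\<^sub>F x in nhds (\<gamma> s'). F s' x = F s x)) &
    (\<forall>\<^sub>F x in nhds (\<gamma> 0). F 0 x = Y x $ a $ b) & (\<forall>\<^sub>F x in nhds (\<gamma> 1). F 1 x = Y1 x $ a $ b)" for a b F N
 have "\<forall>a b. \<exists>F N. Pr a b F N" using cont unfolding analytic_continuation_def Pr_def by blast
 then obtain F M where "!!a b. Pr a b (F a b) (M a b)" by metis
 note FM = this[unfolded Pr_def]
 define germ where "germ s f \<longleftrightarrow> (\<forall>\<^sub>F x in nhds (\<gamma> s). \<forall>a b. F a b s x = f x $ a $ b)" for s and f :: "riemann_sphere => complex ^ 'n ^ 'n"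
 \<comment> \<open>\<open>C s\<close>: the continued germ at time \<open>s\<close> is the germ of a
   solution through the lifted value. It holds at 0 and has to be carried to 1.\<close>
 define C where "C s \<longleftrightarrow> (\<exists>f N. sec f N & \<gamma> s : N & f (\<gamma> s) = u s & germ s f)" for s
 have \<gamma>c: "continuous_on {0..1} \<gamma>" using \<gamma>(1) by (simp add: path_def)
 have \<gamma>X: "\<gamma> s : X" if "s : {0..1}" for s using \<gamma>(2) that by (auto simp: path_image_def)
 have step: "\<exists>\<epsilon>>0. \<exists>E. \<forall>s'\<in>{0..1}. dist s' s < \<epsilon> --> C s' = E" if s: "s : {0..1}" for s
 proof -
  obtain ka z where z: "\<gamma> s = chart ka z" by (rule chart_cases)
  obtain f N e where f: "sec f N" "\<gamma> s : N" "e > 0" "!!s'. s' : {0..1} ==> dist s' s < e ==> u s' = f (\<gamma> s')"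
   using liftE[OF u(1) s] by blast
  define W where "W = N \<inter> (\<Inter>a. \<Inter>b. M a b s)"
  have W: "open W" "\<gamma> s : W" unfolding W_def using FM s f(1,2) sec_open by (auto intro!: open_Int open_INT)
  obtain r where r: "r > 0" "cball z r <= chart ka -` W" using chart_nbhd[of W ka z] W z by auto
  define S where "S = ball z r"
  have SW: "chart ka ` S <= W" using r(2) by (auto simp: S_def subset_iff)
  have oS: "open (chart ka ` S)" "\<gamma> s : chart ka ` S" using r z by (auto simp: S_def open_chart_image)
  \<comment> \<open>By the identity theorem on the disk, agreement of the germs with the solution
    near one point spreads to all of \<open>S\<close>. Hence near \<open>s\<close> the statement
    \<open>C\<close> has the constant truth value \<open>E\<close>.\<close>
  define E where "E \<longleftrightarrow> (\<forall>x\<in>chart ka ` S. \<forall>a b. F a b s x = f x $ a $ b)"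
  obtain e1 where e1: "e1 > 0" "!!s'. s' : {0..1} ==> dist s' s < e1 ==> \<gamma> s' : chart ka ` S"
   using preimage_nbhd[OF \<gamma>c s oS] by blast
  have "\<forall>\<^sub>F s' in nhds s. s' : {0..1} --> (\<forall>\<^sub>F x in nhds (\<gamma> s'). F a b s' x = F a b s x)" for a b
   using FM[of a b] s unfolding eventually_nhds_metric dist_real_def by blast
  hence "\<forall>\<^sub>F s' in nhds s. \<forall>a b. s' : {0..1} --> (\<forall>\<^sub>F x in nhds (\<gamma> s'). F a b s' x = F a b s x)"
   by (intro eventually_all_finite)
  then obtain e2 where e2: "e2 > 0" "!!s' a b. dist s' s < e2 ==> s' : {0..1} ==> \<forall>\<^sub>F x in nhds (\<gamma> s'). F a b s' x = F a b s x"
   unfolding eventually_nhds_metric by blast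
  have hol: "(%w. F a b s (chart ka w)) holomorphic_on S" "(%w. f (chart ka w) $ a $ b) holomorphic_on S" for a b
  proof -
   have "sphere_holomorphic_on (F a b s) (M a b s)" using FM s by blast
   hence "(%w. F a b s (chart ka w)) holomorphic_on chart ka -` M a b s"
    unfolding sphere_holomorphic_on_def by (cases ka) auto
   moreover have "S <= chart ka -` M a b s" using SW by (auto simp: W_def)
   ultimately show "(%w. F a b s (chart ka w)) holomorphic_on S" by (rule holomorphic_on_subset)
   have "mholo (%w. f (chart ka w)) S"
    by (rule mder_imp_mholo, rule sec_mder[OF f(1)]) (use SW in \<open>auto simp: W_def\<close>)
   thus "(%w. f (chart ka w) $ a $ b) holomorphic_on S" by (simp add: mholo_def)
  qed
  have "C s' = E" if s': "s' : {0..1}" "dist s' s < min e (min e1 e2)" for s'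
  proof
   have \<gamma>s': "\<gamma> s' : chart ka ` S" "\<gamma> s' : N" using e1(2)[OF s'(1)] s'(2) SW by (auto simp: W_def)
   have us': "u s' = f (\<gamma> s')" using f(4) s' by auto
   have "\<forall>a b. \<forall>\<^sub>F x in nhds (\<gamma> s'). F a b s' x = F a b s x" using e2(2) s' by auto
   hence Fs': "\<forall>\<^sub>F x in nhds (\<gamma> s'). \<forall>a b. F a b s' x = F a b s x" by (intro eventually_all_finite) auto
   show E if Cs': "C s'"
   proof -
    obtain g L where g: "sec g L" "\<gamma> s' : L" "g (\<gamma> s') = u s'" "germ s' g" using Cs' unfolding C_def by blast
    have fg: "f (\<gamma> s') = g (\<gamma> s')" using us' g(3) by simp
    obtain V where V: "open V" "\<gamma> s' : V" "V <= N \<inter> L" "!!y. y : V ==> f y = g y"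
     by (rule sections_agree_locally[OF f(1) g(1) \<gamma>s'(2) g(2) \<gamma>X[OF s'(1)] fg], rule that)
    have "\<forall>\<^sub>F x in nhds (\<gamma> s'). x : V" using V(1,2) by (rule eventually_nhds_in_open)
    with Fs' g(4)[unfolded germ_def] have "\<forall>\<^sub>F x in nhds (\<gamma> s'). \<forall>a b. F a b s x = f x $ a $ b"
     by eventually_elim (use V(4) in auto)
    then obtain T where T: "open T" "\<gamma> s' : T" "!!x a b. x : T ==> F a b s x = f x $ a $ b"
     unfolding eventually_nhds by blast
    obtain w where w: "w : S" "\<gamma> s' = chart ka w" using \<gamma>s'(1) by auto
    have oT: "open (chart ka -` T \<inter> S)" using open_chart_vimage[OF T(1)] by (auto simp: S_def)
    have "F a b s (chart ka v) = f (chart ka v) $ a $ b" if "v : S" for v a b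
     by (rule analytic_continuation_open[of "chart ka -` T \<inter> S" S "%w. F a b s (chart ka w)" "%w. f (chart ka w) $ a $ b" v, OF oT])
      (use w T hol that in \<open>auto simp: S_def\<close>)
    thus E by (auto simp: E_def)
   qed
   show "C s'" if E
   proof -
    have "\<forall>\<^sub>F x in nhds (\<gamma> s'). x : chart ka ` S" using oS(1) \<gamma>s'(1) by (rule eventually_nhds_in_open)
    with Fs' have "germ s' f" unfolding germ_def by eventually_elim (use that in \<open>auto simp: E_def\<close>)
    thus ?thesis using f(1) \<gamma>s'(2) us' unfolding C_def by auto
   qed
  qed
  thus ?thesis using f(3) e1(1) e2(1) by (intro exI[of _ "min e (min e1 e2)"]) auto
 qed
 have "C 0 = C 1"
 proof (rule connected_equivalence_relation_gen[of "{0..1::real}" 0 1 "%_. True" "%x y. C x = C y"])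
  fix a :: real assume a: "a : {0..1}"
  obtain \<epsilon> E where \<epsilon>: "\<epsilon> > 0" "!!s'. s' : {0..1} ==> dist s' a < \<epsilon> ==> C s' = E" using step[OF a] by blast
  show "\<exists>T. openin (top_of_set {0..1}) T & a : T & (\<forall>x\<in>T. \<forall>y\<in>T. True & True --> C x = C y)"
   by (intro exI[of _ "{0..1} \<inter> ball a \<epsilon>"]) (use \<epsilon> a in \<open>auto simp: dist_commute openin_open_Int\<close>)
 next
  fix a :: real and U assume "openin (top_of_set {0..1}) U" "a : U"
  thus "\<exists>z. z : U & True" by auto
 qed auto
 moreover have "C 0" unfolding C_def germ_def
 proof (intro exI conjI)
  show "sec Y N0" "\<gamma> 0 : N0" "Y (\<gamma> 0) = u 0" using Y u by auto
  show "\<forall>\<^sub>F x in nhds (\<gamma> 0). \<forall>a b. F a b 0 x = Y x $ a $ b" using FM by (intro eventually_all_finite) auto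
 qed
 ultimately obtain f N where f: "sec f N" "\<gamma> 1 : N" "f (\<gamma> 1) = u 1" "germ 1 f" unfolding C_def by auto
 have "u 1 $ a $ b = Y1 (\<gamma> 1) $ a $ b" for a b
 proof -
  have "\<forall>\<^sub>F x in nhds (\<gamma> 1). F a b 1 x = Y1 x $ a $ b" using FM by blast
  hence "F a b 1 (\<gamma> 1) = Y1 (\<gamma> 1) $ a $ b" by (rule eventually_nhds_x_imp_x)
  moreover have "\<forall>a b. F a b 1 (\<gamma> 1) = f (\<gamma> 1) $ a $ b" using f(4) unfolding germ_def by (rule eventually_nhds_x_imp_x)
  ultimately show ?thesis using f(3) by metis
 qed
 thus ?thesis by (simp add: vec_eq_iff)
qed

context regular_singular_system
begin

text \<open>Each loop joins x0, through its free homotopy in \<open>D\<close>, to the collar of its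
  disk. So the path component of x0 together with the disks is open, as is the rest of
  \<open>D\<close>, and connectedness of the sphere leaves no rest.\<close>

lemma D_path_connected:
 assumes x: "x : D"
 shows "\<exists>p. path p & path_image p <= D & pathstart p = x0 & pathfinish p = x"
proof -
 define D0 where "D0 = path_component_set D x0"
 have D0D: "D0 <= D" unfolding D0_def by (rule path_component_subset)
 have nb: "\<exists>N. open N & y : N & N <= D & path_connected N" if y: "y : D" for y
 proof -
  obtain ka z where z: "y = chart ka z" by (rule chart_cases)
  obtain r where r: "r > 0" "cball z r <= chart ka -` D" using chart_nbhd[OF D_open, of ka z] y z by auto
  have "chart ka ` ball z r <= D" using r(2) by (auto simp: subset_iff)
  moreover have "path_connected (chart ka ` ball z r)"
   by (intro path_connected_continuous_image continuous_chart convex_imp_path_connected convex_ball)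
  ultimately show ?thesis using r z by (intro exI[of _ "chart ka ` ball z r"]) (auto simp: open_chart_image)
 qed
 have same: "y : D0 \<longleftrightarrow> y' : D0" if "path_connected N" "N <= D" "y : N" "y' : N" for N y y'
 proof -
  have "path_component D y y'" using that path_component_of_subset[OF that(2)] unfolding path_connected_component by blast
  thus ?thesis unfolding D0_def using path_component_trans path_component_sym by (metis mem_Collect_eq)
 qed
 have oD0: "open D0"
 proof (subst open_subopen, intro ballI)
  fix y assume y: "y : D0"
  then obtain N where "open N" "y : N" "N <= D" "path_connected N" using nb D0D by blast
  thus "\<exists>T. open T & y : T & T <= D0" using same y by blast
 qed
 have oD1: "open (D - D0)"
 proof (subst open_subopen, intro ballI)
  fix y assume y: "y : D - D0"
  then obtain N where "open N" "y : N" "N <= D" "path_connected N" using nb by blast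
  thus "\<exists>T. open T & y : T & T <= D - D0" using same y by blast
 qed
 have x0D0: "x0 : D0" using x0_in by (simp add: D0_def path_component_refl)
 have disk: "\<exists>V. open V & B i <= V & V <= B i \<union> D0" if i: "i < m" for i
 proof -
  obtain a b c d rh where M: "a * d ~= b * c" "B i = moebius a b c d ` cball 0 1" "rh > 1"
   "moebius a b c d ` (cball 0 rh - cball 0 1) <= D" "homotopic_loops D (\<gamma> i) (moebius a b c d \<circ> circlepath 0 rh)"
   using loops_encircle[OF i] unfolding encircles_once_def by blast
  obtain h :: "real \<times> real => riemann_sphere" where h': "continuous_on ({0..1} \<times> {0..1}) h" "\<forall>x\<in>{0..1}. \<forall>y\<in>{0..1}. h (x, y) : D"
   "\<forall>x\<in>{0..1}. h (0, x) = \<gamma> i x" "\<forall>x\<in>{0..1}. h (1, x) = moebius a b c d (circlepath 0 rh x)"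
   using M(5) unfolding homotopic_loops by (auto simp: image_subset_iff Pi_iff)
  have h: "continuous_on ({0..1} \<times> {0..1}) h" "h ` ({0..1} \<times> {0..1}) <= D"
   "!!s. s : {0..1} ==> h (0, s) = \<gamma> i s" "!!s. s : {0..1} ==> h (1, s) = moebius a b c d (circlepath 0 rh s)"
   using h' by auto
  have "path_connected (h ` ({0..1} \<times> {0..1}))"
   by (intro path_connected_continuous_image[OF h(1)] convex_imp_path_connected convex_Times convex_real_interval)
  moreover have "h (0, 0) = x0" using h(3)[of 0] loops[OF i] by (simp add: loop_at_def pathstart_def)
  hence "x0 : h ` ({0..1} \<times> {0..1})" by force
  moreover have h10: "h (1, 0) = moebius a b c d (of_real rh)" using h(4)[of 0] by (simp add: circlepath)
  hence "moebius a b c d (of_real rh) : h ` ({0..1} \<times> {0..1})" by (intro image_eqI[of _ h "(1, 0)"]) auto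
  \<comment> \<open>The image of the homotopy square is path connected and contains both x0 and a
    point of the circle.\<close>
  ultimately have p0: "moebius a b c d (of_real rh) : D0" using same[OF _ h(2)] x0D0 by blast
  have "path_connected (moebius a b c d ` (cball 0 rh - cball 0 1))"
  proof (rule path_connected_continuous_image[OF continuous_moebius[OF M(1)]])
   have "path_connected {z :: complex. z : cball 0 rh & z \<notin> cball 0 1}"
   proof -
    have "{z :: complex. z : cball 0 rh & z \<notin> cball 0 1} = (%(r, t). of_real r * exp (\<i> * of_real t)) ` ({1<..rh} \<times> (UNIV :: real set))"
    proof (intro equalityI subsetI)
     fix z :: complex assume "z : {z. z : cball 0 rh & z \<notin> cball 0 1}"
     hence "norm z : {1<..rh}" by auto
     moreover have "z = of_real (norm z) * exp (\<i> * of_real (Arg z))"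
      using Arg_eq[of z] calculation by (cases "z = 0") auto
     ultimately show "z : (%(r, t). of_real r * exp (\<i> * of_real t)) ` ({1<..rh} \<times> (UNIV :: real set))" by force
    qed (auto simp: norm_mult)
    moreover have "path_connected ((%(r, t). complex_of_real r * exp (\<i> * of_real t)) ` ({1<..rh} \<times> (UNIV :: real set)))"
     by (intro path_connected_continuous_image convex_imp_path_connected convex_Times convex_UNIV convex_real_interval)
      (auto simp: case_prod_unfold intro!: continuous_intros)
    ultimately show ?thesis by simp
   qed
   thus "path_connected (cball (0::complex) rh - cball 0 1)" by (simp add: set_diff_eq)
  qed
  note pc = this
  have inA: "complex_of_real rh : cball 0 rh - cball 0 1" using M(3) by auto
  have ann: "moebius a b c d ` (cball 0 rh - cball 0 1) <= D0" using same[OF pc M(4) imageI[OF inA]] p0 by blast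
  show ?thesis
  proof (intro exI conjI)
   show "open (moebius a b c d ` ball 0 rh)" by (rule open_moebius_image[OF M(1) open_ball])
   show "B i <= moebius a b c d ` ball 0 rh" unfolding M(2) using M(3) by (intro image_mono) auto
   have "ball (0::complex) rh <= cball 0 1 \<union> (cball 0 rh - cball 0 1)" by auto
   thus "moebius a b c d ` ball 0 rh <= B i \<union> D0" unfolding M(2) using ann by blast
  qed
 qed
 hence "\<forall>i. \<exists>V. i < m --> open V & B i <= V & V <= B i \<union> D0" by blast
 from choice[OF this] obtain V where V: "\<forall>i. i < m --> open (V i) & B i <= V i & V i <= B i \<union> D0" ..
 have "open (D0 \<union> (\<Union>i<m. V i))" using oD0 V by (intro open_Un open_UN) auto
 moreover have "UNIV <= (D0 \<union> (\<Union>i<m. V i)) \<union> (D - D0)" using compl_D V by blast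
 moreover have "(D0 \<union> (\<Union>i<m. V i)) \<inter> (D - D0) \<inter> UNIV = {}" using compl_D V by blast
 ultimately have "(D0 \<union> (\<Union>i<m. V i)) \<inter> UNIV = {} \<or> (D - D0) \<inter> UNIV = {}"
  using connectedD[OF sphere_connected _ oD1] by blast
 hence "D - D0 = {}" using x0D0 by blast
 hence "path_component D x0 x" using x by (auto simp: D0_def)
 thus ?thesis unfolding path_component_def by blast
qed

end

text \<open>The demands of \<open>sphere_ode\<close> on a single coefficient, so that its three
  coefficients can be checked independently.\<close>

definition coef_on :: "riemann_sphere set => (bool => complex => complex ^ 'n::finite ^ 'n) => bool" where
 "coef_on X c \<longleftrightarrow> (\<forall>ka. mholo (c ka) (chart ka -` X)) &
   (\<forall>w. w ~= 0 --> inf_chart w : X --> c True w = mat (- 1 / w\<^sup>2) ** c False (1 / w))"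

lemma sphere_ode_iff: "sphere_ode X P Q F \<longleftrightarrow> open X & coef_on X P & coef_on X Q & coef_on X F"
 unfolding sphere_ode_def coef_on_def by blast

lemma mat_mult_zero: "mat c ** (0 :: complex ^ 'n::finite ^ 'n) = 0" "X ** (0 :: complex ^ 'n::finite ^ 'n) = 0" "(0 :: complex ^ 'n::finite ^ 'n) ** X = 0"
 by (simp_all add: vec_eq_iff matrix_matrix_mult_def)

lemma coef_on_0: "coef_on X (%_ _. 0)" by (simp add: coef_on_def mholo_def mat_mult_zero)

lemma coef_on_subset: "coef_on X c ==> Y <= X ==> coef_on Y c"
 unfolding coef_on_def by (meson mholo_subset subset_iff vimage_mono)

lemma mat_mat_mult: "mat a ** (mat b ** Z) = mat (a * b) ** (Z :: complex ^ 'n::finite ^ 'n)"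
 by (simp add: vec_eq_iff mat_mult_left)

lemma coef_on_difference:
 assumes "coef_on X c" "coef_on X c'"
 shows "coef_on X (%ka z. mat s ** (c ka z - c' ka z))" using assms unfolding coef_on_def mholo_def
 by (auto simp: mat_mult_left mat_mat_mult matrix_diff_right[symmetric] mult.commute intro!: holomorphic_intros)

text \<open>Like \<open>mod_scalar\<close> it kills exactly the scalar matrices, but it is also
  compatible with commutators, since these have trace 0. The differential equation therefore passes
  to traceless parts.\<close>

definition traceless :: "complex ^ 'n ^ 'n => complex ^ 'n ^ 'n" where
 "traceless X = X - mat (trace X / of_nat CARD('n))"

lemma traceless_nth: "traceless (X :: complex ^ 'n::finite ^ 'n) $ i $ j = X $ i $ j - (if i = j then (\<Sum>k\<in>UNIV. X $ k $ k) / of_nat CARD('n) else 0)"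
 by (simp add: traceless_def trace_def mat_def)

lemma traceless_mat_mult: "traceless (mat c ** (X :: complex ^ 'n::finite ^ 'n)) = mat c ** traceless X"
 by (simp add: vec_eq_iff traceless_nth mat_mult_left sum_distrib_left[symmetric] algebra_simps)

lemma traceless_add_mat: "traceless (X + mat c) = traceless (X :: complex ^ 'n::finite ^ 'n)"
 by (simp add: vec_eq_iff traceless_nth mat_def sum.distrib add_divide_distrib)

lemma traceless_commutator: "traceless (P ** X - X ** P + F) = P ** traceless X - traceless X ** P + traceless (F :: complex ^ 'n::finite ^ 'n)"
proof -
 have "trace (P ** X - X ** P + F) = trace F" by (simp add: trace_add trace_sub trace_mul_sym[of P X])
 thus ?thesis by (simp add: traceless_def matrix_ring_simps mat_commute[of _ P])
qed

lemma coef_on_traceless: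
 assumes "coef_on X c" shows "coef_on X (%ka z. traceless (c ka z))"
proof -
 have "(%z. traceless (c ka z) $ i $ j) holomorphic_on chart ka -` X" for ka i j
  using assms unfolding coef_on_def mholo_def traceless_nth by (cases "i = j") (auto intro!: holomorphic_intros)
 thus ?thesis using assms by (auto simp: coef_on_def mholo_def traceless_mat_mult)
qed

lemma mder_traceless: "mder X X' z ==> mder (%u. traceless (X u)) (traceless X') z"
 unfolding mder_def traceless_nth by (auto intro!: derivative_eq_intros)

lemma sec_iff:
 assumes "sphere_ode X P Q F"
 shows "sphere_ode.sec X P Q F f N \<longleftrightarrow> open N & N <= X &
   (\<forall>ka z. chart ka z : N --> mder (%u. f (chart ka u)) (P ka z ** f (chart ka z) - f (chart ka z) ** Q ka z + F ka z) z)"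
 unfolding sphere_ode.sec_def[OF assms] sphere_ode.rhs_def[OF assms] ..

lemma sphere_ode_local_system:
 assumes "sphere_ode X P Q F" shows "local_system X (sphere_ode.sec X P Q F)"
proof -
 interpret sphere_ode X P Q F by (rule assms)
 show ?thesis by unfold_locales
qed

lemma ode_lift_combine:
 assumes ode: "sphere_ode X P1 Q1 F1" "sphere_ode X P2 Q2 F2" "sphere_ode X P3 Q3 F3"
  and op: "!!ka z f g. mder f (P1 ka z ** f z - f z ** Q1 ka z + F1 ka z) z ==> mder g (P2 ka z ** g z - g z ** Q2 ka z + F2 ka z) z ==>
    mder (%u. op (f u) (g u)) (P3 ka z ** op (f z) (g z) - op (f z) (g z) ** Q3 ka z + F3 ka z) z"
  and u: "local_system.lift (sphere_ode.sec X P1 Q1 F1) H ph u" "local_system.lift (sphere_ode.sec X P2 Q2 F2) H ph v"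
 shows "local_system.lift (sphere_ode.sec X P3 Q3 F3) H ph (%z. op (u z) (v z))"
proof (rule lift_combine[OF sphere_ode_local_system[OF ode(1)] sphere_ode_local_system[OF ode(2)] sphere_ode_local_system[OF ode(3)] _ u])
 fix f g N assume f: "sphere_ode.sec X P1 Q1 F1 f N" "sphere_ode.sec X P2 Q2 F2 g N"
 show "sphere_ode.sec X P3 Q3 F3 (%x. op (f x) (g x)) N" unfolding sec_iff[OF ode(3)]
 proof (intro conjI allI impI)
  show "open N" "N <= X" using f(1) unfolding sec_iff[OF ode(1)] by auto
  fix ka z assume "chart ka z : N"
  thus "mder (%u. op (f (chart ka u)) (g (chart ka u))) (P3 ka z ** op (f (chart ka z)) (g (chart ka z)) -
    op (f (chart ka z)) (g (chart ka z)) ** Q3 ka z + F3 ka z) z"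
   using f unfolding sec_iff[OF ode(1)] sec_iff[OF ode(2)] by (intro op) auto
 qed
qed

context regular_singular_system
begin

lemma coef_coeff_at:
 assumes "t : P" "X <= - Sing t" shows "coef_on X (coeff_at A t)"
proof -
 have "\<not> singular_point A t x" if "x : X" for x using regular_off_Sing assms that by blast
 thus ?thesis unfolding coef_on_def using coeff_at_switch coeff_at_holomorphic by (metis vimageE)
qed

lemma coef_D: "t : P ==> coef_on D (coeff_at A t)" using coef_coeff_at[of t D] Sing_disjoint_D[of t] by blast

text \<open>The hypothesis provides the differential equation at finite points only. At infinity it
  follows by continuity of both the derivative and the right-hand side in the chart there.\<close>

lemma fundamental_solution_section:
 assumes t: "t : P" and Y: "local_fundamental_solution A t x0 Y"
 obtains N where "sphere_ode.sec D (coeff_at A t) (%_ _. 0) (%_ _. 0) Y N" "x0 : N" "invertible (Y x0)"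
proof -
 have ode: "sphere_ode D (coeff_at A t) (%_ _. 0) (%_ _. 0)"
  using coef_D[OF t] coef_on_0 D_open by (simp add: sphere_ode_iff)
 interpret O: sphere_ode D "coeff_at A t" "%_ _. 0" "%_ _. 0" by (rule ode)
 obtain N where N: "open N" "x0 : N" "!!a b. sphere_holomorphic_on (%x. Y x $ a $ b) N" "!!x. x : N ==> invertible (Y x)"
  "!!z a b. Pt z : N ==> ((%u. Y (Pt u) $ a $ b) has_field_derivative (A z t ** Y (Pt z)) $ a $ b) (at z)"
  using Y unfolding local_fundamental_solution_def by metis
 have F: "mder (%u. Y (Pt u)) (O.rhs False z (Y (Pt z))) z" if "Pt z : N \<inter> D" for z
  using N(5)[of z] that coeff_at_D[OF t, of z] by (simp add: mder_def O.rhs_def mat_mult_zero)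
 have T: "mder (%u. Y (inf_chart u)) (O.rhs True w (Y (inf_chart w))) w" if w: "inf_chart w : N \<inter> D" "w ~= 0" for w
  using O.mder_switch[of Y False "1 / w" True w] F[of "1 / w"] w by simp
 have T0: "mder (%u. Y (inf_chart u)) (O.rhs True 0 (Y (inf_chart 0))) 0" if w: "inf_chart 0 : N \<inter> D"
 proof -
  define S where "S = inf_chart -` (N \<inter> D)"
  have S: "open S" "0 : S" using open_chart_vimage[of "N \<inter> D" True] N(1) D_open w by (auto simp: S_def)
  have hol: "mholo (%u. Y (inf_chart u)) S"
   using N(3) unfolding mholo_def sphere_holomorphic_on_def S_def by (auto intro: holomorphic_on_subset)
  have "((%u. Y (inf_chart u) $ a $ b) has_field_derivative O.rhs True 0 (Y (inf_chart 0)) $ a $ b) (at 0)" for a b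
  proof -
   let ?y = "%u. Y (inf_chart u) $ a $ b"
   have hy: "?y holomorphic_on S" using hol by (simp add: mholo_def)
   have "deriv ?y holomorphic_on S" by (rule holomorphic_deriv[OF hy S(1)])
   hence "isCont (deriv ?y) 0" using S by (meson continuous_on_eq_continuous_at holomorphic_on_imp_continuous_on)
   hence 1: "(deriv ?y \<longlongrightarrow> deriv ?y 0) (at 0)" by (simp add: isCont_def)
   have "mholo (%u. coeff_at A t True u) S"
    using mholo_subset[of "coeff_at A t True" "chart True -` D" S] O.holo(1)[of True] by (auto simp: S_def)
   hence "mholo (%u. coeff_at A t True u ** Y (inf_chart u)) S" using hol by (rule mholo_mult)
   hence "(%u. (coeff_at A t True u ** Y (inf_chart u)) $ a $ b) holomorphic_on S" by (simp add: mholo_def)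
   hence "isCont (%u. (coeff_at A t True u ** Y (inf_chart u)) $ a $ b) 0" using S by (meson continuous_on_eq_continuous_at holomorphic_on_imp_continuous_on)
   hence 2: "((%u. (coeff_at A t True u ** Y (inf_chart u)) $ a $ b) \<longlongrightarrow> (coeff_at A t True 0 ** Y (inf_chart 0)) $ a $ b) (at 0)" by (simp add: isCont_def)
   have "\<forall>\<^sub>F u in at 0. u : S - {0}" by (rule eventually_at_in_open[OF S])
   hence "\<forall>\<^sub>F u in at 0. deriv ?y u = (coeff_at A t True u ** Y (inf_chart u)) $ a $ b"
   proof eventually_elim
    case (elim u)
    hence "mder (%u. Y (inf_chart u)) (O.rhs True u (Y (inf_chart u))) u" by (intro T) (auto simp: S_def)
    thus ?case by (intro DERIV_imp_deriv) (simp add: mder_def O.rhs_def mat_mult_zero)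
   qed
   from tendsto_cong[OF this] 1 2 have "deriv ?y 0 = (coeff_at A t True 0 ** Y (inf_chart 0)) $ a $ b"
    using LIM_unique by blast
   moreover have "(?y has_field_derivative deriv ?y 0) (at 0)" by (rule holomorphic_derivI[OF hy S])
   ultimately show ?thesis by (simp add: O.rhs_def mat_mult_zero)
  qed
  thus ?thesis by (simp add: mder_def)
 qed
 have "O.sec Y (N \<inter> D)" unfolding O.sec_def
 proof (intro conjI allI impI)
  fix ka z assume "chart ka z : N \<inter> D"
  thus "mder (%u. Y (chart ka u)) (O.rhs ka z (Y (chart ka z))) z" using F[of z] T[of z] T0 by (cases ka; cases "z = 0") auto
 qed (use N D_open in auto)
 thus ?thesis using that[of "N \<inter> D"] N x0_in by auto
qed


text \<open>The solution normalized to 1 at x0 is Y times the inverse of Y(x0), so its monodromy is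
  that of Y conjugated by Y(x0); the scalar stays in front.\<close>

lemma monodromy_of_lift:
 assumes t: "t : P" and Y: "local_fundamental_solution A t x0 Y" and i: "i < m"
  and cont: "!!a b. analytic_continuation (\<gamma> i) (%x. Y x $ a $ b) (%x. (Y x ** G ** mat c) $ a $ b)"
  and W: "Y x0 ** W = mat 1"
  and U: "local_system.lift (sphere_ode.sec D (coeff_at A t) (%_ _. 0) (%_ _. 0)) {0..1} (\<gamma> i) U" "U 0 = mat 1"
 shows "U 1 = mat c ** (Y x0 ** G ** W)"
proof -
 have ode: "sphere_ode D (coeff_at A t) (%_ _. 0) (%_ _. 0)"
  using coef_D[OF t] coef_on_0 D_open by (simp add: sphere_ode_iff)
 obtain N where N: "sphere_ode.sec D (coeff_at A t) (%_ _. 0) (%_ _. 0) Y N" "x0 : N" "invertible (Y x0)"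
  by (rule fundamental_solution_section[OF t Y])
 have g: "path (\<gamma> i)" "path_image (\<gamma> i) <= D" "\<gamma> i 0 = x0" "\<gamma> i 1 = x0"
  using loops[OF i] by (auto simp: loop_at_def pathstart_def pathfinish_def)
 have U': "local_system.lift (sphere_ode.sec D (coeff_at A t) (%_ _. 0) (%_ _. 0)) {0..1} (\<gamma> i) (%z. U z ** Y x0)"
 proof (rule ode_lift_combine[OF ode ode ode _ U(1) U(1), where op = "%f g. f ** Y x0"])
  fix ka z and f g :: "complex => complex ^ 'n ^ 'n"
  assume "mder f (coeff_at A t ka z ** f z - f z ** 0 + 0) z"
  from mder_mult[OF this mder_const]
  show "mder (%u. f u ** Y x0) (coeff_at A t ka z ** (f z ** Y x0) - f z ** Y x0 ** 0 + 0) z"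
   by (rule mder_eq) (simp add: mat_mult_zero matrix_mul_assoc)
 qed
 have "U 1 ** Y x0 = Y (\<gamma> i 1) ** G ** mat c"
  by (rule sphere_ode.continuation_lift[OF ode N(1) _ g(1,2) cont U']) (use g N(2) U(2) in auto)
 hence "U 1 ** (Y x0 ** W) = Y x0 ** G ** mat c ** W" using g by (simp add: matrix_mul_assoc)
 also have "\<dots> = mat c ** (Y x0 ** G ** W)" using mat_commute[of c "Y x0 ** G"] by (simp add: matrix_mul_assoc)
 finally show ?thesis using W by simp
qed

end

section \<open>The derivative of the monodromy\<close>

context regular_singular_system
begin

lemma word_transport:
 assumes ode: "sphere_ode D p q f"
  and tr: "!!i. i < m ==> local_system.transport (sphere_ode.sec D p q f) (\<gamma> i) v v"
  and ws: "snd ` set ws <= {..<m}"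
 shows "path (word_path x0 \<gamma> ws) & path_image (word_path x0 \<gamma> ws) <= D & pathstart (word_path x0 \<gamma> ws) = x0 &
  local_system.transport (sphere_ode.sec D p q f) (word_path x0 \<gamma> ws) v v"
proof -
 interpret O: sphere_ode D p q f by (rule ode)
 show ?thesis using ws
 proof (induction ws)
  case Nil
  have "path_image (%_::real. x0) <= D" using x0_in by (auto simp: path_image_def)
  thus ?case using O.transport_const[OF x0_in] by (simp add: pathstart_def path_def)
 next
  case (Cons w ws)
  obtain b i where w: "w = (b, i)" by (cases w)
  have i: "i < m" using Cons.prems w by auto
  define g where "g = (if b then \<gamma> i else reversepath (\<gamma> i))"
  have l: "path (\<gamma> i)" "path_image (\<gamma> i) <= D" "pathstart (\<gamma> i) = x0" "pathfinish (\<gamma> i) = x0"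
   using loops[OF i] by (auto simp: loop_at_def)
  have g: "path g" "path_image g <= D" "pathstart g = x0" "pathfinish g = x0" using l by (auto simp: g_def)
  have tg: "O.transport g v v" using tr[OF i] O.transport_reverse[OF tr[OF i]] by (simp add: g_def)
  have ih: "path (word_path x0 \<gamma> ws)" "path_image (word_path x0 \<gamma> ws) <= D" "pathstart (word_path x0 \<gamma> ws) = x0"
   "O.transport (word_path x0 \<gamma> ws) v v" using Cons by auto
  have wp: "word_path x0 \<gamma> (w # ws) = g +++ word_path x0 \<gamma> ws" by (simp add: w g_def)
  have "O.transport (g +++ word_path x0 \<gamma> ws) v v"
   by (rule O.transport_join[OF g(1,2) ih(1,2) _ tg ih(4)]) (simp add: g ih)
  thus ?case unfolding wp using g ih by (simp add: subset_path_image_join)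
 qed
qed

text \<open>A value fixed by the generating loops is fixed by all words in them, and by homotopy
  invariance by every loop at x0.\<close>

lemma invariant_section:
 assumes ode: "sphere_ode D p q f"
  and tr: "!!i. i < m ==> local_system.transport (sphere_ode.sec D p q f) (\<gamma> i) v v"
 shows "\<exists>b. sphere_ode.sec D p q f b D"
proof -
 interpret O: sphere_ode D p q f by (rule ode)
 have loop: "O.transport p v v" if "path p" "path_image p <= D" "pathstart p = x0" "pathfinish p = x0" for p
 proof -
  have "loop_at D x0 p" using that by (simp add: loop_at_def)
  then obtain ws where ws: "snd ` set ws <= {..<m}" "homotopic_paths D p (word_path x0 \<gamma> ws)"
   using loops_generate unfolding generates_pi1_def by blast
  show ?thesis using O.transport_homotopic[OF homotopic_paths_sym[OF ws(2)]] word_transport[OF ode tr ws(1)] by blast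
 qed
 obtain b where "b x0 = v" "\<forall>x\<in>D. \<exists>f N. O.sec f N & x : N & (\<forall>y\<in>N. b y = f y)"
  using O.global_section_exists[OF x0_in D_open D_path_connected loop] by blast
 hence "O.sec b D" by (intro O.sec_local[OF D_open]) auto
 thus ?thesis by (rule exI[of _ b])
qed

text \<open>Differentiating the monodromy of \<open>U(s) U(0)\<^sup>-\<^sup>1\<close> at \<open>s = 0\<close>: after subtraction of a fixed
 commutator only scalars remain, which disappear in the traceless part of the equation.\<close>

lemma traceless_section:
 assumes t: "t : P" and de: "!!i j. poly_at (den i j) t ~= 0" and proj: "projectively_isomonodromic P m x0 \<gamma> A"
 shows "\<exists>b. sphere_ode.sec D (coeff_at A t) (coeff_at A t) (%ka z. traceless (var_at A t k ka z)) b D"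
proof -
 define ta where "ta s = t + s *s axis k (1::complex)" for s
 have ta0: "ta 0 = t" by (simp add: ta_def)
 define a where "a s = coeff_at A (ta s)" for s
 define F where "F = var_at A t k"
 define Z where "Z = (%(_::bool) (_::complex). 0 :: complex ^ 'n ^ 'n)"
 define sol where "sol c G t Y \<longleftrightarrow> local_fundamental_solution A t x0 Y &
      (\<forall>i<m. \<forall>a b. analytic_continuation (\<gamma> i) (%x. Y x $ a $ b) (%x. (Y x ** G i ** mat (c i t)) $ a $ b))"
  for c :: "nat => complex ^ 'r => complex" and G t Y
 have "\<exists>c G. (\<forall>i<m. mv_holomorphic_on (c i) P & (\<forall>t\<in>P. c i t ~= 0)) & (\<forall>i<m. invertible (G i)) & (\<forall>t\<in>P. \<exists>Y. sol c G t Y)"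
  using proj unfolding projectively_isomonodromic_def sol_def .
 then obtain c G where cG: "\<forall>i<m. mv_holomorphic_on (c i) P & (\<forall>t\<in>P. c i t ~= 0)" and ex: "\<forall>t\<in>P. \<exists>Y. sol c G t Y"
  by (elim exE conjE)
 have cG: "!!i. i < m ==> mv_holomorphic_on (c i) P" "!!i t. i < m ==> t : P ==> c i t ~= 0" using cG by blast+
 from bchoice[OF ex] obtain Y where Y0: "\<forall>t\<in>P. sol c G t (Y t)" ..
 have Y: "local_fundamental_solution A t x0 (Y t)" if "t : P" for t
  using bspec[OF Y0 that] unfolding sol_def by (rule conjunct1)
 have Yc: "analytic_continuation (\<gamma> i) (%x. Y t x $ a $ b) (%x. (Y t x ** G i ** mat (c i t)) $ a $ b)"
  if "t : P" "i < m" for t i a b using bspec[OF Y0 that(1), unfolded sol_def, THEN conjunct2, rule_format, OF that(2)] .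
 have inv: "\<exists>W. Y t x0 ** W = mat 1 & W ** Y t x0 = mat 1" if "t : P" for t
 proof -
  have "invertible (Y t x0)" by (rule fundamental_solution_section[OF that Y[OF that]])
  thus ?thesis unfolding invertible_def by blast
 qed
 then obtain W where W: "!!t. t : P ==> Y t x0 ** W t = mat 1 & W t ** Y t x0 = mat 1" by metis
 \<comment> \<open>The monodromy of the normalized solution with the scalar removed; for different
   \<open>s\<close> these matrices are conjugate to each other.\<close>
 define N where "N i s = Y (ta s) x0 ** G i ** W (ta s)" for i s
 have evP: "\<forall>\<^sub>F s in at 0. ta s : P"
  using eventually_line[OF eventually_nhds_in_open[OF P_open t], of "axis k 1"] by (simp add: ta_def)
 have s0: "\<forall>\<^sub>F s in at (0::complex). s ~= 0" by (auto simp: eventually_at_filter)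
 have DS: "D <= - Sing t" using Sing_disjoint_D[OF t] by blast
 have vDS: "chart ka -` D <= chart ka -` (- Sing t)" for ka using DS by blast
 have cF: "coef_on D F"
  unfolding F_def coef_on_def using mholo_subset[OF var_at_holomorphic[OF t de] vDS] var_at_switch[OF t de] DS by blast
 have ca: "coef_on D (a s)" if "ta s : P" for s using coef_D[OF that] by (simp add: a_def)
 have ca0: "coef_on D (a 0)" using ca[of 0] t ta0 by simp
 have cZ: "coef_on D Z" unfolding Z_def by (rule coef_on_0)
 note iff = sphere_ode_iff
 define lf where "lf P Q F = local_system.lift (sphere_ode.sec D P Q F) {0..1::real}" for P Q F :: "bool => complex => complex ^ 'n ^ 'n"
 \<comment> \<open>Difference quotients of the coefficient, completed by their limit at s = 0 so
   that a single family can be fed into \<open>lift_limit\<close>.\<close>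
 define Fs where "Fs s = (if s = 0 then F else (%ka z. mat (1 / s) ** (a s ka z - a 0 ka z)))" for s
 have cFs: "coef_on D (Fs s)" if "ta s : P" for s using cF coef_on_difference[OF ca[OF that] ca0] by (simp add: Fs_def)
 have gm: "path (\<gamma> i)" "path_image (\<gamma> i) <= D" "pathstart (\<gamma> i) = x0" "pathfinish (\<gamma> i) = x0"
  "continuous_on {0..1} (\<gamma> i)" "\<gamma> i ` {0..1} <= D" if "i < m" for i
  using loops[OF that] by (auto simp: loop_at_def path_def path_image_def)
 have ex: "\<exists>u. lf P Q F (\<gamma> i) u & u 0 = v" if "sphere_ode D P Q F" "i < m" for P Q F i v
  using local_system.lift_path_exists[OF sphere_ode_local_system[OF that(1)] zero_le_one gm(5,6)[OF that(2)]]
  unfolding lf_def .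
 \<comment> \<open>For each loop \<open>e\<close> is the end value of the inhomogeneous solution
   \<open>u0\<close> started at 0. It is the derivative in \<open>s\<close> of the normalized
   monodromy, times the inverse of the monodromy at 0.\<close>
 have key: "\<exists>e U V u0. lf (a 0) Z Z (\<gamma> i) U & U 0 = mat 1 & lf Z (a 0) Z (\<gamma> i) V & V 0 = mat 1 &
   lf (a 0) (a 0) F (\<gamma> i) u0 & u0 0 = 0 & u0 1 = e & U 1 = mat (c i t) ** N i 0 & U 1 ** V 1 = mat 1 &
   ((%s. mat (1 / s) ** (N i s - N i 0)) \<longlongrightarrow> (e - mat (deriv (%s. c i (ta s)) 0 / c i t)) ** N i 0) (at 0)"
  if i: "i < m" for i
 proof -
  have odeU: "sphere_ode D (a s) Z Z" if "ta s : P" for s using ca[OF that] cZ D_open by (simp add: iff)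
  have odeU0: "sphere_ode D (a 0) Z Z" using odeU[of 0] t ta0 by simp
  have odeV: "sphere_ode D Z (a 0) Z" using ca0 cZ D_open by (simp add: iff)
  have odeF: "sphere_ode D (a s) (a 0) (Fs s)" if "ta s : P" for s using ca[OF that] ca0 cFs[OF that] D_open by (simp add: iff)
  have odeZ: "sphere_ode D Z Z Z" using cZ D_open by (simp add: iff)
  have "\<forall>s. \<exists>u. ta s : P --> lf (a s) Z Z (\<gamma> i) u & u 0 = mat 1" using ex[OF odeU i] by blast
  from choice[OF this] obtain U where U: "!!s. ta s : P ==> lf (a s) Z Z (\<gamma> i) (U s)" "!!s. ta s : P ==> U s 0 = mat 1" by blast
  obtain V where V: "lf Z (a 0) Z (\<gamma> i) V" "V 0 = mat 1" using ex[OF odeV i] by blast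
  have "sphere_ode D (a 0) (a 0) F" using odeF[of 0] t ta0 by (simp add: Fs_def)
  from ex[OF this i] obtain u0 where u0: "lf (a 0) (a 0) F (\<gamma> i) u0" "u0 0 = 0" by blast
  have U0: "lf (a 0) Z Z (\<gamma> i) (U 0)" "U 0 0 = mat 1" using U[of 0] t ta0 by auto
  have U1: "U s 1 = mat (c i (ta s)) ** N i s" if s: "ta s : P" for s
  proof -
   have "local_system.lift (sphere_ode.sec D (coeff_at A (ta s)) (%_ _. 0) (%_ _. 0)) {0..1} (\<gamma> i) (U s)"
    using U(1)[OF s] by (simp add: lf_def a_def Z_def)
   from monodromy_of_lift[OF s Y[OF s] i Yc[OF s i] conjunct1[OF W[OF s]] this U(2)[OF s]]
   show ?thesis by (simp add: N_def)
  qed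
  have VU: "V 1 ** U 0 1 = mat 1"
  proof -
   have op: "mder (%u. f u ** g u) (0 ** (f z ** g z) - f z ** g z ** 0 + 0) z"
    if "mder f (0 ** f z - f z ** a 0 ka z + 0) z" "mder g (a 0 ka z ** g z - g z ** 0 + 0) z" for ka z and f g :: "complex => complex ^ 'n ^ 'n"
    by (rule mder_eq[OF mder_mult[OF that]]) (simp add: mat_mult_zero matrix_ring_simps)
   have 1: "lf Z Z Z (\<gamma> i) (%x. V x ** U 0 x)"
    unfolding lf_def by (rule ode_lift_combine[OF odeV odeU0 odeZ _ V(1)[unfolded lf_def] U0(1)[unfolded lf_def]]) (unfold Z_def, rule op)
   have "sphere_ode.sec D Z Z Z (%_. mat 1) D"
    unfolding sec_iff[OF odeZ] using D_open by (auto simp: Z_def mat_mult_zero intro: mder_const)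
   hence 2: "lf Z Z Z (\<gamma> i) (%_. mat 1)" unfolding lf_def using gm(6)[OF i]
    by (intro local_system.lift_section[OF sphere_ode_local_system[OF odeZ], where f = "%_. mat 1"]) auto
   show ?thesis
    using local_system.lift_unique[OF sphere_ode_local_system[OF odeZ] _ gm(5,6)[OF i] 1[unfolded lf_def] 2[unfolded lf_def], of 0 1]
    U0(2) V(2) by auto
  qed
  hence UV: "U 0 1 ** V 1 = mat 1" using matrix_left_right_inverse by blast
  \<comment> \<open>The difference quotient of U(s) U(0)^-1, with \<open>V\<close> as the inverse of
    \<open>U 0\<close>. It solves a Sylvester equation with left coefficient at \<open>s\<close>,
    right coefficient at 0 and inhomogeneity \<open>Fs s\<close>.\<close>
  define \<beta> where "\<beta> s = (if s = 0 then u0 else (%x. mat (1 / s) ** (U s x ** V x - mat 1)))" for s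
  have l\<beta>: "lf (a s) (a 0) (Fs s) (\<gamma> i) (\<beta> s)" if s: "ta s : P" for s
  proof (cases "s = 0")
   case True thus ?thesis using u0(1) by (simp add: Fs_def \<beta>_def)
  next
   case False
   have op: "mder (%u. mat (1 / s) ** (f u ** g u - mat 1))
     (a s ka z ** (mat (1 / s) ** (f z ** g z - mat 1)) - mat (1 / s) ** (f z ** g z - mat 1) ** a 0 ka z + Fs s ka z) z"
    if f: "mder f (a s ka z ** f z - f z ** 0 + 0) z" "mder g (0 ** g z - g z ** a 0 ka z + 0) z" for ka z and f g :: "complex => complex ^ 'n ^ 'n"
   proof -
    have d: "mder (%u. mat (1 / s) ** (f u ** g u - mat 1))
     (0 ** (f z ** g z - mat 1) + mat (1 / s) ** ((a s ka z ** f z - f z ** 0 + 0) ** g z + f z ** (0 ** g z - g z ** a 0 ka z + 0) - 0)) z"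
     by (intro mder_mult mder_diff mder_const f)
    have m: "a s ka z ** (mat (1 / s) ** X) = mat (1 / s) ** (a s ka z ** X)" for X
     by (simp add: matrix_mul_assoc mat_commute[of _ "a s ka z"])
    have m1: "a s ka z ** mat (1 / s) = mat (1 / s) ** a s ka z" by (simp add: mat_commute)
    show ?thesis by (rule mder_eq[OF d]) (simp add: Fs_def False mat_mult_zero m m1 matrix_mul_assoc[symmetric]
       matrix_diff_left matrix_diff_right matrix_minus_right matrix_minus_left)
   qed
   have "lf (a s) (a 0) (Fs s) (\<gamma> i) (%x. mat (1 / s) ** (U s x ** V x - mat 1))"
    unfolding lf_def by (rule ode_lift_combine[OF odeU[OF s] odeV odeF[OF s] _ U(1)[OF s, unfolded lf_def] V(1)[unfolded lf_def]]) (unfold Z_def, rule op)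
   thus ?thesis using False by (simp add: \<beta>_def)
  qed
  have lim: "((%s. \<beta> s 1) \<longlongrightarrow> \<beta> 0 1) (at 0)"
  proof (rule lift_limit[where P = a and Q = "%_. a 0" and F = Fs and X = D and p = "\<gamma> i"])
   show "\<forall>\<^sub>F s in at 0. sphere_ode D (a s) (a 0) (Fs s)" using evP by eventually_elim (rule odeF)
   show "sphere_ode D (a 0) (a 0) (Fs 0)" using odeF[of 0] t ta0 by simp
   fix ka K assume K: "compact K" "K <= chart ka -` D"
   hence K': "K <= chart ka -` (- Sing t)" using DS by blast
   show "uniform_limit K (%s. a s ka) (a 0 ka) (at 0)"
    using coeff_at_limit[OF t de K(1) K', of k] by (simp add: a_def ta_def)
   show "uniform_limit K (%s. a 0 ka) (a 0 ka) (at 0)" by (rule uniform_limit_const)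
   have ev: "\<forall>\<^sub>F s in at 0. \<forall>x\<in>K. mat (1 / s) ** (coeff_at A (t + s *s axis k 1) ka x - coeff_at A t ka x) = Fs s ka x"
    using s0 by eventually_elim (simp add: Fs_def a_def ta_def)
   show "uniform_limit K (%s. Fs s ka) (Fs 0 ka) (at 0)"
    by (rule uniform_limit_cong[THEN iffD1, OF ev _ var_at_limit[OF t de K(1) K', of k]]) (simp add: Fs_def F_def)
  next
   show "\<forall>\<^sub>F s in at 0. local_system.lift (sphere_ode.sec D (a s) (a 0) (Fs s)) {0..1} (\<gamma> i) (\<beta> s)"
    using evP by eventually_elim (rule l\<beta>[unfolded lf_def])
   show "local_system.lift (sphere_ode.sec D (a 0) (a 0) (Fs 0)) {0..1} (\<gamma> i) (\<beta> 0)"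
    using l\<beta>[of 0] t ta0 by (simp add: lf_def)
   have "\<forall>\<^sub>F s in at 0. \<beta> s 0 = \<beta> 0 0"
    using evP by eventually_elim (simp add: \<beta>_def U(2) V(2) u0(2) mat_mult_zero)
   thus "((%s. \<beta> s 0) \<longlongrightarrow> \<beta> 0 0) (at 0)" using tendsto_cong tendsto_const by fastforce
  qed (use gm[OF i] in auto)
  define e where "e = u0 1"
  define d where "d = deriv (%s. c i (ta s)) 0"
  have ct: "c i t ~= 0" by (rule cG(2)[OF i t])
  have "\<exists>D. ((%s. c i (t + s *s axis k 1)) has_field_derivative D) (at 0)"
   by (rule mv_holomorphic_on_line[OF cG(1)[OF i]]) (use t in simp)
  hence dc: "((%s. c i (ta s)) has_field_derivative d) (at 0)" unfolding d_def ta_def using DERIV_imp_deriv by blast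
  hence dq: "((%s. (c i (ta s) - c i t) / s) \<longlongrightarrow> d) (at 0)" by (simp add: DERIV_def ta0)
  have "isCont (%s. c i (ta s)) 0" using dc by (rule DERIV_isCont)
  hence cc: "((%s. c i (ta s)) \<longlongrightarrow> c i t) (at 0)" by (simp add: isCont_def ta0)
  have matlim: "((%s. mat (h s) :: complex ^ 'n ^ 'n) \<longlongrightarrow> mat l) (at (0::complex))" if "(h \<longlongrightarrow> l) (at 0)" for h l
   unfolding mat_def using that by (intro tendsto_vec_lambda) auto
  have multlim: "((%s. X s ** R s) \<longlongrightarrow> X0 ** R0) (at (0::complex))" if "(X \<longlongrightarrow> X0) (at 0)" "(R \<longlongrightarrow> R0) (at 0)" for X R and X0 R0 :: "complex ^ 'n ^ 'n"
   unfolding matrix_matrix_mult_def by (intro tendsto_vec_lambda tendsto_sum tendsto_mult tendsto_vec_nth that)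
  \<comment> \<open>Solving U(s) = c(s) N(s) for N(s) splits its difference quotient into a scalar
    term from \<open>c\<close> and a term with \<beta>.\<close>
  have "((%s. mat (- ((c i (ta s) - c i t) / s) / c i (ta s)) ** N i 0 + mat (c i t / c i (ta s)) ** (\<beta> s 1 ** N i 0)) \<longlongrightarrow>
    mat (- d / c i t) ** N i 0 + mat (c i t / c i t) ** (\<beta> 0 1 ** N i 0)) (at 0)"
   by (intro tendsto_add multlim matlim tendsto_divide tendsto_minus dq cc tendsto_const lim ct)
  moreover have "\<forall>\<^sub>F s in at 0. mat (1 / s) ** (N i s - N i 0) = mat (- ((c i (ta s) - c i t) / s) / c i (ta s)) ** N i 0 + mat (c i t / c i (ta s)) ** (\<beta> s 1 ** N i 0)"
   using evP s0
  proof eventually_elim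
   case (elim s)
   let ?c = "c i (ta s)"
   have cs: "?c ~= 0" by (rule cG(2)[OF i elim(1)])
   have U01: "U 0 1 = mat (c i t) ** N i 0" using U1[of 0] t ta0 by simp
   have "\<beta> s 1 ** U 0 1 = mat (1 / s) ** (U s 1 ** (V 1 ** U 0 1) - U 0 1)"
    using elim(2) by (simp add: \<beta>_def matrix_ring_simps)
   hence "\<beta> s 1 ** U 0 1 = mat (1 / s) ** (U s 1 - U 0 1)" using VU by simp
   hence "\<beta> s 1 ** (mat (c i t) ** N i 0) = mat (1 / s) ** (mat ?c ** N i s - mat (c i t) ** N i 0)"
    by (simp only: U1[OF elim(1)] U01)
   moreover have "\<beta> s 1 ** (mat (c i t) ** N i 0) = mat (c i t) ** (\<beta> s 1 ** N i 0)"
    by (simp add: matrix_mul_assoc mat_commute[of _ "\<beta> s 1"])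
   ultimately have "mat (c i t) ** (\<beta> s 1 ** N i 0) = mat (1 / s) ** (mat ?c ** N i s - mat (c i t) ** N i 0)" by simp
   hence ent: "c i t * (\<beta> s 1 ** N i 0) $ x $ y = (1 / s) * (?c * N i s $ x $ y - c i t * N i 0 $ x $ y)" for x y
    unfolding vec_eq_iff by (simp add: mat_mult_left)
   have "(1 / s) * (N i s $ x $ y - N i 0 $ x $ y) = - ((?c - c i t) / s) / ?c * N i 0 $ x $ y + c i t / ?c * (\<beta> s 1 ** N i 0) $ x $ y" for x y
   proof -
    have "c i t / ?c * (\<beta> s 1 ** N i 0) $ x $ y = (1 / s) * (?c * N i s $ x $ y - c i t * N i 0 $ x $ y) / ?c"
     using ent[of x y] by simp
    thus ?thesis using cs elim(2) by (simp add: field_simps)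
   qed
   thus ?case by (simp add: vec_eq_iff mat_mult_left)
  qed
  ultimately have "((%s. mat (1 / s) ** (N i s - N i 0)) \<longlongrightarrow> mat (- d / c i t) ** N i 0 + mat (c i t / c i t) ** (\<beta> 0 1 ** N i 0)) (at 0)"
   using tendsto_cong by fastforce
  moreover have "mat (- d / c i t) ** N i 0 + mat (c i t / c i t) ** (\<beta> 0 1 ** N i 0) = (e - mat (d / c i t)) ** N i 0"
   using ct by (simp add: vec_eq_iff mat_mult_left \<beta>_def e_def matrix_diff_left)
  moreover have "U 0 1 = mat (c i t) ** N i 0" using U1[of 0] t ta0 by simp
  ultimately show ?thesis
   using U0 V u0 UV unfolding d_def e_def by (intro exI[of _ "u0 1"] exI[of _ "U 0"] exI[of _ V] exI[of _ u0]) auto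
 qed
 hence "\<forall>i. \<exists>e U V u0. i < m --> lf (a 0) Z Z (\<gamma> i) U & U 0 = mat 1 & lf Z (a 0) Z (\<gamma> i) V & V 0 = mat 1 &
   lf (a 0) (a 0) F (\<gamma> i) u0 & u0 0 = 0 & u0 1 = e & U 1 = mat (c i t) ** N i 0 & U 1 ** V 1 = mat 1 &
   ((%s. mat (1 / s) ** (N i s - N i 0)) \<longlongrightarrow> (e - mat (deriv (%s. c i (ta s)) 0 / c i t)) ** N i 0) (at 0)" by blast
 from choice[OF this] obtain e where e: "\<forall>i. \<exists>U V u0. i < m --> lf (a 0) Z Z (\<gamma> i) U & U 0 = mat 1 & lf Z (a 0) Z (\<gamma> i) V & V 0 = mat 1 &
   lf (a 0) (a 0) F (\<gamma> i) u0 & u0 0 = 0 & u0 1 = e i & U 1 = mat (c i t) ** N i 0 & U 1 ** V 1 = mat 1 &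
   ((%s. mat (1 / s) ** (N i s - N i 0)) \<longlongrightarrow> (e i - mat (deriv (%s. c i (ta s)) 0 / c i t)) ** N i 0) (at 0)" ..
 \<comment> \<open>The conjugating matrices come from the solutions \<open>Y\<close>, about whose
   dependence on \<open>s\<close> nothing is known; hence \<open>conjugacy_class_tangent\<close>
   asks for their existence only.\<close>
 have conj: "\<forall>\<^sub>F s in at 0. \<exists>C C'. C ** C' = mat 1 & C' ** C = mat 1 & (\<forall>i<m. C ** N i 0 = N i s ** C)"
  using evP
 proof eventually_elim
  case (elim s)
  have w: "Y t x0 ** W t = mat 1" "W t ** Y t x0 = mat 1" "Y (ta s) x0 ** W (ta s) = mat 1" "W (ta s) ** Y (ta s) x0 = mat 1"
   using W[OF t] W[OF elim] by auto
  let ?C = "Y (ta s) x0 ** W t" and ?C' = "Y t x0 ** W (ta s)"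
  have "?C ** ?C' = Y (ta s) x0 ** (W t ** Y t x0) ** W (ta s)" "?C' ** ?C = Y t x0 ** (W (ta s) ** Y (ta s) x0) ** W t"
   by (simp_all only: matrix_mul_assoc)
  hence 1: "?C ** ?C' = mat 1" "?C' ** ?C = mat 1" using w by simp_all
  have "?C ** N i 0 = Y (ta s) x0 ** (W t ** Y t x0) ** G i ** W t" "N i s ** ?C = Y (ta s) x0 ** G i ** (W (ta s) ** Y (ta s) x0) ** W t" for i
   unfolding N_def ta0 by (simp_all only: matrix_mul_assoc)
  hence "?C ** N i 0 = N i s ** ?C" for i using w by simp
  thus ?case using 1 by blast
 qed
 obtain E where E: "!!i. i < m ==> (e i - mat (deriv (%s. c i (ta s)) 0 / c i t)) ** N i 0 = E ** N i 0 - N i 0 ** E"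
  using conjugacy_class_tangent[OF conj, of "%i. (e i - mat (deriv (%s. c i (ta s)) 0 / c i t)) ** N i 0"] e by blast
 define F' where "F' = (%ka z. traceless (F ka z))"
 have odeF': "sphere_ode D (a 0) (a 0) F'" using coef_on_traceless[OF cF] ca0 D_open by (simp add: iff F'_def)
 have "local_system.transport (sphere_ode.sec D (a 0) (a 0) F') (\<gamma> i) (traceless E) (traceless E)" if i: "i < m" for i
 proof -
  obtain U V u0 where u: "lf (a 0) Z Z (\<gamma> i) U" "U 0 = mat 1" "lf Z (a 0) Z (\<gamma> i) V" "V 0 = mat 1"
   "lf (a 0) (a 0) F (\<gamma> i) u0" "u0 0 = 0" "u0 1 = e i" "U 1 = mat (c i t) ** N i 0" "U 1 ** V 1 = mat 1"
   using e i by blast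
  define l where "l = deriv (%s. c i (ta s)) 0 / c i t"
  have odes: "sphere_ode D (a 0) Z Z" "sphere_ode D Z (a 0) Z" "sphere_ode D (a 0) (a 0) Z" "sphere_ode D (a 0) (a 0) F"
   using ca0 cZ cF D_open by (auto simp: iff)
  have op1: "mder (%u. f u ** E ** g u) (a 0 ka z ** (f z ** E ** g z) - f z ** E ** g z ** a 0 ka z + 0) z"
   if "mder f (a 0 ka z ** f z - f z ** 0 + 0) z" "mder g (0 ** g z - g z ** a 0 ka z + 0) z" for ka z and f g :: "complex => complex ^ 'n ^ 'n"
   by (rule mder_eq[OF mder_mult[OF mder_mult[OF that(1) mder_const[of E]] that(2)]]) (simp add: mat_mult_zero matrix_ring_simps)
  have 1: "lf (a 0) (a 0) Z (\<gamma> i) (%x. U x ** E ** V x)"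
   unfolding lf_def by (rule ode_lift_combine[OF odes(1,2,3) _ u(1)[unfolded lf_def] u(3)[unfolded lf_def], where op = "%f g. f ** E ** g"]) (unfold Z_def, rule op1)
  have op2: "mder (%u. traceless (f u + g u)) (a 0 ka z ** traceless (f z + g z) - traceless (f z + g z) ** a 0 ka z + F' ka z) z"
   if "mder f (a 0 ka z ** f z - f z ** a 0 ka z + 0) z" "mder g (a 0 ka z ** g z - g z ** a 0 ka z + F ka z) z" for ka z and f g :: "complex => complex ^ 'n ^ 'n"
  proof -
   have "a 0 ka z ** f z - f z ** a 0 ka z + 0 + (a 0 ka z ** g z - g z ** a 0 ka z + F ka z) = a 0 ka z ** (f z + g z) - (f z + g z) ** a 0 ka z + F ka z"
    by (simp add: matrix_ring_simps)
   from mder_traceless[OF mder_add[OF that], unfolded this] show ?thesis unfolding traceless_commutator F'_def .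
  qed
  have 2: "lf (a 0) (a 0) F' (\<gamma> i) (%x. traceless (U x ** E ** V x + u0 x))"
   unfolding lf_def by (rule ode_lift_combine[OF odes(3,4) odeF' _ 1[unfolded lf_def] u(5)[unfolded lf_def], where op = "%f g. traceless (f + g)"]) (unfold Z_def, rule op2)
  \<comment> \<open>Continuation along the loop changes the starting value \<open>E\<close> of the
    corrected solution by a scalar only, because up to that scalar the tangent to the monodromy is
    the commutator with \<open>E\<close>.\<close>
  have "U 1 ** E ** V 1 + e i = E + mat l"
  proof -
   have h1: "mat (c i t) ** ((e i - mat l) ** N i 0) = mat (c i t) ** (E ** N i 0 - N i 0 ** E)" using E[OF i] by (simp add: l_def)
   have h2: "mat (c i t) ** (X ** N i 0) = X ** U 1" for X unfolding u(8) by (simp add: matrix_mul_assoc mat_commute[of _ X])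
   have "mat (c i t) ** (E ** N i 0 - N i 0 ** E) = E ** U 1 - mat (c i t) ** (N i 0 ** E)"
    by (simp only: matrix_diff_right h2)
   also have "mat (c i t) ** (N i 0 ** E) = U 1 ** E" by (simp only: u(8) matrix_mul_assoc)
   finally have "(e i - mat l) ** U 1 = E ** U 1 - U 1 ** E" using h1 by (simp only: h2)
   hence "(e i - mat l) ** U 1 ** V 1 = (E ** U 1 - U 1 ** E) ** V 1" by simp
   hence "(e i - mat l) ** (U 1 ** V 1) = E ** (U 1 ** V 1) - U 1 ** E ** V 1" by (simp add: matrix_mul_assoc matrix_diff_left)
   thus ?thesis using u(9) by (simp add: algebra_simps)
  qed
  hence "traceless (U 1 ** E ** V 1 + u0 1) = traceless E" using traceless_add_mat u(7) by metis
  moreover have "traceless (U 0 ** E ** V 0 + u0 0) = traceless E" using u by simp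
  ultimately show ?thesis
   unfolding local_system.transport_def[OF sphere_ode_local_system[OF odeF']] using 2 unfolding lf_def by blast
 qed
 from invariant_section[OF odeF' this] show ?thesis unfolding F'_def F_def a_def ta0 .
qed

end

text \<open>Near the point \<open>f\<close> equals its convergent Laurent series, hence is
  continuous off the point, and limits reproduce its values. So \<open>coeff_at\<close> will have
  the same Laurent expansion as the coefficient itself.\<close>

lemma laurent_limit_eq:
 assumes "(%h. f (al + h)) has_laurent_expansion L"
 shows "\<forall>\<^sub>F x in at al. Lim (at x) f = f x"
proof -
 have L: "fls_conv_radius L > 0" "\<forall>\<^sub>F h in at 0. eval_fls L h = f (al + h)"
  using assms unfolding has_laurent_expansion_def by auto
 have "\<forall>\<^sub>F h in at 0. h : eball 0 (fls_conv_radius L) - {0}"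
  using L(1) by (intro eventually_at_in_open) (auto simp: zero_ereal_def)
 with L(2) have "\<forall>\<^sub>F h in at 0. eval_fls L h = f (al + h) & h : eball 0 (fls_conv_radius L) - {0}"
  by eventually_elim auto
 then obtain r where r: "r > 0" "!!h. h ~= 0 ==> norm h < r ==> eval_fls L h = f (al + h)"
  "!!h :: complex. h ~= 0 ==> norm h < r ==> h : eball 0 (fls_conv_radius L) - {0}"
  unfolding eventually_at by (auto simp: dist_norm)
 have "Lim (at x) f = f x" if x: "x : ball al r - {al}" for x
 proof -
  have xr: "x - al ~= 0" "norm (x - al) < r" using x by (simp_all add: dist_norm norm_minus_commute)
  have "isCont (eval_fls L) (x - al)" by (rule DERIV_isCont[OF has_field_derivative_eval_fls[OF r(3)[OF xr]]])
  hence "isCont (%y. eval_fls L (y - al)) x" by (rule isCont_o2[where f = "%y. y - al", rotated]) (intro continuous_intros)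
  hence 1: "((%y. eval_fls L (y - al)) \<longlongrightarrow> eval_fls L (x - al)) (at x)" by (simp add: isCont_def)
  have "\<forall>\<^sub>F y in at x. y : (ball al r - {al}) - {x}" by (rule eventually_at_in_open) (use x in auto)
  hence "\<forall>\<^sub>F y in at x. eval_fls L (y - al) = f y"
   by eventually_elim (use r(2) in \<open>auto simp: dist_norm norm_minus_commute\<close>)
  hence "(f \<longlongrightarrow> eval_fls L (x - al)) (at x)" using 1 tendsto_cong by fastforce
  moreover have "eval_fls L (x - al) = f x" using r(2)[OF xr] by simp
  ultimately show ?thesis by (simp add: tendsto_Lim)
 qed
 moreover have "\<forall>\<^sub>F x in at al. x : ball al r - {al}" by (rule eventually_at_in_open) (use r in auto)
 ultimately show ?thesis by (auto elim: eventually_mono)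
qed

lemma poly_eqI_cofinite:
 assumes "finite S" "!!z. z \<notin> S ==> poly p z = poly q (z :: complex)" shows "p = q"
proof -
 have "infinite (- S)" using assms(1) infinite_UNIV_char_0[where 'a = complex] by (simp add: Compl_eq_Diff_UNIV)
 moreover have "- S <= {z. poly (p - q) z = 0}" using assms(2) by auto
 ultimately have "infinite {z. poly (p - q) z = 0}" using finite_subset by blast
 hence "p - q = 0" using poly_roots_finite by blast
 thus ?thesis by simp
qed

lemma pole_growth_const: "pole_growth (%_. c)" unfolding pole_growth_def by (intro exI[of _ "norm c"] exI[of _ 0]) simp

lemma pole_growth_traceless:
 fixes X :: "complex => complex ^ 'n::finite ^ 'n"
 assumes "!!i j. pole_growth (%h. X h $ i $ j)" shows "pole_growth (%h. traceless (X h) $ i $ j)"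
proof -
 have "pole_growth (%h. X h $ i $ j + (if i = j then - 1 / of_nat CARD('n) else 0) * (\<Sum>k\<in>UNIV. X h $ k $ k))"
  by (rule pole_growth_add[OF assms pole_growth_mult[OF pole_growth_const pole_growth_sum]]) (rule assms)
 thus ?thesis by (rule pole_growth_cong) (simp add: traceless_nth)
qed

section \<open>Extension over the disks and rational solutions\<close>

context regular_singular_system
begin

lemma finite_Sing: "finite (Sing t)" by (simp add: Sing_def)

lemma open_compl_Sing: "open (- Sing t)" using finite_imp_closed[OF finite_Sing] by (simp add: open_Compl)

lemma eventually_off_Sing: "\<forall>\<^sub>F h in at 0. chart ka (al + h) \<notin> Sing t"
proof -
 have "finite ((%h. chart ka (al + h)) -` Sing t)" by (intro finite_vimageI finite_Sing) (auto simp: inj_def chart_inj)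
 hence "open (- ((%h. chart ka (al + h)) -` Sing t - {0}))" by (intro open_Compl finite_imp_closed) auto
 hence "\<forall>\<^sub>F h in at 0. h : - ((%h. chart ka (al + h)) -` Sing t - {0}) - {0}"
  by (rule eventually_at_in_open) auto
 thus ?thesis by eventually_elim auto
qed

context
 fixes t :: "complex ^ 'r" and k :: 'r and b
 assumes t: "t : P" and de: "!!i j. poly_at (den i j) t ~= 0"
  and b: "sphere_ode.sec D (coeff_at A t) (coeff_at A t) (%ka z. traceless (var_at A t k ka z)) b D"
begin

definition "Fo = (%ka z. traceless (var_at A t k ka z))"

lemma ode_Sing: "X <= - Sing t ==> open X ==> sphere_ode X (coeff_at A t) (coeff_at A t) Fo"
proof -
 assume X: "X <= - Sing t" "open X"
 have "coef_on (- Sing t) (var_at A t k)"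
  unfolding coef_on_def by (intro conjI allI impI var_at_holomorphic[OF t de] var_at_switch[OF t de]) auto
 hence "coef_on X Fo" unfolding Fo_def by (rule coef_on_traceless[OF coef_on_subset[OF _ X(1)]])
 thus ?thesis using X coef_coeff_at[OF t X(1)] by (simp add: sphere_ode_iff)
qed

text \<open>Each disk contains one singular point only, so the section extends over the punctured
  disk by \<open>extend_over_disk\<close>. The extensions agree with \<open>b\<close> on the
  overlaps with \<open>D\<close>, and the disks are disjoint.\<close>

lemma extended_section: "\<exists>b'. sphere_ode.sec (- Sing t) (coeff_at A t) (coeff_at A t) Fo b' (- Sing t)"
proof -
 have ode: "sphere_ode (- Sing t) (coeff_at A t) (coeff_at A t) Fo" by (rule ode_Sing[OF order_refl open_compl_Sing])
 interpret O: sphere_ode "- Sing t" "coeff_at A t" "coeff_at A t" Fo by (rule ode)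
 have DS: "D <= - Sing t" using Sing_disjoint_D[OF t] by blast
 have bD: "O.sec b D" using b DS unfolding Fo_def[symmetric] sec_iff[OF ode] sec_iff[OF ode_Sing[OF DS D_open]] by blast
 have BD: "B i \<inter> D = {}" if "i < m" for i using compl_D that by blast
 have \<xi>B: "\<xi> i t : B i" if "i < m" for i using unique_singular[OF that t] by blast
 have Bdisj: "i = j" if "x : B i" "x : B j" "i < m" "j < m" for i j x
  using disks_disjoint that unfolding disjoint_family_on_def by blast
 have "\<exists>V \<beta>. B i <= V & O.sec \<beta> (V - {\<xi> i t}) & V <= B i \<union> D & (\<forall>x\<in>V \<inter> D. \<beta> x = b x)" if i: "i < m" for i
 proof -
  obtain p q r s rh where M: "p * s ~= q * r" "B i = moebius p q r s ` cball 0 1" "rh > 1"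
   "moebius p q r s ` (cball 0 rh - cball 0 1) <= D" using loops_encircle[OF i] unfolding encircles_once_def by blast
  obtain u0 where u0: "\<xi> i t = moebius p q r s u0" "norm u0 <= 1" using \<xi>B[OF i] M(2) by auto
  define V where "V = moebius p q r s ` ball 0 rh"
  have V: "V <= B i \<union> D"
  proof -
   have "ball (0::complex) rh <= cball 0 1 \<union> (cball 0 rh - cball 0 1)" by auto
   thus ?thesis unfolding V_def M(2) using M(4) by blast
  qed
  have an: "moebius p q r s ` (ball 0 rh - cball 0 1) <= D" using M(4) by (force simp: image_subset_iff)
  have VX: "moebius p q r s ` ball 0 rh - {moebius p q r s u0} <= - Sing t"
  proof
   fix x assume x: "x : moebius p q r s ` ball 0 rh - {moebius p q r s u0}"
   hence "x : B i \<union> D" "x ~= \<xi> i t" using V u0(1) unfolding V_def by auto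
   thus "x : - Sing t" using DS Bdisj[OF _ \<xi>B i] \<xi>B unfolding Sing_def by blast
  qed
  from O.extend_over_disk[OF M(1,3) u0(2) D_open bD an VX]
  obtain \<beta> where \<beta>: "O.sec \<beta> (V - {\<xi> i t})" "\<forall>x\<in>moebius p q r s ` (ball 0 rh - cball 0 1). \<beta> x = b x"
   unfolding V_def u0(1) by blast
  have "\<beta> x = b x" if x: "x : V \<inter> D" for x
  proof -
   obtain u where u: "u : ball 0 rh" "x = moebius p q r s u" using x by (auto simp: V_def)
   have "u \<notin> cball 0 1" using BD[OF i] x u(2) M(2) by blast
   thus ?thesis using \<beta>(2) u by blast
  qed
  moreover have "B i <= V" unfolding M(2) V_def using M(3) by (intro image_mono) auto
  ultimately show ?thesis using \<beta>(1) V by (intro exI[of _ V] exI[of _ \<beta>]) auto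
 qed
 hence "\<forall>i. \<exists>V. \<exists>\<beta>. i < m --> B i <= V & O.sec \<beta> (V - {\<xi> i t}) & V <= B i \<union> D & (\<forall>x\<in>V \<inter> D. \<beta> x = b x)" by blast
 from choice[OF this] obtain V where "\<forall>i. \<exists>\<beta>. i < m --> B i <= V i & O.sec \<beta> (V i - {\<xi> i t}) & V i <= B i \<union> D & (\<forall>x\<in>V i \<inter> D. \<beta> x = b x)" ..
 from choice[OF this] obtain \<beta> where \<beta>: "\<forall>i. i < m --> B i <= V i & O.sec (\<beta> i) (V i - {\<xi> i t}) & V i <= B i \<union> D & (\<forall>x\<in>V i \<inter> D. \<beta> i x = b x)" ..
 define b' where "b' x = (if x : D then b x else \<beta> (THE i. i < m & x : B i) x)" for x
 have b'B: "b' x = \<beta> i x" if "x : B i" "i < m" for x i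
 proof -
  have "(THE i. i < m & x : B i) = i" by (rule the_equality) (use that Bdisj in auto)
  thus ?thesis using BD[OF that(2)] that(1) by (auto simp: b'_def)
 qed
 have "O.sec b' (- Sing t)"
 proof (rule O.sec_local[OF open_compl_Sing order_refl])
  fix x assume x: "x : - Sing t"
  show "\<exists>f N. O.sec f N & x : N & (\<forall>y\<in>N. b' y = f y)"
  proof (cases "x : D")
   case True
   thus ?thesis using bD by (intro exI[of _ b] exI[of _ D]) (auto simp: b'_def)
  next
   case False
   then obtain i where i: "i < m" "x : B i" using compl_D by blast
   have "x ~= \<xi> i t" using x i(1) by (auto simp: Sing_def)
   moreover have "b' y = \<beta> i y" if "y : V i - {\<xi> i t}" for y
    using that \<beta> i(1) b'B[OF _ i(1), of y] by (cases "y : D") (auto simp: b'_def)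
   ultimately show ?thesis using \<beta> i by (intro exI[of _ "\<beta> i"] exI[of _ "V i - {\<xi> i t}"]) auto
  qed
 qed
 thus ?thesis by blast
qed

text \<open>Growth at a singular point has two sources: the equation, tamed by the gauge
  transformation to a simple pole, and the inhomogeneity, whose entries come from quotients of
  polynomials in the local coordinate.\<close>

lemma section_pole_growth:
 fixes b' :: "riemann_sphere => complex ^ 'n ^ 'n"
 assumes b': "sphere_ode.sec (- Sing t) (coeff_at A t) (coeff_at A t) Fo b' (- Sing t)"
  and l: "l < m" and al: "chart ka al = \<xi> l t" "ka \<longleftrightarrow> \<xi> l t = Infty"
 shows "pole_growth (%h. b' (chart ka (al + h)) $ i $ j)"
proof -
 have ode: "sphere_ode (- Sing t) (coeff_at A t) (coeff_at A t) Fo" by (rule ode_Sing[OF order_refl open_compl_Sing])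
 obtain U al' where U: "t : U" "\<forall>t\<in>U. \<xi> l t = chart ka (al' t)" "param_regular_singular U al' (chart_system A ka)"
 proof (cases ka)
  case True
  then obtain U al' where "t : U" "\<forall>t\<in>U. \<xi> l t = inf_chart (al' t)" "param_regular_singular U al' (at_inf A)"
   using regular_singular[OF l t] al(2) unfolding param_regular_singular_near_def by auto
  thus ?thesis using True by (intro that[of U al']) (auto simp: chart_system_def)
 next
  case False
  then obtain U al' where "t : U" "\<forall>t\<in>U. \<xi> l t = Pt (al' t)" "param_regular_singular U al' A"
   using regular_singular[OF l t] al(2) unfolding param_regular_singular_near_def by auto
  thus ?thesis using False by (intro that[of U al']) (auto simp: chart_system_def)
 qed
 have al': "al' t = al" using U(1,2) al(1) chart_inj by metis
 obtain L S S' where LS: "S : laurent_matrices U" "S' : laurent_matrices U"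
  "\<forall>t\<in>U. \<forall>i j. (%h. chart_system A ka (al' t + h) t $ i $ j) has_laurent_expansion (L t $ i $ j)"
  "\<forall>t\<in>U. S t ** S' t = mat 1 & S' t ** S t = mat 1"
  "\<forall>t\<in>U. \<forall>i j. \<forall>k < -1. fls_nth ((S' t ** L t ** S t - S' t ** map_matrix fls_deriv (S t)) $ i $ j) k = 0"
  using U(3) unfolding param_regular_singular_def by blast
 have cr: "fls_conv_radius (S t $ i $ j) > 0" "fls_conv_radius (S' t $ i $ j) > 0" for i j
  using LS(1,2) U(1) unfolding laurent_matrices_def laurent_ring_def by blast+
 have L: "(%h. coeff_at A t ka (al + h) $ i $ j) has_laurent_expansion L t $ i $ j" for i j
 proof -
  have ex: "(%h. chart_system A ka (al + h) t $ i $ j) has_laurent_expansion L t $ i $ j" using LS(3) U(1) al' by metis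
  from laurent_limit_eq[where f = "%x. chart_system A ka x t $ i $ j", OF ex]
  have "\<forall>\<^sub>F x in at al. chart_system A ka x t $ i $ j = coeff_at A t ka x $ i $ j"
   by (simp add: coeff_at_def eq_commute)
  from has_laurent_expansion_cong'[OF this refl refl] ex show ?thesis by blast
 qed
 have der: "\<forall>\<^sub>F h in at 0. mder (%z. b' (chart ka z)) (coeff_at A t ka (al + h) ** b' (chart ka (al + h)) - b' (chart ka (al + h)) ** coeff_at A t ka (al + h) + Fo ka (al + h)) (al + h)"
  using eventually_off_Sing[of ka al t] by eventually_elim (use b' in \<open>auto simp: sec_iff[OF ode]\<close>)
 have "pole_growth (%h. var_at A t k ka (al + h) $ i $ j)" for i j
 proof (rule algebraic_pole_growth)
  show "poly_at (chart_den (num i j) (den i j) ka) t ^ 2 ~= 0" using chart_den_nonzero[OF de] by simp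
  show "\<forall>\<^sub>F h in at 0. var_at A t k ka (al + h) $ i $ j * poly (poly_at (chart_den (num i j) (den i j) ka) t ^ 2) (al + h) =
    poly (poly_at (map (partial k) (chart_num (num i j) (den i j) ka)) t * poly_at (chart_den (num i j) (den i j) ka) t
    - poly_at (chart_num (num i j) (den i j) ka) t * poly_at (map (partial k) (chart_den (num i j) (den i j) ka)) t) (al + h)"
   using eventually_off_Sing[of ka al t]
  proof eventually_elim
   case (elim h)
   from var_at_quotient[OF t de this, where k = k and i = i and j = j] show ?case by (simp add: poly_power mult.commute)
  qed
 qed
 hence F: "pole_growth (%h. Fo ka (al + h) $ i $ j)" for i j unfolding Fo_def by (rule pole_growth_traceless)
 show ?thesis by (rule regular_singular_growth[where S = "S t" and S' = "S' t", OF L cr _ _ _ der F]) (use LS U(1) in auto)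
qed


text \<open>If the denominators of all entries were nonzero at the point, all entries would be
  analytic there. So every finite singular point is a root of \<open>cden\<close>, and a power of
  \<open>cden\<close> will clear all finite poles of the solution.\<close>

lemma cden_root:
 assumes al: "Pt al : Sing t" shows "poly (cden (%i j. poly_at (den i j) t)) al = 0"
proof (rule ccontr)
 assume nz: "poly (cden (%i j. poly_at (den i j) t)) al ~= 0"
 have dnz: "poly (poly_at (den i j) t) al ~= 0" for i j using nz cden_cofac[of "%i j. poly_at (den i j) t" i j] by auto
 have "\<exists>g. g analytic_on {al} & (\<forall>\<^sub>F x in at al. A x t $ i $ j = g x)" for i j
 proof (intro exI conjI)
  have pa: "(%x. poly p x) analytic_on {al}" for p :: "complex poly"
  proof -
   have "(%x. poly p x) holomorphic_on UNIV" by (intro holomorphic_intros)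
   thus ?thesis using analytic_on_open[of UNIV] analytic_on_subset by blast
  qed
  show "(%x. poly (poly_at (num i j) t) x / poly (poly_at (den i j) t) x) analytic_on {al}"
   using dnz[of i j] by (intro analytic_on_divide pa) auto
  obtain S where S: "finite S" "!!x. x \<notin> S ==> poly (poly_at (den i j) t) x * A x t $ i $ j = poly (poly_at (num i j) t) x"
   using eventually_quotient[OF t, of i j] by blast
  have "open (- (S - {al}))" using S(1) by (intro open_Compl finite_imp_closed) auto
  hence "\<forall>\<^sub>F x in at al. x : - (S - {al}) - {al}" by (rule eventually_at_in_open) auto
  moreover have "((%x. poly (poly_at (den i j) t) x) \<longlongrightarrow> poly (poly_at (den i j) t) al) (at al)" by (intro tendsto_intros)
  hence "\<forall>\<^sub>F x in at al. poly (poly_at (den i j) t) x ~= 0" using dnz by (rule tendsto_imp_eventually_ne)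
  ultimately show "\<forall>\<^sub>F x in at al. A x t $ i $ j = poly (poly_at (num i j) t) x / poly (poly_at (den i j) t) x"
   by eventually_elim (use S(2) in \<open>auto simp: nonzero_eq_divide_eq mult.commute\<close>)
 qed
 hence "\<not> singular_point A t (Pt al)" by simp
 moreover obtain l where "l < m" "Pt al = \<xi> l t" using al by (auto simp: Sing_def)
 ultimately show False using unique_singular[OF _ t, of l] by blast
qed

text \<open>The extended section is holomorphic off a finite set and of moderate growth there and at
  infinity, hence rational. Multiplied by a power of the common denominator it becomes polynomial,
  and its differential equation becomes a polynomial identity checked off finitely many points. The
  trace part removed from the inhomogeneity reappears as the scalar \<open>sg\<close>.\<close>

lemma lax_solvable_of_section:
 defines "dA \<equiv> %i j. poly_at (den i j) t" and "nA \<equiv> %i j. poly_at (num i j) t"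
  and "dA' \<equiv> %i j. poly_at (map (partial k) (den i j)) t" and "nA' \<equiv> %i j. poly_at (map (partial k) (num i j)) t"
 shows "\<exists>e r sg. lax_poly e (cden dA) (cnum nA dA) r = (\<chi> i j. cden dA ^ e * cderiv nA dA nA' dA' $ i $ j) + mat sg"
proof -
 define a where "a = coeff_at A t False"
 define q where "q = cden dA"
 have ode: "sphere_ode (- Sing t) (coeff_at A t) (coeff_at A t) Fo" by (rule ode_Sing[OF order_refl open_compl_Sing])
 obtain b' where b': "sphere_ode.sec (- Sing t) (coeff_at A t) (coeff_at A t) Fo b' (- Sing t)"
  using extended_section by blast
 define S where "S = {z. Pt z : Sing t}"
 have finS: "finite S" using finite_vimageI[OF finite_Sing[of t], of Pt] by (simp add: S_def vimage_def inj_def)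
 define bF where "bF z = b' (Pt z)" for z
 have der: "mder bF (a z ** bF z - bF z ** a z + Fo False z) z" if "z \<notin> S" for z
  using b' that unfolding sec_iff[OF ode] S_def bF_def[abs_def] a_def by (auto dest!: spec[of _ False])
 have "mholo bF (- S)" by (rule mder_imp_mholo, rule der) simp
 hence hol: "(%z. bF z $ i $ j) holomorphic_on - S" for i j by (simp add: mholo_def)
 have pole: "\<exists>C N r. r > 0 & (\<forall>h. 0 < norm h & norm h < r --> norm (bF (al + h) $ i $ j) * norm h ^ N <= C)"
  if al: "al : S" for al i j
 proof -
  obtain l where l: "l < m" "Pt al = \<xi> l t" using al by (auto simp: Sing_def S_def)
  have "pole_growth (%h. b' (chart False (al + h)) $ i $ j)"
   by (rule section_pole_growth[OF b' l(1)]) (use l(2)[symmetric] in auto)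
  thus ?thesis unfolding pole_growth_def eventually_at bF_def by (force simp: dist_norm)
 qed
 have "pole_growth (%h. b' (inf_chart h) $ i $ j)" for i j
 proof (cases "Infty : Sing t")
  case True
  then obtain l where l: "l < m" "Infty = \<xi> l t" by (auto simp: Sing_def)
  have "pole_growth (%h. b' (chart True (0 + h)) $ i $ j)"
   by (rule section_pole_growth[OF b' l(1)]) (use l(2)[symmetric] in auto)
  thus ?thesis by simp
 next
  case False
  have "\<forall>ka z. chart ka z : - Sing t --> (\<exists>D. mder (%u. b' (chart ka u)) D z)"
   using b' unfolding sec_iff[OF ode] by blast
  from this[rule_format, of True 0] False have "\<exists>D. mder (%u. b' (inf_chart u)) D 0" by simp
  hence "isCont (%u. b' (inf_chart u) $ i $ j) 0" unfolding mder_def using DERIV_isCont by blast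
  hence "((%u. norm (b' (inf_chart u) $ i $ j)) \<longlongrightarrow> norm (b' (inf_chart 0) $ i $ j)) (at 0)"
   unfolding isCont_def by (rule tendsto_norm)
  hence "\<forall>\<^sub>F u in at 0. norm (b' (inf_chart u) $ i $ j) < norm (b' (inf_chart 0) $ i $ j) + 1"
   by (rule order_tendstoD) simp
  thus ?thesis unfolding pole_growth_def
   by (intro exI[of _ "norm (b' (inf_chart 0) $ i $ j) + 1"] exI[of _ 0]) (auto elim!: eventually_mono)
 qed
 hence infty: "\<exists>C N A. \<forall>z. A <= norm z --> norm (bF z $ i $ j) <= C * norm z ^ N" for i j
 proof -
  obtain C N dl where dl: "dl > 0" "!!h. h ~= 0 ==> norm h < dl ==> norm (b' (inf_chart h) $ i $ j) * norm h ^ N <= C"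
   using \<open>!!i j. pole_growth (%h. b' (inf_chart h) $ i $ j)\<close>[of i j] unfolding pole_growth_def eventually_at by (auto simp: dist_norm)
  \<comment> \<open>The threshold \<open>2 / dl\<close> makes 1/|z| strictly smaller than
    \<open>dl\<close>.\<close>
  have "norm (bF z $ i $ j) <= C * norm z ^ N" if z: "2 / dl <= norm z" for z
  proof -
   have z0: "norm z > 0" using z dl(1) by (smt (verit) divide_pos_pos)
   have "1 / norm z < dl" using z z0 dl(1) by (simp add: field_simps)
   hence "norm (b' (inf_chart (1 / z)) $ i $ j) * norm (1 / z) ^ N <= C" using z0 by (intro dl(2)) (auto simp: norm_divide)
   thus ?thesis using z0 by (simp add: bF_def norm_divide power_divide pos_divide_le_eq)
  qed
  thus ?thesis by blast
 qed
 have "\<forall>i j. \<exists>p N. \<forall>z. z \<notin> S --> bF z $ i $ j * (\<Prod>al\<in>S. (z - al) ^ N) = poly p z"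
  using rational_of_growth[OF finS hol pole infty] by blast
 then obtain p N where p: "!!i j z. z \<notin> S ==> bF z $ i $ j * (\<Prod>al\<in>S. (z - al) ^ N i j) = poly (p i j) z" by metis
 \<comment> \<open>A single exponent that dominates the pole orders of all entries at all points at
   once.\<close>
 define e where "e = (\<Sum>i\<in>UNIV. \<Sum>j\<in>UNIV. N i j) * card S"
 have "\<exists>r. \<forall>z. z \<notin> S --> bF z $ i $ j * poly q z ^ e = poly r z" for i j
 proof -
  have "N i j <= (\<Sum>j\<in>UNIV. N i j)" by (rule member_le_sum) auto
  also have "\<dots> <= (\<Sum>i\<in>UNIV. \<Sum>j\<in>UNIV. N i j)" by (rule member_le_sum[of i UNIV "%i. \<Sum>j\<in>UNIV. N i j"]) auto
  finally have le: "N i j * card S <= e" unfolding e_def by simp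
  have "[:- al, 1:] dvd q" if "al : S" for al
   using cden_root[of al] that unfolding S_def q_def dA_def by (simp add: poly_eq_0_iff_dvd)
  hence "(\<Prod>al\<in>S. [:- al, 1:] ^ N i j) dvd (\<Prod>al\<in>S. q ^ N i j)" by (intro prod_dvd_prod dvd_power_same)
  also have "(\<Prod>al\<in>S. q ^ N i j) = q ^ (N i j * card S)" by (simp add: power_mult)
  also have "\<dots> dvd q ^ e" using le by (rule le_imp_power_dvd)
  finally obtain w where w: "q ^ e = (\<Prod>al\<in>S. [:- al, 1:] ^ N i j) * w" by (rule dvdE)
  have "bF z $ i $ j * poly q z ^ e = poly (p i j * w) z" if "z \<notin> S" for z
  proof -
   have "poly q z ^ e = (\<Prod>al\<in>S. (z - al) ^ N i j) * poly w z"
    unfolding poly_power[symmetric] w by (simp add: poly_prod poly_power)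
   thus ?thesis using p[OF that, of i j] by (simp add: mult.assoc[symmetric])
  qed
  thus ?thesis by blast
 qed
 then obtain r where r: "!!i j z. z \<notin> S ==> bF z $ i $ j * poly q z ^ e = poly (r i j) z" by metis
 define sg where "sg = - smult (1 / of_nat CARD('n)) (q ^ e * (\<Sum>i\<in>UNIV. cderiv nA dA nA' dA' $ i $ i))"
 have qnz: "q ~= 0" unfolding q_def cden_def dA_def using de by simp
 have main: "poly (lax_poly e q (cnum nA dA) (\<chi> i j. r i j) $ i $ j) z = poly (((\<chi> i j. q ^ e * cderiv nA dA nA' dA' $ i $ j) + mat sg) $ i $ j) z"
  if z: "z \<notin> S \<union> {z. poly q z = 0}" for i j z
 proof -
  let ?y = "poly q z" and ?q' = "poly (pderiv q) z"
  have zS: "z \<notin> S" and y0: "?y ~= 0" using z by auto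
  have zC: "chart False z \<notin> Sing t" using zS by (simp add: S_def)
  have a: "?y * a z $ x $ y = poly (cnum nA dA $ x $ y) z" for x y
  proof -
   have "poly (dA x y) z * a z $ x $ y = poly (nA x y) z"
    using chart_quotient[OF t zC, of x y] by (simp add: chart_den_def chart_num_def dA_def nA_def a_def)
   hence "poly (cofac dA x y) z * (poly (dA x y) z * a z $ x $ y) = poly (cofac dA x y) z * poly (nA x y) z" by simp
   thus ?thesis by (simp add: q_def cden_cofac[of dA x y] cnum_def mult_ac)
  qed
  have F: "?y ^ 2 * var_at A t k False z $ x $ y = poly (cderiv nA dA nA' dA' $ x $ y) z" for x y
  proof -
   have "poly (dA x y) z ^ 2 * var_at A t k False z $ x $ y = poly (nA' x y) z * poly (dA x y) z - poly (nA x y) z * poly (dA' x y) z"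
    using var_at_quotient[OF t de zC, where k = k and i = x and j = y] by (simp add: chart_den_def chart_num_def dA_def nA_def dA'_def nA'_def)
   hence "poly (cofac dA x y) z ^ 2 * (poly (dA x y) z ^ 2 * var_at A t k False z $ x $ y) =
    poly (cofac dA x y) z ^ 2 * (poly (nA' x y) z * poly (dA x y) z - poly (nA x y) z * poly (dA' x y) z)" by simp
   thus ?thesis by (simp add: q_def cden_cofac[of dA x y] cderiv_def power_mult_distrib poly_power mult_ac)
  qed
  have Fo: "?y ^ 2 * Fo False z $ i $ j = poly (cderiv nA dA nA' dA' $ i $ j) z - (if i = j then (\<Sum>x\<in>UNIV. poly (cderiv nA dA nA' dA' $ x $ x) z) / of_nat CARD('n) else 0)"
   unfolding Fo_def traceless_nth by (simp add: F[symmetric] right_diff_distrib sum_distrib_left)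
  define b1 where "b1 = (a z ** bF z - bF z ** a z + Fo False z) $ i $ j"
  have db: "((%u. bF u $ i $ j) has_field_derivative b1) (at z)" using der[OF zS] by (simp add: mder_def b1_def)
  have "open (- S)" using finS by (intro open_Compl finite_imp_closed)
  hence "\<forall>\<^sub>F u in nhds z. u : - S" by (rule eventually_nhds_in_open) (use zS in simp)
  hence ev: "\<forall>\<^sub>F u in nhds z. bF u $ i $ j * poly q u ^ e = poly (r i j) u" by eventually_elim (use r in auto)
  have "((%u. bF u $ i $ j * poly q u ^ e) has_field_derivative b1 * ?y ^ e + (of_nat e * ?y ^ (e - 1) * ?q') * bF z $ i $ j) (at z)"
   by (rule DERIV_mult[OF db]) (auto intro!: derivative_eq_intros)
  hence "((%u. poly (r i j) u) has_field_derivative b1 * ?y ^ e + (of_nat e * ?y ^ (e - 1) * ?q') * bF z $ i $ j) (at z)"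
   using DERIV_cong_ev[OF refl ev refl] by blast
  hence "poly (pderiv (r i j)) z = b1 * ?y ^ e + (of_nat e * ?y ^ (e - 1) * ?q') * bF z $ i $ j"
   using DERIV_unique poly_DERIV by blast
  hence "?y * poly (pderiv (r i j)) z = ?y * b1 * ?y ^ e + of_nat e * (?y * ?y ^ (e - 1)) * ?q' * bF z $ i $ j" by (simp add: algebra_simps)
  also have "of_nat e * (?y * ?y ^ (e - 1)) = of_nat e * ?y ^ e" by (cases e) auto
  finally have dr: "?y * poly (pderiv (r i j)) z = ?y * b1 * ?y ^ e + of_nat e * ?q' * poly (r i j) z"
   using r[OF zS, of i j] by (simp add: mult_ac)
  have rr: "poly (r x y) z = bF z $ x $ y * ?y ^ e" for x y using r[OF zS, of x y] by simp
  have comm: "poly ((cnum nA dA ** (\<chi> i j. r i j) - (\<chi> i j. r i j) ** cnum nA dA) $ i $ j) z = ?y * ?y ^ e * (a z ** bF z - bF z ** a z) $ i $ j"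
   by (simp add: matrix_matrix_mult_def poly_sum a[symmetric] rr sum_distrib_left right_diff_distrib mult_ac)
  have "poly (lax_poly e q (cnum nA dA) (\<chi> i j. r i j) $ i $ j) z =
    ?y * (?y * poly (pderiv (r i j)) z) - of_nat e * ?y * ?q' * poly (r i j) z - ?y * (?y * ?y ^ e * (a z ** bF z - bF z ** a z) $ i $ j)"
   unfolding lax_poly_def using comm by (simp add: poly_power power2_eq_square mult.assoc)
  also have "\<dots> = ?y ^ e * (?y ^ 2 * Fo False z $ i $ j)"
   unfolding dr b1_def by (simp add: power2_eq_square algebra_simps)
  also have "\<dots> = poly (((\<chi> i j. q ^ e * cderiv nA dA nA' dA' $ i $ j) + mat sg) $ i $ j) z"
   unfolding Fo by (simp add: mat_def sg_def poly_power poly_sum right_diff_distrib)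
  finally show ?thesis .
 qed
 have "lax_poly e q (cnum nA dA) (\<chi> i j. r i j) = (\<chi> i j. q ^ e * cderiv nA dA nA' dA' $ i $ j) + mat sg"
 proof -
  have "finite (S \<union> {z. poly q z = 0})" using finS poly_roots_finite[OF qnz] by simp
  from poly_eqI_cofinite[OF this main] show ?thesis by (simp add: vec_eq_iff)
 qed
 thus ?thesis unfolding q_def by blast
qed

end

end

section \<open>Descent of the conjugated commutator group to complex matrices\<close>

theorem corollary10:
  fixes P :: "(complex ^ 'r) set"
    and D :: "riemann_sphere set"
    and m :: nat
    and B :: "nat \<Rightarrow> riemann_sphere set"
    and x0 :: riemann_sphere
    and \<gamma> :: "nat \<Rightarrow> real \<Rightarrow> riemann_sphere"
    and num den :: "'n::finite \<Rightarrow> 'n \<Rightarrow> (complex ^ 'r \<Rightarrow> complex) list"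
    and A :: "complex \<Rightarrow> complex ^ 'r \<Rightarrow> complex ^ 'n ^ 'n"
    and \<xi> :: "nat \<Rightarrow> complex ^ 'r \<Rightarrow> riemann_sphere"
    and R :: "(complex ^ 'r \<Rightarrow> complex) set"
    and \<iota> :: "(complex ^ 'r \<Rightarrow> complex) \<Rightarrow> 'k::field"
    and d :: "'r \<Rightarrow> 'k \<Rightarrow> 'k"
    and dx :: "'k poly fract \<Rightarrow> 'k poly fract"
    and dt :: "'r \<Rightarrow> 'k poly fract \<Rightarrow> 'k poly fract"
    and h :: "'k poly fract \<Rightarrow> 'K::field"
    and Dx :: "'K \<Rightarrow> 'K"
    and Dt :: "'r \<Rightarrow> 'K \<Rightarrow> 'K"
    and Z :: "'K ^ 'n ^ 'n"
    and G :: "('k ^ 'n ^ 'n) set"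
  assumes "regular_singular_system P D m B x0 \<gamma> num den A \<xi>"
    and "closed_base_field P num den R \<iota> d"
    and "PPV_extension d (matrix_over_k \<iota> num den) dx dt h Dx Dt Z"
    and "G = PPV_group h Dx Dt Z"
    and "projectively_isomonodromic P m x0 \<gamma> A"
  shows "\<exists>C \<in> carrier GL. \<exists>H. subgroup H (GL :: (complex ^ 'n ^ 'n) monoid) \<and>
           (\<lambda>N. C ** N ** matrix_inv C) ` derived GL G = map_matrix (\<lambda>c. \<iota> (\<lambda>_. c)) ` H"
proof -
 interpret S: regular_singular_system P D m B x0 \<gamma> num den A \<xi> by (rule assms(1))
 interpret K: closed_base_field P num den R \<iota> d by (rule assms(2))
 have conn: "connected P" by (rule simply_connected_imp_connected[OF S.P_simply_connected])
 have "\<forall>i. \<exists>f. \<forall>j. f j : set (den i j) & (\<exists>t\<in>P. f j t ~= 0)"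
  by (intro allI choice) (use S.den_nonzero in blast)
 from choice[OF this] obtain f where f: "\<forall>i j. f i j : set (den i j) & (\<exists>t\<in>P. f i j t ~= 0)" ..
 have fh: "mv_holomorphic_on (f i j) P" for i j using S.coeffs_holomorphic[of "f i j" i j] f by blast
 \<comment> \<open>The generic parameters: one chosen coefficient of every denominator is nonzero,
   so that no denominator vanishes identically in x, as the difference quotient argument
   requires.\<close>
 define U where "U = {t\<in>P. \<forall>i j. f i j t ~= 0}"
 have Ueq: "U = P \<inter> (\<Inter>i. \<Inter>j. f i j -` (- {0}) \<inter> P)" by (auto simp: U_def)
 have o: "open (f i j -` (- {0}) \<inter> P)" for i j
  using continuous_on_open_vimage[OF S.P_open] mv_holomorphic_on_continuous[OF fh[of i j]] by blast
 have oU: "open U" unfolding Ueq by (intro open_Int S.P_open open_INT ballI finite o)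
 have "\<exists>t\<in>P. \<forall>p. f (fst p) (snd p) t ~= 0"
  by (rule mv_holomorphic_common_nonzero[OF S.P_open conn _ _ S.P_open order_refl K.P_nonempty]) (use fh f in auto)
 hence neU: "U ~= {}" by (fastforce simp: U_def)
 have sol: "K.lax_solvable_at k t" if t: "t : U" for k t
 proof -
  have tP: "t : P" using t by (simp add: U_def)
  have de: "poly_at (den i j) t ~= 0" for i j
  proof -
   have "f i j : set (den i j)" "f i j t ~= 0" using t f by (auto simp: U_def)
   thus ?thesis unfolding poly_at_def Poly_nonzero by auto
  qed
  obtain b where b: "sphere_ode.sec D (coeff_at A t) (coeff_at A t) (%ka z. traceless (var_at A t k ka z)) b D"
   using S.traceless_section[OF tP de assms(5)] by blast
  show ?thesis using S.lax_solvable_of_section[OF tP de b]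
   unfolding K.lax_solvable_at_def K.den_at_def K.num_at_def K.den'_at_def K.num'_at_def .
 qed
 have UP: "U <= P" by (auto simp: U_def)
 obtain C C' :: "'k ^ 'n ^ 'n" where C: "C ** C' = mat 1" "derived GL G <= carrier GL"
  "!!N i. N : derived GL G ==> map_matrix (d i) (C ** N ** C') = 0"
  using K.derived_PPV_group_constant_of_solvable[OF S.P_open conn oU UP neU sol S.den_nonzero assms(3)] assms(4) by blast
 have C': "C' ** C = mat 1" using C(1) matrix_left_right_inverse by blast
 have invC: "invertible C" unfolding invertible_def using C(1) C' by blast
 \<comment> \<open>\<open>matrix_inv\<close> is a choice among two-sided inverses, hence equal to
   \<open>C'\<close>.\<close>
 have mi: "matrix_inv C = C'"
 proof -
  have "C ** matrix_inv C = mat 1 & matrix_inv C ** C = mat 1"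
   unfolding matrix_inv_def by (rule someI[of _ C']) (use C(1) C' in blast)
  hence "(C' ** C) ** matrix_inv C = C'" unfolding matrix_mul_assoc[symmetric] by simp
  thus ?thesis unfolding C' by simp
 qed
 define e where "e c = \<iota> (%_. c)" for c
 have e: "is_field_hom e"
  unfolding is_field_hom_def e_def using K.\<iota>_one K.\<iota>_add[OF K.R_const K.R_const] K.\<iota>_mult[OF K.R_const K.R_const] by auto
 note me = map_matrix_hom[OF e]
 have inj: "X = Y" if "map_matrix e X = map_matrix e Y" for X Y :: "complex ^ 'n ^ 'n"
  using that field_hom_inj[OF e] by (simp add: vec_eq_iff map_matrix_nth inj_eq)
 have me1: "map_matrix e (mat 1) = (mat 1 :: 'k ^ 'n ^ 'n)"
  using field_hom_simps[OF e] by (simp add: vec_eq_iff map_matrix_nth mat_def)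
 have sub: "subgroup (derived GL G) (GL :: ('k ^ 'n ^ 'n) monoid)" unfolding derived_def
 proof (rule group.generate_is_subgroup[OF group_GL])
  show "derived_set GL G <= carrier GL"
  proof
   fix x :: "'k ^ 'n ^ 'n" assume "x : derived_set GL G"
   hence "x : derived GL G" unfolding derived_def by (rule generate.incl)
   thus "x : carrier GL" by (rule subsetD[OF C(2)])
  qed
 qed
 interpret G: subgroup "derived GL G" "GL :: ('k ^ 'n ^ 'n) monoid" by (rule sub)
 have GLs: "x \<otimes>\<^bsub>GL\<^esub> y = x ** y" "\<one>\<^bsub>GL\<^esub> = mat 1" for x y :: "'a::field ^ 'n ^ 'n" by (simp_all add: GL_def)
 have cj: "(C ** N ** C') ** (C ** N' ** C') = C ** (N ** N') ** C'" for N N'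
 proof -
  have "(C ** N ** C') ** (C ** N' ** C') = C ** N ** (C' ** C) ** N' ** C'" by (simp only: matrix_mul_assoc)
  thus ?thesis unfolding C' by (simp add: matrix_mul_assoc)
 qed
 have c1: "C ** mat 1 ** C' = mat 1" using C(1) by simp
 have ginv: "\<exists>N'\<in>derived GL G. N ** N' = mat 1 & N' ** N = mat 1" if N: "N : derived GL G" for N
 proof -
  have "N \<otimes>\<^bsub>GL\<^esub> inv\<^bsub>GL\<^esub> N = \<one>\<^bsub>GL\<^esub>" "inv\<^bsub>GL\<^esub> N \<otimes>\<^bsub>GL\<^esub> N = \<one>\<^bsub>GL\<^esub>"
   by (rule group.r_inv[OF group_GL] group.l_inv[OF group_GL], rule subsetD[OF C(2) N])+
  thus ?thesis using G.m_inv_closed[OF N] unfolding GLs by blast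
 qed
 \<comment> \<open>Entries annihilated by all derivations are constants, and these are the images of
   complex numbers.\<close>
 have lift: "\<exists>X. map_matrix e X = C ** N ** C'" if N: "N : derived GL G" for N
 proof -
  have "\<exists>c. (C ** N ** C') $ x $ y = e c" for x y
  proof -
   have "\<forall>i. d i ((C ** N ** C') $ x $ y) = 0" using C(3)[OF N] by (simp add: vec_eq_iff map_matrix_nth)
   thus ?thesis using K.constants unfolding e_def by blast
  qed
  then obtain c where "!!x y. (C ** N ** C') $ x $ y = e (c x y)" by metis
  hence "map_matrix e (\<chi> x y. c x y) = C ** N ** C'" by (simp add: vec_eq_iff map_matrix_nth)
  thus ?thesis by blast
 qed
 \<comment> \<open>The preimage of the conjugated group under the entrywise embedding of complex
   matrices; injectivity of that embedding transfers the group laws.\<close>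
 define H where "H = {X. \<exists>N\<in>derived GL G. map_matrix e X = C ** N ** C'}"
 have Hinv: "\<exists>X'\<in>H. X ** X' = mat 1 & X' ** X = mat 1" if XH: "X : H" for X
 proof -
  obtain N where N: "N : derived GL G" "map_matrix e X = C ** N ** C'" using XH unfolding H_def by blast
  obtain N' where N': "N' : derived GL G" "N ** N' = mat 1" "N' ** N = mat 1" using ginv[OF N(1)] by blast
  obtain X' where X': "map_matrix e X' = C ** N' ** C'" using lift[OF N'(1)] by blast
  have "map_matrix e (X ** X') = map_matrix e (mat 1)" "map_matrix e (X' ** X) = map_matrix e (mat 1)"
   unfolding me1 me(1) N(2) X' cj N'(2,3) c1 by (rule refl)+
  hence "X ** X' = mat 1" "X' ** X = mat 1" using inj by blast+
  thus ?thesis using X' N'(1) by (auto simp: H_def)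
 qed
 have HGL: "H <= carrier GL" using Hinv by (fastforce simp: GL_def invertible_def)
 have "subgroup H (GL :: (complex ^ 'n ^ 'n) monoid)"
 proof (rule group.subgroupI[OF group_GL HGL])
  have "mat 1 : H" using me1 c1 G.one_closed unfolding H_def GLs by force
  thus "H ~= {}" by blast
  fix X assume X: "X : H"
  obtain X' where X': "X' : H" "X ** X' = mat 1" "X' ** X = mat 1" using Hinv[OF X] by blast
  have "inv\<^bsub>GL\<^esub> X = X'"
   by (rule group.inv_equality[OF group_GL]) (use X X' HGL in \<open>auto simp: GLs\<close>)
  thus "inv\<^bsub>GL\<^esub> X : H" using X'(1) by simp
 next
  fix X Y assume "X : H" "Y : H"
  then obtain N N' where N: "N : derived GL G" "map_matrix e X = C ** N ** C'" "N' : derived GL G" "map_matrix e Y = C ** N' ** C'"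
   by (auto simp: H_def)
  have "map_matrix e (X ** Y) = C ** (N ** N') ** C'" unfolding me(1) N(2,4) cj by (rule refl)
  thus "X \<otimes>\<^bsub>GL\<^esub> Y : H" using G.m_closed[OF N(1,3)] unfolding GLs H_def by blast
 qed
 moreover have "(%N. C ** N ** matrix_inv C) ` derived GL G = map_matrix (%c. \<iota> (%_. c)) ` H"
  unfolding mi e_def[abs_def, symmetric]
 proof (intro equalityI subsetI)
  fix M assume "M : (%N. C ** N ** C') ` derived GL G"
  then obtain N where N: "N : derived GL G" "M = C ** N ** C'" by blast
  obtain X where "map_matrix e X = C ** N ** C'" using lift[OF N(1)] by blast
  thus "M : map_matrix e ` H" using N by (force simp: H_def)
 qed (auto simp: H_def)
 ultimately show ?thesis using invC by (intro bexI[of _ C] exI[of _ H]) (auto simp: GL_def)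
qed

end
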